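(* Let $x_0\ge 0$ and let $X_1$ be the value at time $t=1$ of the strong solution of $dX_t = 1\,dt + 2\sqrt{X_t}\,dW_t$, $X_0=x_0$. For all $p\in[1,\infty)$ and for all $q\in[1,\infty)$ the $n$-th minimal error $e_p^{\mathrm{ad}}(n)$ for adaptive methods satisfies $$e_p^{\mathrm{ad}}(n)\preccurlyeq n^{-q}.$$
   Context: $W=(W_t)_{t\ge0}$ is a standard one-dimensional Brownian motion with respect to a filtration satisfying the usual conditions on a complete probability space. The SDE $dX_t = 1\,dt + 2\sqrt{X_t}\,dW_t$, $X_0=x_0\ge0$, driven by $W$, has a unique non-negative strong solution $X$. For a random variable $\widehat X_1$ and $p\in[1,\infty)$ put $e_p(\widehat X_1)=\left(\mathrm{E}\,|X_1-\widehat X_1|^p\right)^{1/p}$. For $n\in\mathbb N=\{1,2,\dots\}$ let $\mathfrak C^{\mathrm{ad}}(n)$ be the set of all random variables of the form $\widehat X_1=\Phi(W_{t_1},\dots,W_{t_n})$ with $\Phi:\mathbb R^n\to\mathbb R$ Borel-measurable, where $t_1\in[0,1]$ is a fixed number and, for $k=2,\dots,n$, $t_k=\varphi_k(W_{t_1},\dots,W_{t_{k-1}})$ with $\varphi_k:\mathbb R^{k-1}\to[0,1]$ Borel-measurable. Define $e_p^{\mathrm{ad}}(n)=\inf\{e_p(\widehat X_1):\widehat X_1\in\mathfrak C^{\mathrm{ad}}(n)\}$. For sequences of non-negative reals, $a_n\preccurlyeq b_n$ means there is a constant $c>0$ with $a_n\le c\,b_n$ for all $n\in\mathbb N$ (the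 constant may depend on $p$, $q$ and $x_0$, but not on $n$). *)

theory Defs
  imports "HOL-Probability.Probability"
begin

text \<open>
  Processes have type \<^typ>\<open>real \<Rightarrow> 'a \<Rightarrow> real\<close>, filtrations have type \<^typ>\<open>real \<Rightarrow> 'a measure\<close>; in both
  cases only time indices \<open>t \<ge> 0\<close> are ever referred to.  Of the measures \<open>F t\<close> only the
  underlying \<open>\<sigma>\<close>-algebras matter.
\<close>

definition usual_filtration :: "'a measure \<Rightarrow> (real \<Rightarrow> 'a measure) \<Rightarrow> bool" where
  "usual_filtration M F \<longleftrightarrow>
     (\<forall>t\<ge>0. subalgebra M (F t)) \<and>
     (\<forall>s\<ge>0. \<forall>t\<ge>s. sets (F s) \<subseteq> sets (F t)) \<and>
     (\<forall>t\<ge>0. (\<Inter>u\<in>{t<..}. sets (F u)) = sets (F t)) \<and>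
     null_sets M \<subseteq> sets (F 0)"

definition adapted :: "(real \<Rightarrow> 'a measure) \<Rightarrow> (real \<Rightarrow> 'a \<Rightarrow> real) \<Rightarrow> bool" where
  "adapted F H \<longleftrightarrow> (\<forall>t\<ge>0. H t \<in> borel_measurable (F t))"

definition brownian_motion ::
  "'a measure \<Rightarrow> (real \<Rightarrow> 'a measure) \<Rightarrow> (real \<Rightarrow> 'a \<Rightarrow> real) \<Rightarrow> bool" where
  "brownian_motion M F W \<longleftrightarrow>
     adapted F W \<and>
     (AE \<omega> in M. W 0 \<omega> = 0) \<and>
     (AE \<omega> in M. continuous_on {0..} (\<lambda>t. W t \<omega>)) \<and>
     (\<forall>s\<ge>0. \<forall>t>s.
        distributed M lborel (\<lambda>\<omega>. W t \<omega> - W s \<omega>) (normal_density 0 (sqrt (t - s))) \<and>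
        prob_space.indep_set M (sets (F s))
          {(\<lambda>\<omega>. W t \<omega> - W s \<omega>) -` A \<inter> space M | A. A \<in> sets borel})"


subsection \<open>The Ito integral\<close>

text \<open>
  The simple process given by \<open>m\<close>, \<open>s\<close>, \<open>\<xi>\<close> takes the value \<open>\<xi> i\<close> on \<open>(s i, s (i + 1)]\<close> for \<open>i < m\<close> and
  vanishes elsewhere.
\<close>

definition simple_process ::
  "'a measure \<Rightarrow> (real \<Rightarrow> 'a measure) \<Rightarrow> nat \<Rightarrow> (nat \<Rightarrow> real) \<Rightarrow> (nat \<Rightarrow> 'a \<Rightarrow> real) \<Rightarrow> bool" where
  "simple_process M F m s \<xi> \<longleftrightarrow>
     0 \<le> s 0 \<and>
     (\<forall>i<m. s i \<le> s (Suc i) \<and> \<xi> i \<in> borel_measurable (F (s i)) \<and>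
            (\<exists>C. \<forall>\<omega>\<in>space M. \<bar>\<xi> i \<omega>\<bar> \<le> C))"

definition simple_value ::
  "nat \<Rightarrow> (nat \<Rightarrow> real) \<Rightarrow> (nat \<Rightarrow> 'a \<Rightarrow> real) \<Rightarrow> real \<Rightarrow> 'a \<Rightarrow> real" where
  "simple_value m s \<xi> t \<omega> = (\<Sum>i<m. \<xi> i \<omega> * indicator {s i<..s (Suc i)} t)"

definition simple_integral ::
  "(real \<Rightarrow> 'a \<Rightarrow> real) \<Rightarrow> nat \<Rightarrow> (nat \<Rightarrow> real) \<Rightarrow> (nat \<Rightarrow> 'a \<Rightarrow> real) \<Rightarrow> real \<Rightarrow> 'a \<Rightarrow> real" where
  "simple_integral W m s \<xi> t \<omega> =
     (\<Sum>i<m. \<xi> i \<omega> * (W (min t (s (Suc i))) \<omega> - W (min t (s i)) \<omega>))"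

text \<open>
  Convergence to \<open>0\<close> in probability.  Measurability is part of the definition because
  \<^const>\<open>measure\<close> is \<open>0\<close> on non-measurable sets; the values are extended so that a divergent
  integral is not mistaken for \<open>0\<close>.
\<close>

definition tends_to_0_in_prob :: "'a measure \<Rightarrow> (nat \<Rightarrow> 'a \<Rightarrow> ennreal) \<Rightarrow> bool" where
  "tends_to_0_in_prob M Y \<longleftrightarrow>
     (\<forall>k. Y k \<in> borel_measurable M) \<and>
     (\<forall>\<epsilon>>0. (\<lambda>k. measure M {\<omega> \<in> space M. ennreal \<epsilon> < Y k \<omega>}) \<longlonglongrightarrow> 0)"

text \<open>
  \<open>has_ito_integral M F W H t J\<close>: the random variable \<open>J\<close> is (a version of) \<open>\<integral>\<^sub>0\<^sup>t H\<^sub>u dW\<^sub>u\<close>, that is,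
  the limit in probability of the integrals of simple processes \<open>G\<^sub>k\<close> for which
  \<open>\<integral>\<^sub>0\<^sup>t (G\<^sub>k(u) - H\<^sub>u)\<^sup>2 du\<close> tends to \<open>0\<close> in probability.
\<close>

definition has_ito_integral ::
  "'a measure \<Rightarrow> (real \<Rightarrow> 'a measure) \<Rightarrow> (real \<Rightarrow> 'a \<Rightarrow> real) \<Rightarrow> (real \<Rightarrow> 'a \<Rightarrow> real) \<Rightarrow>
   real \<Rightarrow> ('a \<Rightarrow> real) \<Rightarrow> bool" where
  "has_ito_integral M F W H t J \<longleftrightarrow>
     adapted F H \<and>
     (AE \<omega> in M. (\<lambda>u. H u \<omega>) \<in> borel_measurable (restrict_space borel {0..t})) \<and>
     J \<in> borel_measurable M \<and>
     (\<exists>m s \<xi>.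
        (\<forall>k. simple_process M F (m k) (s k) (\<xi> k)) \<and>
        tends_to_0_in_prob M (\<lambda>k \<omega>.
          \<integral>\<^sup>+u\<in>{0..t}. ennreal ((simple_value (m k) (s k) (\<xi> k) u \<omega> - H u \<omega>)\<^sup>2) \<partial>lborel) \<and>
        tends_to_0_in_prob M (\<lambda>k \<omega>.
          ennreal \<bar>simple_integral W (m k) (s k) (\<xi> k) t \<omega> - J \<omega>\<bar>))"

text \<open>Strong solutions of \<open>dX\<^sub>t = a(X\<^sub>t) dt + b(X\<^sub>t) dW\<^sub>t\<close>, \<open>X\<^sub>0 = x\<^sub>0\<close>, on \<open>[0,\<infinity>)\<close>.\<close>

definition strong_solution ::
  "'a measure \<Rightarrow> (real \<Rightarrow> 'a measure) \<Rightarrow> (real \<Rightarrow> 'a \<Rightarrow> real) \<Rightarrow> (real \<Rightarrow> real) \<Rightarrow> (real \<Rightarrow> real) \<Rightarrow>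
   real \<Rightarrow> (real \<Rightarrow> 'a \<Rightarrow> real) \<Rightarrow> bool" where
  "strong_solution M F W a b x0 X \<longleftrightarrow>
     adapted F X \<and>
     (AE \<omega> in M. continuous_on {0..} (\<lambda>t. X t \<omega>)) \<and>
     (AE \<omega> in M. X 0 \<omega> = x0) \<and>
     (\<forall>t\<ge>0. \<exists>J. has_ito_integral M F W (\<lambda>u \<omega>. b (X u \<omega>)) t J \<and>
        (AE \<omega> in M. set_integrable lborel {0..t} (\<lambda>u. a (X u \<omega>)) \<and>
                    X t \<omega> = x0 + (LINT u:{0..t}|lborel. a (X u \<omega>)) + J \<omega>))"


subsection \<open>Adaptive methods and minimal errors\<close>

text \<open>
  \<open>\<real>\<^sup>k\<close> is \<open>Pi\<^sub>M {1..k} (\<lambda>_. borel)\<close>; \<open>\<tau> k \<omega>\<close> is the \<open>k\<close>-th observation time.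
\<close>

definition adaptive_methods ::
  "'a measure \<Rightarrow> (real \<Rightarrow> 'a \<Rightarrow> real) \<Rightarrow> nat \<Rightarrow> ('a \<Rightarrow> real) set" where
  "adaptive_methods M W n =
     {Y \<in> borel_measurable M.
        \<exists>t1 \<phi> \<Phi> \<tau>.
          t1 \<in> {0..1} \<and>
          (\<forall>k\<in>{2..n}. \<phi> k \<in> measurable (Pi\<^sub>M {1..k-1} (\<lambda>_. borel)) (restrict_space borel {0..1})) \<and>
          \<Phi> \<in> borel_measurable (Pi\<^sub>M {1..n} (\<lambda>_. borel)) \<and>
          (\<forall>\<omega>\<in>space M.
             \<tau> 1 \<omega> = t1 \<and>
             (\<forall>k\<in>{2..n}. \<tau> k \<omega> = \<phi> k (\<lambda>i\<in>{1..k-1}. W (\<tau> i \<omega>) \<omega>)) \<and>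
             Y \<omega> = \<Phi> (\<lambda>i\<in>{1..n}. W (\<tau> i \<omega>) \<omega>))}"

text \<open>
  \<open>(E |X - Y|\<^sup>p)\<^sup>1\<^sup>/\<^sup>p\<close>, with value \<open>\<infinity>\<close> if the moment is infinite.
\<close>

definition Lp_error :: "'a measure \<Rightarrow> real \<Rightarrow> ('a \<Rightarrow> real) \<Rightarrow> ('a \<Rightarrow> real) \<Rightarrow> ennreal" where
  "Lp_error M p X Y =
     (let E = \<integral>\<^sup>+\<omega>. ennreal (\<bar>X \<omega> - Y \<omega>\<bar> powr p) \<partial>M
      in if E = \<infinity> then \<infinity> else ennreal (enn2real E powr (1 / p)))"

definition min_error_ad ::
  "'a measure \<Rightarrow> (real \<Rightarrow> 'a \<Rightarrow> real) \<Rightarrow> ('a \<Rightarrow> real) \<Rightarrow> real \<Rightarrow> nat \<Rightarrow> ennreal" where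
  "min_error_ad M W X1 p n = (INF Y\<in>adaptive_methods M W n. Lp_error M p X1 Y)"

text \<open>
  \<open>a\<^sub>n \<preceq> b\<^sub>n\<close> for \<open>n \<ge> 1\<close>.  As the right-hand side is finite, \<open>\<preceq>\<close> includes finiteness of the \<open>a\<^sub>n\<close>.
\<close>

definition asymp_le :: "(nat \<Rightarrow> ennreal) \<Rightarrow> (nat \<Rightarrow> real) \<Rightarrow> bool" where
  "asymp_le a b \<longleftrightarrow> (\<exists>c>0. \<forall>n\<ge>1. a n \<le> ennreal (c * b n))"

end

theory Submission
  imports Defs
begin

text \<open>
  The square root of \<open>X\<close> is a Brownian motion reflected at \<open>0\<close>, so
  \<open>X\<^sub>1 = (W\<^sub>1 + max (sqrt x\<^sub>0) (- min\<^bsub>[0,1]\<^esub> W))\<^sup>2\<close>.  This follows from Ito's formula for \<open>sqrt (x + \<epsilon>)\<close>: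
  its drift is non-negative and vanishes in the limit \<open>\<epsilon> \<rightarrow> 0\<close> off the zeros of \<open>X\<close>, and the zeros have Lebesgue measure
  \<open>0\<close>.  It remains to approximate the minimum of \<open>W\<close>.  A search that refines only those intervals whose left
  endpoint is nearly minimal does this with an error that is polynomially small of any order in the number of
  evaluations: by Levy's inequality and independence, the number of nearly minimal grid points is large with a
  probability that is itself polynomially small of any order.
\<close>

subsection \<open>Brownian increments\<close>

text \<open>The stochastic integral is given separately for each time, as a limit in probability,
  and no moments of \<open>X\<close> are assumed. Everything is therefore reduced to finite sums in
  which coefficients known at the left end of a cell multiply centred noise independent of the past.
  Stopping the coefficients once their accumulated variance gets large turns the discrete isometry
  into an estimate in probability. Ito's formula then holds along a subsequence of grids, which is
  enough for almost sure identities between fixed times.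

  Every order q is reached because the power of z that bounds the cost is the same for all depths:
  with z^2 parts per interval and L levels, a constant times z^6 evaluations find the minimum up to
  z^(1 - L) outside a rare event. A budget of z^8 absorbs the constant, so L alone carries q. The
  rare event is controlled as follows: from a nearly minimal point the path fails to drop clearly
  lower within z^4 steps with probability O(1/z), and m failures in succession have probability
  O(z^(-m)) with m at will. On the rare event the Cauchy-Schwarz inequality and a moment bound for
  the maximum of |W| suffice.\<close>

locale brownian = prob_space M for M :: "'a measure" +
  fixes F :: "real \<Rightarrow> 'a measure" and W :: "real \<Rightarrow> 'a \<Rightarrow> real"
  assumes usual: "usual_filtration M F" and bm: "brownian_motion M F W"
begin

lemma subalg: "0 \<le> t \<Longrightarrow> subalgebra M (F t)"
  using usual by (simp add: usual_filtration_def)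

lemma space_F: "0 \<le> t \<Longrightarrow> space (F t) = space M"
  using subalg by (auto simp: subalgebra_def)

lemma sets_F: "0 \<le> t \<Longrightarrow> A \<in> sets (F t) \<Longrightarrow> A \<in> sets M"
  using subalg by (auto simp: subalgebra_def)

lemma sets_F_mono: "0 \<le> s \<Longrightarrow> s \<le> t \<Longrightarrow> A \<in> sets (F s) \<Longrightarrow> A \<in> sets (F t)"
  using usual by (auto simp: usual_filtration_def)

lemma borel_F: "0 \<le> t \<Longrightarrow> f \<in> borel_measurable (F t) \<Longrightarrow> f \<in> borel_measurable M"
  using measurable_from_subalg[OF subalg] by blast

lemma borel_F_mono: "0 \<le> s \<Longrightarrow> s \<le> t \<Longrightarrow> f \<in> borel_measurable (F s) \<Longrightarrow> f \<in> borel_measurable (F t)"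
  by (rule measurable_from_subalg[of "F t" "F s"]) (auto simp: subalgebra_def space_F intro: sets_F_mono)

lemma W_F: "0 \<le> s \<Longrightarrow> s \<le> t \<Longrightarrow> W s \<in> borel_measurable (F t)"
  using bm borel_F_mono by (auto simp: brownian_motion_def adapted_def)

lemma W_M [measurable]: "0 \<le> s \<Longrightarrow> W s \<in> borel_measurable M"
  using W_F[of s s] borel_F by auto

lemma AE_W_0: "AE \<omega> in M. W 0 \<omega> = 0"
  and AE_W_continuous: "AE \<omega> in M. continuous_on {0..} (\<lambda>t. W t \<omega>)"
  using bm by (auto simp: brownian_motion_def)

lemma increment_distributed:
  "0 \<le> s \<Longrightarrow> s < t \<Longrightarrow> distributed M lborel (\<lambda>\<omega>. W t \<omega> - W s \<omega>) (normal_density 0 (sqrt (t - s)))"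
  using bm by (auto simp: brownian_motion_def)

lemma increment_indep:
  assumes "0 \<le> s" "s < t" "A \<in> sets (F s)" "B \<in> sets borel"
  shows "prob (A \<inter> ((\<lambda>\<omega>. W t \<omega> - W s \<omega>) -` B \<inter> space M)) =
         prob A * prob ((\<lambda>\<omega>. W t \<omega> - W s \<omega>) -` B \<inter> space M)"
proof (rule indep_setD)
  show "indep_set (sets (F s)) {(\<lambda>\<omega>. W t \<omega> - W s \<omega>) -` A \<inter> space M | A. A \<in> sets borel}"
    using bm assms by (auto simp: brownian_motion_def)
qed (use assms in auto)

text \<open>The definition of Brownian motion speaks of independent events. Both families of
  preimages are stable under intersection, so independence extends to the generated
  \<sigma>-algebras and thus to random variables. The map \<open>g\<close> serves the squares of the
  increments.\<close>

lemma increment_indep_var: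
  fixes \<xi> :: "'a \<Rightarrow> real" and g :: "real \<Rightarrow> real"
  assumes st: "0 \<le> s" "s < t" and \<xi>: "\<xi> \<in> borel_measurable (F s)" and g: "g \<in> borel_measurable borel"
  shows "indep_var borel \<xi> borel (\<lambda>\<omega>. g (W t \<omega> - W s \<omega>))"
proof -
  have inc: "(\<lambda>\<omega>. W t \<omega> - W s \<omega>) \<in> borel_measurable M" using st by simp
  have stable: "Int_stable {Y -` A \<inter> space M | A. A \<in> sets (borel :: real measure)}" for Y :: "'a \<Rightarrow> real"
    unfolding Int_stable_def
  proof safe
    fix A B :: "real set" assume "A \<in> sets borel" "B \<in> sets borel"
    then show "\<exists>C. (Y -` A \<inter> space M) \<inter> (Y -` B \<inter> space M) = Y -` C \<inter> space M \<and> C \<in> sets borel"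
      by (intro exI[of _ "A \<inter> B"]) auto
  qed
  have "indep_set {\<xi> -` A \<inter> space M | A. A \<in> sets borel}
      {(\<lambda>\<omega>. W t \<omega> - W s \<omega>) -` A \<inter> space M | A. A \<in> sets borel}"
  proof (rule indep_setI)
    show "{\<xi> -` A \<inter> space M | A. A \<in> sets borel} \<subseteq> events"
      using borel_F[OF st(1) \<xi>] by (auto intro: measurable_sets)
    show "{(\<lambda>\<omega>. W t \<omega> - W s \<omega>) -` A \<inter> space M | A. A \<in> sets borel} \<subseteq> events"
      using inc by (auto intro: measurable_sets)
    fix a b
    assume "a \<in> {\<xi> -` A \<inter> space M | A. A \<in> sets borel}"
      and "b \<in> {(\<lambda>\<omega>. W t \<omega> - W s \<omega>) -` A \<inter> space M | A. A \<in> sets borel}"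
    then obtain A B where "A \<in> sets borel" "B \<in> sets borel" and a: "a = \<xi> -` A \<inter> space M"
      and b: "b = (\<lambda>\<omega>. W t \<omega> - W s \<omega>) -` B \<inter> space M" by auto
    then have "a \<in> sets (F s)"
      using measurable_sets[OF \<xi>] by (metis space_F[OF st(1)])
    then show "prob (a \<inter> b) = prob a * prob b"
      unfolding b using increment_indep[OF st] \<open>B \<in> sets borel\<close> by auto
  qed
  then have "indep_set (sigma_sets (space M) {\<xi> -` A \<inter> space M | A. A \<in> sets borel})
        (sigma_sets (space M) {(\<lambda>\<omega>. W t \<omega> - W s \<omega>) -` A \<inter> space M | A. A \<in> sets borel})"
    by (rule indep_set_sigma_sets[OF _ stable[of \<xi>] stable[of "\<lambda>\<omega>. W t \<omega> - W s \<omega>"]])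
  then have "indep_var borel \<xi> borel (\<lambda>\<omega>. W t \<omega> - W s \<omega>)"
    using inc borel_F[OF st(1) \<xi>] by (simp add: indep_var_eq)
  from indep_var_compose[OF this measurable_ident g] show ?thesis by (simp add: comp_def)
qed

lemma increment_moment:
  assumes st: "0 \<le> s" "s < t"
  shows "integrable M (\<lambda>\<omega>. (W t \<omega> - W s \<omega>) ^ k)"
    and "expectation (\<lambda>\<omega>. W t \<omega> - W s \<omega>) = 0"
    and "expectation (\<lambda>\<omega>. (W t \<omega> - W s \<omega>) ^ (2 * k)) = fact (2 * k) / (2 ^ k * fact k) * (t - s) ^ k"
proof -
  note D = increment_distributed[OF st]
  have pos: "0 < sqrt (t - s)" using st by simp
  have "integrable lborel (\<lambda>x. normal_density 0 (sqrt (t - s)) x * x ^ k)"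
    using integrable_normal_moment[OF pos, of 0 k] by simp
  then show "integrable M (\<lambda>\<omega>. (W t \<omega> - W s \<omega>) ^ k)"
    using distributed_integrable[OF D, of "\<lambda>x. x ^ k"] by simp
  show "expectation (\<lambda>\<omega>. W t \<omega> - W s \<omega>) = 0"
    using normal_distributed_expectation[OF pos D] by simp
  have "expectation (\<lambda>\<omega>. (W t \<omega> - W s \<omega>) ^ (2 * k)) = (\<integral>x. normal_density 0 (sqrt (t - s)) x * x ^ (2 * k) \<partial>lborel)"
    using distributed_integral[OF D, of "\<lambda>x. x ^ (2 * k)"] by simp
  also have "\<dots> = fact (2 * k) / ((2 / (sqrt (t - s))\<^sup>2) ^ k * fact k)"
    using has_bochner_integral_integral_eq[OF normal_moment_even[OF pos, of 0 k]] by simp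
  also have "\<dots> = fact (2 * k) / (2 ^ k * fact k) * (t - s) ^ k"
    using st by (simp add: power_divide)
  finally show "expectation (\<lambda>\<omega>. (W t \<omega> - W s \<omega>) ^ (2 * k)) = fact (2 * k) / (2 ^ k * fact k) * (t - s) ^ k" .
qed

text \<open>This is what a discrete isometry asks of its random factor: the mixed terms of a squared
  sum use the independence of \<open>\<zeta>\<close> from the past, the diagonal terms that of its
  square. The increment of \<open>W\<close> and its compensated square are the two
  instances.\<close>

definition noise :: "real \<Rightarrow> real \<Rightarrow> ('a \<Rightarrow> real) \<Rightarrow> real \<Rightarrow> bool" where
  "noise s t \<zeta> v \<longleftrightarrow> \<zeta> \<in> borel_measurable (F t) \<and> (\<forall>\<xi>\<in>borel_measurable (F s). indep_var borel \<xi> borel \<zeta>) \<and>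
     (\<forall>\<xi>\<in>borel_measurable (F s). indep_var borel \<xi> borel (\<lambda>\<omega>. (\<zeta> \<omega>)\<^sup>2)) \<and>
     integrable M \<zeta> \<and> expectation \<zeta> = 0 \<and> integrable M (\<lambda>\<omega>. (\<zeta> \<omega>)\<^sup>2) \<and> expectation (\<lambda>\<omega>. (\<zeta> \<omega>)\<^sup>2) = v"

lemma noise_increment:
  assumes st: "0 \<le> s" "s < t"
  shows "noise s t (\<lambda>\<omega>. W t \<omega> - W s \<omega>) (t - s)"
proof -
  have "integrable M (\<lambda>\<omega>. W t \<omega> - W s \<omega>)"
    using increment_moment(1)[OF st, of 1] by simp
  moreover have "expectation (\<lambda>\<omega>. (W t \<omega> - W s \<omega>)\<^sup>2) = t - s"
    using increment_moment(3)[OF st, of 1] by (simp add: fact_numeral)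
  moreover have "(\<lambda>\<omega>. W t \<omega> - W s \<omega>) \<in> borel_measurable (F t)"
    using st by (intro borel_measurable_diff W_F) auto
  ultimately show ?thesis
    unfolding noise_def
    by (intro conjI ballI increment_indep_var[OF st, of _ "\<lambda>x. x"] increment_indep_var[OF st, of _ "\<lambda>x. x\<^sup>2"]
        increment_moment[OF st]) auto
qed

lemma noise_increment_square:
  assumes st: "0 \<le> s" "s < t"
  shows "noise s t (\<lambda>\<omega>. (W t \<omega> - W s \<omega>)\<^sup>2 - (t - s)) (2 * (t - s)\<^sup>2)"
proof -
  let ?D = "\<lambda>\<omega>. W t \<omega> - W s \<omega>"
  have i2: "integrable M (\<lambda>\<omega>. (?D \<omega>)\<^sup>2)" and i4: "integrable M (\<lambda>\<omega>. (?D \<omega>) ^ 4)"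
    using increment_moment(1)[OF st] by auto
  have e2: "expectation (\<lambda>\<omega>. (?D \<omega>)\<^sup>2) = t - s"
    using increment_moment(3)[OF st, of 1] by (simp add: fact_numeral)
  have e4: "expectation (\<lambda>\<omega>. (?D \<omega>) ^ 4) = 3 * (t - s)\<^sup>2"
    using increment_moment(3)[OF st, of 2] by (simp add: fact_numeral)
  have "(y\<^sup>2 - c)\<^sup>2 = y ^ 4 - 2 * c * y\<^sup>2 + c\<^sup>2" for y c :: real
    by (simp add: power2_eq_square power4_eq_xxxx algebra_simps)
  then have sq: "((?D \<omega>)\<^sup>2 - (t - s))\<^sup>2 = (?D \<omega>) ^ 4 - 2 * (t - s) * (?D \<omega>)\<^sup>2 + (t - s)\<^sup>2" for \<omega>
    by blast
  have "expectation (\<lambda>\<omega>. ((?D \<omega>)\<^sup>2 - (t - s))\<^sup>2) = 3 * (t - s)\<^sup>2 - 2 * (t - s) * (t - s) + (t - s)\<^sup>2"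
    unfolding sq using i2 i4 e2 e4 by (simp add: prob_space)
  also have "\<dots> = 2 * (t - s)\<^sup>2" by (simp add: power2_eq_square)
  finally have e: "expectation (\<lambda>\<omega>. ((?D \<omega>)\<^sup>2 - (t - s))\<^sup>2) = 2 * (t - s)\<^sup>2" .
  have i: "integrable M (\<lambda>\<omega>. ((?D \<omega>)\<^sup>2 - (t - s))\<^sup>2)"
    unfolding sq using i2 i4 by auto
  have "(\<lambda>\<omega>. (?D \<omega>)\<^sup>2 - (t - s)) \<in> borel_measurable (F t)"
    using st by (intro borel_measurable_diff borel_measurable_power W_F) auto
  moreover have "expectation (\<lambda>\<omega>. (?D \<omega>)\<^sup>2 - (t - s)) = 0"
    using i2 e2 by (simp add: prob_space)
  moreover have "integrable M (\<lambda>\<omega>. (?D \<omega>)\<^sup>2 - (t - s))"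
    using i2 by simp
  ultimately show ?thesis
    unfolding noise_def using i e
    by (intro conjI ballI increment_indep_var[OF st, of _ "\<lambda>x. x\<^sup>2 - (t - s)"]
        increment_indep_var[OF st, of _ "\<lambda>x. (x\<^sup>2 - (t - s))\<^sup>2"]) auto
qed

end

section \<open>Finite partitions of a time interval\<close>

definition strict_chain :: "nat \<Rightarrow> (nat \<Rightarrow> real) \<Rightarrow> bool" where
  "strict_chain N p \<longleftrightarrow> (\<forall>l<N. p l < p (Suc l))"

lemma strict_chainD: "strict_chain N p \<Longrightarrow> l < N \<Longrightarrow> p l < p (Suc l)"
  by (simp add: strict_chain_def)

lemma strict_chain_iff:
  fixes p :: "nat \<Rightarrow> real"
  assumes p: "strict_chain N p" and "i \<le> N" "j \<le> N"
  shows "p i < p j \<longleftrightarrow> i < j" and "p i \<le> p j \<longleftrightarrow> i \<le> j"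
proof -
  have *: "p i < p j" if "i < j" "j \<le> N" for i j
    using that
  proof (induction j)
    case (Suc j)
    then show ?case using strict_chainD[OF p, of j] by (cases "i = j") auto
  qed simp
  show lt: "p i < p j \<longleftrightarrow> i < j"
    using *[of i j] *[of j i] assms(2,3) by (cases i j rule: linorder_cases) auto
  show "p i \<le> p j \<longleftrightarrow> i \<le> j"
    using *[of i j] *[of j i] assms(2,3) by (cases i j rule: linorder_cases) auto
qed

lemma obtain_strict_chain:
  fixes P :: "real set"
  assumes "finite P" "P \<noteq> {}"
  obtains p N where "strict_chain N p" "p ` {..N} = P" "p 0 = Min P" "p N = Max P"
proof -
  define L where "L = sorted_list_of_set P"
  have L: "set L = P" "sorted_wrt (<) L" "L \<noteq> []"
    using assms by (auto simp: L_def )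
  define N where "N = length L - 1"
  have len: "length L = Suc N" using L(3) by (cases L) (auto simp: N_def)
  have lt: "strict_chain N (\<lambda>l. L ! l)"
    using L(2) len by (auto simp: strict_chain_def sorted_wrt_iff_nth_less)
  have im: "(\<lambda>l. L ! l) ` {..N} = P"
    using L(1) len by (auto simp: set_conv_nth image_def less_Suc_eq_le)
  have "L ! 0 = Min P" "L ! N = Max P"
    using strict_chain_iff(2)[of N "\<lambda>l. L ! l", OF lt] im assms(1)
    by (auto intro!: Min_eqI[symmetric] Max_eqI[symmetric])
  then show thesis using that[of N "\<lambda>l. L ! l"] lt im by auto
qed

text \<open>Spreads an increment over a coarse interval onto the cells of a finer partition. Cells
  are tested at their right ends because simple processes are constant on intervals that are open on
  the left and closed on the right.\<close>

lemma telescope_indicator: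
  fixes p :: "nat \<Rightarrow> real" and g :: "real \<Rightarrow> real"
  assumes p: "strict_chain N p" and ab: "a \<in> p ` {..N}" "b \<in> p ` {..N}" "a \<le> b"
  shows "(\<Sum>l<N. indicator {a<..b} (p (Suc l)) * (g (p (Suc l)) - g (p l))) = g b - g a"
proof -
  obtain i j where ij: "i \<le> N" "a = p i" "j \<le> N" "b = p j" using ab by auto
  then have "i \<le> j" using ab strict_chain_iff(2)[OF p] by auto
  have "(\<Sum>l<N. indicator {a<..b} (p (Suc l)) * (g (p (Suc l)) - g (p l)))
      = (\<Sum>l<N. if l \<in> {i..<j} then g (p (Suc l)) - g (p l) else 0)"
  proof (rule sum.cong)
    fix l assume "l \<in> {..<N}"
    then have "p i < p (Suc l) \<longleftrightarrow> i \<le> l" "p (Suc l) \<le> p j \<longleftrightarrow> l < j"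
      using ij strict_chain_iff[OF p, of i "Suc l"] strict_chain_iff[OF p, of "Suc l" j] by auto
    then show "indicator {a<..b} (p (Suc l)) * (g (p (Suc l)) - g (p l))
        = (if l \<in> {i..<j} then g (p (Suc l)) - g (p l) else 0)"
      using ij by (auto simp: indicator_def)
  qed simp
  also have "\<dots> = (\<Sum>l\<in>{i..<j}. g (p (Suc l)) - g (p l))"
    using ij by (subst sum.inter_restrict[symmetric]) (auto intro!: sum.cong)
  also have "\<dots> = g b - g a"
    using \<open>i \<le> j\<close> ij sum_Suc_diff'[of i j "\<lambda>l. g (p l)"] by simp
  finally show ?thesis .
qed

text \<open>The hypothesis says nothing about the value at \<open>p 0\<close>; this single point
  does not affect the integral.\<close>

lemma nn_integral_step:
  fixes p :: "nat \<Rightarrow> real" and \<phi> :: "real \<Rightarrow> real"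
  assumes p: "strict_chain N p"
    and \<phi>: "\<And>l u. l < N \<Longrightarrow> p l < u \<Longrightarrow> u \<le> p (Suc l) \<Longrightarrow> \<phi> u = \<phi> (p (Suc l))"
  shows "(\<integral>\<^sup>+u\<in>{p 0..p N}. ennreal ((\<phi> u)\<^sup>2) \<partial>lborel) = ennreal (\<Sum>l<N. (\<phi> (p (Suc l)))\<^sup>2 * (p (Suc l) - p l))"
proof -
  have pw: "ennreal ((\<phi> u)\<^sup>2) * indicator {p 0<..p n} u
      = (\<Sum>l<n. ennreal ((\<phi> (p (Suc l)))\<^sup>2) * indicator {p l<..p (Suc l)} u)" if "n \<le> N" for n u
    using that
  proof (induction n)
    case (Suc n)
    then have "p 0 \<le> p n" "p n < p (Suc n)"
      using strict_chain_iff(2)[OF p, of 0 n] strict_chainD[OF p, of n] by auto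
    then have "indicator {p 0<..p (Suc n)} u = (indicator {p 0<..p n} u + indicator {p n<..p (Suc n)} u :: ennreal)"
      by (auto simp: indicator_def)
    then have "ennreal ((\<phi> u)\<^sup>2) * indicator {p 0<..p (Suc n)} u =
        ennreal ((\<phi> u)\<^sup>2) * indicator {p 0<..p n} u + ennreal ((\<phi> u)\<^sup>2) * indicator {p n<..p (Suc n)} u"
      by (simp add: distrib_left)
    also have "ennreal ((\<phi> u)\<^sup>2) * indicator {p n<..p (Suc n)} u
        = ennreal ((\<phi> (p (Suc n)))\<^sup>2) * indicator {p n<..p (Suc n)} u"
      using \<phi>[of n u] Suc.prems by (auto simp: indicator_def)
    finally show ?case using Suc by simp
  qed simp
  have "(\<integral>\<^sup>+u\<in>{p 0..p N}. ennreal ((\<phi> u)\<^sup>2) \<partial>lborel) = (\<integral>\<^sup>+u\<in>{p 0<..p N}. ennreal ((\<phi> u)\<^sup>2) \<partial>lborel)"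
    using AE_lborel_singleton[of "p 0"] by (intro nn_integral_cong_AE) (auto simp: indicator_def)
  also have "\<dots> = (\<integral>\<^sup>+u. (\<Sum>l<N. ennreal ((\<phi> (p (Suc l)))\<^sup>2) * indicator {p l<..p (Suc l)} u) \<partial>lborel)"
    using pw[OF order_refl] by simp
  also have "\<dots> = (\<Sum>l<N. ennreal ((\<phi> (p (Suc l)))\<^sup>2) * ennreal (p (Suc l) - p l))"
    using strict_chainD[OF p] by (subst nn_integral_sum) (auto simp: nn_integral_cmult_indicator less_imp_le intro!: sum.cong)
  also have "\<dots> = ennreal (\<Sum>l<N. (\<phi> (p (Suc l)))\<^sup>2 * (p (Suc l) - p l))"
    using strict_chainD[OF p] by (subst sum_ennreal[symmetric]) (auto simp: ennreal_mult less_imp_le intro!: sum.cong)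
  finally show ?thesis .
qed

context brownian
begin

text \<open>The discrete Ito isometry. In a product of two terms with \<open>l < k\<close>
  everything except \<open>\<zeta> k\<close> is known at time \<open>p k\<close>, so the product has
  expectation 0. The deterministic bounds \<open>b l\<close> on the coefficients make all products
  integrable.\<close>

lemma noise_sum_L2:
  assumes p: "0 \<le> p 0" "strict_chain N p"
    and n: "\<And>l. l < N \<Longrightarrow> noise (p l) (p (Suc l)) (\<zeta> l) (v l)"
    and c: "\<And>l. l < N \<Longrightarrow> c l \<in> borel_measurable (F (p l))"
    and bd: "\<And>l \<omega>. l < N \<Longrightarrow> \<omega> \<in> space M \<Longrightarrow> \<bar>c l \<omega>\<bar> \<le> b l"
    and B: "B \<subseteq> {..<N}"
  shows "integrable M (\<lambda>\<omega>. (\<Sum>l\<in>B. c l \<omega> * \<zeta> l \<omega>)\<^sup>2)"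
    and "expectation (\<lambda>\<omega>. (\<Sum>l\<in>B. c l \<omega> * \<zeta> l \<omega>)\<^sup>2) = (\<Sum>l\<in>B. expectation (\<lambda>\<omega>. (c l \<omega>)\<^sup>2) * v l)"
proof -
  have finB: "finite B" using B finite_subset by blast
  have p0: "0 \<le> p l" if "l \<le> N" for l
    using strict_chain_iff(2)[OF p(2), of 0 l] that p(1) by auto
  have cM [measurable]: "c l \<in> borel_measurable M" if "l < N" for l
    using borel_F[OF p0 c[OF that]] that by auto
  have \<zeta>M [measurable]: "\<zeta> l \<in> borel_measurable M" if "l < N" for l
    using n[OF that] borel_F[OF p0, of "Suc l"] that by (auto simp: noise_def)
  have bounded: "integrable M f" if "f \<in> borel_measurable M" "\<And>\<omega>. \<omega> \<in> space M \<Longrightarrow> \<bar>f \<omega>\<bar> \<le> K" for f :: "'a \<Rightarrow> real" and K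
    using that by (intro integrable_const_bound[where B = K]) auto
  have diag: "integrable M (\<lambda>\<omega>. (c l \<omega> * \<zeta> l \<omega>) * (c l \<omega> * \<zeta> l \<omega>))"
    "expectation (\<lambda>\<omega>. (c l \<omega> * \<zeta> l \<omega>) * (c l \<omega> * \<zeta> l \<omega>)) = expectation (\<lambda>\<omega>. (c l \<omega>)\<^sup>2) * v l" if l: "l < N" for l
  proof -
    have "(\<lambda>\<omega>. (c l \<omega>)\<^sup>2) \<in> borel_measurable (F (p l))" using c[OF l] by simp
    then have ind: "indep_var borel (\<lambda>\<omega>. (c l \<omega>)\<^sup>2) borel (\<lambda>\<omega>. (\<zeta> l \<omega>)\<^sup>2)"
      using n[OF l] by (auto simp: noise_def)
    have i1: "integrable M (\<lambda>\<omega>. (c l \<omega>)\<^sup>2)"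
      using order_trans[OF bd[OF l] abs_ge_self] l
      by (intro bounded[of _ "(b l)\<^sup>2"]) (auto simp: abs_le_square_iff[symmetric])
    have i2: "integrable M (\<lambda>\<omega>. (\<zeta> l \<omega>)\<^sup>2)" using n[OF l] by (auto simp: noise_def)
    have eq: "(c l \<omega> * \<zeta> l \<omega>) * (c l \<omega> * \<zeta> l \<omega>) = (c l \<omega>)\<^sup>2 * (\<zeta> l \<omega>)\<^sup>2" for \<omega>
      by (simp add: power2_eq_square)
    show "integrable M (\<lambda>\<omega>. (c l \<omega> * \<zeta> l \<omega>) * (c l \<omega> * \<zeta> l \<omega>))"
      unfolding eq by (rule indep_var_integrable[OF ind i1 i2])
    show "expectation (\<lambda>\<omega>. (c l \<omega> * \<zeta> l \<omega>) * (c l \<omega> * \<zeta> l \<omega>)) = expectation (\<lambda>\<omega>. (c l \<omega>)\<^sup>2) * v l"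
      unfolding eq indep_var_lebesgue_integral[OF ind i1 i2] using n[OF l] by (simp add: noise_def)
  qed
  have off: "integrable M (\<lambda>\<omega>. (c l \<omega> * \<zeta> l \<omega>) * (c k \<omega> * \<zeta> k \<omega>)) \<and>
      expectation (\<lambda>\<omega>. (c l \<omega> * \<zeta> l \<omega>) * (c k \<omega> * \<zeta> k \<omega>)) = 0" if l: "l < k" and k: "k < N" for l k
  proof -
    have lN: "l < N" using l k by simp
    have mono: "p l \<le> p k" "p (Suc l) \<le> p k"
      using strict_chain_iff(2)[OF p(2), of _ k] l k by auto
    have "\<zeta> l \<in> borel_measurable (F (p k))" "c l \<in> borel_measurable (F (p k))"
      using borel_F_mono[OF p0 mono(2)] borel_F_mono[OF p0 mono(1)] n[OF lN] c[OF lN] lN by (auto simp: noise_def)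
    then have "(\<lambda>\<omega>. c l \<omega> * c k \<omega> * \<zeta> l \<omega>) \<in> borel_measurable (F (p k))"
      using c[OF k] by (intro borel_measurable_times) auto
    then have ind: "indep_var borel (\<lambda>\<omega>. c l \<omega> * c k \<omega> * \<zeta> l \<omega>) borel (\<zeta> k)"
      using n[OF k] unfolding noise_def by blast
    have cb: "\<bar>c l \<omega> * c k \<omega>\<bar> \<le> b l * b k" if "\<omega> \<in> space M" for \<omega>
      unfolding abs_mult using bd[OF lN that] bd[OF k that] by (intro mult_mono) auto
    have le: "norm (c l \<omega> * c k \<omega> * \<zeta> l \<omega>) \<le> norm (b l * b k * \<zeta> l \<omega>)" if "\<omega> \<in> space M" for \<omega>
      unfolding real_norm_def abs_mult[of _ "\<zeta> l \<omega>"] using order_trans[OF cb[OF that] abs_ge_self]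
      by (rule mult_right_mono) simp
    have "integrable M (\<lambda>\<omega>. b l * b k * \<zeta> l \<omega>)" using n[OF lN] by (simp add: noise_def)
    moreover have "(\<lambda>\<omega>. c l \<omega> * c k \<omega> * \<zeta> l \<omega>) \<in> borel_measurable M"
      using cM[OF lN] cM[OF k] \<zeta>M[OF lN] by (intro borel_measurable_times)
    ultimately have i1: "integrable M (\<lambda>\<omega>. c l \<omega> * c k \<omega> * \<zeta> l \<omega>)"
      using le by (rule Bochner_Integration.integrable_bound[OF _ _ AE_I2])
    have i2: "integrable M (\<zeta> k)" "expectation (\<zeta> k) = 0" using n[OF k] by (auto simp: noise_def)
    have eq: "(c l \<omega> * \<zeta> l \<omega>) * (c k \<omega> * \<zeta> k \<omega>) = c l \<omega> * c k \<omega> * \<zeta> l \<omega> * \<zeta> k \<omega>" for \<omega>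
      by simp
    show ?thesis
      unfolding eq indep_var_lebesgue_integral[OF ind i1 i2(1)] i2(2)
      using indep_var_integrable[OF ind i1 i2(1)] by simp
  qed
  have int: "integrable M (\<lambda>\<omega>. (c l \<omega> * \<zeta> l \<omega>) * (c k \<omega> * \<zeta> k \<omega>))" if "l \<in> B" "k \<in> B" for l k
    using that B diag(1)[of l] off[of l k] off[of k l] by (cases l k rule: linorder_cases) (auto simp: mult.commute)
  have ex: "expectation (\<lambda>\<omega>. (c l \<omega> * \<zeta> l \<omega>) * (c k \<omega> * \<zeta> k \<omega>)) = (if l = k then expectation (\<lambda>\<omega>. (c l \<omega>)\<^sup>2) * v l else 0)"
    if "l \<in> B" "k \<in> B" for l k
    using that B diag(2)[of l] off[of l k] off[of k l] by (cases l k rule: linorder_cases) (auto simp: mult.commute)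
  have sq: "(\<Sum>l\<in>B. c l \<omega> * \<zeta> l \<omega>)\<^sup>2 = (\<Sum>l\<in>B. \<Sum>k\<in>B. (c l \<omega> * \<zeta> l \<omega>) * (c k \<omega> * \<zeta> k \<omega>))" for \<omega>
    by (simp add: power2_eq_square sum_product)
  show "integrable M (\<lambda>\<omega>. (\<Sum>l\<in>B. c l \<omega> * \<zeta> l \<omega>)\<^sup>2)"
    unfolding sq using int by auto
  show "expectation (\<lambda>\<omega>. (\<Sum>l\<in>B. c l \<omega> * \<zeta> l \<omega>)\<^sup>2) = (\<Sum>l\<in>B. expectation (\<lambda>\<omega>. (c l \<omega>)\<^sup>2) * v l)"
    unfolding sq using int finB by (simp add: Bochner_Integration.integral_sum ex cong: sum.cong)
qed

text \<open>The blocks \<open>B g\<close> cover at once the square of a weighted sum (one block) and a weighted sum of squares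
  (singletons).\<close>

lemma noise_lenglart:
  assumes p: "0 \<le> p 0" "strict_chain N p"
    and n: "\<And>l. l < N \<Longrightarrow> noise (p l) (p (Suc l)) (\<zeta> l) (v l)" and v: "\<And>l. l < N \<Longrightarrow> 0 < v l"
    and c: "\<And>l. l < N \<Longrightarrow> c l \<in> borel_measurable (F (p l))"
    and G: "finite G" "\<And>g. g \<in> G \<Longrightarrow> B g \<subseteq> {..<N}" "disjoint_family_on B G"
    and pos: "0 < \<eta>" "0 < \<delta>"
  shows "prob {\<omega>\<in>space M. \<delta> < (\<Sum>g\<in>G. (\<Sum>l\<in>B g. c l \<omega> * \<zeta> l \<omega>)\<^sup>2)}
    \<le> prob {\<omega>\<in>space M. \<eta> < (\<Sum>l<N. (c l \<omega>)\<^sup>2 * v l)} + \<eta> / \<delta>"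
proof -
  have p0: "0 \<le> p l" if "l \<le> N" for l
    using strict_chain_iff(2)[OF p(2), of 0 l] that p(1) by auto
  have cM [measurable]: "c l \<in> borel_measurable M" if "l < N" for l
    using borel_F[OF p0 c[OF that]] that by auto
  have \<zeta>M [measurable]: "\<zeta> l \<in> borel_measurable M" if "l < N" for l
    using n[OF that] borel_F[OF p0, of "Suc l"] that by (auto simp: noise_def)
  define Q where "Q l \<omega> = (\<Sum>k<l. (c k \<omega>)\<^sup>2 * v k)" for l \<omega>
  \<comment> \<open>The coefficient is switched off as soon as the accumulated variance, including
    the current term, exceeds \<open>\<eta>\<close>. That sum contains only \<open>c 0\<close>, ...,
    \<open>c l\<close>, so the cut-off coefficient is still known at time
    \<open>p l\<close>.\<close>
  define c' where "c' l \<omega> = (if Q (Suc l) \<omega> \<le> \<eta> then c l \<omega> else 0)" for l \<omega>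
  have Qmono: "Q l \<omega> \<le> Q k \<omega>" if "l \<le> k" "k \<le> N" for l k \<omega>
    unfolding Q_def using that v by (intro sum_mono2) (auto intro!: mult_nonneg_nonneg simp: less_imp_le)
  have c'_F: "c' l \<in> borel_measurable (F (p l))" if l: "l < N" for l
  proof -
    have "c k \<in> borel_measurable (F (p l))" if "k \<le> l" for k
      using that l strict_chain_iff(2)[OF p(2), of k l] borel_F_mono[OF p0 _ c, of k "p l"] by auto
    then have "Q (Suc l) \<in> borel_measurable (F (p l))"
      unfolding Q_def by (intro borel_measurable_sum borel_measurable_times borel_measurable_power) auto
    then show ?thesis unfolding c'_def using c[OF l] by measurable
  qed
  have c'_sq: "(c' l \<omega>)\<^sup>2 * v l \<le> \<eta>" if l: "l < N" for l \<omega>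
  proof (cases "Q (Suc l) \<omega> \<le> \<eta>")
    case True
    have "(c l \<omega>)\<^sup>2 * v l \<le> Q (Suc l) \<omega>"
      unfolding Q_def using v l by (intro member_le_sum) (auto intro!: mult_nonneg_nonneg simp: less_imp_le)
    with True show ?thesis by (simp add: c'_def)
  qed (use pos in \<open>simp add: c'_def\<close>)
  \<comment> \<open>The isometry wants a deterministic bound for each coefficient. A single summand
    of the stopped variance is at most \<open>\<eta>\<close>, and \<open>v l\<close> is
    positive.\<close>
  have c'_bd: "\<bar>c' l \<omega>\<bar> \<le> sqrt (\<eta> / v l)" if "l < N" for l \<omega>
    using c'_sq[OF that, of \<omega>] v[OF that] by (intro real_le_rsqrt) (simp add: pos_le_divide_eq)
  have total: "(\<Sum>l<k. (c' l \<omega>)\<^sup>2 * v l) \<le> \<eta>" if "k \<le> N" for k \<omega>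
    using that
  proof (induction k)
    case (Suc k)
    show ?case
    proof (cases "Q (Suc k) \<omega> \<le> \<eta>")
      case True
      have "(\<Sum>l<Suc k. (c' l \<omega>)\<^sup>2 * v l) \<le> (\<Sum>l<Suc k. (c l \<omega>)\<^sup>2 * v l)"
        using v Suc.prems by (intro sum_mono mult_right_mono) (auto simp: c'_def less_imp_le)
      then show ?thesis using True by (simp add: Q_def)
    qed (use Suc in \<open>simp add: c'_def\<close>)
  qed (use pos in simp)
  let ?Y = "\<lambda>\<omega>. \<Sum>g\<in>G. (\<Sum>l\<in>B g. c' l \<omega> * \<zeta> l \<omega>)\<^sup>2"
  note L2 = noise_sum_L2[OF p n c'_F c'_bd]
  have intY: "integrable M ?Y" using L2(1) G by auto
  have ic': "integrable M (\<lambda>\<omega>. (c' l \<omega>)\<^sup>2 * v l)" if "l < N" for l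
    using c'_sq[OF that] v[OF that] borel_F[OF p0 c'_F[OF that]] that
    by (intro integrable_const_bound[where B = \<eta>]) auto
  have eY: "expectation ?Y \<le> \<eta>"
  proof -
    have "expectation ?Y = (\<Sum>g\<in>G. \<Sum>l\<in>B g. expectation (\<lambda>\<omega>. (c' l \<omega>)\<^sup>2) * v l)"
      using L2 G by (subst Bochner_Integration.integral_sum) (auto intro!: sum.cong)
    also have "\<dots> = (\<Sum>l\<in>(\<Union>g\<in>G. B g). expectation (\<lambda>\<omega>. (c' l \<omega>)\<^sup>2) * v l)"
      using G finite_subset[OF G(2)] by (subst sum.UNION_disjoint) (auto simp: disjoint_family_on_def)
    also have "\<dots> \<le> (\<Sum>l<N. expectation (\<lambda>\<omega>. (c' l \<omega>)\<^sup>2) * v l)"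
      using G v by (intro sum_mono2) (auto intro!: mult_nonneg_nonneg simp: less_imp_le)
    also have "\<dots> = expectation (\<lambda>\<omega>. \<Sum>l<N. (c' l \<omega>)\<^sup>2 * v l)"
      using ic' by (subst Bochner_Integration.integral_sum) auto
    also have "\<dots> \<le> expectation (\<lambda>\<omega>. \<eta>)"
      using total ic' by (intro integral_mono) auto
    finally show ?thesis by (simp add: prob_space)
  qed
  have [measurable]: "{\<omega>\<in>space M. \<eta> < (\<Sum>l<N. (c l \<omega>)\<^sup>2 * v l)} \<in> sets M" "{\<omega>\<in>space M. \<delta> \<le> ?Y \<omega>} \<in> sets M"
    using intY by measurable
  \<comment> \<open>If the total variance stays below \<open>\<eta>\<close>, the cut-off never acts
    and both sums agree. Markov's inequality for \<open>?Y\<close> then gives the term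
    \<open>\<eta> / \<delta>\<close>.\<close>
  have "{\<omega>\<in>space M. \<delta> < (\<Sum>g\<in>G. (\<Sum>l\<in>B g. c l \<omega> * \<zeta> l \<omega>)\<^sup>2)}
      \<subseteq> {\<omega>\<in>space M. \<eta> < (\<Sum>l<N. (c l \<omega>)\<^sup>2 * v l)} \<union> {\<omega>\<in>space M. \<delta> \<le> ?Y \<omega>}"
  proof safe
    fix \<omega> assume *: "\<delta> < (\<Sum>g\<in>G. (\<Sum>l\<in>B g. c l \<omega> * \<zeta> l \<omega>)\<^sup>2)" "\<not> \<delta> \<le> ?Y \<omega>"
    show "\<eta> < (\<Sum>l<N. (c l \<omega>)\<^sup>2 * v l)"
    proof (rule ccontr)
      assume "\<not> \<eta> < (\<Sum>l<N. (c l \<omega>)\<^sup>2 * v l)"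
      then have "Q N \<omega> \<le> \<eta>" by (simp add: Q_def)
      then have "c' l \<omega> = c l \<omega>" if "l < N" for l
        using Qmono[of "Suc l" N \<omega>] that by (auto simp: c'_def)
      then have "?Y \<omega> = (\<Sum>g\<in>G. (\<Sum>l\<in>B g. c l \<omega> * \<zeta> l \<omega>)\<^sup>2)"
        using G(2) by (intro sum.cong arg_cong[where f = "\<lambda>x. x\<^sup>2"]) auto
      with * show False by simp
    qed
  qed
  then have "prob {\<omega>\<in>space M. \<delta> < (\<Sum>g\<in>G. (\<Sum>l\<in>B g. c l \<omega> * \<zeta> l \<omega>)\<^sup>2)}
      \<le> prob ({\<omega>\<in>space M. \<eta> < (\<Sum>l<N. (c l \<omega>)\<^sup>2 * v l)} \<union> {\<omega>\<in>space M. \<delta> \<le> ?Y \<omega>})"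
    by (intro finite_measure_mono) auto
  also have "\<dots> \<le> prob {\<omega>\<in>space M. \<eta> < (\<Sum>l<N. (c l \<omega>)\<^sup>2 * v l)} + prob {\<omega>\<in>space M. \<delta> \<le> ?Y \<omega>}"
    by (rule measure_Un_le) auto
  also have "prob {\<omega>\<in>space M. \<delta> \<le> ?Y \<omega>} \<le> expectation ?Y / \<delta>"
    using pos by (intro integral_Markov_inequality_measure[OF intY, of "{}"]) (auto intro!: sum_nonneg)
  also have "\<dots> \<le> \<eta> / \<delta>" using eY pos by (simp add: divide_right_mono)
  finally show ?thesis by simp
qed

end

section \<open>Simple processes on a common refinement\<close>

definition refines :: "nat \<Rightarrow> (nat \<Rightarrow> real) \<Rightarrow> nat \<Rightarrow> (nat \<Rightarrow> real) \<Rightarrow> bool" where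
  "refines N p m s \<longleftrightarrow> strict_chain N p \<and> p 0 = 0 \<and> (\<forall>i<m. s i \<le> s (Suc i)) \<and> (\<forall>i\<le>m. min (p N) (s i) \<in> p ` {..N})"

text \<open>No knot of the simple process lies inside a cell. In \<open>refines\<close> the knots
  beyond \<open>p N\<close> are cut back to it, since a simple process may live longer than the time
  up to which it is integrated; for such knots both sides are false.\<close>

lemma refines_cell:
  assumes r: "refines N p m s" and i: "i \<le> m" and l: "l < N" and u: "p l < u" "u \<le> p (Suc l)"
  shows "s i < u \<longleftrightarrow> s i \<le> p l"
proof -
  have p: "strict_chain N p" using r by (simp add: refines_def)
  obtain j where j: "j \<le> N" "min (p N) (s i) = p j" using r i by (auto simp: refines_def)
  have "u \<le> p N" using u l strict_chain_iff(2)[OF p, of "Suc l" N] by simp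
  moreover have "p j \<le> p l \<longleftrightarrow> j \<le> l" "p (Suc l) \<le> p j \<longleftrightarrow> Suc l \<le> j"
    using strict_chain_iff(2)[OF p] j l by auto
  moreover have "p l < p N" using strict_chain_iff(1)[OF p] l by auto
  ultimately show ?thesis using u j(2) by (cases "j \<le> l") auto
qed

lemma refines_simple_value:
  assumes r: "refines N p m s" and l: "l < N" and u: "p l < u" "u \<le> p (Suc l)"
  shows "simple_value m s \<xi> u \<omega> = simple_value m s \<xi> (p (Suc l)) \<omega>"
proof -
  have p: "strict_chain N p" using r by (simp add: refines_def)
  have "indicator {s i<..s (Suc i)} u = (indicator {s i<..s (Suc i)} (p (Suc l)) :: real)" if "i < m" for i
    using refines_cell[OF r _ l u, of i] refines_cell[OF r _ l u, of "Suc i"] that strict_chainD[OF p l]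
      refines_cell[OF r _ l _ order_refl, of i] refines_cell[OF r _ l _ order_refl, of "Suc i"]
    by (simp add: indicator_def not_less[symmetric])
  then show ?thesis by (simp add: simple_value_def)
qed

text \<open>Brings integrals of different simple processes, and up to different times, to sums over
  the same cells, so that they can be subtracted cell by cell.\<close>

lemma refines_simple_integral:
  assumes r: "refines N p m s" and t: "t \<in> p ` {..N}" "0 \<le> s 0"
  shows "simple_integral W m s \<xi> t \<omega> =
    (\<Sum>l<N. indicator {..t} (p (Suc l)) * simple_value m s \<xi> (p (Suc l)) \<omega> * (W (p (Suc l)) \<omega> - W (p l) \<omega>))"
proof -
  have p: "strict_chain N p" "p 0 = 0" using r by (auto simp: refines_def)
  have tN: "t \<le> p N" using t strict_chain_iff(2)[OF p(1), of _ N] by auto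
  have mem: "min t (s i) \<in> p ` {..N}" if "i \<le> m" for i
    using r that t tN unfolding refines_def min_def by (metis (no_types, lifting) order_antisym order_trans linorder_linear)
  have "simple_integral W m s \<xi> t \<omega> =
      (\<Sum>i<m. \<xi> i \<omega> * (\<Sum>l<N. indicator {min t (s i)<..min t (s (Suc i))} (p (Suc l)) * (W (p (Suc l)) \<omega> - W (p l) \<omega>)))"
    unfolding simple_integral_def
  proof (intro sum.cong refl arg_cong2[where f = "(*)"])
    fix i assume "i \<in> {..<m}"
    then have "min t (s i) \<in> p ` {..N}" "min t (s (Suc i)) \<in> p ` {..N}" "min t (s i) \<le> min t (s (Suc i))"
      using mem r by (auto simp: refines_def min_def intro: order_trans)
    from telescope_indicator[OF p(1) this, of "\<lambda>u. W u \<omega>"]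
    show "W (min t (s (Suc i))) \<omega> - W (min t (s i)) \<omega> =
      (\<Sum>l<N. indicator {min t (s i)<..min t (s (Suc i))} (p (Suc l)) * (W (p (Suc l)) \<omega> - W (p l) \<omega>))"
      by simp
  qed
  also have "\<dots> = (\<Sum>l<N. \<Sum>i<m. \<xi> i \<omega> * (indicator {min t (s i)<..min t (s (Suc i))} (p (Suc l)) * (W (p (Suc l)) \<omega> - W (p l) \<omega>)))"
    unfolding sum_distrib_left by (rule sum.swap)
  also have "\<dots> = (\<Sum>l<N. indicator {..t} (p (Suc l)) * simple_value m s \<xi> (p (Suc l)) \<omega> * (W (p (Suc l)) \<omega> - W (p l) \<omega>))"
  proof (rule sum.cong)
    fix l
    have "indicator {min t (s i)<..min t (s (Suc i))} u = (indicator {..t} u * indicator {s i<..s (Suc i)} u :: real)" for i u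
      by (auto simp: indicator_def min_def)
    note ind = this
    show "(\<Sum>i<m. \<xi> i \<omega> * (indicator {min t (s i)<..min t (s (Suc i))} (p (Suc l)) * (W (p (Suc l)) \<omega> - W (p l) \<omega>)))
        = indicator {..t} (p (Suc l)) * simple_value m s \<xi> (p (Suc l)) \<omega> * (W (p (Suc l)) \<omega> - W (p l) \<omega>)"
      unfolding ind simple_value_def sum_distrib_left sum_distrib_right
      by (intro sum.cong refl) (simp only: ac_simps)
  qed simp
  finally show ?thesis .
qed

lemma obtain_refinement:
  assumes "0 < T" "finite Q" "Q \<subseteq> {0..T}"
  obtains p N where "strict_chain N p" "p 0 = 0" "p N = T" "Q \<subseteq> p ` {..N}"
proof -
  let ?P = "insert 0 (insert T Q)"
  obtain p N where p: "strict_chain N p" "p ` {..N} = ?P" "p 0 = Min ?P" "p N = Max ?P"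
    by (rule obtain_strict_chain[of ?P]) (use assms in auto)
  have "Min ?P = 0" "Max ?P = T"
    using assms by (intro Min_eqI Max_eqI; auto)+
  then show thesis using that[of N p] p by auto
qed

context brownian
begin

text \<open>Predictability: if the cell lies in \<open>{s i<..s (Suc i)}\<close>, then
  \<open>s i \<le> p l\<close>, and \<open>\<xi> i\<close> is known at the left end of the
  cell.\<close>

lemma refines_simple_value_F:
  assumes r: "refines N p m s" and sp: "simple_process M F m s \<xi>" and l: "l < N"
  shows "simple_value m s \<xi> (p (Suc l)) \<in> borel_measurable (F (p l))"
proof -
  have p: "strict_chain N p" "p 0 = 0" using r by (auto simp: refines_def)
  have s0: "0 \<le> s i" if "i \<le> m" for i
    using that
  proof (induction i)
    case (Suc i)
    then show ?case using sp by (auto simp: simple_process_def intro: order_trans)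
  qed (use sp in \<open>simp add: simple_process_def\<close>)
  have "(\<lambda>\<omega>. \<xi> i \<omega> * indicator {s i<..s (Suc i)} (p (Suc l))) \<in> borel_measurable (F (p l))" if i: "i < m" for i
  proof (cases "s i < p (Suc l)")
    case True
    then have "s i \<le> p l" using refines_cell[OF r _ l strict_chainD[OF p(1) l] order_refl, of i] i by simp
    then have "\<xi> i \<in> borel_measurable (F (p l))"
      using sp i s0[of i] borel_F_mono[of "s i" "p l"] by (auto simp: simple_process_def)
    then show ?thesis by simp
  qed simp
  then show ?thesis unfolding simple_value_def by (intro borel_measurable_sum) auto
qed

text \<open>\<open>noise_lenglart\<close> for the increments of \<open>W\<close>. The accumulated
  variance appears as the time integral of \<open>\<Psi>\<close> squared, the quantity that is small
  in probability by the definition of the Ito integral.\<close>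

lemma step_lenglart:
  fixes \<Psi> :: "real \<Rightarrow> 'a \<Rightarrow> real"
  assumes p: "strict_chain N p" "p 0 = 0" "p N = T"
    and \<Psi>_F: "\<And>l. l < N \<Longrightarrow> \<Psi> (p (Suc l)) \<in> borel_measurable (F (p l))"
    and \<Psi>: "\<And>l u \<omega>. l < N \<Longrightarrow> p l < u \<Longrightarrow> u \<le> p (Suc l) \<Longrightarrow> \<Psi> u \<omega> = \<Psi> (p (Suc l)) \<omega>"
    and G: "finite G" "\<And>g. g \<in> G \<Longrightarrow> B g \<subseteq> {..<N}" "disjoint_family_on B G"
    and pos: "0 < \<eta>" "0 < \<delta>"
  shows "prob {\<omega>\<in>space M. \<delta> < (\<Sum>g\<in>G. (\<Sum>l\<in>B g. \<Psi> (p (Suc l)) \<omega> * (W (p (Suc l)) \<omega> - W (p l) \<omega>))\<^sup>2)}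
    \<le> prob {\<omega>\<in>space M. ennreal \<eta> < (\<integral>\<^sup>+u\<in>{0..T}. ennreal ((\<Psi> u \<omega>)\<^sup>2) \<partial>lborel)} + \<eta> / \<delta>"
proof -
  have p0: "0 \<le> p l" if "l \<le> N" for l
    using strict_chain_iff(2)[OF p(1), of 0 l] that p(2) by auto
  have eq: "(\<integral>\<^sup>+u\<in>{0..T}. ennreal ((\<Psi> u \<omega>)\<^sup>2) \<partial>lborel) = ennreal (\<Sum>l<N. (\<Psi> (p (Suc l)) \<omega>)\<^sup>2 * (p (Suc l) - p l))" for \<omega>
    using nn_integral_step[OF p(1), of "\<lambda>u. \<Psi> u \<omega>", OF \<Psi>] unfolding p(2,3) by blast
  have "0 \<le> p 0" using p by simp
  note L = noise_lenglart[where \<zeta> = "\<lambda>l \<omega>. W (p (Suc l)) \<omega> - W (p l) \<omega>" and v = "\<lambda>l. p (Suc l) - p l"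
      and c = "\<lambda>l. \<Psi> (p (Suc l))" and p = p and N = N and G = G and B = B, OF this p(1) _ _ \<Psi>_F G pos]
  have "ennreal \<eta> < ennreal x \<longleftrightarrow> \<eta> < x" for x
    using pos by (intro ennreal_less_iff) simp
  note lt = this
  show ?thesis
    unfolding eq lt
    by (rule L) (use p0 strict_chainD[OF p(1)] in \<open>auto intro!: noise_increment\<close>)
qed

text \<open>The estimate behind the uniqueness of the Ito integral: simple processes that are close
  in the square mean over time, in probability, have integrals that are close in probability. It is
  the case of a single block on a common refinement.\<close>

lemma simple_integral_diff_prob:
  assumes sp: "simple_process M F m s \<xi>" "simple_process M F m' s' \<xi>'" and t: "0 < t" and pos: "0 < \<eta>" "0 < \<delta>"
  shows "prob {\<omega>\<in>space M. \<delta> < \<bar>simple_integral W m s \<xi> t \<omega> - simple_integral W m' s' \<xi>' t \<omega>\<bar>}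
    \<le> prob {\<omega>\<in>space M. ennreal \<eta> < (\<integral>\<^sup>+u\<in>{0..t}. ennreal ((simple_value m s \<xi> u \<omega> - simple_value m' s' \<xi>' u \<omega>)\<^sup>2) \<partial>lborel)} + \<eta> / \<delta>\<^sup>2"
proof -
  have s0: "0 \<le> s i" if "i \<le> m" "simple_process M F m s \<xi>" for i m s and \<xi> :: "nat \<Rightarrow> 'a \<Rightarrow> real"
    using that
  proof (induction i)
    case (Suc i)
    then show ?case by (auto simp: simple_process_def intro: order_trans)
  qed (simp add: simple_process_def)
  define Q where "Q = (\<lambda>i. min t (s i)) ` {..m} \<union> (\<lambda>i. min t (s' i)) ` {..m'}"
  have "Q \<subseteq> {0..t}" "finite Q" using s0[OF _ sp(1)] s0[OF _ sp(2)] t by (auto simp: Q_def)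
  then obtain p N where p: "strict_chain N p" "p 0 = 0" "p N = t" "Q \<subseteq> p ` {..N}"
    using obtain_refinement[OF t] by metis
  have r: "refines N p m s" "refines N p m' s'"
    using p sp by (auto simp: refines_def Q_def simple_process_def image_subset_iff)
  let ?\<Psi> = "\<lambda>u \<omega>. simple_value m s \<xi> u \<omega> - simple_value m' s' \<xi>' u \<omega>"
  have tp: "t \<in> p ` {..N}" using p(3) by auto
  have "p (Suc l) \<le> t" if "l < N" for l
    using strict_chain_iff(2)[OF p(1), of "Suc l" N] that p(3) by auto
  then have eq: "simple_integral W m s \<xi> t \<omega> - simple_integral W m' s' \<xi>' t \<omega>
      = (\<Sum>l<N. ?\<Psi> (p (Suc l)) \<omega> * (W (p (Suc l)) \<omega> - W (p l) \<omega>))" for \<omega>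
    using refines_simple_integral[OF r(1) tp, of W \<xi> \<omega>] refines_simple_integral[OF r(2) tp, of W \<xi>' \<omega>] sp
    by (simp add: simple_process_def sum_subtractf[symmetric] left_diff_distrib)
  have lt: "\<delta> < \<bar>x\<bar> \<longleftrightarrow> \<delta>\<^sup>2 < x\<^sup>2" for x
    using pos abs_le_square_iff[of x \<delta>] by (simp add: not_le[symmetric])
  have \<Psi>: "?\<Psi> (p (Suc l)) \<in> borel_measurable (F (p l))"
    "p l < u \<Longrightarrow> u \<le> p (Suc l) \<Longrightarrow> ?\<Psi> u \<omega> = ?\<Psi> (p (Suc l)) \<omega>" if "l < N" for l u \<omega>
    using refines_simple_value_F[OF r(1) sp(1) that] refines_simple_value_F[OF r(2) sp(2) that]
      refines_simple_value[OF r(1) that, of u \<xi> \<omega>] refines_simple_value[OF r(2) that, of u \<xi>' \<omega>] by simp_all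
  show ?thesis
    unfolding lt eq
    using step_lenglart[OF p(1-3) \<Psi>, of "{()}" "\<lambda>_. {..<N}" \<eta> "\<delta>\<^sup>2"] pos
    by (simp add: disjoint_family_on_def)
qed

end

subsection \<open>Increments of the Ito integral over a grid\<close>

lemma nn_integral_square_split:
  fixes f g h :: "real \<Rightarrow> real"
  assumes le: "\<And>u. u \<in> S \<Longrightarrow> (f u)\<^sup>2 \<le> a * (g u)\<^sup>2 + b * (h u)\<^sup>2"
    and ab: "0 \<le> a" "0 \<le> b"
    and m: "(\<lambda>u. g u * indicator S u) \<in> borel_measurable borel" "(\<lambda>u. h u * indicator S u) \<in> borel_measurable borel"
  shows "(\<integral>\<^sup>+u\<in>S. ennreal ((f u)\<^sup>2) \<partial>lborel) \<le>
    ennreal a * (\<integral>\<^sup>+u\<in>S. ennreal ((g u)\<^sup>2) \<partial>lborel) + ennreal b * (\<integral>\<^sup>+u\<in>S. ennreal ((h u)\<^sup>2) \<partial>lborel)"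
proof -
  have eq: "ennreal ((k u)\<^sup>2) * indicator S u = ennreal ((k u * indicator S u)\<^sup>2)" for k u
    by (simp add: indicator_def)
  have "(\<integral>\<^sup>+u\<in>S. ennreal ((f u)\<^sup>2) \<partial>lborel)
      \<le> (\<integral>\<^sup>+u. ennreal a * ennreal ((g u * indicator S u)\<^sup>2) + ennreal b * ennreal ((h u * indicator S u)\<^sup>2) \<partial>lborel)"
  proof (rule nn_integral_mono)
    fix u
    show "ennreal ((f u)\<^sup>2) * indicator S u
        \<le> ennreal a * ennreal ((g u * indicator S u)\<^sup>2) + ennreal b * ennreal ((h u * indicator S u)\<^sup>2)"
      using le[of u] ab by (cases "u \<in> S") (auto simp: ennreal_mult[symmetric] ennreal_plus[symmetric] simp del: ennreal_plus intro!: ennreal_leI)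
  qed
  also have "\<dots> = ennreal a * (\<integral>\<^sup>+u\<in>S. ennreal ((g u)\<^sup>2) \<partial>lborel) + ennreal b * (\<integral>\<^sup>+u\<in>S. ennreal ((h u)\<^sup>2) \<partial>lborel)"
    unfolding eq using m by (subst nn_integral_add) (auto simp: nn_integral_cmult)
  finally show ?thesis .
qed

text \<open>Only the two covering events have to be measurable. Events about time integrals of paths
  can thus be taken as \<open>A\<close> directly.\<close>

lemma (in prob_space) prob_le_two:
  assumes "B \<in> events" "C \<in> events" "AE \<omega> in M. \<omega> \<in> A \<longrightarrow> \<omega> \<in> B \<or> \<omega> \<in> C"
  shows "prob A \<le> prob B + prob C"
proof -
  have "prob A \<le> prob (B \<union> C)"
    using assms by (intro finite_measure_mono_AE) auto
  also have "\<dots> \<le> prob B + prob C" using assms by (intro measure_Un_le)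
  finally show ?thesis .
qed

section \<open>Convergence in probability and almost surely convergent subsequences\<close>

definition (in prob_space) null_prob :: "(nat \<Rightarrow> 'a \<Rightarrow> real) \<Rightarrow> bool" where
  "null_prob Y \<longleftrightarrow> (\<forall>k. Y k \<in> borel_measurable M) \<and>
     (\<forall>\<epsilon>>0. (\<lambda>k. prob {\<omega>\<in>space M. \<epsilon> < \<bar>Y k \<omega>\<bar>}) \<longlonglongrightarrow> 0)"

context prob_space
begin

lemma null_probI:
  assumes m: "\<And>k. Y k \<in> borel_measurable M"
    and le: "\<And>\<epsilon> \<gamma>. 0 < \<epsilon> \<Longrightarrow> 0 < \<gamma> \<Longrightarrow> \<forall>\<^sub>F k in sequentially. prob {\<omega>\<in>space M. \<epsilon> < \<bar>Y k \<omega>\<bar>} \<le> \<gamma>"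
  shows "null_prob Y"
  unfolding null_prob_def
proof (intro conjI allI impI m)
  fix \<epsilon> :: real assume \<epsilon>: "0 < \<epsilon>"
  show "(\<lambda>k. prob {\<omega>\<in>space M. \<epsilon> < \<bar>Y k \<omega>\<bar>}) \<longlonglongrightarrow> 0"
  proof (rule tendstoI)
    fix e :: real assume "0 < e"
    then have "\<forall>\<^sub>F k in sequentially. prob {\<omega>\<in>space M. \<epsilon> < \<bar>Y k \<omega>\<bar>} \<le> e / 2"
      using le[OF \<epsilon>, of "e / 2"] by simp
    then show "\<forall>\<^sub>F k in sequentially. dist (prob {\<omega>\<in>space M. \<epsilon> < \<bar>Y k \<omega>\<bar>}) 0 < e"
      by eventually_elim (use \<open>0 < e\<close> in auto)
  qed
qed

lemma null_probD:
  assumes "null_prob Y" "0 < \<epsilon>" "0 < \<gamma>"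
  shows "\<forall>\<^sub>F k in sequentially. prob {\<omega>\<in>space M. \<epsilon> < \<bar>Y k \<omega>\<bar>} \<le> \<gamma>"
proof -
  have "(\<lambda>k. prob {\<omega>\<in>space M. \<epsilon> < \<bar>Y k \<omega>\<bar>}) \<longlonglongrightarrow> 0" using assms by (simp add: null_prob_def)
  from order_tendstoD(2)[OF this assms(3)] show ?thesis by eventually_elim simp
qed

lemma null_prob_meas: "null_prob Y \<Longrightarrow> Y k \<in> borel_measurable M"
  by (simp add: null_prob_def)

lemma tends_to_0_in_probD:
  assumes "tends_to_0_in_prob M Y" "0 < \<epsilon>" "0 < \<gamma>"
  shows "\<forall>\<^sub>F k in sequentially. prob {\<omega>\<in>space M. ennreal \<epsilon> < Y k \<omega>} \<le> \<gamma>"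
proof -
  have "(\<lambda>k. prob {\<omega>\<in>space M. ennreal \<epsilon> < Y k \<omega>}) \<longlonglongrightarrow> 0" using assms by (simp add: tends_to_0_in_prob_def)
  from order_tendstoD(2)[OF this assms(3)] show ?thesis by eventually_elim simp
qed

lemma prob_tendsto_0_AE:
  assumes m: "\<And>k. A k \<in> events" and ae: "AE \<omega> in M. \<forall>\<^sub>F k in sequentially. \<omega> \<notin> A k"
  shows "(\<lambda>k. prob (A k)) \<longlonglongrightarrow> 0"
proof -
  have "(\<lambda>k. expectation (indicat_real (A k))) \<longlonglongrightarrow> expectation (\<lambda>_. 0)"
  proof (rule integral_dominated_convergence[where w = "\<lambda>_. 1"])
    show "AE \<omega> in M. (\<lambda>k. indicat_real (A k) \<omega>) \<longlonglongrightarrow> 0"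
      using ae
    proof eventually_elim
      case (elim \<omega>)
      then have "\<forall>\<^sub>F k in sequentially. indicat_real (A k) \<omega> = 0" by eventually_elim simp
      then show ?case by (rule tendsto_eventually)
    qed
  qed (use m in \<open>auto simp: indicator_def\<close>)
  then show ?thesis using m by simp
qed

lemma null_prob_AE:
  assumes m: "\<And>k. Y k \<in> borel_measurable M" and ae: "AE \<omega> in M. (\<lambda>k. Y k \<omega>) \<longlonglongrightarrow> 0"
  shows "null_prob Y"
  unfolding null_prob_def
proof (intro conjI allI impI m prob_tendsto_0_AE)
  fix \<epsilon> :: real assume \<epsilon>: "0 < \<epsilon>"
  show "{\<omega>\<in>space M. \<epsilon> < \<bar>Y k \<omega>\<bar>} \<in> events" for k
    using m[of k] by measurable
  show "AE \<omega> in M. \<forall>\<^sub>F k in sequentially. \<omega> \<notin> {\<omega>\<in>space M. \<epsilon> < \<bar>Y k \<omega>\<bar>}"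
    using ae
  proof eventually_elim
    case (elim \<omega>)
    from tendstoD[OF this \<epsilon>] show ?case by eventually_elim auto
  qed
qed

lemma null_prob_add_abs:
  assumes "null_prob Y" "null_prob Z"
  shows "null_prob (\<lambda>k \<omega>. \<bar>Y k \<omega>\<bar> + \<bar>Z k \<omega>\<bar>)"
proof (rule null_probI)
  note [measurable] = null_prob_meas[OF assms(1)] null_prob_meas[OF assms(2)]
  show "(\<lambda>\<omega>. \<bar>Y k \<omega>\<bar> + \<bar>Z k \<omega>\<bar>) \<in> borel_measurable M" for k by measurable
  fix \<epsilon> \<gamma> :: real assume pos: "0 < \<epsilon>" "0 < \<gamma>"
  then have "0 < \<epsilon> / 2" "0 < \<gamma> / 2" by auto
  from null_probD[OF assms(1) this] null_probD[OF assms(2) this]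
  show "\<forall>\<^sub>F k in sequentially. prob {\<omega>\<in>space M. \<epsilon> < \<bar>\<bar>Y k \<omega>\<bar> + \<bar>Z k \<omega>\<bar>\<bar>} \<le> \<gamma>"
  proof eventually_elim
    case (elim k)
    have "prob {\<omega>\<in>space M. \<epsilon> < \<bar>\<bar>Y k \<omega>\<bar> + \<bar>Z k \<omega>\<bar>\<bar>}
        \<le> prob {\<omega>\<in>space M. \<epsilon> / 2 < \<bar>Y k \<omega>\<bar>} + prob {\<omega>\<in>space M. \<epsilon> / 2 < \<bar>Z k \<omega>\<bar>}"
      by (rule prob_le_two) auto
    with elim show ?case by simp
  qed
qed

lemma null_prob_sum_abs:
  assumes "finite I" "\<And>i. i \<in> I \<Longrightarrow> null_prob (Y i)"
  shows "null_prob (\<lambda>k \<omega>. \<Sum>i\<in>I. \<bar>Y i k \<omega>\<bar>)"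
  using assms
proof (induction rule: finite_induct)
  case empty
  then show ?case by (intro null_prob_AE) auto
next
  case (insert i I)
  then have "null_prob (\<lambda>k \<omega>. \<bar>Y i k \<omega>\<bar> + \<bar>\<Sum>i\<in>I. \<bar>Y i k \<omega>\<bar>\<bar>)" by (intro null_prob_add_abs) auto
  then show ?case using insert by (simp add: sum_nonneg)
qed

text \<open>The truncation \<open>min 1 \<bar>Y k \<omega>\<bar>\<close> turns convergence in
  probability into convergence in L1, from which an almost surely convergent subsequence is
  extracted. Near the limit 0 the truncation is not felt.\<close>

lemma null_prob_AE_subseq:
  assumes "null_prob Y"
  obtains r where "strict_mono (r :: nat \<Rightarrow> nat)" "AE \<omega> in M. (\<lambda>k. Y (r k) \<omega>) \<longlonglongrightarrow> 0"
proof -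
  note [measurable] = null_prob_meas[OF assms]
  let ?Z = "\<lambda>k \<omega>. min 1 \<bar>Y k \<omega>\<bar>"
  have int: "integrable M (?Z k)" for k
    by (intro integrable_const_bound[where B = 1]) auto
  have "(\<lambda>k. expectation (\<lambda>\<omega>. norm (?Z k \<omega>))) \<longlonglongrightarrow> 0"
  proof (rule tendstoI)
    fix e :: real assume e: "0 < e"
    have "\<forall>\<^sub>F k in sequentially. prob {\<omega>\<in>space M. e / 3 < \<bar>Y k \<omega>\<bar>} \<le> e / 3"
      using e by (intro null_probD assms) auto
    then show "\<forall>\<^sub>F k in sequentially. dist (expectation (\<lambda>\<omega>. norm (?Z k \<omega>))) 0 < e"
    proof eventually_elim
      case (elim k)
      define S where "S = {\<omega>\<in>space M. e / 3 < \<bar>Y k \<omega>\<bar>}"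
      have A: "S \<in> events" unfolding S_def by measurable
      have "expectation (\<lambda>\<omega>. norm (?Z k \<omega>)) \<le> expectation (\<lambda>\<omega>. e / 3 + indicator S \<omega>)"
      proof (rule integral_mono)
        show "integrable M (\<lambda>\<omega>. norm (?Z k \<omega>))" by (intro integrable_norm int)
        show "integrable M (\<lambda>\<omega>. e / 3 + indicat_real S \<omega>)"
          by (intro Bochner_Integration.integrable_add integrable_const integrable_real_indicator A)
            (simp add: less_top[symmetric])
        show "norm (?Z k \<omega>) \<le> e / 3 + indicator S \<omega>" if "\<omega> \<in> space M" for \<omega>
          using e that by (auto simp: S_def indicator_def)
      qed
      also have "\<dots> = e / 3 + prob S"
        using A integrable_real_indicator[OF A]
        by (subst Bochner_Integration.integral_add) (auto simp: prob_space less_top[symmetric])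
      also have "\<dots> < e" using elim e by (simp add: S_def)
      finally show ?case by simp
    qed
  qed
  from tendsto_L1_AE_subseq[OF int this] obtain r :: "nat \<Rightarrow> nat" where r: "strict_mono r"
    "AE \<omega> in M. (\<lambda>k. ?Z (r k) \<omega>) \<longlonglongrightarrow> 0" by blast
  have "AE \<omega> in M. (\<lambda>k. Y (r k) \<omega>) \<longlonglongrightarrow> 0"
    using r(2)
  proof eventually_elim
    case (elim \<omega>)
    have "\<forall>\<^sub>F k in sequentially. norm (Y (r k) \<omega>) \<le> ?Z (r k) \<omega>"
      using order_tendstoD(2)[OF elim, of 1] by (auto elim: eventually_mono)
    then show ?case by (rule Lim_null_comparison[OF _ elim])
  qed
  with r(1) show thesis using that by blast
qed

text \<open>A common subsequence is obtained from the sum of the absolute values, which dominates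
  each member of the family.\<close>

lemma null_prob_AE_subseq_finite:
  assumes "finite I" "\<And>i. i \<in> I \<Longrightarrow> null_prob (Y i)"
  obtains r where "strict_mono (r :: nat \<Rightarrow> nat)" "AE \<omega> in M. \<forall>i\<in>I. (\<lambda>k. Y i (r k) \<omega>) \<longlonglongrightarrow> 0"
proof -
  from null_prob_AE_subseq[OF null_prob_sum_abs[of I Y, OF assms]] obtain r :: "nat \<Rightarrow> nat" where r: "strict_mono r"
    "AE \<omega> in M. (\<lambda>k. \<Sum>i\<in>I. \<bar>Y i (r k) \<omega>\<bar>) \<longlonglongrightarrow> 0" by blast
  have "AE \<omega> in M. \<forall>i\<in>I. (\<lambda>k. Y i (r k) \<omega>) \<longlonglongrightarrow> 0"
    using r(2)
  proof eventually_elim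
    case (elim \<omega>)
    have "norm (Y i (r k) \<omega>) \<le> (\<Sum>i\<in>I. \<bar>Y i (r k) \<omega>\<bar>)" if "i \<in> I" for i k
      using member_le_sum[OF that, of "\<lambda>i. \<bar>Y i (r k) \<omega>\<bar>"] assms(1) by simp
    then show ?case by (intro ballI Lim_null_comparison[OF always_eventually elim]) auto
  qed
  with r(1) show thesis using that by blast
qed

end

context brownian
begin

lemma simple_process_nonneg:
  assumes "simple_process M F m s \<xi>" "i \<le> m"
  shows "0 \<le> s i"
  using assms(2)
proof (induction i)
  case (Suc i)
  then show ?case using assms(1) by (auto simp: simple_process_def intro: order_trans)
qed (use assms in \<open>simp add: simple_process_def\<close>)

text \<open>The weighted error is itself the integral of a step process \<open>?\<Psi>\<close>,
  equal to \<open>\<theta> i\<close> times the difference of the simple value and \<open>A i\<close>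
  on \<open>{\<tau> i<..\<tau> (Suc i)}\<close>. Hence \<open>step_lenglart\<close> applies once the
  grid \<open>\<tau>\<close> and the knots of the simple process have a common refinement. The sets
  \<open>D g\<close> group the grid intervals.\<close>

lemma weighted_error_prob:
  assumes sp: "simple_process M F m s \<xi>" and \<tau>: "strict_chain n \<tau>" "0 \<le> \<tau> 0" "0 < n"
    and \<theta>: "\<And>i. i < n \<Longrightarrow> \<theta> i \<in> borel_measurable (F (\<tau> i))" and A: "\<And>i. i < n \<Longrightarrow> A i \<in> borel_measurable (F (\<tau> i))"
    and G: "finite G" "\<And>g. g \<in> G \<Longrightarrow> D g \<subseteq> {..<n}" "disjoint_family_on D G"
    and pos: "0 < \<eta>" "0 < \<delta>"
  shows "prob {\<omega>\<in>space M. \<delta> < (\<Sum>g\<in>G. (\<Sum>i\<in>D g. \<theta> i \<omega> * (simple_integral W m s \<xi> (\<tau> (Suc i)) \<omega> - simple_integral W m s \<xi> (\<tau> i) \<omega>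
      - A i \<omega> * (W (\<tau> (Suc i)) \<omega> - W (\<tau> i) \<omega>)))\<^sup>2)}
    \<le> prob {\<omega>\<in>space M. ennreal \<eta> < (\<integral>\<^sup>+u\<in>{0..\<tau> n}.
        ennreal ((\<Sum>i<n. indicator {\<tau> i<..\<tau> (Suc i)} u * (\<theta> i \<omega> * (simple_value m s \<xi> u \<omega> - A i \<omega>)))\<^sup>2) \<partial>lborel)} + \<eta> / \<delta>"
proof -
  define T where "T = \<tau> n"
  have \<tau>0: "0 \<le> \<tau> i" "\<tau> i \<le> T" if "i \<le> n" for i
    using strict_chain_iff(2)[OF \<tau>(1), of 0 i] strict_chain_iff(2)[OF \<tau>(1), of i n] that \<tau>(2) by (auto simp: T_def)
  have T: "0 < T" using strict_chain_iff(1)[OF \<tau>(1), of 0 n] \<tau> by (simp add: T_def)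
  define Q where "Q = (\<lambda>i. min T (s i)) ` {..m} \<union> \<tau> ` {..n}"
  have "Q \<subseteq> {0..T}" "finite Q" using simple_process_nonneg[OF sp] \<tau>0 T by (auto simp: Q_def)
  then obtain p N where p: "strict_chain N p" "p 0 = 0" "p N = T" "Q \<subseteq> p ` {..N}"
    using obtain_refinement[OF T] by metis
  have r: "refines N p m s"
    using p sp by (auto simp: refines_def Q_def simple_process_def image_subset_iff)
  have \<tau>p: "\<tau> i \<in> p ` {..N}" if "i \<le> n" for i
    using p(4) that by (auto simp: Q_def image_subset_iff)
  have r\<tau>: "refines N p n \<tau>"
    using p \<tau>p \<tau>0 strict_chainD[OF \<tau>(1)] by (auto simp: refines_def min_absorb2 less_imp_le)
  have p0: "0 \<le> p l" if "l \<le> N" for l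
    using strict_chain_iff(2)[OF p(1), of 0 l] that p(2) by auto
  let ?ind = "\<lambda>i u. indicat_real {\<tau> i<..\<tau> (Suc i)} u"
  let ?\<Psi> = "\<lambda>u \<omega>. \<Sum>i<n. ?ind i u * (\<theta> i \<omega> * (simple_value m s \<xi> u \<omega> - A i \<omega>))"
  have \<Psi>_F: "?\<Psi> (p (Suc l)) \<in> borel_measurable (F (p l))" if l: "l < N" for l
  proof (intro borel_measurable_sum)
    fix i assume "i \<in> {..<n}"
    then have i: "i < n" by simp
    show "(\<lambda>\<omega>. ?ind i (p (Suc l)) * (\<theta> i \<omega> * (simple_value m s \<xi> (p (Suc l)) \<omega> - A i \<omega>))) \<in> borel_measurable (F (p l))"
    proof (cases "\<tau> i < p (Suc l)")
      case True
      then have le: "\<tau> i \<le> p l"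
        using refines_cell[OF r\<tau> _ l strict_chainD[OF p(1) l] order_refl, of i] i by simp
      have "\<theta> i \<in> borel_measurable (F (p l))" "A i \<in> borel_measurable (F (p l))"
        using borel_F_mono[OF \<tau>0(1) le] \<theta>[OF i] A[OF i] i by auto
      then show ?thesis
        using refines_simple_value_F[OF r sp l] by (intro borel_measurable_times borel_measurable_diff) auto
    qed simp
  qed
  have \<Psi>_cell: "?\<Psi> u \<omega> = ?\<Psi> (p (Suc l)) \<omega>" if l: "l < N" "p l < u" "u \<le> p (Suc l)" for l u \<omega>
  proof (intro sum.cong refl)
    fix i assume "i \<in> {..<n}"
    then have i: "i < n" by simp
    have "?ind i u = ?ind i (p (Suc l))"
      using refines_cell[OF r\<tau> _ l, of i] refines_cell[OF r\<tau> _ l, of "Suc i"] i strict_chainD[OF p(1) l(1)]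
        refines_cell[OF r\<tau> _ l(1) _ order_refl, of i] refines_cell[OF r\<tau> _ l(1) _ order_refl, of "Suc i"]
      by (simp add: indicator_def not_less[symmetric])
    then show "?ind i u * (\<theta> i \<omega> * (simple_value m s \<xi> u \<omega> - A i \<omega>))
        = ?ind i (p (Suc l)) * (\<theta> i \<omega> * (simple_value m s \<xi> (p (Suc l)) \<omega> - A i \<omega>))"
      using refines_simple_value[OF r l, of \<xi> \<omega>] by simp
  qed
  \<comment> \<open>The refined cells lying in the grid intervals of group \<open>g\<close>. A cell
    lies in at most one grid interval, so disjoint groups give disjoint blocks of cells.\<close>
  define B where "B g = {l\<in>{..<N}. \<exists>i\<in>D g. \<tau> i < p (Suc l) \<and> p (Suc l) \<le> \<tau> (Suc i)}" for g
  have uniq: "i = j" if "i < n" "j < n" "\<tau> i < u" "u \<le> \<tau> (Suc i)" "\<tau> j < u" "u \<le> \<tau> (Suc j)" for i j u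
  proof -
    have "\<tau> i < \<tau> (Suc j)" "\<tau> j < \<tau> (Suc i)" using that by auto
    then have "i < Suc j" "j < Suc i" using strict_chain_iff(1)[OF \<tau>(1)] that by auto
    then show ?thesis by simp
  qed
  have Bdisj: "disjoint_family_on B G"
    unfolding disjoint_family_on_def
  proof (intro ballI impI)
    fix g h assume gh: "g \<in> G" "h \<in> G" "g \<noteq> h"
    have "D g \<inter> D h = {}" using gh G(3) by (auto simp: disjoint_family_on_def)
    have "l \<notin> B h" if "l \<in> B g" for l
    proof
      assume "l \<in> B h"
      then obtain j where j: "j \<in> D h" "\<tau> j < p (Suc l)" "p (Suc l) \<le> \<tau> (Suc j)" by (auto simp: B_def)
      from that obtain i where i: "i \<in> D g" "\<tau> i < p (Suc l)" "p (Suc l) \<le> \<tau> (Suc i)" by (auto simp: B_def)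
      have "i = j" using G(2)[OF gh(1)] G(2)[OF gh(2)] i j by (intro uniq[of i j "p (Suc l)"]) auto
      then show False using i j \<open>D g \<inter> D h = {}\<close> by auto
    qed
    then show "B g \<inter> B h = {}" by auto
  qed
  let ?dW = "\<lambda>l \<omega>. W (p (Suc l)) \<omega> - W (p l) \<omega>"
  let ?e = "\<lambda>i \<omega>. simple_integral W m s \<xi> (\<tau> (Suc i)) \<omega> - simple_integral W m s \<xi> (\<tau> i) \<omega> - A i \<omega> * (W (\<tau> (Suc i)) \<omega> - W (\<tau> i) \<omega>)"
  have e: "?e i \<omega> = (\<Sum>l<N. ?ind i (p (Suc l)) * (simple_value m s \<xi> (p (Suc l)) \<omega> - A i \<omega>) * ?dW l \<omega>)" if i: "i < n" for i \<omega>
  proof -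
    have ind: "indicator {..\<tau> (Suc i)} x = ?ind i x + indicator {..\<tau> i} x" for x
      using strict_chainD[OF \<tau>(1) i] by (auto simp: indicator_def)
    have "\<tau> i \<le> \<tau> (Suc i)" using strict_chainD[OF \<tau>(1) i] by simp
    note tel = telescope_indicator[OF p(1) \<tau>p \<tau>p this, of "\<lambda>u. W u \<omega>"]
    have "simple_integral W m s \<xi> (\<tau> (Suc i)) \<omega> - simple_integral W m s \<xi> (\<tau> i) \<omega>
        = (\<Sum>l<N. ?ind i (p (Suc l)) * simple_value m s \<xi> (p (Suc l)) \<omega> * ?dW l \<omega>)"
      using refines_simple_integral[OF r \<tau>p, of "Suc i" W \<xi> \<omega>] refines_simple_integral[OF r \<tau>p, of i W \<xi> \<omega>] i sp
      by (simp add: simple_process_def ind sum_subtractf[symmetric] algebra_simps)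
    moreover have "A i \<omega> * (W (\<tau> (Suc i)) \<omega> - W (\<tau> i) \<omega>) = (\<Sum>l<N. ?ind i (p (Suc l)) * A i \<omega> * ?dW l \<omega>)"
      using tel i by (simp add: sum_distrib_left[symmetric] mult.assoc mult.left_commute)
    ultimately show ?thesis by (simp add: sum_subtractf[symmetric] algebra_simps)
  qed
  have sum_eq: "(\<Sum>i\<in>D g. \<theta> i \<omega> * ?e i \<omega>) = (\<Sum>l\<in>B g. ?\<Psi> (p (Suc l)) \<omega> * ?dW l \<omega>)" if g: "g \<in> G" for g \<omega>
  proof -
    let ?t = "\<lambda>i l. ?ind i (p (Suc l)) * (\<theta> i \<omega> * (simple_value m s \<xi> (p (Suc l)) \<omega> - A i \<omega>))"
    have fin: "finite (D g)" using G(2)[OF g] finite_subset by blast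
    have pw: "(\<Sum>i\<in>D g. ?t i l) = (if l \<in> B g then ?\<Psi> (p (Suc l)) \<omega> else 0)" if l: "l < N" for l
    proof (cases "l \<in> B g")
      case True
      then obtain i where i: "i \<in> D g" "\<tau> i < p (Suc l)" "p (Suc l) \<le> \<tau> (Suc i)" by (auto simp: B_def)
      have z: "?t j l = 0" if "j \<noteq> i" "j < n" for j
        using uniq[of i j "p (Suc l)"] i that G(2)[OF g] by (auto simp: indicator_def)
      have "(\<Sum>j\<in>D g. ?t j l) = (\<Sum>j\<in>{i}. ?t j l)"
        using i(1) G(2)[OF g] fin z by (intro sum.mono_neutral_right) auto
      moreover have "(\<Sum>j<n. ?t j l) = (\<Sum>j\<in>{i}. ?t j l)"
        using i(1) G(2)[OF g] z by (intro sum.mono_neutral_right) auto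
      ultimately show ?thesis using True by simp
    next
      case False
      then have "?ind j (p (Suc l)) = 0" if "j \<in> D g" for j using that l by (auto simp: B_def indicator_def)
      then have "(\<Sum>i\<in>D g. ?t i l) = 0" by (intro sum.neutral) simp
      then show ?thesis using False by simp
    qed
    have "(\<Sum>i\<in>D g. \<theta> i \<omega> * ?e i \<omega>) = (\<Sum>i\<in>D g. \<Sum>l<N. ?t i l * ?dW l \<omega>)"
    proof (intro sum.cong refl)
      fix i assume "i \<in> D g"
      then have "i < n" using G(2)[OF g] by auto
      show "\<theta> i \<omega> * ?e i \<omega> = (\<Sum>l<N. ?t i l * ?dW l \<omega>)"
        unfolding e[OF \<open>i < n\<close>] sum_distrib_left by (intro sum.cong refl) simp
    qed
    also have "\<dots> = (\<Sum>l<N. (\<Sum>i\<in>D g. ?t i l) * ?dW l \<omega>)"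
      unfolding sum_distrib_right by (rule sum.swap)
    also have "\<dots> = (\<Sum>l<N. if l \<in> B g then ?\<Psi> (p (Suc l)) \<omega> * ?dW l \<omega> else 0)"
      by (intro sum.cong refl) (simp add: pw)
    also have "\<dots> = (\<Sum>l\<in>B g. ?\<Psi> (p (Suc l)) \<omega> * ?dW l \<omega>)"
      by (subst sum.inter_restrict[symmetric]) (auto simp: B_def intro!: sum.cong)
    finally show ?thesis .
  qed
  have sq_eq: "(\<Sum>g\<in>G. (\<Sum>i\<in>D g. \<theta> i \<omega> * ?e i \<omega>)\<^sup>2) = (\<Sum>g\<in>G. (\<Sum>l\<in>B g. ?\<Psi> (p (Suc l)) \<omega> * ?dW l \<omega>)\<^sup>2)" for \<omega>
    by (intro sum.cong refl) (simp only: sum_eq)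
  have "B g \<subseteq> {..<N}" for g by (auto simp: B_def)
  from step_lenglart[OF p(1) p(2) p(3) \<Psi>_F \<Psi>_cell G(1) this Bdisj pos]
  show ?thesis unfolding sq_eq T_def .
qed

end

lemma oscillation_from_rationals:
  fixes f :: "real \<Rightarrow> real"
  assumes c: "continuous_on {a..b} f" and ab: "a < b"
    and r: "\<And>r. r \<in> \<rat> \<Longrightarrow> a \<le> r \<Longrightarrow> r \<le> b \<Longrightarrow> \<bar>f r - f a\<bar> \<le> \<kappa>" and u: "u \<in> {a..b}"
  shows "\<bar>f u - f a\<bar> \<le> \<kappa>"
proof (rule ccontr)
  assume "\<not> \<bar>f u - f a\<bar> \<le> \<kappa>"
  then have "0 < \<bar>f u - f a\<bar> - \<kappa>" by simp
  then obtain d where d: "0 < d" "\<And>x. x \<in> {a..b} \<Longrightarrow> dist x u < d \<Longrightarrow> dist (f x) (f u) < \<bar>f u - f a\<bar> - \<kappa>"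
    using c u unfolding continuous_on_iff by metis
  have "max a (u - d) < min b (u + d)" using u ab d(1) by auto
  then obtain x where x: "x \<in> \<rat>" "max a (u - d) < x" "x < min b (u + d)" using Rats_dense_in_real by blast
  then have "dist (f x) (f u) < \<bar>f u - f a\<bar> - \<kappa>" by (intro d(2)) (auto simp: dist_real_def)
  moreover have "\<bar>f x - f a\<bar> \<le> \<kappa>" using r x by auto
  ultimately show False by (simp add: dist_real_def)
qed

lemma simple_value_path_measurable:
  fixes H :: "real \<Rightarrow> 'a \<Rightarrow> real"
  assumes "(\<lambda>u. H u \<omega>) \<in> borel_measurable (restrict_space borel {0..T})" "t \<le> T"
  shows "(\<lambda>u. (simple_value m s \<xi> u \<omega> - H u \<omega>) * indicator {0..t} u) \<in> borel_measurable borel"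
proof -
  have "(\<lambda>u. indicator {0..T} u *\<^sub>R H u \<omega>) \<in> borel_measurable borel"
    using assms(1) by (subst (asm) borel_measurable_restrict_space_iff) auto
  then have "(\<lambda>u. simple_value m s \<xi> u \<omega> * indicator {0..t} u - (indicator {0..T} u *\<^sub>R H u \<omega>) * indicator {0..t} u) \<in> borel_measurable borel"
    unfolding simple_value_def by measurable
  also have "(\<lambda>u. simple_value m s \<xi> u \<omega> * indicator {0..t} u - (indicator {0..T} u *\<^sub>R H u \<omega>) * indicator {0..t} u)
      = (\<lambda>u. (simple_value m s \<xi> u \<omega> - H u \<omega>) * indicator {0..t} u)"
    using assms(2) by (auto simp: fun_eq_iff indicator_def)
  finally show ?thesis .
qed

context brownian
begin

lemma simple_integral_M:
  assumes sp: "simple_process M F m s \<xi>" and t: "0 \<le> t"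
  shows "simple_integral W m s \<xi> t \<in> borel_measurable M"
proof -
  have "(\<lambda>\<omega>. \<xi> i \<omega> * (W (min t (s (Suc i))) \<omega> - W (min t (s i)) \<omega>)) \<in> borel_measurable M" if i: "i < m" for i
  proof -
    have "0 \<le> s i" "0 \<le> s (Suc i)" using simple_process_nonneg[OF sp] i by auto
    moreover have "\<xi> i \<in> borel_measurable M"
      using sp i borel_F[OF \<open>0 \<le> s i\<close>] by (auto simp: simple_process_def)
    ultimately show ?thesis using t by (intro borel_measurable_times borel_measurable_diff W_M) auto
  qed
  then have "(\<lambda>\<omega>. \<Sum>i<m. \<xi> i \<omega> * (W (min t (s (Suc i))) \<omega> - W (min t (s i)) \<omega>)) \<in> borel_measurable M"
    by (intro borel_measurable_sum) auto
  then show ?thesis by (simp add: simple_integral_def[abs_def])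
qed

text \<open>The integral at \<open>t\<close> comes with its own approximating sequence. Comparing it
  with the given sequence shows that one sequence approximating \<open>H\<close> on
  \<open>{0..T}\<close> yields the integrals at all earlier times, in particular at all points of a
  grid.\<close>

lemma simple_integral_tendsto_ito:
  assumes sp: "\<And>k. simple_process M F (m k) (s k) (\<xi> k)"
    and ap: "tends_to_0_in_prob M (\<lambda>k \<omega>. \<integral>\<^sup>+u\<in>{0..T}. ennreal ((simple_value (m k) (s k) (\<xi> k) u \<omega> - H u \<omega>)\<^sup>2) \<partial>lborel)"
    and Hm: "AE \<omega> in M. (\<lambda>u. H u \<omega>) \<in> borel_measurable (restrict_space borel {0..T})"
    and J: "has_ito_integral M F W H t J" and t: "0 \<le> t" "t \<le> T"
  shows "null_prob (\<lambda>k \<omega>. simple_integral W (m k) (s k) (\<xi> k) t \<omega> - J \<omega>)"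
proof (rule null_probI)
  from J obtain m' s' \<xi>' where sp': "\<And>k. simple_process M F (m' k) (s' k) (\<xi>' k)"
    and ap': "tends_to_0_in_prob M (\<lambda>k \<omega>. \<integral>\<^sup>+u\<in>{0..t}. ennreal ((simple_value (m' k) (s' k) (\<xi>' k) u \<omega> - H u \<omega>)\<^sup>2) \<partial>lborel)"
    and in': "tends_to_0_in_prob M (\<lambda>k \<omega>. ennreal \<bar>simple_integral W (m' k) (s' k) (\<xi>' k) t \<omega> - J \<omega>\<bar>)"
    and JM: "J \<in> borel_measurable M"
    unfolding has_ito_integral_def by blast
  let ?I = "\<lambda>k. simple_integral W (m k) (s k) (\<xi> k) t" and ?I' = "\<lambda>k. simple_integral W (m' k) (s' k) (\<xi>' k) t"
  let ?V = "\<lambda>k u \<omega>. simple_value (m k) (s k) (\<xi> k) u \<omega>" and ?V' = "\<lambda>k u \<omega>. simple_value (m' k) (s' k) (\<xi>' k) u \<omega>"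
  have IM: "?I k \<in> borel_measurable M" "?I' k \<in> borel_measurable M" for k
    using simple_integral_M sp sp' t by auto
  show "(\<lambda>\<omega>. ?I k \<omega> - J \<omega>) \<in> borel_measurable M" for k using IM JM by auto
  fix \<epsilon> \<gamma> :: real assume pos: "0 < \<epsilon>" "0 < \<gamma>"
  \<comment> \<open>With this choice \<open>\<eta> / (\<epsilon> / 2)\<^sup>2\<close> is a quarter
    of \<open>\<gamma>\<close>. The two approximation errors may each be \<open>\<eta> / 4\<close>,
    because the square of a difference is at most twice the sum of the two squares.\<close>
  define \<eta> where "\<eta> = (\<epsilon> / 2)\<^sup>2 * (\<gamma> / 4)"
  have \<eta>: "0 < \<eta>" "0 < \<eta> / 4" "0 < \<epsilon> / 2" "0 < \<gamma> / 4" using pos by (auto simp: \<eta>_def)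
  have key: "prob {\<omega>\<in>space M. \<epsilon> / 2 < \<bar>?I k \<omega> - ?I' k \<omega>\<bar>}
      \<le> prob {\<omega>\<in>space M. ennreal (\<eta> / 4) < (\<integral>\<^sup>+u\<in>{0..T}. ennreal ((?V k u \<omega> - H u \<omega>)\<^sup>2) \<partial>lborel)}
       + prob {\<omega>\<in>space M. ennreal (\<eta> / 4) < (\<integral>\<^sup>+u\<in>{0..t}. ennreal ((?V' k u \<omega> - H u \<omega>)\<^sup>2) \<partial>lborel)} + \<gamma> / 4" (is "_ \<le> prob ?A + prob ?B + _") for k
  \<comment> \<open>The comparison lemma needs a positive time; at time 0 both integrals
    vanish.\<close>
  proof (cases "t = 0")
    case True
    then have "?I k \<omega> = 0" "?I' k \<omega> = 0" for \<omega>
      using simple_process_nonneg[OF sp[of k]] simple_process_nonneg[OF sp'[of k]]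
      by (auto simp: simple_integral_def min_def intro!: sum.neutral)
    then have e: "{\<omega>\<in>space M. \<epsilon> / 2 < \<bar>?I k \<omega> - ?I' k \<omega>\<bar>} = {}" using pos by auto
    have "0 \<le> prob ?A + prob ?B + \<gamma> / 4" using pos by (intro add_nonneg_nonneg) auto
    then show ?thesis unfolding e by simp
  next
    case False
    then have "0 < t" using t by simp
    have AB: "?A \<in> events" "?B \<in> events"
      using ap ap' unfolding tends_to_0_in_prob_def by (auto intro!: borel_measurable_less)
    have "prob {\<omega>\<in>space M. \<epsilon> / 2 < \<bar>?I k \<omega> - ?I' k \<omega>\<bar>}
       \<le> prob {\<omega>\<in>space M. ennreal \<eta> < (\<integral>\<^sup>+u\<in>{0..t}. ennreal ((?V k u \<omega> - ?V' k u \<omega>)\<^sup>2) \<partial>lborel)} + \<eta> / (\<epsilon> / 2)\<^sup>2"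
      by (rule simple_integral_diff_prob[OF sp sp' \<open>0 < t\<close> \<eta>(1,3)])
    also have "\<eta> / (\<epsilon> / 2)\<^sup>2 = \<gamma> / 4" using pos by (simp add: \<eta>_def)
    also have "prob {\<omega>\<in>space M. ennreal \<eta> < (\<integral>\<^sup>+u\<in>{0..t}. ennreal ((?V k u \<omega> - ?V' k u \<omega>)\<^sup>2) \<partial>lborel)} \<le> prob ?A + prob ?B"
    proof (rule prob_le_two[OF AB])
      show "AE \<omega> in M. \<omega> \<in> {\<omega>\<in>space M. ennreal \<eta> < (\<integral>\<^sup>+u\<in>{0..t}. ennreal ((?V k u \<omega> - ?V' k u \<omega>)\<^sup>2) \<partial>lborel)} \<longrightarrow> \<omega> \<in> ?A \<or> \<omega> \<in> ?B"
        using Hm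
      proof eventually_elim
        case (elim \<omega>)
        let ?a = "\<integral>\<^sup>+u\<in>{0..T}. ennreal ((?V k u \<omega> - H u \<omega>)\<^sup>2) \<partial>lborel"
        let ?b = "\<integral>\<^sup>+u\<in>{0..t}. ennreal ((?V' k u \<omega> - H u \<omega>)\<^sup>2) \<partial>lborel"
        have "(x - y)\<^sup>2 \<le> 2 * (x - z)\<^sup>2 + 2 * (y - z)\<^sup>2" for x y z :: real
          using sum_squares_bound[of "x - z" "z - y"] by (simp add: power2_eq_square algebra_simps)
        then have "(\<integral>\<^sup>+u\<in>{0..t}. ennreal ((?V k u \<omega> - ?V' k u \<omega>)\<^sup>2) \<partial>lborel)
            \<le> ennreal 2 * (\<integral>\<^sup>+u\<in>{0..t}. ennreal ((?V k u \<omega> - H u \<omega>)\<^sup>2) \<partial>lborel) + ennreal 2 * ?b"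
          using simple_value_path_measurable[of H \<omega>, OF elim t(2)] by (intro nn_integral_square_split) auto
        also have "(\<integral>\<^sup>+u\<in>{0..t}. ennreal ((?V k u \<omega> - H u \<omega>)\<^sup>2) \<partial>lborel) \<le> ?a"
          using t by (intro nn_integral_mono) (auto simp: indicator_def)
        finally have le: "(\<integral>\<^sup>+u\<in>{0..t}. ennreal ((?V k u \<omega> - ?V' k u \<omega>)\<^sup>2) \<partial>lborel) \<le> ennreal 2 * ?a + ennreal 2 * ?b"
          by (simp add: mult_left_mono add_right_mono)
        have "ennreal 2 * ?a + ennreal 2 * ?b \<le> ennreal \<eta>" if "?a \<le> ennreal (\<eta> / 4)" "?b \<le> ennreal (\<eta> / 4)"
        proof -
          have "ennreal 2 * ?a + ennreal 2 * ?b \<le> ennreal 2 * ennreal (\<eta> / 4) + ennreal 2 * ennreal (\<eta> / 4)"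
            using that by (intro add_mono mult_left_mono) auto
          also have "ennreal 2 * ennreal (\<eta> / 4) = ennreal (\<eta> / 2)"
            using \<eta> by (subst ennreal_mult[symmetric]) auto
          also have "ennreal (\<eta> / 2) + ennreal (\<eta> / 2) = ennreal \<eta>"
            using \<eta> by (subst ennreal_plus[symmetric]) auto
          finally show ?thesis .
        qed
        note bound = order_trans[OF le this]
        show ?case
        proof (intro impI, rule ccontr)
          assume lt: "\<omega> \<in> {\<omega>\<in>space M. ennreal \<eta> < (\<integral>\<^sup>+u\<in>{0..t}. ennreal ((?V k u \<omega> - ?V' k u \<omega>)\<^sup>2) \<partial>lborel)}"
            and "\<not> (\<omega> \<in> ?A \<or> \<omega> \<in> ?B)"
          then have "?a \<le> ennreal (\<eta> / 4)" "?b \<le> ennreal (\<eta> / 4)" by (auto simp: not_less)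
          from bound[OF this] lt show False by (simp add: not_less[symmetric])
        qed
      qed
    qed
    finally show ?thesis by simp
  qed
  have lt: "ennreal (\<epsilon> / 2) < ennreal x \<longleftrightarrow> \<epsilon> / 2 < x" for x using pos by (intro ennreal_less_iff) simp
  from tends_to_0_in_probD[OF ap \<eta>(2,4)] tends_to_0_in_probD[OF ap' \<eta>(2,4)] tends_to_0_in_probD[OF in' \<eta>(3,4)]
  show "\<forall>\<^sub>F k in sequentially. prob {\<omega>\<in>space M. \<epsilon> < \<bar>?I k \<omega> - J \<omega>\<bar>} \<le> \<gamma>"
  proof eventually_elim
    case (elim k)
    have "prob {\<omega>\<in>space M. \<epsilon> < \<bar>?I k \<omega> - J \<omega>\<bar>}
        \<le> prob {\<omega>\<in>space M. \<epsilon> / 2 < \<bar>?I k \<omega> - ?I' k \<omega>\<bar>} + prob {\<omega>\<in>space M. \<epsilon> / 2 < \<bar>?I' k \<omega> - J \<omega>\<bar>}"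
    proof (rule prob_le_two)
      show "AE \<omega> in M. \<omega> \<in> {\<omega>\<in>space M. \<epsilon> < \<bar>?I k \<omega> - J \<omega>\<bar>} \<longrightarrow>
          \<omega> \<in> {\<omega>\<in>space M. \<epsilon> / 2 < \<bar>?I k \<omega> - ?I' k \<omega>\<bar>} \<or> \<omega> \<in> {\<omega>\<in>space M. \<epsilon> / 2 < \<bar>?I' k \<omega> - J \<omega>\<bar>}"
      proof (rule AE_I2)
        fix \<omega>
        show "\<omega> \<in> {\<omega>\<in>space M. \<epsilon> < \<bar>?I k \<omega> - J \<omega>\<bar>} \<longrightarrow>
          \<omega> \<in> {\<omega>\<in>space M. \<epsilon> / 2 < \<bar>?I k \<omega> - ?I' k \<omega>\<bar>} \<or> \<omega> \<in> {\<omega>\<in>space M. \<epsilon> / 2 < \<bar>?I' k \<omega> - J \<omega>\<bar>}"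
          using abs_triangle_ineq[of "?I k \<omega> - ?I' k \<omega>" "?I' k \<omega> - J \<omega>"] by auto
      qed
    qed (use IM[of k] JM in auto)
    with elim key[of k] show ?case unfolding lt by linarith
  qed
qed

text \<open>Only rational times enter, which makes this a measurable event; on continuous paths its
  complement bounds the oscillation at all times of the cells.\<close>

definition osc_event :: "(real \<Rightarrow> 'a \<Rightarrow> real) \<Rightarrow> nat \<Rightarrow> (nat \<Rightarrow> real) \<Rightarrow> real \<Rightarrow> 'a set" where
  "osc_event H n \<tau> \<kappa> = {\<omega>\<in>space M. \<exists>i\<in>{..<n}. \<exists>r\<in>\<rat> \<inter> {\<tau> i..\<tau> (Suc i)}. \<kappa> < \<bar>H r \<omega> - H (\<tau> i) \<omega>\<bar>}"

lemma osc_event_measurable: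
  assumes H: "\<And>t. 0 \<le> t \<Longrightarrow> H t \<in> borel_measurable M" and \<tau>: "\<And>i. i < n \<Longrightarrow> 0 \<le> \<tau> i"
  shows "osc_event H n \<tau> \<kappa> \<in> events"
proof -
  have "osc_event H n \<tau> \<kappa> = (\<Union>i\<in>{..<n}. \<Union>r\<in>\<rat> \<inter> {\<tau> i..\<tau> (Suc i)}. {\<omega>\<in>space M. \<kappa> < \<bar>H r \<omega> - H (\<tau> i) \<omega>\<bar>})"
    unfolding osc_event_def by blast
  also have "\<dots> \<in> events"
  proof (rule sets.finite_UN)
    fix i assume i: "i \<in> {..<n}"
    show "(\<Union>r\<in>\<rat> \<inter> {\<tau> i..\<tau> (Suc i)}. {\<omega>\<in>space M. \<kappa> < \<bar>H r \<omega> - H (\<tau> i) \<omega>\<bar>}) \<in> events"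
    proof (rule sets.countable_UN'')
      fix r assume "r \<in> \<rat> \<inter> {\<tau> i..\<tau> (Suc i)}"
      then have "H r \<in> borel_measurable M" "H (\<tau> i) \<in> borel_measurable M"
        using \<tau>[of i] i H[of r] H[of "\<tau> i"] by auto
      then show "{\<omega>\<in>space M. \<kappa> < \<bar>H r \<omega> - H (\<tau> i) \<omega>\<bar>} \<in> events" by measurable
    qed (auto intro: countable_subset[OF _ countable_rat])
  qed simp
  finally show ?thesis .
qed

text \<open>Freezes the integrand at the left ends of the cells. Outside \<open>osc_event\<close>
  this changes it by at most \<open>\<kappa>\<close>, and the approximating simple process may be
  off by \<open>\<kappa>\<^sup>2 * T\<close> in the integrated square. Of the threshold
  \<open>2 * \<delta>\<close>, one half belongs to the simple integrals and one half to the passage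
  from them to \<open>J\<close>.\<close>

lemma ito_error_prob:
  assumes HF: "\<And>t. 0 \<le> t \<Longrightarrow> H t \<in> borel_measurable (F t)" and cont: "AE \<omega> in M. continuous_on {0..} (\<lambda>u. H u \<omega>)"
    and J: "\<And>t. 0 \<le> t \<Longrightarrow> has_ito_integral M F W H t (J t)"
    and \<tau>: "strict_chain n \<tau>" "0 \<le> \<tau> 0" "0 < n"
    and \<theta>: "\<And>i. i < n \<Longrightarrow> \<theta> i \<in> borel_measurable (F (\<tau> i))" and C: "0 < C" "\<And>i \<omega>. i < n \<Longrightarrow> \<omega> \<in> space M \<Longrightarrow> \<bar>\<theta> i \<omega>\<bar> \<le> C"
    and G: "finite G" "\<And>g. g \<in> G \<Longrightarrow> D g \<subseteq> {..<n}" "disjoint_family_on D G"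
    and pos: "0 < \<kappa>" "0 < \<delta>"
  shows "prob {\<omega>\<in>space M. 2 * \<delta> < (\<Sum>g\<in>G. (\<Sum>i\<in>D g. \<theta> i \<omega> * (J (\<tau> (Suc i)) \<omega> - J (\<tau> i) \<omega>
      - H (\<tau> i) \<omega> * (W (\<tau> (Suc i)) \<omega> - W (\<tau> i) \<omega>)))\<^sup>2)}
    \<le> prob (osc_event H n \<tau> \<kappa>) + 4 * C\<^sup>2 * \<kappa>\<^sup>2 * \<tau> n / \<delta>"
proof -
  define T where "T = \<tau> n"
  have \<tau>0: "0 \<le> \<tau> i" "\<tau> i \<le> T" if "i \<le> n" for i
    using strict_chain_iff(2)[OF \<tau>(1), of 0 i] strict_chain_iff(2)[OF \<tau>(1), of i n] that \<tau>(2) by (auto simp: T_def)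
  have T: "0 < T" using strict_chain_iff(1)[OF \<tau>(1), of 0 n] \<tau> by (simp add: T_def)
  from J[of T] T obtain m s \<xi> where sp: "\<And>k. simple_process M F (m k) (s k) (\<xi> k)"
    and ap: "tends_to_0_in_prob M (\<lambda>k \<omega>. \<integral>\<^sup>+u\<in>{0..T}. ennreal ((simple_value (m k) (s k) (\<xi> k) u \<omega> - H u \<omega>)\<^sup>2) \<partial>lborel)"
    and Hm: "AE \<omega> in M. (\<lambda>u. H u \<omega>) \<in> borel_measurable (restrict_space borel {0..T})"
    unfolding has_ito_integral_def by (meson less_imp_le)
  let ?I = "\<lambda>k. simple_integral W (m k) (s k) (\<xi> k)"
  let ?V = "\<lambda>k u \<omega>. simple_value (m k) (s k) (\<xi> k) u \<omega>"
  let ?dW = "\<lambda>i \<omega>. W (\<tau> (Suc i)) \<omega> - W (\<tau> i) \<omega>"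
  have "null_prob (\<lambda>k \<omega>. ?I k (\<tau> i) \<omega> - J (\<tau> i) \<omega>)" if "i \<in> {..n}" for i
    using that \<tau>0 by (intro simple_integral_tendsto_ito[OF sp ap Hm J]) auto
  from null_prob_AE_subseq_finite[of "{..n}" "\<lambda>i k \<omega>. ?I k (\<tau> i) \<omega> - J (\<tau> i) \<omega>", OF _ this]
  obtain r :: "nat \<Rightarrow> nat" where r: "strict_mono r" and conv: "AE \<omega> in M. \<forall>i\<in>{..n}. (\<lambda>k. ?I (r k) (\<tau> i) \<omega> - J (\<tau> i) \<omega>) \<longlonglongrightarrow> 0"
    by blast
  let ?Y = "\<lambda>\<omega>. \<Sum>g\<in>G. (\<Sum>i\<in>D g. \<theta> i \<omega> * (J (\<tau> (Suc i)) \<omega> - J (\<tau> i) \<omega> - H (\<tau> i) \<omega> * ?dW i \<omega>))\<^sup>2"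
  let ?Yk = "\<lambda>k \<omega>. \<Sum>g\<in>G. (\<Sum>i\<in>D g. \<theta> i \<omega> * (?I k (\<tau> (Suc i)) \<omega> - ?I k (\<tau> i) \<omega> - H (\<tau> i) \<omega> * ?dW i \<omega>))\<^sup>2"
  have JM: "J t \<in> borel_measurable M" if "0 \<le> t" for t
    using J[OF that] by (simp add: has_ito_integral_def)
  have HM: "H t \<in> borel_measurable M" if "0 \<le> t" for t using HF[OF that] borel_F[OF that] by blast
  have meas: "\<theta> i \<in> borel_measurable M" "J (\<tau> (Suc i)) \<in> borel_measurable M" "J (\<tau> i) \<in> borel_measurable M"
    "H (\<tau> i) \<in> borel_measurable M" "W (\<tau> (Suc i)) \<in> borel_measurable M" "W (\<tau> i) \<in> borel_measurable M"
    "?I k (\<tau> (Suc i)) \<in> borel_measurable M" "?I k (\<tau> i) \<in> borel_measurable M" if "i < n" for i k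
    using that \<tau>0[of i] \<tau>0[of "Suc i"] borel_F[OF _ \<theta>[of i]] by (auto intro!: JM HM W_M simple_integral_M sp)
  have YM: "?Y \<in> borel_measurable M" "?Yk k \<in> borel_measurable M" for k
    using G(2) by (intro borel_measurable_sum borel_measurable_power borel_measurable_times borel_measurable_diff meas; blast)+
  have "AE \<omega> in M. (\<lambda>k. ?Yk (r k) \<omega> - ?Y \<omega>) \<longlonglongrightarrow> 0"
    using conv
  proof eventually_elim
    case (elim \<omega>)
    have lim: "(\<lambda>k. ?I (r k) (\<tau> i) \<omega>) \<longlonglongrightarrow> J (\<tau> i) \<omega>" if "i \<le> n" for i
      using elim that LIM_zero_iff by fastforce
    have "i < n" if "g \<in> G" "i \<in> D g" for g i using G(2) that by blast
    then have "(\<lambda>k. ?Yk (r k) \<omega>) \<longlonglongrightarrow> ?Y \<omega>"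
      by (intro tendsto_sum tendsto_power tendsto_mult tendsto_diff tendsto_const lim) (auto simp: Suc_leI less_imp_le)
    then show ?case by (rule LIM_zero)
  qed
  then have np: "null_prob (\<lambda>k \<omega>. ?Yk (r k) \<omega> - ?Y \<omega>)"
    using YM by (intro null_prob_AE) auto
  have osc: "osc_event H n \<tau> \<kappa> \<in> events" using HM \<tau>0 by (intro osc_event_measurable) auto
  \<comment> \<open>Twice \<open>2 * C\<^sup>2 * \<kappa>\<^sup>2 * T\<close>: one share for the
    approximation error of the simple process, one for the oscillation of \<open>H\<close> within
    the cells.\<close>
  define \<eta> where "\<eta> = 4 * C\<^sup>2 * \<kappa>\<^sup>2 * T"
  have \<eta>: "0 < \<eta>" "0 < \<kappa>\<^sup>2 * T" using pos C T by (auto simp: \<eta>_def)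
  let ?Q = "\<lambda>k. {\<omega>\<in>space M. ennreal (\<kappa>\<^sup>2 * T) < (\<integral>\<^sup>+u\<in>{0..T}. ennreal ((?V k u \<omega> - H u \<omega>)\<^sup>2) \<partial>lborel)}"
  let ?\<Psi> = "\<lambda>k u \<omega>. \<Sum>i<n. indicator {\<tau> i<..\<tau> (Suc i)} u * (\<theta> i \<omega> * (?V k u \<omega> - H (\<tau> i) \<omega>))"
  have QM: "?Q k \<in> events" for k
    using ap unfolding tends_to_0_in_prob_def by (auto intro!: borel_measurable_less)
  have psi: "prob {\<omega>\<in>space M. ennreal \<eta> < (\<integral>\<^sup>+u\<in>{0..T}. ennreal ((?\<Psi> k u \<omega>)\<^sup>2) \<partial>lborel)} \<le> prob (osc_event H n \<tau> \<kappa>) + prob (?Q k)" for k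
  proof (rule prob_le_two[OF osc QM])
    show "AE \<omega> in M. \<omega> \<in> {\<omega>\<in>space M. ennreal \<eta> < (\<integral>\<^sup>+u\<in>{0..T}. ennreal ((?\<Psi> k u \<omega>)\<^sup>2) \<partial>lborel)} \<longrightarrow> \<omega> \<in> osc_event H n \<tau> \<kappa> \<or> \<omega> \<in> ?Q k"
      using Hm cont
    proof eventually_elim
      case (elim \<omega>)
      show ?case
      proof (intro impI, rule ccontr)
        assume in_set: "\<omega> \<in> {\<omega>\<in>space M. ennreal \<eta> < (\<integral>\<^sup>+u\<in>{0..T}. ennreal ((?\<Psi> k u \<omega>)\<^sup>2) \<partial>lborel)}"
          and not_in: "\<not> (\<omega> \<in> osc_event H n \<tau> \<kappa> \<or> \<omega> \<in> ?Q k)"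
        have \<omega>: "\<omega> \<in> space M" using in_set by simp
        have near: "\<bar>H u \<omega> - H (\<tau> i) \<omega>\<bar> \<le> \<kappa>" if i: "i < n" and u: "u \<in> {\<tau> i..\<tau> (Suc i)}" for i u
        proof (rule oscillation_from_rationals[OF _ strict_chainD[OF \<tau>(1) i] _ u])
          show "continuous_on {\<tau> i..\<tau> (Suc i)} (\<lambda>u. H u \<omega>)"
            using \<tau>0[of i] i by (intro continuous_on_subset[OF elim(2)]) auto
          show "\<bar>H r \<omega> - H (\<tau> i) \<omega>\<bar> \<le> \<kappa>" if "r \<in> \<rat>" "\<tau> i \<le> r" "r \<le> \<tau> (Suc i)" for r
          proof -
            have "\<not> \<kappa> < \<bar>H r \<omega> - H (\<tau> i) \<omega>\<bar>"
              using not_in that i \<omega> unfolding osc_event_def by auto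
            then show ?thesis by simp
          qed
        qed
        have le: "(?\<Psi> k u \<omega>)\<^sup>2 \<le> (2 * C\<^sup>2) * (?V k u \<omega> - H u \<omega>)\<^sup>2 + (2 * C\<^sup>2) * \<kappa>\<^sup>2" for u
        proof (cases "\<exists>i<n. \<tau> i < u \<and> u \<le> \<tau> (Suc i)")
          case True
          then obtain i where i: "i < n" "\<tau> i < u" "u \<le> \<tau> (Suc i)" by blast
          have z: "indicat_real {\<tau> j<..\<tau> (Suc j)} u = 0" if "j \<noteq> i" "j < n" for j
          proof (rule ccontr)
            assume "indicat_real {\<tau> j<..\<tau> (Suc j)} u \<noteq> 0"
            then have "\<tau> j < \<tau> (Suc i)" "\<tau> i < \<tau> (Suc j)" using i by (auto simp: indicator_def split: if_splits)
            then have "j < Suc i" "i < Suc j" using strict_chain_iff(1)[OF \<tau>(1)] i that by auto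
            with that show False by simp
          qed
          have "?\<Psi> k u \<omega> = (\<Sum>j\<in>{i}. indicator {\<tau> j<..\<tau> (Suc j)} u * (\<theta> j \<omega> * (?V k u \<omega> - H (\<tau> j) \<omega>)))"
            using i(1) z by (intro sum.mono_neutral_right) auto
          also have "\<dots> = \<theta> i \<omega> * (?V k u \<omega> - H (\<tau> i) \<omega>)" using i by (simp add: indicator_def)
          finally have "(?\<Psi> k u \<omega>)\<^sup>2 = (\<theta> i \<omega>)\<^sup>2 * (?V k u \<omega> - H (\<tau> i) \<omega>)\<^sup>2" by (simp add: power_mult_distrib)
          also have "\<dots> \<le> C\<^sup>2 * (2 * (?V k u \<omega> - H u \<omega>)\<^sup>2 + 2 * \<kappa>\<^sup>2)"
          proof (rule mult_mono)
            show "(\<theta> i \<omega>)\<^sup>2 \<le> C\<^sup>2" using C(2)[OF i(1) \<omega>] C(1) by (simp add: abs_le_square_iff[symmetric])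
            have "(H u \<omega> - H (\<tau> i) \<omega>)\<^sup>2 \<le> \<kappa>\<^sup>2"
              using near[OF i(1), of u] i pos(1) by (simp add: abs_le_square_iff[symmetric])
            moreover have "(x + y)\<^sup>2 \<le> 2 * x\<^sup>2 + 2 * y\<^sup>2" for x y :: real
              using sum_squares_bound[of x y] by (simp add: power2_sum)
            from this[of "?V k u \<omega> - H u \<omega>" "H u \<omega> - H (\<tau> i) \<omega>"]
            have "(?V k u \<omega> - H (\<tau> i) \<omega>)\<^sup>2 \<le> 2 * (?V k u \<omega> - H u \<omega>)\<^sup>2 + 2 * (H u \<omega> - H (\<tau> i) \<omega>)\<^sup>2" by simp
            ultimately show "(?V k u \<omega> - H (\<tau> i) \<omega>)\<^sup>2 \<le> 2 * (?V k u \<omega> - H u \<omega>)\<^sup>2 + 2 * \<kappa>\<^sup>2" by simp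
          qed auto
          finally show ?thesis by (simp add: algebra_simps)
        next
          case False
          then have "?\<Psi> k u \<omega> = 0" by (intro sum.neutral) (auto simp: indicator_def)
          then show ?thesis by simp
        qed
        have "(\<integral>\<^sup>+u\<in>{0..T}. ennreal ((?\<Psi> k u \<omega>)\<^sup>2) \<partial>lborel)
          \<le> ennreal (2 * C\<^sup>2) * (\<integral>\<^sup>+u\<in>{0..T}. ennreal ((?V k u \<omega> - H u \<omega>)\<^sup>2) \<partial>lborel) + ennreal (2 * C\<^sup>2) * (\<integral>\<^sup>+u\<in>{0..T}. ennreal (\<kappa>\<^sup>2) \<partial>lborel)"
          using simple_value_path_measurable[of H \<omega>, OF elim(1) order_refl] le by (intro nn_integral_square_split) auto
        also have "(\<integral>\<^sup>+u\<in>{0..T}. ennreal (\<kappa>\<^sup>2) \<partial>lborel) = ennreal (\<kappa>\<^sup>2 * T)"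
          using T by (simp add: nn_integral_cmult_indicator ennreal_mult)
        also have "(\<integral>\<^sup>+u\<in>{0..T}. ennreal ((?V k u \<omega> - H u \<omega>)\<^sup>2) \<partial>lborel) \<le> ennreal (\<kappa>\<^sup>2 * T)"
          using not_in \<omega> by (auto simp: not_less)
        finally have "(\<integral>\<^sup>+u\<in>{0..T}. ennreal ((?\<Psi> k u \<omega>)\<^sup>2) \<partial>lborel) \<le> ennreal (2 * C\<^sup>2) * ennreal (\<kappa>\<^sup>2 * T) + ennreal (2 * C\<^sup>2) * ennreal (\<kappa>\<^sup>2 * T)"
          by (simp add: mult_left_mono add_right_mono)
        also have "\<dots> = ennreal \<eta>"
          using T by (simp add: \<eta>_def ennreal_mult[symmetric] ennreal_plus[symmetric] algebra_simps del: ennreal_plus)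
        finally show False using in_set by (simp add: not_less[symmetric])
      qed
    qed
  qed
  \<comment> \<open>The approximation index \<open>k\<close> is absent from the claimed bound. For
    large \<open>k\<close> the two remaining probabilities are at most \<open>e / 2\<close> each,
    and one such \<open>k\<close> suffices.\<close>
  have "prob {\<omega>\<in>space M. 2 * \<delta> < ?Y \<omega>} \<le> (prob (osc_event H n \<tau> \<kappa>) + \<eta> / \<delta>) + e" if e: "0 < e" for e
  proof -
    have "0 < e / 2" using e by simp
    have "\<forall>\<^sub>F k in sequentially. prob (?Q (r k)) \<le> e / 2"
      using eventually_subseq[OF r] tends_to_0_in_probD[OF ap \<eta>(2) \<open>0 < e / 2\<close>] by blast
    with null_probD[OF np pos(2) \<open>0 < e / 2\<close>]
    have "\<forall>\<^sub>F k in sequentially. prob {\<omega>\<in>space M. 2 * \<delta> < ?Y \<omega>} \<le> (prob (osc_event H n \<tau> \<kappa>) + \<eta> / \<delta>) + e"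
    proof eventually_elim
      case (elim k)
      have "prob {\<omega>\<in>space M. 2 * \<delta> < ?Y \<omega>} \<le> prob {\<omega>\<in>space M. \<delta> < ?Yk (r k) \<omega>} + prob {\<omega>\<in>space M. \<delta> < \<bar>?Yk (r k) \<omega> - ?Y \<omega>\<bar>}"
      proof (rule prob_le_two)
        show "{\<omega>\<in>space M. \<delta> < ?Yk (r k) \<omega>} \<in> events" "{\<omega>\<in>space M. \<delta> < \<bar>?Yk (r k) \<omega> - ?Y \<omega>\<bar>} \<in> events"
          using YM(1) YM(2)[of "r k"] by (auto intro!: borel_measurable_less)
      qed (intro AE_I2, auto)
      also have "prob {\<omega>\<in>space M. \<delta> < ?Yk (r k) \<omega>} \<le> prob {\<omega>\<in>space M. ennreal \<eta> < (\<integral>\<^sup>+u\<in>{0..T}. ennreal ((?\<Psi> (r k) u \<omega>)\<^sup>2) \<partial>lborel)} + \<eta> / \<delta>"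
        unfolding T_def using HF \<tau>0 by (intro weighted_error_prob[OF sp \<tau> \<theta> _ G \<eta>(1) pos(2)]) auto
      finally show ?case using psi[of "r k"] elim by linarith
    qed
    then show ?thesis by (auto dest: eventually_happens)
  qed
  then show ?thesis unfolding \<eta>_def T_def by (rule field_le_epsilon)
qed

end

subsection \<open>Ito's formula for the squared Bessel process\<close>

text \<open>The deterministic part of Ito's formula along a sequence of grids. In the Taylor
  expansion the squared step is the square of the noise part \<open>2 * sqrt x * w\<close> plus
  terms containing the small part \<open>h + e\<close>. The noise square may be replaced by
  \<open>4 * x * h\<close>, up to the sum that vanishes by \<open>Z3\<close>, and this yields the
  drift \<open>f1 x + 2 * x * f2 x\<close>. All probability is contained in the four limits
  \<open>Z1\<close> to \<open>Z4\<close>.\<close>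

lemma ito_pathwise:
  fixes x w e :: "nat \<Rightarrow> nat \<Rightarrow> real" and h \<mu> :: "nat \<Rightarrow> real" and f f1 f2 :: "real \<Rightarrow> real" and N :: "nat \<Rightarrow> nat"
  assumes step: "\<And>n i. i < N n \<Longrightarrow> x n (Suc i) - x n i = h n + 2 * sqrt (x n i) * w n i + e n i"
    and N: "\<And>n. 0 < N n" and x: "\<And>n i. i \<le> N n \<Longrightarrow> 0 \<le> x n i" "\<And>n i. i \<le> N n \<Longrightarrow> x n i \<le> K"
    and taylor: "\<And>x y. 0 \<le> x \<Longrightarrow> 0 \<le> y \<Longrightarrow> \<bar>f y - f x - f1 x * (y - x) - f2 x * (y - x)\<^sup>2 / 2\<bar> \<le> C * \<bar>y - x\<bar> ^ 3"
    and f2: "\<And>x. \<bar>f2 x\<bar> \<le> C"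
    and h: "\<And>n. 0 \<le> h n" "\<And>n. real (N n) * h n = T" "h \<longlonglongrightarrow> 0"
    and \<mu>: "\<And>n i. i < N n \<Longrightarrow> \<bar>x n (Suc i) - x n i\<bar> \<le> \<mu> n" "\<mu> \<longlonglongrightarrow> 0"
    and Z1: "(\<lambda>n. \<Sum>i<N n. f1 (x n i) * e n i) \<longlonglongrightarrow> 0"
    and Z2: "(\<lambda>n. \<Sum>i<N n. (e n i)\<^sup>2) \<longlonglongrightarrow> 0"
    and Z3: "(\<lambda>n. \<Sum>i<N n. f2 (x n i) * (4 * x n i) * ((w n i)\<^sup>2 - h n)) \<longlonglongrightarrow> 0"
    and Z4: "(\<lambda>n. \<Sum>i<N n. 4 * x n i * ((w n i)\<^sup>2 - h n)) \<longlonglongrightarrow> 0"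
  shows "(\<lambda>n. f (x n (N n)) - f (x n 0) - (\<Sum>i<N n. (f1 (x n i) + 2 * x n i * f2 (x n i)) * h n)
      - (\<Sum>i<N n. f1 (x n i) * (2 * sqrt (x n i)) * w n i)) \<longlonglongrightarrow> 0"
proof -
  have C: "0 \<le> C" using f2[of 0] by linarith
  have K: "0 \<le> K" using x[of 0 0] by linarith
  \<comment> \<open>\<open>A n\<close> bounds the sum of the squares of the small parts
    \<open>h + e\<close> and tends to 0. \<open>Q n\<close> bounds that of the noise parts and only
    stays bounded. \<open>B n\<close> collects all errors.\<close>
  define A where "A n = 2 * (T * h n + (\<Sum>i<N n. (e n i)\<^sup>2))" for n
  define Q where "Q n = \<bar>\<Sum>i<N n. 4 * x n i * ((w n i)\<^sup>2 - h n)\<bar> + 4 * K * T" for n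
  define B where "B n = \<bar>\<Sum>i<N n. f1 (x n i) * e n i\<bar> + \<bar>\<Sum>i<N n. f2 (x n i) * (4 * x n i) * ((w n i)\<^sup>2 - h n)\<bar> / 2
      + C * (A n + 2 * (sqrt (A n) * sqrt (Q n))) / 2 + C * (\<mu> n * (2 * A n + 8 * Q n))" for n
  have A0: "A \<longlonglongrightarrow> 0"
    unfolding A_def using tendsto_mult[OF tendsto_const[of 2] tendsto_add[OF tendsto_mult[OF tendsto_const[of T] h(3)] Z2]] by simp
  have Q0: "Q \<longlonglongrightarrow> 4 * K * T"
    unfolding Q_def using tendsto_add[OF tendsto_rabs[OF Z4] tendsto_const[of "4 * K * T"]] by simp
  have "B \<longlonglongrightarrow> \<bar>0\<bar> + \<bar>0\<bar> / 2 + C * (0 + 2 * (sqrt 0 * sqrt (4 * K * T))) / 2 + C * (0 * (2 * 0 + 8 * (4 * K * T)))"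
    unfolding B_def by (intro tendsto_intros Z1 Z3 A0 Q0 \<mu>(2)) auto
  then have B0: "B \<longlonglongrightarrow> 0" by simp
  show ?thesis
  proof (rule Lim_null_comparison[OF always_eventually B0], rule allI)
    fix n
    let ?x = "x n" and ?w = "w n" and ?e = "e n" and ?h = "h n" and ?I = "{..<N n}"
    let ?d = "\<lambda>i. ?x (Suc i) - ?x i" and ?g = "\<lambda>i. ?h + ?e i" and ?m = "\<lambda>i. 2 * sqrt (?x i) * ?w i"
    let ?R = "\<lambda>i. f (?x (Suc i)) - f (?x i) - f1 (?x i) * ?d i - f2 (?x i) * (?d i)\<^sup>2 / 2"
    have xi: "0 \<le> ?x i" "0 \<le> ?x (Suc i)" "?x i \<le> K" if "i < N n" for i using x[of _ n] that by auto
    have \<mu>0: "0 \<le> \<mu> n" using \<mu>(1)[OF N[of n]] by linarith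
    have tele: "f (?x (N n)) - f (?x 0) = (\<Sum>i<N n. f (?x (Suc i)) - f (?x i))"
      by (simp add: sum_lessThan_telescope[of "\<lambda>i. f (?x i)"])
    have Ag: "(\<Sum>i<N n. (?g i)\<^sup>2) \<le> A n"
    proof -
      have "(?g i)\<^sup>2 \<le> 2 * ?h\<^sup>2 + 2 * (?e i)\<^sup>2" for i
        using sum_squares_bound[of ?h "?e i"] by (simp add: power2_sum)
      then have "(\<Sum>i<N n. (?g i)\<^sup>2) \<le> (\<Sum>i<N n. 2 * ?h\<^sup>2 + 2 * (?e i)\<^sup>2)" by (intro sum_mono)
      also have "\<dots> = 2 * ((real (N n) * ?h) * ?h) + 2 * (\<Sum>i<N n. (?e i)\<^sup>2)"
        by (simp add: sum.distrib sum_distrib_left power2_eq_square algebra_simps)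
      also have "\<dots> = A n" unfolding h(2) by (simp add: A_def)
      finally show ?thesis .
    qed
    have Qm: "(\<Sum>i<N n. (?m i)\<^sup>2) \<le> Q n"
    proof -
      have "(\<Sum>i<N n. (?m i)\<^sup>2) = (\<Sum>i<N n. 4 * ?x i * ((?w i)\<^sup>2 - ?h) + 4 * ?x i * ?h)"
        using xi by (intro sum.cong refl) (simp add: power_mult_distrib algebra_simps)
      also have "\<dots> \<le> (\<Sum>i<N n. 4 * ?x i * ((?w i)\<^sup>2 - ?h)) + (\<Sum>i<N n. 4 * K * ?h)"
        unfolding sum.distrib using xi h(1)[of n] by (intro add_left_mono sum_mono mult_right_mono) auto
      also have "(\<Sum>i<N n. 4 * K * ?h) = 4 * K * T" using h(2)[of n] by (simp add: algebra_simps)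
      finally show ?thesis unfolding Q_def by linarith
    qed
    have A_nn: "0 \<le> A n" using order_trans[OF sum_nonneg Ag] by simp
    have Q_nn: "0 \<le> Q n" using order_trans[OF sum_nonneg Qm] by simp
    \<comment> \<open>By the Cauchy-Schwarz inequality the mixed sum is at most
      \<open>sqrt (A n) * sqrt (Q n)\<close>, where the first factor tends to 0.\<close>
    have cross: "\<bar>\<Sum>i<N n. f2 (?x i) * ?g i * (2 * ?m i + ?g i)\<bar> \<le> C * (A n + 2 * (sqrt (A n) * sqrt (Q n)))"
    proof -
      have "\<bar>\<Sum>i<N n. f2 (?x i) * ?g i * (2 * ?m i + ?g i)\<bar> \<le> (\<Sum>i<N n. \<bar>f2 (?x i) * ?g i * (2 * ?m i + ?g i)\<bar>)"
        by (rule sum_abs)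
      also have "\<dots> \<le> (\<Sum>i<N n. C * ((?g i)\<^sup>2 + 2 * (\<bar>?g i\<bar> * \<bar>?m i\<bar>)))"
      proof (rule sum_mono)
        fix i
        have "\<bar>?g i * (2 * ?m i + ?g i)\<bar> \<le> (?g i)\<^sup>2 + 2 * (\<bar>?g i\<bar> * \<bar>?m i\<bar>)"
        proof -
          have "\<bar>?g i * (2 * ?m i + ?g i)\<bar> \<le> \<bar>?g i\<bar> * (2 * \<bar>?m i\<bar> + \<bar>?g i\<bar>)"
            unfolding abs_mult[of "?g i"] by (intro mult_left_mono) auto
          also have "\<dots> = (?g i)\<^sup>2 + 2 * (\<bar>?g i\<bar> * \<bar>?m i\<bar>)"
            by (simp add: distrib_left power2_eq_square)
          finally show ?thesis .
        qed
        then have "\<bar>f2 (?x i)\<bar> * \<bar>?g i * (2 * ?m i + ?g i)\<bar> \<le> C * ((?g i)\<^sup>2 + 2 * (\<bar>?g i\<bar> * \<bar>?m i\<bar>))"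
          using f2 C by (intro mult_mono) auto
        then show "\<bar>f2 (?x i) * ?g i * (2 * ?m i + ?g i)\<bar> \<le> C * ((?g i)\<^sup>2 + 2 * (\<bar>?g i\<bar> * \<bar>?m i\<bar>))"
          by (simp add: abs_mult mult.assoc)
      qed
      also have "\<dots> = C * ((\<Sum>i<N n. (?g i)\<^sup>2) + 2 * (\<Sum>i<N n. \<bar>?g i\<bar> * \<bar>?m i\<bar>))"
        by (simp add: sum_distrib_left sum.distrib distrib_left)
      also have "\<dots> \<le> C * (A n + 2 * (sqrt (A n) * sqrt (Q n)))"
      proof -
        have "(\<Sum>i<N n. \<bar>?g i\<bar> * \<bar>?m i\<bar>) \<le> L2_set ?g ?I * L2_set ?m ?I" by (rule L2_set_mult_ineq)
        also have "\<dots> \<le> sqrt (A n) * sqrt (Q n)"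
          unfolding L2_set_def using Ag Qm A_nn by (intro mult_mono real_sqrt_le_mono) (auto intro!: sum_nonneg)
        finally show ?thesis using Ag C by (intro mult_left_mono) auto
      qed
      finally show ?thesis .
    qed
    \<comment> \<open>Of the cubed step, one factor is bounded by the largest step
      \<open>\<mu> n\<close>; the remaining squares have a bounded sum.\<close>
    have rem: "\<bar>\<Sum>i<N n. ?R i\<bar> \<le> C * (\<mu> n * (2 * A n + 8 * Q n))"
    proof -
      have "\<bar>\<Sum>i<N n. ?R i\<bar> \<le> (\<Sum>i<N n. \<bar>?R i\<bar>)" by (rule sum_abs)
      also have "\<dots> \<le> (\<Sum>i<N n. C * (\<mu> n * (2 * (?g i)\<^sup>2 + 2 * (?m i)\<^sup>2)))"
      proof (rule sum_mono)
        fix i assume "i \<in> {..<N n}"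
        then have i: "i < N n" by simp
        have "\<bar>?R i\<bar> \<le> C * \<bar>?d i\<bar> ^ 3" using taylor xi[OF i] by blast
        also have "\<bar>?d i\<bar> ^ 3 = \<bar>?d i\<bar> * (?d i)\<^sup>2" by (simp add: power3_eq_cube power2_eq_square)
        also have "\<bar>?d i\<bar> * (?d i)\<^sup>2 \<le> \<mu> n * (2 * (?g i)\<^sup>2 + 2 * (?m i)\<^sup>2)"
        proof (rule mult_mono)
          have "(u + v)\<^sup>2 \<le> 2 * u\<^sup>2 + 2 * v\<^sup>2" for u v :: real
            using sum_squares_bound[of u v] by (simp add: power2_sum)
          from this[of "?g i" "?m i"] show "(?d i)\<^sup>2 \<le> 2 * (?g i)\<^sup>2 + 2 * (?m i)\<^sup>2"
            unfolding step[OF i] by (simp add: algebra_simps)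
        qed (use \<mu>(1)[OF i] \<mu>0 in auto)
        finally show "\<bar>?R i\<bar> \<le> C * (\<mu> n * (2 * (?g i)\<^sup>2 + 2 * (?m i)\<^sup>2))"
          using C by (simp add: mult_left_mono)
      qed
      also have "\<dots> = C * (\<mu> n * (2 * (\<Sum>i<N n. (?g i)\<^sup>2) + 2 * (\<Sum>i<N n. (?m i)\<^sup>2)))"
        by (simp add: sum_distrib_left sum.distrib distrib_left)
      also have "\<dots> \<le> C * (\<mu> n * (2 * A n + 8 * Q n))"
        using Ag Qm Q_nn C \<mu>0 by (intro mult_left_mono) auto
      finally show ?thesis .
    qed
    have "f (?x (Suc i)) - f (?x i) - (f1 (?x i) + 2 * ?x i * f2 (?x i)) * ?h - f1 (?x i) * (2 * sqrt (?x i)) * ?w i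
        = f1 (?x i) * ?e i + f2 (?x i) * (4 * ?x i) * ((?w i)\<^sup>2 - ?h) / 2 + f2 (?x i) * ?g i * (2 * ?m i + ?g i) / 2 + ?R i"
      if i: "i < N n" for i
    proof -
      have s: "sqrt (?x i) * sqrt (?x i) = ?x i" using xi[OF i] by simp
      have d: "?d i = ?g i + ?m i" using step[OF i] by simp
      have m2: "(?m i)\<^sup>2 = 4 * ?x i * (?w i)\<^sup>2" using s by (simp add: power2_eq_square algebra_simps)
      have "(?d i)\<^sup>2 = (?m i)\<^sup>2 + ?g i * (2 * ?m i + ?g i)" unfolding d by (simp add: power2_eq_square algebra_simps)
      then have "(?d i)\<^sup>2 = 4 * ?x i * ((?w i)\<^sup>2 - ?h) + 4 * ?x i * ?h + ?g i * (2 * ?m i + ?g i)"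
        unfolding m2 by (simp add: algebra_simps)
      then have "f2 (?x i) * (?d i)\<^sup>2 / 2 = f2 (?x i) * (4 * ?x i) * ((?w i)\<^sup>2 - ?h) / 2 + 2 * ?x i * f2 (?x i) * ?h + f2 (?x i) * ?g i * (2 * ?m i + ?g i) / 2"
        by (simp add: field_simps)
      moreover have "f1 (?x i) * ?d i = f1 (?x i) * ?h + f1 (?x i) * (2 * sqrt (?x i)) * ?w i + f1 (?x i) * ?e i"
        unfolding step[OF i] by (simp add: algebra_simps)
      moreover have "(f1 (?x i) + 2 * ?x i * f2 (?x i)) * ?h = f1 (?x i) * ?h + 2 * ?x i * f2 (?x i) * ?h"
        by (rule distrib_right)
      ultimately show ?thesis by linarith
    qed
    then have "f (?x (N n)) - f (?x 0) - (\<Sum>i<N n. (f1 (?x i) + 2 * ?x i * f2 (?x i)) * ?h) - (\<Sum>i<N n. f1 (?x i) * (2 * sqrt (?x i)) * ?w i)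
       = (\<Sum>i<N n. f1 (?x i) * ?e i + f2 (?x i) * (4 * ?x i) * ((?w i)\<^sup>2 - ?h) / 2 + f2 (?x i) * ?g i * (2 * ?m i + ?g i) / 2 + ?R i)"
      unfolding tele sum_subtractf[symmetric] by (intro sum.cong refl) auto
    also have "\<dots> = (\<Sum>i<N n. f1 (?x i) * ?e i) + (\<Sum>i<N n. f2 (?x i) * (4 * ?x i) * ((?w i)\<^sup>2 - ?h)) / 2
        + (\<Sum>i<N n. f2 (?x i) * ?g i * (2 * ?m i + ?g i)) / 2 + (\<Sum>i<N n. ?R i)"
      by (simp only: sum.distrib sum_divide_distrib)
    finally show "norm (f (?x (N n)) - f (?x 0) - (\<Sum>i<N n. (f1 (?x i) + 2 * ?x i * f2 (?x i)) * ?h)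
        - (\<Sum>i<N n. f1 (?x i) * (2 * sqrt (?x i)) * ?w i)) \<le> B n"
      using cross rem unfolding B_def real_norm_def by linarith
  qed
qed

section \<open>Equidistant grids and Riemann sums\<close>

definition time_grid :: "real \<Rightarrow> real \<Rightarrow> nat \<Rightarrow> nat \<Rightarrow> real" where
  "time_grid a b n i = a + real i * ((b - a) / real (Suc n))"

lemma time_grid_simps [simp]: "time_grid a b n 0 = a" "time_grid a b n (Suc n) = b"
  by (auto simp: time_grid_def)

lemma time_grid_diff: "time_grid a b n (Suc i) - time_grid a b n i = (b - a) / real (Suc n)"
  by (simp add: time_grid_def algebra_simps add_divide_distrib diff_divide_distrib)

lemma strict_chain_time_grid: "a < b \<Longrightarrow> strict_chain (Suc n) (time_grid a b n)"
  unfolding strict_chain_def using time_grid_diff[of a b n] by (metis diff_gt_0_iff_gt divide_pos_pos of_nat_0_less_iff zero_less_Suc)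

lemma time_grid_bounds:
  assumes "a < b" "i \<le> Suc n"
  shows "a \<le> time_grid a b n i" "time_grid a b n i \<le> b"
  using strict_chain_iff(2)[OF strict_chain_time_grid[OF assms(1), of n], of 0 i]
    strict_chain_iff(2)[OF strict_chain_time_grid[OF assms(1), of n], of i "Suc n"] assms(2) by auto

lemma mesh_tendsto_0: "(\<lambda>n. c / real (Suc n)) \<longlonglongrightarrow> 0"
  using LIMSEQ_Suc[OF lim_const_over_n[of c]] by simp

lemma grid_modulus:
  fixes f :: "real \<Rightarrow> real"
  assumes c: "continuous_on {a..b} f" and ab: "a < b" and \<epsilon>: "0 < \<epsilon>"
  shows "\<forall>\<^sub>F n in sequentially. \<forall>i<Suc n. \<forall>u\<in>{time_grid a b n i..time_grid a b n (Suc i)}. \<bar>f u - f (time_grid a b n i)\<bar> < \<epsilon>"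
proof -
  have "uniformly_continuous_on {a..b} f" using c by (intro compact_uniformly_continuous) auto
  then obtain d where d: "0 < d" "\<And>x y. x \<in> {a..b} \<Longrightarrow> y \<in> {a..b} \<Longrightarrow> dist y x < d \<Longrightarrow> dist (f y) (f x) < \<epsilon>"
    using \<epsilon> unfolding uniformly_continuous_on_def by metis
  have "\<forall>\<^sub>F n in sequentially. (b - a) / real (Suc n) < d"
    using order_tendstoD(2)[OF mesh_tendsto_0 d(1)] .
  then show ?thesis
  proof eventually_elim
    case (elim n)
    show ?case
    proof (intro allI impI ballI)
      fix i u assume i: "i < Suc n" and u: "u \<in> {time_grid a b n i..time_grid a b n (Suc i)}"
      have "a \<le> time_grid a b n i" "time_grid a b n (Suc i) \<le> b" using time_grid_bounds[OF ab] i by auto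
      then show "\<bar>f u - f (time_grid a b n i)\<bar> < \<epsilon>"
        using d(2)[of "time_grid a b n i" u] u elim time_grid_diff[of a b n i] by (auto simp: dist_real_def)
    qed
  qed
qed

lemma riemann_sum_tendsto:
  fixes f :: "real \<Rightarrow> real"
  assumes c: "continuous_on {a..b} f" and ab: "a < b"
  shows "(\<lambda>n. \<Sum>i<Suc n. f (time_grid a b n i) * ((b - a) / real (Suc n))) \<longlonglongrightarrow> integral {a..b} f"
proof (rule tendstoI)
  fix e :: real assume e: "0 < e"
  define \<kappa> where "\<kappa> = e / (2 * (b - a))"
  have "e / (2 * c) * c = e / 2" if "c \<noteq> 0" for c :: real using that by simp
  from this[of "b - a"] have "\<kappa> * (b - a) = e / 2" using ab unfolding \<kappa>_def by simp
  then have \<kappa>: "\<kappa> * (b - a) < e" "0 < \<kappa>" using e ab by (linarith, simp add: \<kappa>_def)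
  from grid_modulus[OF c ab \<kappa>(2)]
  show "\<forall>\<^sub>F n in sequentially. dist (\<Sum>i<Suc n. f (time_grid a b n i) * ((b - a) / real (Suc n))) (integral {a..b} f) < e"
  proof eventually_elim
    case (elim n)
    let ?t = "time_grid a b n" and ?h = "(b - a) / real (Suc n)"
    have bd: "a \<le> ?t i" "?t i \<le> b" if "i \<le> Suc n" for i using time_grid_bounds[OF ab that] by auto
    have int: "f integrable_on {?t i..?t j}" if "i \<le> Suc n" "j \<le> Suc n" for i j
      using bd[OF that(1)] bd[OF that(2)] by (intro integrable_continuous_real continuous_on_subset[OF c]) auto
    have le: "?t i \<le> ?t (Suc i)" for i
    proof -
      have "0 \<le> ?t (Suc i) - ?t i" unfolding time_grid_diff using ab by simp
      then show ?thesis by simp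
    qed
    have sum: "integral {a..?t k} f = (\<Sum>i<k. integral {?t i..?t (Suc i)} f)" if "k \<le> Suc n" for k
      using that
    proof (induction k)
      case (Suc k)
      then show ?case
        using Henstock_Kurzweil_Integration.integral_combine[of a "?t k" "?t (Suc k)" f] bd[of k] le[of k] int[of 0 "Suc k"]
        by simp
    qed simp
    have each: "\<bar>f (?t i) * ?h - integral {?t i..?t (Suc i)} f\<bar> \<le> \<kappa> * ?h" if i: "i < Suc n" for i
    proof -
      have h: "?h = ?t (Suc i) - ?t i" by (simp only: time_grid_diff)
      have "integral {?t i..?t (Suc i)} (\<lambda>u. f u - f (?t i)) = integral {?t i..?t (Suc i)} f - f (?t i) * ?h"
        using int[of i "Suc i"] i le[of i] h by (subst Henstock_Kurzweil_Integration.integral_diff) auto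
      moreover have "norm (integral {?t i..?t (Suc i)} (\<lambda>u. f u - f (?t i))) \<le> \<kappa> * (?t (Suc i) - ?t i)"
      proof (rule integral_bound[OF le])
        show "continuous_on {?t i..?t (Suc i)} (\<lambda>u. f u - f (?t i))"
          using bd[of i] bd[of "Suc i"] i by (intro continuous_intros continuous_on_subset[OF c]) auto
        show "norm (f u - f (?t i)) \<le> \<kappa>" if "u \<in> {?t i..?t (Suc i)}" for u
          using elim i that by (auto intro: less_imp_le)
      qed
      ultimately show ?thesis unfolding h by (simp add: abs_minus_commute)
    qed
    have "\<bar>(\<Sum>i<Suc n. f (?t i) * ?h) - integral {a..b} f\<bar> = \<bar>\<Sum>i<Suc n. f (?t i) * ?h - integral {?t i..?t (Suc i)} f\<bar>"
      using sum[of "Suc n"] by (simp only: sum_subtractf time_grid_simps)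
    also have "\<dots> \<le> (\<Sum>i<Suc n. \<kappa> * ?h)"
      using each by (intro order_trans[OF sum_abs] sum_mono) auto
    also have "\<dots> = \<kappa> * (b - a)" by (simp del: of_nat_Suc)
    finally show ?case using \<kappa> by (simp add: dist_real_def)
  qed
qed

context brownian
begin

lemma osc_event_time_grid_tendsto_0:
  assumes H: "\<And>t. 0 \<le> t \<Longrightarrow> H t \<in> borel_measurable M" and cont: "AE \<omega> in M. continuous_on {0..} (\<lambda>u. H u \<omega>)"
    and ab: "0 \<le> a" "a < b" and \<kappa>: "0 < \<kappa>"
  shows "(\<lambda>n. prob (osc_event H (Suc n) (time_grid a b n) \<kappa>)) \<longlonglongrightarrow> 0"
proof (rule prob_tendsto_0_AE)
  have "0 \<le> time_grid a b n i" if "i < Suc n" for n i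
    using time_grid_bounds(1)[OF ab(2), of i n] that ab(1) by linarith
  then show "osc_event H (Suc n) (time_grid a b n) \<kappa> \<in> events" for n
    by (intro osc_event_measurable H) auto
  show "AE \<omega> in M. \<forall>\<^sub>F n in sequentially. \<omega> \<notin> osc_event H (Suc n) (time_grid a b n) \<kappa>"
    using cont
  proof eventually_elim
    case (elim \<omega>)
    have "continuous_on {a..b} (\<lambda>u. H u \<omega>)" using ab by (intro continuous_on_subset[OF elim]) auto
    from grid_modulus[OF this ab(2) \<kappa>] show ?case
      by eventually_elim (force simp: osc_event_def not_less)
  qed
qed

text \<open>The weights are bounded uniformly in \<open>n\<close>. So \<open>\<kappa>\<close> can be
  fixed before the grid, after which the oscillation event becomes improbable as the mesh
  shrinks.\<close>

lemma ito_error_null: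
  assumes HF: "\<And>t. 0 \<le> t \<Longrightarrow> H t \<in> borel_measurable (F t)" and cont: "AE \<omega> in M. continuous_on {0..} (\<lambda>u. H u \<omega>)"
    and J: "\<And>t. 0 \<le> t \<Longrightarrow> has_ito_integral M F W H t (J t)"
    and ab: "0 \<le> a" "a < b"
    and \<theta>: "\<And>n i. i < Suc n \<Longrightarrow> \<theta> n i \<in> borel_measurable (F (time_grid a b n i))"
    and C: "\<And>n i \<omega>. \<bar>\<theta> n i \<omega>\<bar> \<le> C"
    and G: "\<And>n. finite (G n)" "\<And>n g. g \<in> G n \<Longrightarrow> D n g \<subseteq> {..<Suc n}" "\<And>n. disjoint_family_on (D n) (G n)"
  shows "null_prob (\<lambda>n \<omega>. \<Sum>g\<in>G n. (\<Sum>i\<in>D n g. \<theta> n i \<omega> * (J (time_grid a b n (Suc i)) \<omega> - J (time_grid a b n i) \<omega>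
      - H (time_grid a b n i) \<omega> * (W (time_grid a b n (Suc i)) \<omega> - W (time_grid a b n i) \<omega>)))\<^sup>2)"
proof (rule null_probI)
  let ?t = "time_grid a b"
  have t0: "0 \<le> ?t n i" if "i \<le> Suc n" for n i
    using time_grid_bounds(1)[OF ab(2) that] ab(1) by linarith
  have HM: "H t \<in> borel_measurable M" if "0 \<le> t" for t using HF[OF that] borel_F[OF that] by blast
  have JM: "J t \<in> borel_measurable M" if "0 \<le> t" for t
    using J[OF that] by (simp add: has_ito_integral_def)
  show "(\<lambda>\<omega>. \<Sum>g\<in>G n. (\<Sum>i\<in>D n g. \<theta> n i \<omega> * (J (?t n (Suc i)) \<omega> - J (?t n i) \<omega>
      - H (?t n i) \<omega> * (W (?t n (Suc i)) \<omega> - W (?t n i) \<omega>)))\<^sup>2) \<in> borel_measurable M" for n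
  proof (intro borel_measurable_sum borel_measurable_power)
    fix g i assume "g \<in> G n" "i \<in> D n g"
    then have i: "i < Suc n" using G(2) by blast
    then have "0 \<le> ?t n i" "0 \<le> ?t n (Suc i)" using t0[of i n] t0[of "Suc i" n] by auto
    then show "(\<lambda>\<omega>. \<theta> n i \<omega> * (J (?t n (Suc i)) \<omega> - J (?t n i) \<omega> - H (?t n i) \<omega> * (W (?t n (Suc i)) \<omega> - W (?t n i) \<omega>))) \<in> borel_measurable M"
      using borel_F[OF _ \<theta>[OF i]] by (intro borel_measurable_times borel_measurable_diff HM JM W_M) auto
  qed
  fix \<epsilon> \<gamma> :: real assume pos: "0 < \<epsilon>" "0 < \<gamma>"
  define C' where "C' = max 1 C"
  have C': "0 < C'" "\<bar>\<theta> n i \<omega>\<bar> \<le> C'" for n i \<omega> using C[of n i \<omega>] by (auto simp: C'_def)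
  have b: "0 < b" using ab by simp
  \<comment> \<open>Chosen so that the second term of the bound in \<open>ito_error_prob\<close>,
    used with \<open>\<epsilon> / 2\<close> for its threshold, is
    \<open>\<gamma> / 2\<close>.\<close>
  define \<kappa> where "\<kappa> = sqrt (\<gamma> / 2 * (\<epsilon> / 2) / (4 * C'\<^sup>2 * b))"
  have \<kappa>: "0 < \<kappa>" using pos C' b by (simp add: \<kappa>_def)
  have "\<kappa>\<^sup>2 = \<gamma> / 2 * (\<epsilon> / 2) / (4 * C'\<^sup>2 * b)" using pos C' b by (simp add: \<kappa>_def)
  then have *: "4 * C'\<^sup>2 * \<kappa>\<^sup>2 * b / (\<epsilon> / 2) = \<gamma> / 2" using pos C' b by (simp add: field_simps)
  have "\<forall>\<^sub>F n in sequentially. prob (osc_event H (Suc n) (?t n) \<kappa>) < \<gamma> / 2"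
    using pos by (intro order_tendstoD(2)[OF osc_event_time_grid_tendsto_0[OF HM cont ab \<kappa>]]) auto
  then show "\<forall>\<^sub>F n in sequentially. prob {\<omega>\<in>space M. \<epsilon> < \<bar>\<Sum>g\<in>G n. (\<Sum>i\<in>D n g. \<theta> n i \<omega> * (J (?t n (Suc i)) \<omega> - J (?t n i) \<omega>
      - H (?t n i) \<omega> * (W (?t n (Suc i)) \<omega> - W (?t n i) \<omega>)))\<^sup>2\<bar>} \<le> \<gamma>"
  proof eventually_elim
    case (elim n)
    have e2: "2 * (\<epsilon> / 2) = \<epsilon>" by simp
    have "0 \<le> ?t n 0" "0 < Suc n" "0 < \<epsilon> / 2" using ab pos by auto
    from ito_error_prob[where H = H and J = J and \<theta> = "\<theta> n" and C = C' and D = "D n" and \<tau> = "?t n", OF HF cont J strict_chain_time_grid[OF ab(2)] this(1,2) \<theta> C'(1) C'(2) G(1) G(2) G(3) \<kappa> this(3)]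
    have "prob {\<omega>\<in>space M. \<epsilon> < (\<Sum>g\<in>G n. (\<Sum>i\<in>D n g. \<theta> n i \<omega> * (J (?t n (Suc i)) \<omega> - J (?t n i) \<omega>
      - H (?t n i) \<omega> * (W (?t n (Suc i)) \<omega> - W (?t n i) \<omega>)))\<^sup>2)} \<le> prob (osc_event H (Suc n) (?t n) \<kappa>) + \<gamma> / 2"
      by (simp only: e2 time_grid_simps *)
    then show ?case using elim by (simp add: abs_of_nonneg sum_nonneg)
  qed
qed

text \<open>Needs no moments of the coefficients: an accumulated variance that vanishes almost
  surely is small in probability, and \<open>noise_lenglart\<close> with one block transfers this to
  the sum.\<close>

lemma noise_sum_null:
  assumes p: "\<And>n. 0 \<le> p n 0" "\<And>n. strict_chain (N n) (p n)"
    and \<zeta>: "\<And>n l. l < N n \<Longrightarrow> noise (p n l) (p n (Suc l)) (\<zeta> n l) (v n l)" and v: "\<And>n l. l < N n \<Longrightarrow> 0 < v n l"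
    and c: "\<And>n l. l < N n \<Longrightarrow> c n l \<in> borel_measurable (F (p n l))"
    and ae: "AE \<omega> in M. (\<lambda>n. \<Sum>l<N n. (c n l \<omega>)\<^sup>2 * v n l) \<longlonglongrightarrow> 0"
  shows "null_prob (\<lambda>n \<omega>. \<Sum>l<N n. c n l \<omega> * \<zeta> n l \<omega>)"
proof (rule null_probI)
  have p0: "0 \<le> p n l" if "l \<le> N n" for n l
    using strict_chain_iff(2)[OF p(2), of 0 n l] that p(1)[of n] by auto
  have cM: "c n l \<in> borel_measurable M" if "l < N n" for n l
    using borel_F[OF p0 c[OF that]] that by auto
  have \<zeta>M: "\<zeta> n l \<in> borel_measurable M" if "l < N n" for n l
    using \<zeta>[OF that] borel_F[OF p0, of "Suc l" n] that by (auto simp: noise_def)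
  show "(\<lambda>\<omega>. \<Sum>l<N n. c n l \<omega> * \<zeta> n l \<omega>) \<in> borel_measurable M" for n
    using cM \<zeta>M by (intro borel_measurable_sum borel_measurable_times) auto
  have QM: "(\<lambda>\<omega>. \<Sum>l<N n. (c n l \<omega>)\<^sup>2 * v n l) \<in> borel_measurable M" for n
    using cM by (intro borel_measurable_sum borel_measurable_times borel_measurable_power) auto
  fix \<epsilon> \<gamma> :: real assume pos: "0 < \<epsilon>" "0 < \<gamma>"
  define \<eta> where "\<eta> = \<gamma> / 2 * \<epsilon>\<^sup>2"
  have \<eta>: "0 < \<eta>" "0 < \<gamma> / 2" "0 < \<epsilon>\<^sup>2" "\<eta> / \<epsilon>\<^sup>2 = \<gamma> / 2" using pos by (auto simp: \<eta>_def)
  from null_probD[OF null_prob_AE[OF QM ae] \<eta>(1,2)]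
  show "\<forall>\<^sub>F n in sequentially. prob {\<omega>\<in>space M. \<epsilon> < \<bar>\<Sum>l<N n. c n l \<omega> * \<zeta> n l \<omega>\<bar>} \<le> \<gamma>"
  proof eventually_elim
    case (elim n)
    have lt: "\<epsilon> < \<bar>x\<bar> \<longleftrightarrow> \<epsilon>\<^sup>2 < x\<^sup>2" for x
      using pos abs_le_square_iff[of x \<epsilon>] by (simp add: not_le[symmetric])
    have nn: "\<bar>\<Sum>l<N n. (c n l \<omega>)\<^sup>2 * v n l\<bar> = (\<Sum>l<N n. (c n l \<omega>)\<^sup>2 * v n l)" for \<omega>
      using v by (intro abs_of_nonneg sum_nonneg) (auto simp: less_imp_le)
    have dj: "disjoint_family_on (\<lambda>_::unit. {..<N n}) {()}" by (simp add: disjoint_family_on_def)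
    have "prob {\<omega>\<in>space M. \<epsilon>\<^sup>2 < (\<Sum>g\<in>{()}. (\<Sum>l\<in>{..<N n}. c n l \<omega> * \<zeta> n l \<omega>)\<^sup>2)}
      \<le> prob {\<omega>\<in>space M. \<eta> < (\<Sum>l<N n. (c n l \<omega>)\<^sup>2 * v n l)} + \<eta> / \<epsilon>\<^sup>2"
      using p(1) by (rule noise_lenglart[OF _ p(2) \<zeta> v c _ _ dj \<eta>(1,3)]) auto
    then show ?case using elim unfolding lt nn \<eta>(4) by simp
  qed
qed

end

locale sq_bessel = brownian +
  fixes X :: "real \<Rightarrow> 'a \<Rightarrow> real" and x0 :: real
  assumes x0: "0 \<le> x0" and sol: "strong_solution M F W (\<lambda>x. 1) (\<lambda>x. 2 * sqrt x) x0 X"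
    and nonneg: "AE \<omega> in M. \<forall>t\<ge>0. 0 \<le> X t \<omega>"
begin

lemma X_F: "0 \<le> t \<Longrightarrow> X t \<in> borel_measurable (F t)"
  and X_continuous: "AE \<omega> in M. continuous_on {0..} (\<lambda>t. X t \<omega>)"
  and X_0: "AE \<omega> in M. X 0 \<omega> = x0"
  using sol unfolding strong_solution_def adapted_def by blast+

lemma X_M: "0 \<le> t \<Longrightarrow> X t \<in> borel_measurable M"
  using X_F borel_F by blast

text \<open>The equation provides a version of the stochastic integral for each time separately,
  without regularity in time. Choosing one version per time makes increments over a grid
  meaningful.\<close>

definition drift_free :: "real \<Rightarrow> 'a \<Rightarrow> real" where
  "drift_free t = (SOME J. has_ito_integral M F W (\<lambda>u \<omega>. 2 * sqrt (X u \<omega>)) t J \<and> (AE \<omega> in M. X t \<omega> = x0 + t + J \<omega>))"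

lemma drift_free:
  assumes "0 \<le> t"
  shows "has_ito_integral M F W (\<lambda>u \<omega>. 2 * sqrt (X u \<omega>)) t (drift_free t)"
    and "AE \<omega> in M. X t \<omega> = x0 + t + drift_free t \<omega>"
proof -
  obtain J where J: "has_ito_integral M F W (\<lambda>u \<omega>. 2 * sqrt (X u \<omega>)) t J"
    and ae: "AE \<omega> in M. set_integrable lborel {0..t} (\<lambda>u. 1 :: real) \<and> X t \<omega> = x0 + (LINT u:{0..t}|lborel. 1) + J \<omega>"
    using sol assms unfolding strong_solution_def by blast
  have "(LINT u:{0..t}|lborel. (1::real)) = t" using assms by (simp add: set_lebesgue_integral_def)
  with ae have "AE \<omega> in M. X t \<omega> = x0 + t + J \<omega>" by simp
  with J have "\<exists>J. has_ito_integral M F W (\<lambda>u \<omega>. 2 * sqrt (X u \<omega>)) t J \<and> (AE \<omega> in M. X t \<omega> = x0 + t + J \<omega>)" by blast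
  from someI_ex[OF this] show "has_ito_integral M F W (\<lambda>u \<omega>. 2 * sqrt (X u \<omega>)) t (drift_free t)"
    "AE \<omega> in M. X t \<omega> = x0 + t + drift_free t \<omega>"
    unfolding drift_free_def by auto
qed

text \<open>Supplies the limits \<open>Z1\<close> to \<open>Z4\<close> of
  \<open>ito_pathwise\<close>. They hold in probability along the full sequence of grids and almost
  surely along one common subsequence. The path of \<open>X\<close> is bounded on
  \<open>{a..b}\<close> by a random constant only, which is enough because the last step is taken
  path by path.\<close>

lemma ito_subseq:
  assumes ab: "0 \<le> a" "a < b"
    and taylor: "\<And>x y. 0 \<le> x \<Longrightarrow> 0 \<le> y \<Longrightarrow> \<bar>f y - f x - f1 x * (y - x) - f2 x * (y - x)\<^sup>2 / 2\<bar> \<le> C * \<bar>y - x\<bar> ^ 3"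
    and C: "\<And>x. \<bar>f1 x\<bar> \<le> C" "\<And>x. \<bar>f2 x\<bar> \<le> C"
    and m: "f1 \<in> borel_measurable borel" "f2 \<in> borel_measurable borel"
  obtains r where "strict_mono (r :: nat \<Rightarrow> nat)"
    "AE \<omega> in M. (\<lambda>k. f (X b \<omega>) - f (X a \<omega>)
       - (\<Sum>i<Suc (r k). (f1 (X (time_grid a b (r k) i) \<omega>) + 2 * X (time_grid a b (r k) i) \<omega> * f2 (X (time_grid a b (r k) i) \<omega>)) * ((b - a) / real (Suc (r k))))
       - (\<Sum>i<Suc (r k). f1 (X (time_grid a b (r k) i) \<omega>) * (2 * sqrt (X (time_grid a b (r k) i) \<omega>))
            * (W (time_grid a b (r k) (Suc i)) \<omega> - W (time_grid a b (r k) i) \<omega>))) \<longlonglongrightarrow> 0"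
proof -
  let ?t = "time_grid a b" and ?h = "\<lambda>n. (b - a) / real (Suc n)"
  let ?H = "\<lambda>u \<omega>. 2 * sqrt (X u \<omega>)"
  let ?J = "drift_free"
  let ?dW = "\<lambda>n i \<omega>. W (?t n (Suc i)) \<omega> - W (?t n i) \<omega>"
  let ?e = "\<lambda>n i \<omega>. ?J (?t n (Suc i)) \<omega> - ?J (?t n i) \<omega> - ?H (?t n i) \<omega> * ?dW n i \<omega>"
  have t0: "0 \<le> ?t n i" if "i \<le> Suc n" for n i
    using time_grid_bounds(1)[OF ab(2) that] ab(1) by linarith
  have chain: "strict_chain (Suc n) (?t n)" for n by (rule strict_chain_time_grid[OF ab(2)])
  have HF: "?H t \<in> borel_measurable (F t)" if "0 \<le> t" for t using X_F[OF that] by measurable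
  have Hc: "AE \<omega> in M. continuous_on {0..} (\<lambda>u. ?H u \<omega>)"
    using X_continuous by eventually_elim (intro continuous_intros)
  have XF: "X (?t n i) \<in> borel_measurable (F (?t n i))" if "i < Suc n" for n i
    using X_F t0 that by auto
  note [measurable] = m
  have gF: "(\<lambda>\<omega>. g (X (?t n i) \<omega>)) \<in> borel_measurable (F (?t n i))" if "i < Suc n" "g \<in> borel_measurable borel" for n i and g :: "real \<Rightarrow> real"
    using measurable_compose[OF XF[OF that(1)] that(2)] .
  define Z1 Z2 Z3 Z4 where
    "Z1 = (\<lambda>n \<omega>. \<Sum>i<Suc n. f1 (X (?t n i) \<omega>) * ?e n i \<omega>)" and
    "Z2 = (\<lambda>n \<omega>. \<Sum>i<Suc n. (?e n i \<omega>)\<^sup>2)" and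
    "Z3 = (\<lambda>n \<omega>. \<Sum>i<Suc n. (f2 (X (?t n i) \<omega>) * (4 * X (?t n i) \<omega>)) * ((?dW n i \<omega>)\<^sup>2 - ?h n))" and
    "Z4 = (\<lambda>n \<omega>. \<Sum>i<Suc n. (4 * X (?t n i) \<omega>) * ((?dW n i \<omega>)\<^sup>2 - ?h n))"
  have sqrt_null: "null_prob Y" if "null_prob (\<lambda>n \<omega>. (Y n \<omega>)\<^sup>2)" "\<And>n. Y n \<in> borel_measurable M" for Y :: "nat \<Rightarrow> 'a \<Rightarrow> real"
  proof (rule null_probI[OF that(2)])
    fix \<epsilon> \<gamma> :: real assume pos: "0 < \<epsilon>" "0 < \<gamma>"
    have lt: "\<epsilon> < \<bar>x\<bar> \<longleftrightarrow> \<epsilon>\<^sup>2 < \<bar>x\<^sup>2\<bar>" for x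
      using pos abs_le_square_iff[of x \<epsilon>] by (simp add: not_le[symmetric])
    show "\<forall>\<^sub>F k in sequentially. prob {\<omega>\<in>space M. \<epsilon> < \<bar>Y k \<omega>\<bar>} \<le> \<gamma>"
      unfolding lt using pos by (intro null_probD[OF that(1)]) auto
  qed
  have eM: "?e n i \<in> borel_measurable M" if "i < Suc n" for n i
  proof -
    have "0 \<le> ?t n i" "0 \<le> ?t n (Suc i)" using t0[of i n] t0[of "Suc i" n] that by auto
    moreover have "?J t \<in> borel_measurable M" if "0 \<le> t" for t
      using drift_free(1)[OF that] by (simp add: has_ito_integral_def)
    ultimately have [measurable]: "?J (?t n i) \<in> borel_measurable M" "?J (?t n (Suc i)) \<in> borel_measurable M"
      "W (?t n i) \<in> borel_measurable M" "W (?t n (Suc i)) \<in> borel_measurable M" "X (?t n i) \<in> borel_measurable M"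
      using X_M W_M by blast+
    show ?thesis by measurable
  qed
  have Z1M: "Z1 n \<in> borel_measurable M" for n
    unfolding Z1_def using eM borel_F[OF t0 gF[OF _ m(1)]] by (intro borel_measurable_sum borel_measurable_times) auto
  \<comment> \<open>One block with the weights \<open>f1 (X u \<omega>)\<close> gives the square of
    \<open>Z1\<close>; weights 1 and one block per cell give the sum of squares
    \<open>Z2\<close>.\<close>
  have n1: "null_prob Z1"
  proof (rule sqrt_null[OF _ Z1M])
    have "null_prob (\<lambda>n \<omega>. \<Sum>g\<in>{()}. (\<Sum>i\<in>{..<Suc n}. f1 (X (?t n i) \<omega>) * ?e n i \<omega>)\<^sup>2)"
      by (rule ito_error_null[OF HF Hc drift_free(1) ab gF[OF _ m(1)] C(1)]) (auto simp: disjoint_family_on_def)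
    then show "null_prob (\<lambda>n \<omega>. (Z1 n \<omega>)\<^sup>2)" by (simp add: Z1_def)
  qed
  have n2: "null_prob Z2"
  proof -
    have "null_prob (\<lambda>n \<omega>. \<Sum>g\<in>{..<Suc n}. (\<Sum>i\<in>{g}. 1 * ?e n i \<omega>)\<^sup>2)"
      by (rule ito_error_null[OF HF Hc drift_free(1) ab, where C = 1]) (auto simp: disjoint_family_on_def)
    then show ?thesis by (simp add: Z2_def)
  qed
  have noise: "noise (?t n i) (?t n (Suc i)) (\<lambda>\<omega>. (?dW n i \<omega>)\<^sup>2 - ?h n) (2 * (?h n)\<^sup>2)" if "i < Suc n" for n i
    using noise_increment_square[OF t0 strict_chainD[OF chain that]] that unfolding time_grid_diff by simp
  have h: "0 < ?h n" for n using ab by simp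
  have bounded: "\<exists>K. \<forall>u\<in>{a..b}. X u \<omega> \<le> K" if "continuous_on {0..} (\<lambda>t. X t \<omega>)" for \<omega>
  proof -
    have "continuous_on {a..b} (\<lambda>t. X t \<omega>)" using ab by (intro continuous_on_subset[OF that]) auto
    then have "bounded ((\<lambda>t. X t \<omega>) ` {a..b})" by (intro compact_imp_bounded compact_continuous_image) auto
    then show ?thesis unfolding bounded_iff by (auto dest: abs_le_D1)
  qed
  have t_in: "?t n i \<in> {a..b}" if "i \<le> Suc n" for n i using time_grid_bounds[OF ab(2) that] by auto
  \<comment> \<open>The compensated square of an increment has variance twice the squared mesh. Over
    \<open>Suc n\<close> cells this adds up to a constant of the path times the mesh.\<close>
  have quad: "null_prob (\<lambda>n \<omega>. \<Sum>i<Suc n. (g (X (?t n i) \<omega>) * (4 * X (?t n i) \<omega>)) * ((?dW n i \<omega>)\<^sup>2 - ?h n))"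
    if g: "g \<in> borel_measurable borel" "\<And>x. \<bar>g x\<bar> \<le> B" for g :: "real \<Rightarrow> real" and B
  proof (rule noise_sum_null[OF _ chain noise])
    show "0 < 2 * (?h n)\<^sup>2" for n using h[of n] ab by simp
    show "(\<lambda>\<omega>. g (X (?t n i) \<omega>) * (4 * X (?t n i) \<omega>)) \<in> borel_measurable (F (?t n i))" if "i < Suc n" for n i
      using that gF[OF that g(1)] XF[OF that] by (intro borel_measurable_times) auto
    show "AE \<omega> in M. (\<lambda>n. \<Sum>i<Suc n. (g (X (?t n i) \<omega>) * (4 * X (?t n i) \<omega>))\<^sup>2 * (2 * (?h n)\<^sup>2)) \<longlonglongrightarrow> 0"
      using X_continuous nonneg
    proof eventually_elim
      case (elim \<omega>)
      obtain K where K: "\<And>u. u \<in> {a..b} \<Longrightarrow> X u \<omega> \<le> K" using bounded[OF elim(1)] by blast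
      have K0: "0 \<le> K" using K[of a] elim(2) ab by fastforce
      have B0: "0 \<le> B" using g(2)[of 0] by linarith
      show ?case
      proof (rule Lim_null_comparison[OF always_eventually], rule allI)
        show "(\<lambda>n. (B * (4 * K))\<^sup>2 * 2 * (b - a) * ?h n) \<longlonglongrightarrow> 0"
          by (rule tendsto_mult_right_zero[OF mesh_tendsto_0])
        fix n
        have "(g (X (?t n i) \<omega>) * (4 * X (?t n i) \<omega>))\<^sup>2 \<le> (B * (4 * K))\<^sup>2" if "i < Suc n" for i
        proof -
          have x: "0 \<le> X (?t n i) \<omega>" "X (?t n i) \<omega> \<le> K" using elim(2) t0[of i n] K[OF t_in[of i n]] that by auto
          have "\<bar>g (X (?t n i) \<omega>) * (4 * X (?t n i) \<omega>)\<bar> \<le> B * (4 * K)"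
            unfolding abs_mult using x g(2) B0 by (intro mult_mono) auto
          then show ?thesis using B0 K0 by (simp add: abs_le_square_iff[symmetric])
        qed
        then have "(\<Sum>i<Suc n. (g (X (?t n i) \<omega>) * (4 * X (?t n i) \<omega>))\<^sup>2 * (2 * (?h n)\<^sup>2)) \<le> (\<Sum>i<Suc n. (B * (4 * K))\<^sup>2 * (2 * (?h n)\<^sup>2))"
          by (intro sum_mono mult_right_mono) auto
        also have "\<dots> = (B * (4 * K))\<^sup>2 * 2 * (real (Suc n) * ?h n) * ?h n"
          by (simp add: power2_eq_square del: of_nat_Suc)
        also have "real (Suc n) * ?h n = b - a" by (simp del: of_nat_Suc)
        finally have "(\<Sum>i<Suc n. (g (X (?t n i) \<omega>) * (4 * X (?t n i) \<omega>))\<^sup>2 * (2 * (?h n)\<^sup>2)) \<le> (B * (4 * K))\<^sup>2 * 2 * (b - a) * ?h n" .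
        moreover have "0 \<le> (\<Sum>i<Suc n. (g (X (?t n i) \<omega>) * (4 * X (?t n i) \<omega>))\<^sup>2 * (2 * (?h n)\<^sup>2))"
          by (intro sum_nonneg) simp
        ultimately show "norm (\<Sum>i<Suc n. (g (X (?t n i) \<omega>) * (4 * X (?t n i) \<omega>))\<^sup>2 * (2 * (?h n)\<^sup>2)) \<le> (B * (4 * K))\<^sup>2 * 2 * (b - a) * ?h n"
          by simp
      qed
    qed
  qed (use ab in simp)
  have n3: "null_prob Z3" unfolding Z3_def by (rule quad[OF m(2) C(2)])
  have n4: "null_prob Z4" using quad[of "\<lambda>_. 1" 1] by (simp add: Z4_def)
  define Z where "Z j = (if j = (0::nat) then Z1 else if j = 1 then Z2 else if j = 2 then Z3 else Z4)" for j
  have nZ: "null_prob (Z j)" if "j \<in> {..<4}" for j using n1 n2 n3 n4 by (simp add: Z_def)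
  obtain r :: "nat \<Rightarrow> nat" where r: "strict_mono r" and rZ: "AE \<omega> in M. \<forall>j\<in>{..<4}. (\<lambda>k. Z j (r k) \<omega>) \<longlonglongrightarrow> 0"
    by (rule null_prob_AE_subseq_finite[of "{..<4}" Z]) (use nZ in auto)
  \<comment> \<open>The exceptional null set depends on the time. All grids together have only
    countably many points.\<close>
  have Xeq: "AE \<omega> in M. \<forall>n. \<forall>i\<le>Suc n. X (?t n i) \<omega> = x0 + ?t n i + ?J (?t n i) \<omega>"
    using drift_free(2)[OF t0] by (auto simp: AE_all_countable)
  have "AE \<omega> in M. (\<lambda>k. f (X b \<omega>) - f (X a \<omega>)
       - (\<Sum>i<Suc (r k). (f1 (X (?t (r k) i) \<omega>) + 2 * X (?t (r k) i) \<omega> * f2 (X (?t (r k) i) \<omega>)) * ?h (r k))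
       - (\<Sum>i<Suc (r k). f1 (X (?t (r k) i) \<omega>) * (2 * sqrt (X (?t (r k) i) \<omega>)) * ?dW (r k) i \<omega>)) \<longlonglongrightarrow> 0"
    using rZ Xeq X_continuous nonneg
  proof eventually_elim
    case (elim \<omega>)
    obtain K where K: "\<And>u. u \<in> {a..b} \<Longrightarrow> X u \<omega> \<le> K" using bounded[OF elim(3)] by blast
    have cX: "continuous_on {a..b} (\<lambda>t. X t \<omega>)" using ab by (intro continuous_on_subset[OF elim(3)]) auto
    define \<mu> where "\<mu> n = Max ((\<lambda>i. \<bar>X (?t n (Suc i)) \<omega> - X (?t n i) \<omega>\<bar>) ` {..<Suc n})" for n
    have \<mu>: "\<bar>X (?t n (Suc i)) \<omega> - X (?t n i) \<omega>\<bar> \<le> \<mu> n" if "i < Suc n" for n i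
      unfolding \<mu>_def using that by (intro Max_ge) auto
    have "\<mu> \<longlonglongrightarrow> 0"
    proof (rule tendstoI)
      fix \<epsilon> :: real assume \<epsilon>: "0 < \<epsilon>"
      from grid_modulus[OF cX ab(2) \<epsilon>] show "\<forall>\<^sub>F n in sequentially. dist (\<mu> n) 0 < \<epsilon>"
      proof eventually_elim
        case (elim n)
        have "\<bar>X (?t n (Suc i)) \<omega> - X (?t n i) \<omega>\<bar> < \<epsilon>" if "i < Suc n" for i
          using elim that strict_chainD[OF chain that] by auto
        then have "\<mu> n < \<epsilon>" unfolding \<mu>_def by (subst Max_less_iff) auto
        moreover have "0 \<le> \<mu> n" using \<mu>[of 0 n] by linarith
        ultimately show ?case by simp
      qed
    qed
    then have \<mu>r: "(\<lambda>k. \<mu> (r k)) \<longlonglongrightarrow> 0" using LIMSEQ_subseq_LIMSEQ[OF _ r] by (auto simp: comp_def)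
    have hr: "(\<lambda>k. ?h (r k)) \<longlonglongrightarrow> 0" using LIMSEQ_subseq_LIMSEQ[OF mesh_tendsto_0 r] by (auto simp: comp_def)
    have Zr: "(\<lambda>k. Z1 (r k) \<omega>) \<longlonglongrightarrow> 0" "(\<lambda>k. Z2 (r k) \<omega>) \<longlonglongrightarrow> 0" "(\<lambda>k. Z3 (r k) \<omega>) \<longlonglongrightarrow> 0" "(\<lambda>k. Z4 (r k) \<omega>) \<longlonglongrightarrow> 0"
      using bspec[OF elim(1), of 0] bspec[OF elim(1), of 1] bspec[OF elim(1), of 2] bspec[OF elim(1), of 3] by (auto simp: Z_def)
    have "(\<lambda>k. f (X (?t (r k) (Suc (r k))) \<omega>) - f (X (?t (r k) 0) \<omega>)
       - (\<Sum>i<Suc (r k). (f1 (X (?t (r k) i) \<omega>) + 2 * X (?t (r k) i) \<omega> * f2 (X (?t (r k) i) \<omega>)) * ?h (r k))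
       - (\<Sum>i<Suc (r k). f1 (X (?t (r k) i) \<omega>) * (2 * sqrt (X (?t (r k) i) \<omega>)) * ?dW (r k) i \<omega>)) \<longlonglongrightarrow> 0"
    proof (rule ito_pathwise[where x = "\<lambda>k i. X (?t (r k) i) \<omega>" and w = "\<lambda>k i. ?dW (r k) i \<omega>" and e = "\<lambda>k i. ?e (r k) i \<omega>"
        and h = "\<lambda>k. ?h (r k)" and \<mu> = "\<lambda>k. \<mu> (r k)" and N = "\<lambda>k. Suc (r k)" and T = "b - a" and K = K and C = C])
      show "X (?t (r n) (Suc i)) \<omega> - X (?t (r n) i) \<omega> = ?h (r n) + 2 * sqrt (X (?t (r n) i) \<omega>) * ?dW (r n) i \<omega> + ?e (r n) i \<omega>"
        if "i < Suc (r n)" for n i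
      proof -
        have "X (?t (r n) (Suc i)) \<omega> = x0 + ?t (r n) (Suc i) + ?J (?t (r n) (Suc i)) \<omega>"
          "X (?t (r n) i) \<omega> = x0 + ?t (r n) i + ?J (?t (r n) i) \<omega>" using elim(2) that by auto
        then have "X (?t (r n) (Suc i)) \<omega> - X (?t (r n) i) \<omega> = (?t (r n) (Suc i) - ?t (r n) i) + ?J (?t (r n) (Suc i)) \<omega> - ?J (?t (r n) i) \<omega>"
          by linarith
        then show ?thesis unfolding time_grid_diff by simp
      qed
      show "0 \<le> X (?t (r n) i) \<omega>" if "i \<le> Suc (r n)" for n i using elim(4) t0[OF that] by auto
      show "X (?t (r n) i) \<omega> \<le> K" if "i \<le> Suc (r n)" for n i using K t_in[OF that] by auto
      show "0 \<le> ?h (r n)" "real (Suc (r n)) * ?h (r n) = b - a" for n using h[of "r n"] by (auto simp del: of_nat_Suc)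
    qed (use taylor C \<mu>r hr \<mu> Zr in \<open>auto simp: Z1_def Z2_def Z3_def Z4_def simp del: of_nat_Suc sum.lessThan_Suc\<close>)
    then show ?case by simp
  qed
  with r show thesis using that by blast
qed


lemma X_interval:
  assumes "continuous_on {0..} (\<lambda>t. X t \<omega>)" "\<forall>t\<ge>0. 0 \<le> X t \<omega>" "0 \<le> a" and g: "continuous_on {0..} g"
  shows "continuous_on {a..b} (\<lambda>u. g (X u \<omega>))"
proof (rule continuous_on_compose2[OF g])
  show "continuous_on {a..b} (\<lambda>u. X u \<omega>)" using assms(3) by (intro continuous_on_subset[OF assms(1)]) auto
  show "(\<lambda>u. X u \<omega>) ` {a..b} \<subseteq> {0..}"
  proof (rule image_subsetI)
    fix u assume "u \<in> {a..b}"
    then have "0 \<le> u" using assms(3) by simp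
    then show "X u \<omega> \<in> {0..}" using assms(2) by simp
  qed
qed

text \<open>\<open>N\<close> is the limit of the sums with integrand
  \<open>f1 x * (2 * sqrt x) - \<kappa>\<close>, that is, the martingale part of
  \<open>f (X u \<omega>)\<close> less \<open>\<kappa>\<close> times \<open>W\<close>. The discrete
  isometry, Fatou's lemma for the squared sums and dominated convergence for the integrated squares
  bound its second moment. The bound \<open>\<beta>\<close> makes all of this integrable although
  \<open>X\<close> may be unbounded.\<close>

lemma ito_L2:
  assumes ab: "0 \<le> a" "a < b"
    and taylor: "\<And>x y. 0 \<le> x \<Longrightarrow> 0 \<le> y \<Longrightarrow> \<bar>f y - f x - f1 x * (y - x) - f2 x * (y - x)\<^sup>2 / 2\<bar> \<le> C * \<bar>y - x\<bar> ^ 3"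
    and C: "\<And>x. \<bar>f1 x\<bar> \<le> C" "\<And>x. \<bar>f2 x\<bar> \<le> C"
    and m: "f1 \<in> borel_measurable borel" "f2 \<in> borel_measurable borel"
    and cont: "continuous_on {0..} f1" "continuous_on {0..} f2"
    and \<beta>: "\<And>x. \<bar>f1 x * (2 * sqrt x) - \<kappa>\<bar> \<le> \<beta>"
  shows "\<exists>N B. N \<in> borel_measurable M \<and> B \<in> borel_measurable M \<and>
    (AE \<omega> in M. N \<omega> = f (X b \<omega>) - f (X a \<omega>) - \<kappa> * (W b \<omega> - W a \<omega>) - integral {a..b} (\<lambda>u. f1 (X u \<omega>) + 2 * X u \<omega> * f2 (X u \<omega>))) \<and>
    (AE \<omega> in M. B \<omega> = integral {a..b} (\<lambda>u. (f1 (X u \<omega>) * (2 * sqrt (X u \<omega>)) - \<kappa>)\<^sup>2)) \<and>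
    (AE \<omega> in M. \<bar>B \<omega>\<bar> \<le> \<beta>\<^sup>2 * (b - a)) \<and> integrable M (\<lambda>\<omega>. (N \<omega>)\<^sup>2) \<and> expectation (\<lambda>\<omega>. (N \<omega>)\<^sup>2) \<le> expectation B"
proof -
  let ?t = "time_grid a b" and ?h = "\<lambda>n. (b - a) / real (Suc n)"
  let ?dW = "\<lambda>n i \<omega>. W (?t n (Suc i)) \<omega> - W (?t n i) \<omega>"
  define g where "g x = f1 x * (2 * sqrt x) - \<kappa>" for x
  note [measurable] = m
  have gm [measurable]: "g \<in> borel_measurable borel" unfolding g_def[abs_def] by measurable
  have gc: "continuous_on {0..} g" unfolding g_def[abs_def] by (intro continuous_intros cont)
  have gb: "\<bar>g x\<bar> \<le> \<beta>" for x using \<beta> by (simp add: g_def)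
  have \<beta>0: "0 \<le> \<beta>" using gb[of 0] by linarith
  from ito_subseq[OF ab taylor C m] obtain r :: "nat \<Rightarrow> nat" where r: "strict_mono r" and conv: "AE \<omega> in M. (\<lambda>k. f (X b \<omega>) - f (X a \<omega>)
       - (\<Sum>i<Suc (r k). (f1 (X (?t (r k) i) \<omega>) + 2 * X (?t (r k) i) \<omega> * f2 (X (?t (r k) i) \<omega>)) * ?h (r k))
       - (\<Sum>i<Suc (r k). f1 (X (?t (r k) i) \<omega>) * (2 * sqrt (X (?t (r k) i) \<omega>)) * ?dW (r k) i \<omega>)) \<longlonglongrightarrow> 0"
    by blast
  define Mk where "Mk n \<omega> = (\<Sum>i<Suc n. g (X (?t n i) \<omega>) * ?dW n i \<omega>)" for n \<omega>
  define Bk where "Bk n \<omega> = (\<Sum>i<Suc n. (g (X (?t n i) \<omega>))\<^sup>2 * ?h n)" for n \<omega>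
  define T where "T \<omega> = f (X b \<omega>) - f (X a \<omega>) - \<kappa> * (W b \<omega> - W a \<omega>) - integral {a..b} (\<lambda>u. f1 (X u \<omega>) + 2 * X u \<omega> * f2 (X u \<omega>))" for \<omega>
  have t0: "0 \<le> ?t n i" if "i \<le> Suc n" for n i
    using time_grid_bounds(1)[OF ab(2) that] ab(1) by linarith
  have chain: "strict_chain (Suc n) (?t n)" for n by (rule strict_chain_time_grid[OF ab(2)])
  have gF: "(\<lambda>\<omega>. g (X (?t n i) \<omega>)) \<in> borel_measurable (F (?t n i))" if "i < Suc n" for n i
    using measurable_compose[OF X_F gm, of "?t n i"] t0[of i n] that by simp
  have noise: "noise (?t n i) (?t n (Suc i)) (?dW n i) (?h n)" if "i < Suc n" for n i
    using noise_increment[OF t0 strict_chainD[OF chain that]] that unfolding time_grid_diff by simp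
  have a0: "0 \<le> ?t n 0" for n using ab by simp
  have L2: "integrable M (\<lambda>\<omega>. (Mk n \<omega>)\<^sup>2)" "expectation (\<lambda>\<omega>. (Mk n \<omega>)\<^sup>2) = expectation (Bk n)" for n
  proof -
    note L = noise_sum_L2[where c = "\<lambda>i \<omega>. g (X (?t n i) \<omega>)" and b = "\<lambda>_. \<beta>", OF a0 chain noise gF gb order_refl]
    show "integrable M (\<lambda>\<omega>. (Mk n \<omega>)\<^sup>2)" unfolding Mk_def by (rule L(1))
    have "integrable M (\<lambda>\<omega>. (g (X (?t n i) \<omega>))\<^sup>2)" if "i < Suc n" for i
    proof (rule integrable_const_bound[where B = "\<beta>\<^sup>2"])
      show "AE \<omega> in M. norm ((g (X (?t n i) \<omega>))\<^sup>2) \<le> \<beta>\<^sup>2"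
        using gb \<beta>0 by (auto simp: abs_le_square_iff[symmetric])
      show "(\<lambda>\<omega>. (g (X (?t n i) \<omega>))\<^sup>2) \<in> borel_measurable M"
        using borel_F[OF t0 gF[OF that]] that by simp
    qed
    then have "expectation (Bk n) = (\<Sum>i<Suc n. expectation (\<lambda>\<omega>. (g (X (?t n i) \<omega>))\<^sup>2) * ?h n)"
      unfolding Bk_def[abs_def] by (subst Bochner_Integration.integral_sum) auto
    then show "expectation (\<lambda>\<omega>. (Mk n \<omega>)\<^sup>2) = expectation (Bk n)" unfolding Mk_def using L(2) by simp
  qed
  have BkM: "Bk n \<in> borel_measurable M" for n
    unfolding Bk_def[abs_def] using borel_F[OF t0 gF] by (intro borel_measurable_sum borel_measurable_times borel_measurable_power) auto
  have MkM: "Mk n \<in> borel_measurable M" for n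
    unfolding Mk_def[abs_def] using borel_F[OF t0 gF] t0
    by (intro borel_measurable_sum borel_measurable_times borel_measurable_diff W_M) auto
  have Bk_bound: "\<bar>Bk n \<omega>\<bar> \<le> \<beta>\<^sup>2 * (b - a)" for n \<omega>
  proof -
    have "0 \<le> Bk n \<omega>" unfolding Bk_def using ab by (intro sum_nonneg) auto
    moreover have "Bk n \<omega> \<le> (\<Sum>i<Suc n. \<beta>\<^sup>2 * ?h n)"
      unfolding Bk_def using gb \<beta>0 ab by (intro sum_mono mult_right_mono) (auto simp: abs_le_square_iff[symmetric])
    moreover have "(\<Sum>i<Suc n. \<beta>\<^sup>2 * ?h n) = \<beta>\<^sup>2 * (b - a)" by (simp del: of_nat_Suc)
    ultimately show ?thesis by simp
  qed
  have subseq: "(\<lambda>k. z (r k)) \<longlonglongrightarrow> l" if "z \<longlonglongrightarrow> l" for z :: "nat \<Rightarrow> real" and l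
    using LIMSEQ_subseq_LIMSEQ[OF that r] by (simp add: comp_def)
  have Mlim: "AE \<omega> in M. (\<lambda>k. Mk (r k) \<omega>) \<longlonglongrightarrow> T \<omega>"
    using conv X_continuous nonneg
  proof eventually_elim
    case (elim \<omega>)
    have "continuous_on {a..b} (\<lambda>u. f1 (X u \<omega>) + 2 * X u \<omega> * f2 (X u \<omega>))"
      by (rule X_interval[OF elim(2,3) ab(1)]) (intro continuous_intros cont)
    from subseq[OF riemann_sum_tendsto[OF this ab(2)]]
    have R: "(\<lambda>k. \<Sum>i<Suc (r k). (f1 (X (?t (r k) i) \<omega>) + 2 * X (?t (r k) i) \<omega> * f2 (X (?t (r k) i) \<omega>)) * ?h (r k))
      \<longlonglongrightarrow> integral {a..b} (\<lambda>u. f1 (X u \<omega>) + 2 * X u \<omega> * f2 (X u \<omega>))" .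
    have tele: "(\<Sum>i<Suc n. ?dW n i \<omega>) = W b \<omega> - W a \<omega>" for n
      using sum_lessThan_telescope[of "\<lambda>i. W (?t n i) \<omega>" "Suc n"] by (simp only: time_grid_simps)
    have eq: "(\<Sum>i<Suc n. f1 (X (?t n i) \<omega>) * (2 * sqrt (X (?t n i) \<omega>)) * ?dW n i \<omega>) = Mk n \<omega> + \<kappa> * (W b \<omega> - W a \<omega>)" for n
      unfolding tele[of n, symmetric] Mk_def g_def sum_distrib_left sum.distrib[symmetric]
      by (intro sum.cong refl) (simp add: algebra_simps)
    have "(\<lambda>k. (f (X b \<omega>) - f (X a \<omega>) - \<kappa> * (W b \<omega> - W a \<omega>)
        - (\<Sum>i<Suc (r k). (f1 (X (?t (r k) i) \<omega>) + 2 * X (?t (r k) i) \<omega> * f2 (X (?t (r k) i) \<omega>)) * ?h (r k)))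
        - (f (X b \<omega>) - f (X a \<omega>)
       - (\<Sum>i<Suc (r k). (f1 (X (?t (r k) i) \<omega>) + 2 * X (?t (r k) i) \<omega> * f2 (X (?t (r k) i) \<omega>)) * ?h (r k))
       - (\<Sum>i<Suc (r k). f1 (X (?t (r k) i) \<omega>) * (2 * sqrt (X (?t (r k) i) \<omega>)) * ?dW (r k) i \<omega>))) \<longlonglongrightarrow> T \<omega> - 0"
      unfolding T_def by (intro tendsto_diff tendsto_const R elim(1))
    then show ?case unfolding eq by (simp add: algebra_simps)
  qed
  have Blim: "AE \<omega> in M. (\<lambda>k. Bk (r k) \<omega>) \<longlonglongrightarrow> integral {a..b} (\<lambda>u. (g (X u \<omega>))\<^sup>2)"
    using X_continuous nonneg
  proof eventually_elim
    case (elim \<omega>)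
    have "continuous_on {a..b} (\<lambda>u. (g (X u \<omega>))\<^sup>2)"
      by (intro continuous_on_power X_interval[OF elim ab(1) gc])
    from subseq[OF riemann_sum_tendsto[OF this ab(2)]] show ?case unfolding Bk_def .
  qed
  \<comment> \<open>Taken as limits of measurable sums, \<open>N\<close> and \<open>B\<close> are
    measurable by construction; they agree almost surely with the expressions in terms of path
    integrals.\<close>
  define N where "N \<omega> = lim (\<lambda>k. Mk (r k) \<omega>)" for \<omega>
  define B where "B \<omega> = lim (\<lambda>k. Bk (r k) \<omega>)" for \<omega>
  have NM: "N \<in> borel_measurable M" unfolding N_def[abs_def] using MkM by (rule borel_measurable_lim_metric)
  have BM: "B \<in> borel_measurable M" unfolding B_def[abs_def] using BkM by (rule borel_measurable_lim_metric)
  have Neq: "AE \<omega> in M. N \<omega> = T \<omega>" using Mlim by eventually_elim (simp add: N_def limI)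
  have Beq: "AE \<omega> in M. B \<omega> = integral {a..b} (\<lambda>u. (g (X u \<omega>))\<^sup>2)" using Blim by eventually_elim (simp add: B_def limI)
  have Blim': "AE \<omega> in M. (\<lambda>k. Bk (r k) \<omega>) \<longlonglongrightarrow> B \<omega>" using Blim Beq by eventually_elim simp
  have Bb: "AE \<omega> in M. \<bar>B \<omega>\<bar> \<le> \<beta>\<^sup>2 * (b - a)"
    using Blim' by eventually_elim (rule LIMSEQ_le_const2[OF tendsto_rabs], use Bk_bound in auto)
  have EB: "(\<lambda>k. expectation (Bk (r k))) \<longlonglongrightarrow> expectation B"
    using Blim' BM BkM Bk_bound by (intro integral_dominated_convergence[where w = "\<lambda>_. \<beta>\<^sup>2 * (b - a)"]) auto
  have "(\<integral>\<^sup>+\<omega>. ennreal ((N \<omega>)\<^sup>2) \<partial>M) = (\<integral>\<^sup>+\<omega>. liminf (\<lambda>k. ennreal ((Mk (r k) \<omega>)\<^sup>2)) \<partial>M)"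
  proof (rule nn_integral_cong_AE)
    show "AE \<omega> in M. ennreal ((N \<omega>)\<^sup>2) = liminf (\<lambda>k. ennreal ((Mk (r k) \<omega>)\<^sup>2))"
      using Mlim Neq
    proof eventually_elim
      case (elim \<omega>)
      then have "(\<lambda>k. ennreal ((Mk (r k) \<omega>)\<^sup>2)) \<longlonglongrightarrow> ennreal ((N \<omega>)\<^sup>2)" by (intro tendsto_ennrealI tendsto_power) simp
      then show ?case by (rule lim_imp_Liminf[OF sequentially_bot, symmetric])
    qed
  qed
  also have "\<dots> \<le> liminf (\<lambda>k. \<integral>\<^sup>+\<omega>. ennreal ((Mk (r k) \<omega>)\<^sup>2) \<partial>M)"
    using MkM by (intro nn_integral_liminf) auto
  also have "(\<lambda>k. \<integral>\<^sup>+\<omega>. ennreal ((Mk (r k) \<omega>)\<^sup>2) \<partial>M) = (\<lambda>k. ennreal (expectation (Bk (r k))))"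
    using L2 by (subst nn_integral_eq_integral) auto
  also have "liminf \<dots> = ennreal (expectation B)"
    by (rule lim_imp_Liminf[OF sequentially_bot tendsto_ennrealI[OF EB]])
  finally have le: "(\<integral>\<^sup>+\<omega>. ennreal ((N \<omega>)\<^sup>2) \<partial>M) \<le> ennreal (expectation B)" .
  have Nint: "integrable M (\<lambda>\<omega>. (N \<omega>)\<^sup>2)"
    using NM le by (intro integrableI_bounded) (auto simp: le_less_trans)
  have "0 \<le> expectation B"
    using LIMSEQ_le_const[OF EB] by (auto simp: L2(2)[symmetric] intro!: exI[of _ 0])
  with le Nint have "expectation (\<lambda>\<omega>. (N \<omega>)\<^sup>2) \<le> expectation B"
    by (simp add: nn_integral_eq_integral)
  with NM BM Neq Beq Bb Nint show ?thesis unfolding T_def g_def by blast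
qed

text \<open>If the integrands tend to the constant \<open>\<kappa>\<close> along the path, then the
  martingale parts approach \<open>\<kappa>\<close> times the increment of \<open>W\<close>, and
  only the drift is left. The Taylor constants \<open>C k\<close> may blow up with \<open>k\<close>;
  the bound \<open>\<beta>\<close> must not, as it dominates. The cases are
  \<open>\<kappa> = 0\<close> for the zero set and \<open>\<kappa> = 1\<close> for the square
  root.\<close>

lemma ito_vanish:
  fixes f f1 f2 :: "nat \<Rightarrow> real \<Rightarrow> real"
  assumes ab: "0 \<le> a" "a < b"
    and taylor: "\<And>k x y. 0 \<le> x \<Longrightarrow> 0 \<le> y \<Longrightarrow> \<bar>f k y - f k x - f1 k x * (y - x) - f2 k x * (y - x)\<^sup>2 / 2\<bar> \<le> C k * \<bar>y - x\<bar> ^ 3"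
    and C: "\<And>k x. \<bar>f1 k x\<bar> \<le> C k" "\<And>k x. \<bar>f2 k x\<bar> \<le> C k"
    and m: "\<And>k. f1 k \<in> borel_measurable borel" "\<And>k. f2 k \<in> borel_measurable borel"
    and cont: "\<And>k. continuous_on {0..} (f1 k)" "\<And>k. continuous_on {0..} (f2 k)"
    and \<beta>: "\<And>k x. \<bar>f1 k x * (2 * sqrt x) - \<kappa>\<bar> \<le> \<beta>"
    and small: "AE \<omega> in M. (\<lambda>k. integral {a..b} (\<lambda>u. (f1 k (X u \<omega>) * (2 * sqrt (X u \<omega>)) - \<kappa>)\<^sup>2)) \<longlonglongrightarrow> 0"
  obtains r where "strict_mono (r :: nat \<Rightarrow> nat)"
    "AE \<omega> in M. (\<lambda>k. f (r k) (X b \<omega>) - f (r k) (X a \<omega>) - \<kappa> * (W b \<omega> - W a \<omega>)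
       - integral {a..b} (\<lambda>u. f1 (r k) (X u \<omega>) + 2 * X u \<omega> * f2 (r k) (X u \<omega>))) \<longlonglongrightarrow> 0"
proof -
  let ?T = "\<lambda>k \<omega>. f k (X b \<omega>) - f k (X a \<omega>) - \<kappa> * (W b \<omega> - W a \<omega>) - integral {a..b} (\<lambda>u. f1 k (X u \<omega>) + 2 * X u \<omega> * f2 k (X u \<omega>))"
  let ?I = "\<lambda>k \<omega>. integral {a..b} (\<lambda>u. (f1 k (X u \<omega>) * (2 * sqrt (X u \<omega>)) - \<kappa>)\<^sup>2)"
  have "\<forall>k. \<exists>NB. fst NB \<in> borel_measurable M \<and> snd NB \<in> borel_measurable M \<and>
    (AE \<omega> in M. fst NB \<omega> = ?T k \<omega>) \<and> (AE \<omega> in M. snd NB \<omega> = ?I k \<omega>) \<and>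
    (AE \<omega> in M. \<bar>snd NB \<omega>\<bar> \<le> \<beta>\<^sup>2 * (b - a)) \<and> integrable M (\<lambda>\<omega>. (fst NB \<omega>)\<^sup>2) \<and> expectation (\<lambda>\<omega>. (fst NB \<omega>)\<^sup>2) \<le> expectation (snd NB)"
    using ito_L2[OF ab taylor C m cont \<beta>] by simp
  from choice[OF this] obtain NB where NB: "\<And>k. fst (NB k) \<in> borel_measurable M" "\<And>k. snd (NB k) \<in> borel_measurable M"
    "\<And>k. AE \<omega> in M. fst (NB k) \<omega> = ?T k \<omega>" "\<And>k. AE \<omega> in M. snd (NB k) \<omega> = ?I k \<omega>"
    "\<And>k. AE \<omega> in M. \<bar>snd (NB k) \<omega>\<bar> \<le> \<beta>\<^sup>2 * (b - a)" "\<And>k. integrable M (\<lambda>\<omega>. (fst (NB k) \<omega>)\<^sup>2)"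
    "\<And>k. expectation (\<lambda>\<omega>. (fst (NB k) \<omega>)\<^sup>2) \<le> expectation (snd (NB k))" by blast
  have "AE \<omega> in M. \<forall>k. snd (NB k) \<omega> = ?I k \<omega>" using NB(4) by (simp add: AE_all_countable)
  then have Bl: "AE \<omega> in M. (\<lambda>k. snd (NB k) \<omega>) \<longlonglongrightarrow> 0" using small by eventually_elim simp
  have "(\<lambda>k. expectation (snd (NB k))) \<longlonglongrightarrow> expectation (\<lambda>_. 0)"
    using Bl NB by (intro integral_dominated_convergence[where w = "\<lambda>_. \<beta>\<^sup>2 * (b - a)"]) auto
  then have "(\<lambda>k. expectation (snd (NB k))) \<longlonglongrightarrow> 0" by simp
  then have "(\<lambda>k. expectation (\<lambda>\<omega>. norm ((fst (NB k) \<omega>)\<^sup>2))) \<longlonglongrightarrow> 0"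
    by (rule Lim_null_comparison[OF always_eventually, rotated]) (use NB(7) in auto)
  from tendsto_L1_AE_subseq[OF NB(6) this] obtain r :: "nat \<Rightarrow> nat" where r: "strict_mono r"
    and rl: "AE \<omega> in M. (\<lambda>k. (fst (NB (r k)) \<omega>)\<^sup>2) \<longlonglongrightarrow> 0" by blast
  have "AE \<omega> in M. \<forall>k. fst (NB k) \<omega> = ?T k \<omega>" using NB(3) by (simp add: AE_all_countable)
  then have "AE \<omega> in M. (\<lambda>k. ?T (r k) \<omega>) \<longlonglongrightarrow> 0"
    using rl
  proof eventually_elim
    case (elim \<omega>)
    have "(\<lambda>k. sqrt ((fst (NB (r k)) \<omega>)\<^sup>2)) \<longlonglongrightarrow> sqrt 0" by (intro tendsto_real_sqrt elim(2))
    then have "(\<lambda>k. fst (NB (r k)) \<omega>) \<longlonglongrightarrow> 0" by (simp add: tendsto_rabs_zero_iff)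
    then show ?case by (simp only: elim(1)[rule_format])
  qed
  with r show thesis using that by blast
qed

end

subsection \<open>The square root is a reflected Brownian motion\<close>

text \<open>For this rational function the second-order Taylor remainder is exactly
  \<open>\<epsilon>\<^sup>2 / (a ^ 3 * b) * (b - a) ^ 3\<close>. In the application \<open>a\<close>
  and \<open>b\<close> are the two states shifted by \<open>\<epsilon>\<close>.\<close>

lemma fraction_remainder:
  fixes a b \<epsilon> :: real
  assumes "0 < \<epsilon>" "\<epsilon> \<le> a" "\<epsilon> \<le> b"
  shows "\<bar>(\<epsilon> - \<epsilon>\<^sup>2 / b) - (\<epsilon> - \<epsilon>\<^sup>2 / a) - \<epsilon>\<^sup>2 / a\<^sup>2 * (b - a) - (- 2 * \<epsilon>\<^sup>2 / a ^ 3) * (b - a)\<^sup>2 / 2\<bar> \<le> 1 / \<epsilon>\<^sup>2 * \<bar>b - a\<bar> ^ 3"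
proof -
  have ab: "0 < a" "0 < b" using assms by auto
  then have "(\<epsilon> - \<epsilon>\<^sup>2 / b) - (\<epsilon> - \<epsilon>\<^sup>2 / a) - \<epsilon>\<^sup>2 / a\<^sup>2 * (b - a) - (- 2 * \<epsilon>\<^sup>2 / a ^ 3) * (b - a)\<^sup>2 / 2
      = \<epsilon>\<^sup>2 / (a ^ 3 * b) * (b - a) ^ 3"
    by (simp add: field_simps) algebra
  then have "\<bar>(\<epsilon> - \<epsilon>\<^sup>2 / b) - (\<epsilon> - \<epsilon>\<^sup>2 / a) - \<epsilon>\<^sup>2 / a\<^sup>2 * (b - a) - (- 2 * \<epsilon>\<^sup>2 / a ^ 3) * (b - a)\<^sup>2 / 2\<bar>
      = \<epsilon>\<^sup>2 / (a ^ 3 * b) * \<bar>b - a\<bar> ^ 3"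
    using ab by (simp add: abs_mult power_abs)
  also have "\<dots> \<le> 1 / \<epsilon>\<^sup>2 * \<bar>b - a\<bar> ^ 3"
  proof (rule mult_right_mono)
    have "\<epsilon> ^ 3 * \<epsilon> \<le> a ^ 3 * b" using assms by (intro mult_mono power_mono) auto
    then have "\<epsilon>\<^sup>2 / (a ^ 3 * b) \<le> \<epsilon>\<^sup>2 / (\<epsilon> ^ 3 * \<epsilon>)" using assms by (intro divide_left_mono) auto
    also have "\<dots> = 1 / \<epsilon>\<^sup>2" using assms by (simp add: power2_eq_square power3_eq_cube)
    finally show "\<epsilon>\<^sup>2 / (a ^ 3 * b) \<le> 1 / \<epsilon>\<^sup>2" .
  qed simp
  finally show ?thesis .
qed

text \<open>Written in terms of the roots \<open>a\<close> and \<open>b\<close>, the Taylor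
  remainder of the square root is a rational expression and again contains the exact factor
  \<open>(b - a) ^ 3\<close>. The lower bound \<open>s\<close> on the roots is the square root of
  the shift.\<close>

lemma sqrt_remainder:
  fixes a b s :: real
  assumes "0 < s" "s \<le> a" "s \<le> b"
  shows "\<bar>b - a - 1 / (2 * a) * (b\<^sup>2 - a\<^sup>2) - (- 1 / (4 * a ^ 3)) * (b\<^sup>2 - a\<^sup>2)\<^sup>2 / 2\<bar> \<le> 1 / s ^ 5 * \<bar>b\<^sup>2 - a\<^sup>2\<bar> ^ 3"
proof -
  have ab: "0 < a" "0 < b" using assms by auto
  then have "b - a - 1 / (2 * a) * (b\<^sup>2 - a\<^sup>2) - (- 1 / (4 * a ^ 3)) * (b\<^sup>2 - a\<^sup>2)\<^sup>2 / 2 = (b + 3 * a) / (8 * a ^ 3) * (b - a) ^ 3"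
    by (simp add: field_simps) algebra
  then have "\<bar>b - a - 1 / (2 * a) * (b\<^sup>2 - a\<^sup>2) - (- 1 / (4 * a ^ 3)) * (b\<^sup>2 - a\<^sup>2)\<^sup>2 / 2\<bar> = (b + 3 * a) / (8 * a ^ 3) * \<bar>b - a\<bar> ^ 3"
    using ab by (simp add: abs_mult power_abs)
  also have "\<dots> \<le> (1 / s ^ 5 * (a + b) ^ 3) * \<bar>b - a\<bar> ^ 3"
  proof (rule mult_right_mono)
    have "(b + 3 * a) / (8 * a ^ 3) \<le> (8 * (a + b)) / (8 * a ^ 3)" using ab by (intro divide_right_mono) auto
    also have "\<dots> = (a + b) / a ^ 3" by (rule mult_divide_mult_cancel_left) simp
    also have "\<dots> \<le> (a + b) / s ^ 3" using assms ab by (intro divide_left_mono power_mono) auto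
    also have "\<dots> = (a + b) * s\<^sup>2 / s ^ 5"
    proof -
      have "(a + b) * s\<^sup>2 / (s ^ 3 * s\<^sup>2) = (a + b) / s ^ 3"
        using assms by (intro mult_divide_mult_cancel_right) simp
      moreover have "s ^ 3 * s\<^sup>2 = s ^ 5" by (simp flip: power_add)
      ultimately show ?thesis by simp
    qed
    also have "\<dots> \<le> (a + b) * (a + b)\<^sup>2 / s ^ 5"
      using assms ab by (intro divide_right_mono mult_left_mono power_mono) auto
    also have "\<dots> = 1 / s ^ 5 * (a + b) ^ 3" by (simp add: power2_eq_square power3_eq_cube)
    finally show "(b + 3 * a) / (8 * a ^ 3) \<le> 1 / s ^ 5 * (a + b) ^ 3" .
  qed simp
  also have "\<dots> = 1 / s ^ 5 * (\<bar>b - a\<bar> * (a + b)) ^ 3" by (simp add: power_mult_distrib)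
  also have "\<bar>b - a\<bar> * (a + b) = \<bar>b\<^sup>2 - a\<^sup>2\<bar>"
  proof -
    have "b\<^sup>2 - a\<^sup>2 = (b - a) * (a + b)" by (simp add: power2_eq_square algebra_simps)
    then show ?thesis using ab by (simp add: abs_mult)
  qed
  finally show ?thesis .
qed

context sq_bessel
begin

text \<open>Ito's formula for \<open>\<epsilon> * x / (x + \<epsilon>) = \<epsilon> - \<epsilon>\<^sup>2 / (x + \<epsilon>)\<close>, which tends to \<open>0\<close> uniformly, while its drift tends to the
  indicator function of \<open>{0}\<close>.\<close>

lemma zero_set_null:
  assumes ab: "0 \<le> a" "a < b"
  shows "AE \<omega> in M. ((\<lambda>u. if X u \<omega> = 0 then 1 else 0 :: real) has_integral 0) {a..b}"
proof -
  define \<epsilon> :: "nat \<Rightarrow> real" where "\<epsilon> k = 1 / real (Suc k)" for k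
  have \<epsilon>: "0 < \<epsilon> k" "\<epsilon> k \<le> 1" for k by (auto simp: \<epsilon>_def)
  have \<epsilon>0: "\<epsilon> \<longlonglongrightarrow> 0" unfolding \<epsilon>_def by (rule mesh_tendsto_0)
  define f where "f k x = \<epsilon> k - (\<epsilon> k)\<^sup>2 / (x + \<epsilon> k)" for k x
  \<comment> \<open>The absolute value agrees with \<open>f\<close> on the non-negative states and
    keeps the derivatives bounded and continuous on the whole line.\<close>
  define f1 where "f1 k x = (\<epsilon> k)\<^sup>2 / (\<bar>x\<bar> + \<epsilon> k)\<^sup>2" for k x
  define f2 where "f2 k x = - 2 * (\<epsilon> k)\<^sup>2 / (\<bar>x\<bar> + \<epsilon> k) ^ 3" for k x
  define C where "C k = 1 + 2 / \<epsilon> k + 1 / (\<epsilon> k)\<^sup>2" for k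
  have C0: "1 \<le> C k" "2 / \<epsilon> k \<le> C k" "1 / (\<epsilon> k)\<^sup>2 \<le> C k" for k using \<epsilon>[of k] by (auto simp: C_def)
  have f1b: "\<bar>f1 k x\<bar> \<le> 1" for k x
    using \<epsilon>[of k] unfolding f1_def by (simp add: power_mono)
  have f2b: "\<bar>f2 k x\<bar> \<le> 2 / \<epsilon> k" for k x
  proof -
    have "\<bar>f2 k x\<bar> = 2 * (\<epsilon> k)\<^sup>2 / (\<bar>x\<bar> + \<epsilon> k) ^ 3" using \<epsilon>[of k] by (simp add: f2_def abs_mult)
    also have "\<dots> \<le> 2 * (\<epsilon> k)\<^sup>2 / (\<epsilon> k) ^ 3" using \<epsilon>[of k] by (intro divide_left_mono power_mono) (auto intro!: mult_pos_pos)
    also have "\<dots> = 2 / \<epsilon> k" using \<epsilon>[of k] by (simp add: power2_eq_square power3_eq_cube)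
    finally show ?thesis .
  qed
  \<comment> \<open>The arithmetic-geometric mean inequality for \<open>sqrt ?y\<close> and
    \<open>sqrt ?e\<close>. The martingale part is thus uniformly small, the case
    \<open>\<kappa> = 0\<close> of \<open>ito_vanish\<close>.\<close>
  have g: "\<bar>f1 k x * (2 * sqrt x)\<bar> \<le> 2 * sqrt (\<epsilon> k)" for k x
  proof -
    let ?y = "\<bar>x\<bar>" and ?e = "\<epsilon> k"
    have sq: "\<bar>sqrt x\<bar> = sqrt ?y" by (auto simp: abs_if real_sqrt_minus)
    have s: "sqrt ?y * sqrt ?y = ?y" "sqrt ?e * sqrt ?e = ?e" "0 \<le> sqrt ?y" "0 < sqrt ?e" using \<epsilon>[of k] by auto
    have "?e * sqrt ?e * sqrt ?y \<le> (?y + ?e)\<^sup>2"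
    proof -
      have "2 * (sqrt ?y * sqrt ?e) \<le> ?y + ?e"
        using sum_squares_bound[of "sqrt ?y" "sqrt ?e"] s by (simp add: power2_eq_square)
      moreover have "0 \<le> sqrt ?y * sqrt ?e" using s by simp
      ultimately have "sqrt ?y * sqrt ?e \<le> ?y + ?e" by linarith
      then have "?e * (sqrt ?y * sqrt ?e) \<le> (?y + ?e) * (?y + ?e)"
        using \<open>0 \<le> sqrt ?y * sqrt ?e\<close> \<epsilon>[of k] by (intro mult_mono) auto
      then show ?thesis by (simp add: power2_eq_square mult_ac)
    qed
    then have "?e\<^sup>2 * sqrt ?y \<le> sqrt ?e * (?y + ?e)\<^sup>2"
      using mult_left_mono[of "?e * sqrt ?e * sqrt ?y" "(?y + ?e)\<^sup>2" "sqrt ?e"] s by (simp add: power2_eq_square mult_ac)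
    then have "?e\<^sup>2 / (?y + ?e)\<^sup>2 * sqrt ?y \<le> sqrt ?e"
      using \<epsilon>[of k] by (simp add: pos_divide_le_eq)
    moreover have "\<bar>f1 k x * (2 * sqrt x)\<bar> = 2 * (?e\<^sup>2 / (?y + ?e)\<^sup>2 * sqrt ?y)"
      by (simp add: f1_def abs_mult sq)
    ultimately show ?thesis by linarith
  qed
  have sqrt_le: "sqrt (\<epsilon> k) \<le> 1" for k using \<epsilon>[of k] by simp
  have cont: "continuous_on S (f1 k)" "continuous_on S (f2 k)" for S k
    unfolding f1_def[abs_def] f2_def[abs_def] using \<epsilon>[of k]
    by (auto intro!: continuous_intros simp: add_nonneg_pos less_imp_neq[OF add_nonneg_pos, symmetric])
  have m: "f1 k \<in> borel_measurable borel" "f2 k \<in> borel_measurable borel" for k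
    using cont[of UNIV k] by (auto intro: borel_measurable_continuous_onI)
  have taylor: "\<bar>f k y - f k x - f1 k x * (y - x) - f2 k x * (y - x)\<^sup>2 / 2\<bar> \<le> C k * \<bar>y - x\<bar> ^ 3" if "0 \<le> x" "0 \<le> y" for k x y
  proof -
    have "\<bar>f k y - f k x - f1 k x * (y - x) - f2 k x * (y - x)\<^sup>2 / 2\<bar> \<le> 1 / (\<epsilon> k)\<^sup>2 * \<bar>y - x\<bar> ^ 3"
      using fraction_remainder[of "\<epsilon> k" "x + \<epsilon> k" "y + \<epsilon> k"] \<epsilon>[of k] that by (simp add: f_def f1_def f2_def)
    also have "\<dots> \<le> C k * \<bar>y - x\<bar> ^ 3" using C0(3)[of k] by (intro mult_right_mono) auto
    finally show ?thesis .
  qed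
  have small: "AE \<omega> in M. (\<lambda>k. integral {a..b} (\<lambda>u. (f1 k (X u \<omega>) * (2 * sqrt (X u \<omega>)) - 0)\<^sup>2)) \<longlonglongrightarrow> 0"
    using X_continuous nonneg
  proof eventually_elim
    case (elim \<omega>)
    show ?case
    proof (rule Lim_null_comparison[OF always_eventually], rule allI)
      show "(\<lambda>k. 4 * \<epsilon> k * (b - a)) \<longlonglongrightarrow> 0" using tendsto_mult_left_zero[OF tendsto_mult_right_zero[OF \<epsilon>0]] by simp
      fix k
      show "norm (integral {a..b} (\<lambda>u. (f1 k (X u \<omega>) * (2 * sqrt (X u \<omega>)) - 0)\<^sup>2)) \<le> 4 * \<epsilon> k * (b - a)"
      proof (rule integral_bound)
        show "continuous_on {a..b} (\<lambda>u. (f1 k (X u \<omega>) * (2 * sqrt (X u \<omega>)) - 0)\<^sup>2)"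
          by (rule X_interval[OF elim ab(1)]) (intro continuous_intros cont)
        show "norm ((f1 k (X u \<omega>) * (2 * sqrt (X u \<omega>)) - 0)\<^sup>2) \<le> 4 * \<epsilon> k" for u
          using power_mono[OF g[of k "X u \<omega>"], of 2] \<epsilon>[of k] by (simp add: power_mult_distrib)
      qed (use ab in simp)
    qed
  qed
  obtain r :: "nat \<Rightarrow> nat" where r: "strict_mono r" and conv: "AE \<omega> in M. (\<lambda>k. f (r k) (X b \<omega>) - f (r k) (X a \<omega>) - 0 * (W b \<omega> - W a \<omega>)
       - integral {a..b} (\<lambda>u. f1 (r k) (X u \<omega>) + 2 * X u \<omega> * f2 (r k) (X u \<omega>))) \<longlonglongrightarrow> 0"
  proof (rule ito_vanish[of a b f f1 f2 C 0 2])
    show "\<bar>f1 k x * (2 * sqrt x) - 0\<bar> \<le> 2" for k x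
      using g[of k x] sqrt_le[of k] by linarith
    show "\<bar>f1 k x\<bar> \<le> C k" "\<bar>f2 k x\<bar> \<le> C k" for k x
      using f1b[of k x] f2b[of k x] C0[of k] by linarith+
  qed (use ab taylor m cont small in auto)
  show ?thesis
    using conv X_continuous nonneg
  proof eventually_elim
    case (elim \<omega>)
    have rlim: "(\<lambda>k. \<epsilon> (r k)) \<longlonglongrightarrow> 0" using LIMSEQ_subseq_LIMSEQ[OF \<epsilon>0 r] by (simp add: comp_def)
    have fb: "\<bar>f k x\<bar> \<le> \<epsilon> k" if "0 \<le> x" for k x
    proof -
      have "(\<epsilon> k)\<^sup>2 / (x + \<epsilon> k) \<le> (\<epsilon> k)\<^sup>2 / \<epsilon> k" using \<epsilon>[of k] that by (intro divide_left_mono) (auto intro!: mult_pos_pos)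
      also have "\<dots> = \<epsilon> k" by (simp add: power2_eq_square)
      finally have "(\<epsilon> k)\<^sup>2 / (x + \<epsilon> k) \<le> \<epsilon> k" .
      moreover have "0 \<le> (\<epsilon> k)\<^sup>2 / (x + \<epsilon> k)" using \<epsilon>[of k] that by simp
      ultimately show ?thesis unfolding f_def by simp
    qed
    have fl: "(\<lambda>k. f (r k) x) \<longlonglongrightarrow> 0" if "0 \<le> x" for x
      by (rule Lim_null_comparison[OF always_eventually rlim]) (use fb that in auto)
    let ?\<phi> = "\<lambda>k u. f1 (r k) (X u \<omega>) + 2 * X u \<omega> * f2 (r k) (X u \<omega>)"
    have Xnn: "0 \<le> X u \<omega>" if "u \<in> {a..b}" for u using elim(3) ab that by auto
    have fX: "(\<lambda>k. f (r k) (X b \<omega>)) \<longlonglongrightarrow> 0" "(\<lambda>k. f (r k) (X a \<omega>)) \<longlonglongrightarrow> 0" using fl Xnn ab by auto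
    have "(\<lambda>k. f (r k) (X b \<omega>) - f (r k) (X a \<omega>) - (f (r k) (X b \<omega>) - f (r k) (X a \<omega>) - 0 * (W b \<omega> - W a \<omega>) - integral {a..b} (?\<phi> k))) \<longlonglongrightarrow> 0 - 0 - 0"
      by (intro tendsto_diff fX elim(1))
    then have int0: "(\<lambda>k. integral {a..b} (?\<phi> k)) \<longlonglongrightarrow> 0" by simp
    \<comment> \<open>At a zero of \<open>X\<close> the drift is equal to 1, elsewhere it tends to
      0. The dominating constant 5 is 1 for \<open>f1\<close> plus 4 for the second-order
      term.\<close>
    have dc: "(\<lambda>u. if X u \<omega> = 0 then 1 else 0 :: real) integrable_on {a..b} \<and>
        (\<lambda>k. integral {a..b} (?\<phi> k)) \<longlonglongrightarrow> integral {a..b} (\<lambda>u. if X u \<omega> = 0 then 1 else 0)"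
    proof (rule conjI; rule dominated_convergence[where h = "\<lambda>_. 5"])
      show "?\<phi> k integrable_on {a..b}" for k
        by (intro integrable_continuous_real X_interval[OF elim(2,3) ab(1)] continuous_intros cont)
      then show "?\<phi> k integrable_on {a..b}" for k .
      show "(\<lambda>_. 5::real) integrable_on {a..b}" by (intro integrable_continuous_real continuous_intros)
      then show "(\<lambda>_. 5::real) integrable_on {a..b}" .
      show bound: "norm (?\<phi> k u) \<le> 5" if "u \<in> {a..b}" for k u
      proof -
        let ?x = "X u \<omega>" and ?e = "\<epsilon> (r k)"
        have x: "0 \<le> ?x" "0 < ?e" using Xnn[OF that] \<epsilon> by auto
        have "\<bar>2 * ?x * f2 (r k) ?x\<bar> = 4 * (?x / (?x + ?e)) * (?e\<^sup>2 / (?x + ?e)\<^sup>2)"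
          using x by (simp add: f2_def abs_mult power2_eq_square power3_eq_cube mult_ac)
        also have "\<dots> \<le> 4 * 1 * 1" using x by (intro mult_mono) (auto simp: power_mono)
        finally show ?thesis using f1b[of "r k" ?x] by (simp add: abs_le_iff)
      qed
      then show "norm (?\<phi> k u) \<le> 5" if "u \<in> {a..b}" for k u using that .
      show lim: "(\<lambda>k. ?\<phi> k u) \<longlonglongrightarrow> (if X u \<omega> = 0 then 1 else 0)" if "u \<in> {a..b}" for u
      proof (cases "X u \<omega> = 0")
        case True
        have "?\<phi> k u = 1" for k using \<epsilon>[of "r k"] True by (simp add: f1_def)
        then show ?thesis using True by simp
      next
        case False
        then have x: "0 < X u \<omega>" using Xnn[OF that] by simp
        have "(\<lambda>k. (\<epsilon> (r k))\<^sup>2 / (\<bar>X u \<omega>\<bar> + \<epsilon> (r k))\<^sup>2 + 2 * X u \<omega> * (- 2 * (\<epsilon> (r k))\<^sup>2 / (\<bar>X u \<omega>\<bar> + \<epsilon> (r k)) ^ 3))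
          \<longlonglongrightarrow> 0\<^sup>2 / (\<bar>X u \<omega>\<bar> + 0)\<^sup>2 + 2 * X u \<omega> * (- 2 * 0\<^sup>2 / (\<bar>X u \<omega>\<bar> + 0) ^ 3)"
          using x by (intro tendsto_intros rlim) auto
        then show ?thesis using False by (simp add: f1_def f2_def)
      qed
      then show "(\<lambda>k. ?\<phi> k u) \<longlonglongrightarrow> (if X u \<omega> = 0 then 1 else 0)" if "u \<in> {a..b}" for u using that .
    qed
    then have "integral {a..b} (\<lambda>u. if X u \<omega> = 0 then 1 else 0 :: real) = 0"
      using LIMSEQ_unique[OF int0] by auto
    with dc show ?case by (metis integrable_integral)
  qed
qed

text \<open>The drift of \<open>sqrt (x + \<epsilon>)\<close> is \<open>\<epsilon> / (2 * (x + \<epsilon>) powr (3 / 2))\<close>.\<close>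

lemma sqrt_increment:
  assumes ab: "0 \<le> a" "a < b"
  shows "AE \<omega> in M. W b \<omega> - W a \<omega> \<le> sqrt (X b \<omega>) - sqrt (X a \<omega>) \<and>
    ((\<forall>u\<in>{a..b}. X u \<omega> \<noteq> 0) \<longrightarrow> sqrt (X b \<omega>) - sqrt (X a \<omega>) = W b \<omega> - W a \<omega>)"
proof -
  define \<epsilon> :: "nat \<Rightarrow> real" where "\<epsilon> k = 1 / real (Suc k)" for k
  have \<epsilon>: "0 < \<epsilon> k" for k by (auto simp: \<epsilon>_def)
  have \<epsilon>0: "\<epsilon> \<longlonglongrightarrow> 0" unfolding \<epsilon>_def by (rule mesh_tendsto_0)
  define s where "s k = sqrt (\<epsilon> k)" for k
  have s: "0 < s k" for k using \<epsilon> by (simp add: s_def)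
  define f where "f k x = sqrt (x + \<epsilon> k)" for k x
  define f1 where "f1 k x = 1 / (2 * sqrt (\<bar>x\<bar> + \<epsilon> k))" for k x
  define f2 where "f2 k x = - 1 / (4 * sqrt (\<bar>x\<bar> + \<epsilon> k) ^ 3)" for k x
  define C where "C k = 1 / s k + 1 / s k ^ 3 + 1 / s k ^ 5" for k
  have C0: "1 / s k \<le> C k" "1 / s k ^ 3 \<le> C k" "1 / s k ^ 5 \<le> C k" for k using s[of k] by (auto simp: C_def)
  have root: "s k \<le> sqrt (\<bar>x\<bar> + \<epsilon> k)" "0 < sqrt (\<bar>x\<bar> + \<epsilon> k)" for k x
    using \<epsilon>[of k] by (auto simp: s_def add_nonneg_pos)
  have f1b: "\<bar>f1 k x\<bar> \<le> C k" for k x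
  proof -
    have "\<bar>f1 k x\<bar> = 1 / (2 * sqrt (\<bar>x\<bar> + \<epsilon> k))" using root(2)[of x k] by (simp add: f1_def)
    also have "\<dots> \<le> 1 / s k" using root(1)[of k x] root(2)[of x k] s[of k] by (intro divide_left_mono) auto
    finally show ?thesis using C0(1)[of k] by simp
  qed
  have f2b: "\<bar>f2 k x\<bar> \<le> C k" for k x
  proof -
    have p: "s k ^ 3 \<le> sqrt (\<bar>x\<bar> + \<epsilon> k) ^ 3" "0 < sqrt (\<bar>x\<bar> + \<epsilon> k) ^ 3"
      using root(1)[of k x] root(2)[of x k] s[of k] by (auto intro!: power_mono zero_less_power simp del: real_sqrt_gt_0_iff)
    have "\<bar>f2 k x\<bar> = 1 / (4 * sqrt (\<bar>x\<bar> + \<epsilon> k) ^ 3)" using p(2) by (simp add: f2_def)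
    also have "\<dots> \<le> 1 / s k ^ 3"
    proof (rule divide_left_mono)
      show "s k ^ 3 \<le> 4 * sqrt (\<bar>x\<bar> + \<epsilon> k) ^ 3" using p by linarith
      show "0 < 4 * sqrt (\<bar>x\<bar> + \<epsilon> k) ^ 3 * s k ^ 3" using p(2) s[of k] by (intro mult_pos_pos) auto
    qed simp
    finally show ?thesis using C0(2)[of k] by simp
  qed
  have g: "\<bar>f1 k x * (2 * sqrt x) - 1\<bar> \<le> 2" for k x
  proof -
    have sq: "\<bar>sqrt x\<bar> = sqrt \<bar>x\<bar>" by (auto simp: abs_if real_sqrt_minus)
    have "\<bar>sqrt x\<bar> \<le> sqrt (\<bar>x\<bar> + \<epsilon> k)" unfolding sq using \<epsilon>[of k] by simp
    then have "\<bar>f1 k x * (2 * sqrt x)\<bar> \<le> 1"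
      using root(2)[of x k] by (simp add: f1_def abs_mult divide_le_eq)
    then show ?thesis by linarith
  qed
  have nz: "\<bar>x\<bar> + \<epsilon> k \<noteq> 0" for k x using \<epsilon>[of k] abs_ge_zero[of x] by linarith
  have cont: "continuous_on S (f1 k)" "continuous_on S (f2 k)" for S k
    unfolding f1_def[abs_def] f2_def[abs_def] using nz
    by (auto intro!: continuous_intros)
  have m: "f1 k \<in> borel_measurable borel" "f2 k \<in> borel_measurable borel" for k
    using cont[of UNIV k] by (auto intro: borel_measurable_continuous_onI)
  have taylor: "\<bar>f k y - f k x - f1 k x * (y - x) - f2 k x * (y - x)\<^sup>2 / 2\<bar> \<le> C k * \<bar>y - x\<bar> ^ 3" if "0 \<le> x" "0 \<le> y" for k x y
  proof -
    have "(sqrt (y + \<epsilon> k))\<^sup>2 - (sqrt (x + \<epsilon> k))\<^sup>2 = y - x" using \<epsilon>[of k] that by simp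
    then have "\<bar>f k y - f k x - f1 k x * (y - x) - f2 k x * (y - x)\<^sup>2 / 2\<bar> \<le> 1 / s k ^ 5 * \<bar>y - x\<bar> ^ 3"
      using sqrt_remainder[of "s k" "sqrt (x + \<epsilon> k)" "sqrt (y + \<epsilon> k)"] s[of k] root(1)[of k x] root(1)[of k y] that
      by (simp add: f_def f1_def f2_def)
    also have "\<dots> \<le> C k * \<bar>y - x\<bar> ^ 3" using C0(3)[of k] by (intro mult_right_mono) auto
    finally show ?thesis .
  qed
  \<comment> \<open>Off the zeros the integrand tends to 0, but at a zero it is constantly 1. Here
    the nullity of the zero set is indispensable.\<close>
  have small: "AE \<omega> in M. (\<lambda>k. integral {a..b} (\<lambda>u. (f1 k (X u \<omega>) * (2 * sqrt (X u \<omega>)) - 1)\<^sup>2)) \<longlonglongrightarrow> 0"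
    using X_continuous nonneg zero_set_null[OF ab]
  proof eventually_elim
    case (elim \<omega>)
    let ?\<phi> = "\<lambda>k u. (f1 k (X u \<omega>) * (2 * sqrt (X u \<omega>)) - 1)\<^sup>2"
    have "(\<lambda>k. integral {a..b} (?\<phi> k)) \<longlonglongrightarrow> integral {a..b} (\<lambda>u. if X u \<omega> = 0 then 1 else 0)"
    proof (rule dominated_convergence[where h = "\<lambda>_. 4"])
      show "?\<phi> k integrable_on {a..b}" for k
        by (intro integrable_continuous_real X_interval[OF elim(1,2) ab(1)] continuous_intros cont)
      show "(\<lambda>_. 4::real) integrable_on {a..b}" by (intro integrable_continuous_real continuous_intros)
      show "norm (?\<phi> k u) \<le> 4" for k u using power_mono[OF g[of k "X u \<omega>"], of 2] by simp
      show "(\<lambda>k. ?\<phi> k u) \<longlonglongrightarrow> (if X u \<omega> = 0 then 1 else 0)" if "u \<in> {a..b}" for u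
      proof (cases "X u \<omega> = 0")
        case False
        then have x: "0 < X u \<omega>" using elim(2) ab that by (metis atLeastAtMost_iff order.trans order_le_less)
        have "(\<lambda>k. (1 / (2 * sqrt (\<bar>X u \<omega>\<bar> + \<epsilon> k)) * (2 * sqrt (X u \<omega>)) - 1)\<^sup>2) \<longlonglongrightarrow> (1 / (2 * sqrt (\<bar>X u \<omega>\<bar> + 0)) * (2 * sqrt (X u \<omega>)) - 1)\<^sup>2"
          using x by (intro tendsto_intros \<epsilon>0) auto
        then show ?thesis using False x by (simp add: f1_def)
      qed simp
    qed
    then show ?case using integral_unique[OF elim(3)] by simp
  qed
  obtain r :: "nat \<Rightarrow> nat" where r: "strict_mono r" and conv: "AE \<omega> in M. (\<lambda>k. f (r k) (X b \<omega>) - f (r k) (X a \<omega>) - 1 * (W b \<omega> - W a \<omega>)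
       - integral {a..b} (\<lambda>u. f1 (r k) (X u \<omega>) + 2 * X u \<omega> * f2 (r k) (X u \<omega>))) \<longlonglongrightarrow> 0"
    by (rule ito_vanish[of a b f f1 f2 C 1 2]) (use ab taylor m cont small f1b f2b g in auto)
  show ?thesis
    using conv X_continuous nonneg
  proof eventually_elim
    case (elim \<omega>)
    have rlim: "(\<lambda>k. \<epsilon> (r k)) \<longlonglongrightarrow> 0" using LIMSEQ_subseq_LIMSEQ[OF \<epsilon>0 r] by (simp add: comp_def)
    let ?\<phi> = "\<lambda>k u. f1 (r k) (X u \<omega>) + 2 * X u \<omega> * f2 (r k) (X u \<omega>)"
    let ?y = "sqrt (X b \<omega>) - sqrt (X a \<omega>) - (W b \<omega> - W a \<omega>)"
    have Xnn: "0 \<le> X u \<omega>" if "u \<in> {a..b}" for u using elim(3) ab that by auto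
    have fl: "(\<lambda>k. f (r k) x) \<longlonglongrightarrow> sqrt x" for x
    proof -
      have "(\<lambda>k. sqrt (x + \<epsilon> (r k))) \<longlonglongrightarrow> sqrt (x + 0)" by (intro tendsto_intros rlim)
      then show ?thesis by (simp add: f_def)
    qed
    have "(\<lambda>k. f (r k) (X b \<omega>) - f (r k) (X a \<omega>) - 1 * (W b \<omega> - W a \<omega>)
        - (f (r k) (X b \<omega>) - f (r k) (X a \<omega>) - 1 * (W b \<omega> - W a \<omega>) - integral {a..b} (?\<phi> k))) \<longlonglongrightarrow> sqrt (X b \<omega>) - sqrt (X a \<omega>) - 1 * (W b \<omega> - W a \<omega>) - 0"
      by (intro tendsto_diff tendsto_const fl elim(1))
    then have int: "(\<lambda>k. integral {a..b} (?\<phi> k)) \<longlonglongrightarrow> ?y" by simp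
    have \<phi>: "?\<phi> k u = \<epsilon> (r k) / (2 * sqrt (X u \<omega> + \<epsilon> (r k)) ^ 3)" if "u \<in> {a..b}" for k u
    proof -
      define q where "q = sqrt (X u \<omega> + \<epsilon> (r k))"
      have q: "0 < q" "q\<^sup>2 = X u \<omega> + \<epsilon> (r k)" using Xnn[OF that] \<epsilon>[of "r k"] by (auto simp: q_def)
      have "?\<phi> k u = 1 / (2 * q) + 2 * (q\<^sup>2 - \<epsilon> (r k)) * (- 1 / (4 * q ^ 3))"
        using Xnn[OF that] q by (simp add: f1_def f2_def q_def[symmetric])
      also have "\<dots> = \<epsilon> (r k) / (2 * q ^ 3)" using q(1) by (simp add: field_simps power2_eq_square power3_eq_cube)
      finally show ?thesis by (simp add: q_def)
    qed
    \<comment> \<open>The non-negative drift gives the inequality of the increments in the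
      limit.\<close>
    have "0 \<le> integral {a..b} (?\<phi> k)" for k
    proof (rule integral_nonneg)
      show "?\<phi> k integrable_on {a..b}"
        by (intro integrable_continuous_real X_interval[OF elim(2,3) ab(1)] continuous_intros cont)
      show "0 \<le> ?\<phi> k u" if "u \<in> {a..b}" for u
        unfolding \<phi>[OF that] using \<epsilon>[of "r k"] Xnn[OF that] by simp
    qed
    then have "0 \<le> ?y" by (intro LIMSEQ_le_const[OF int]) auto
    \<comment> \<open>A path without zeros on \<open>{a..b}\<close> has a positive minimum
      \<open>c\<close> there, and the drift is at most
      \<open>\<epsilon> (r k) / (2 * sqrt c ^ 3)\<close>, which tends to 0.\<close>
    moreover have "?y = 0" if nz: "\<forall>u\<in>{a..b}. X u \<omega> \<noteq> 0"
    proof -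
      have "continuous_on {a..b} (\<lambda>u. X u \<omega>)" using ab by (intro continuous_on_subset[OF elim(2)]) auto
      then obtain v where v: "v \<in> {a..b}" "\<And>u. u \<in> {a..b} \<Longrightarrow> X v \<omega> \<le> X u \<omega>"
        using continuous_attains_inf[of "{a..b}" "\<lambda>u. X u \<omega>"] ab by auto
      define c where "c = X v \<omega>"
      have c: "0 < c" using nz v(1) Xnn[OF v(1)] by (auto simp: c_def order_le_less)
      have "(\<lambda>k. integral {a..b} (?\<phi> k)) \<longlonglongrightarrow> 0"
      proof (rule Lim_null_comparison[OF always_eventually], rule allI)
        show "(\<lambda>k. \<epsilon> (r k) / (2 * sqrt c ^ 3) * (b - a)) \<longlonglongrightarrow> 0"
          using tendsto_mult_left_zero[OF tendsto_mult_left_zero[OF rlim, of "inverse (2 * sqrt c ^ 3)"], of "b - a"]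
          by (simp only: divide_inverse)
        fix k
        show "norm (integral {a..b} (?\<phi> k)) \<le> \<epsilon> (r k) / (2 * sqrt c ^ 3) * (b - a)"
        proof (rule integral_bound)
          show "continuous_on {a..b} (?\<phi> k)"
            by (intro X_interval[OF elim(2,3) ab(1)] continuous_intros cont)
          fix u assume u: "u \<in> {a..b}"
          have "sqrt c ^ 3 \<le> sqrt (X u \<omega> + \<epsilon> (r k)) ^ 3"
            using v(2)[OF u] \<epsilon>[of "r k"] c by (intro power_mono) (auto simp: c_def)
          then have "\<epsilon> (r k) / (2 * sqrt (X u \<omega> + \<epsilon> (r k)) ^ 3) \<le> \<epsilon> (r k) / (2 * sqrt c ^ 3)"
            using \<epsilon>[of "r k"] c Xnn[OF u] by (intro divide_left_mono) (auto intro!: mult_pos_pos)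
          then show "norm (?\<phi> k u) \<le> \<epsilon> (r k) / (2 * sqrt c ^ 3)"
            unfolding \<phi>[OF u] using \<epsilon>[of "r k"] Xnn[OF u] by simp
        qed (use ab in simp)
      qed
      then show ?thesis using LIMSEQ_unique[OF int] by blast
    qed
    ultimately show ?case by (auto simp: algebra_simps)
  qed
qed

end

text \<open>Increments are controlled simultaneously only for rational left ends; continuity carries
  closed conditions over to a real left end. The approach is from the right since the path has no
  zeros after its last one, while nothing of the kind holds before it. The set \<open>K\<close> is a
  half-line for the inequality and \<open>{0}\<close> for the equality.\<close>

lemma eq_right_limit:
  fixes \<phi> :: "real \<Rightarrow> real"
  assumes c: "continuous_on {0..1} \<phi>" and s: "0 \<le> s" "s < 1"
    and P: "\<And>q. q \<in> \<rat> \<Longrightarrow> s < q \<Longrightarrow> q < 1 \<Longrightarrow> \<phi> q \<in> K" and K: "closed K"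
  shows "\<phi> s \<in> K"
proof (rule ccontr)
  assume "\<phi> s \<notin> K"
  then obtain e where e: "0 < e" "ball (\<phi> s) e \<subseteq> - K"
    using K open_contains_ball[of "- K"] by (auto simp: closed_def)
  have "s \<in> {0..1}" using s by simp
  then obtain d where d: "0 < d" "\<And>x. x \<in> {0..1} \<Longrightarrow> dist x s < d \<Longrightarrow> dist (\<phi> x) (\<phi> s) < e"
    using c e(1) unfolding continuous_on_iff by blast
  obtain q where q: "q \<in> \<rat>" "s < q" "q < min (s + d) 1"
    using Rats_dense_in_real[of s "min (s + d) 1"] s d(1) by auto
  have "dist (\<phi> q) (\<phi> s) < e" using q s by (intro d(2)) (auto simp: dist_real_def)
  then have "\<phi> q \<notin> K" using e(2) by (auto simp: dist_commute)
  then show False using P[of q] q by simp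
qed

context sq_bessel
begin

text \<open>The inequality of the increments on \<open>[u, 1]\<close> bounds \<open>sqrt X\<^sub>1\<close> from below for every \<open>u\<close>; it is an equality when \<open>u\<close> is
  the last zero of \<open>X\<close>, or \<open>0\<close> if there is none.\<close>

lemma terminal_value:
  "AE \<omega> in M. \<exists>v\<in>{0..1}. (\<forall>u\<in>{0..1}. W v \<omega> \<le> W u \<omega>) \<and> X 1 \<omega> = (W 1 \<omega> + max (sqrt x0) (- W v \<omega>))\<^sup>2"
proof -
  \<comment> \<open>Every left end has its own null set, hence the restriction to rational
    ones.\<close>
  have "AE \<omega> in M. \<forall>a\<in>\<rat> \<inter> {0..<1}. W 1 \<omega> - W a \<omega> \<le> sqrt (X 1 \<omega>) - sqrt (X a \<omega>) \<and>
    ((\<forall>u\<in>{a..1}. X u \<omega> \<noteq> 0) \<longrightarrow> sqrt (X 1 \<omega>) - sqrt (X a \<omega>) = W 1 \<omega> - W a \<omega>)"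
    using sqrt_increment by (subst AE_ball_countable) (auto intro: countable_subset[OF _ countable_rat])
  then show ?thesis
    using X_continuous nonneg X_0 AE_W_0 AE_W_continuous
  proof eventually_elim
    case (elim \<omega>)
    let ?W = "\<lambda>u. W u \<omega>" and ?Y = "\<lambda>u. sqrt (X u \<omega>)"
    have cX: "continuous_on {0..1} (\<lambda>u. X u \<omega>)" by (intro continuous_on_subset[OF elim(2)]) auto
    have cW: "continuous_on {0..1} ?W" by (intro continuous_on_subset[OF elim(6)]) auto
    have cD: "continuous_on {0..1} (\<lambda>a. (?Y 1 - ?Y a) - (?W 1 - ?W a))"
      by (intro continuous_intros cX cW)
    have ge: "?W 1 - ?W a \<le> ?Y 1 - ?Y a" if a: "a \<in> {0..1}" for a
    proof (cases "a = 1")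
      case False
      have "(?Y 1 - ?Y a) - (?W 1 - ?W a) \<in> {0..}"
      proof (rule eq_right_limit[OF cD])
        show "(?Y 1 - ?Y q) - (?W 1 - ?W q) \<in> {0..}" if "q \<in> \<rat>" "a < q" "q < 1" for q
          using elim(1) that a by auto
      qed (use a False in auto)
      then show ?thesis by simp
    qed simp
    have Y0: "0 \<le> ?Y u" if "0 \<le> u" for u using elim(3) that by simp
    have lower: "?W 1 + sqrt x0 \<le> ?Y 1" "\<And>u. u \<in> {0..1} \<Longrightarrow> ?W 1 - ?W u \<le> ?Y 1"
    proof -
      show "?W 1 + sqrt x0 \<le> ?Y 1" using ge[of 0] elim(4,5) by simp
      show "?W 1 - ?W u \<le> ?Y 1" if "u \<in> {0..1}" for u
      proof -
        have "0 \<le> ?Y u" using Y0 that by auto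
        with ge[OF that] show ?thesis by linarith
      qed
    qed
    have upper: "?Y 1 = ?W 1 + sqrt x0 \<or> (\<exists>u\<in>{0..1}. ?Y 1 = ?W 1 - ?W u)"
    proof (cases "\<exists>u\<in>{0..1}. X u \<omega> = 0")
      case False
      moreover have "(\<forall>u\<in>{0..1}. X u \<omega> \<noteq> 0) \<longrightarrow> ?Y 1 - ?Y 0 = ?W 1 - ?W 0"
        using elim(1) Rats_0 by (metis Int_iff atLeastLessThan_iff order_refl zero_less_one)
      ultimately have "?Y 1 - ?Y 0 = ?W 1 - ?W 0" by blast
      then show ?thesis using elim(4,5) by simp
    next
      case True
      let ?Z = "{u\<in>{0..1}. X u \<omega> = 0}"
      have "closed ?Z" by (rule continuous_closed_preimage_constant[OF cX closed_atLeastAtMost])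
      moreover have "bounded ?Z" by (rule bounded_subset[of "{0..1}"]) auto
      ultimately have "compact ?Z" by (simp add: compact_eq_bounded_closed)
      moreover have "?Z \<noteq> {}" using True by auto
      ultimately obtain s where s: "s \<in> ?Z" "\<And>u. u \<in> ?Z \<Longrightarrow> u \<le> s"
        using compact_attains_sup[of ?Z] by blast
      show ?thesis
      \<comment> \<open>If the last zero is 1 itself, then \<open>?Y 1\<close> is 0 and
        \<open>u = 1\<close> is the required point; there are no rationals between \<open>s\<close>
        and 1 to approach it.\<close>
      proof (cases "s = 1")
        case True
        then show ?thesis using s(1) by (intro disjI2 bexI[of _ 1]) auto
      next
        case False
        then have s1: "0 \<le> s" "s < 1" using s(1) by auto
        have "(?Y 1 - ?Y s) - (?W 1 - ?W s) \<in> {0}"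
        proof (rule eq_right_limit[OF cD s1])
          fix q assume q: "q \<in> \<rat>" "s < q" "q < 1"
          have "X u \<omega> \<noteq> 0" if "u \<in> {q..1}" for u
          proof
            assume "X u \<omega> = 0"
            then have "u \<in> ?Z" using that q s1 by auto
            from s(2)[OF this] show False using that q by auto
          qed
          moreover have "q \<in> \<rat> \<inter> {0..<1}" using q s1 by auto
          ultimately have "?Y 1 - ?Y q = ?W 1 - ?W q" using elim(1) by blast
          then show "(?Y 1 - ?Y q) - (?W 1 - ?W q) \<in> {0}" by simp
        qed simp
        then show ?thesis using s(1) by (intro disjI2 bexI[of _ s]) auto
      qed
    qed
    obtain v where v: "v \<in> {0..1}" "\<And>u. u \<in> {0..1} \<Longrightarrow> ?W v \<le> ?W u"
      using continuous_attains_inf[OF _ _ cW] by auto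
    have "?Y 1 = ?W 1 + max (sqrt x0) (- ?W v)"
    proof (rule antisym)
      show "?W 1 + max (sqrt x0) (- ?W v) \<le> ?Y 1" using lower(1) lower(2)[OF v(1)] by (simp add: max_def)
      show "?Y 1 \<le> ?W 1 + max (sqrt x0) (- ?W v)"
      proof (cases "?Y 1 = ?W 1 + sqrt x0")
        case False
        then obtain u where u: "u \<in> {0..1}" "?Y 1 = ?W 1 - ?W u" using upper by blast
        then show ?thesis using v(2)[OF u(1)] by simp
      qed simp
    qed
    moreover have "X 1 \<omega> = (?Y 1)\<^sup>2" using elim(3) by simp
    ultimately have "X 1 \<omega> = (?W 1 + max (sqrt x0) (- ?W v))\<^sup>2" by (simp only:)
    then show ?case using v by (intro bexI[of _ v] conjI ballI)
  qed
qed

end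

subsection \<open>Near-minimal points of a random walk\<close>

context brownian
begin

text \<open>Markov's inequality for an even moment. Polynomial decay is all that is used, but of
  every order, so \<open>k\<close> stays free.\<close>

lemma increment_tail:
  assumes st: "0 \<le> s" "s < t" and y: "0 < y"
  shows "prob {\<omega>\<in>space M. y * sqrt (t - s) \<le> \<bar>W t \<omega> - W s \<omega>\<bar>} \<le> fact (2 * k) / (2 ^ k * fact k) / y ^ (2 * k)"
proof -
  let ?D = "\<lambda>\<omega>. W t \<omega> - W s \<omega>" and ?c = "y * sqrt (t - s)"
  have int: "integrable M (\<lambda>\<omega>. ?D \<omega> ^ (2 * k))" by (rule increment_moment(1)[OF st])
  have pos: "0 < ?c" using st y by simp
  have [measurable]: "W t \<in> borel_measurable M" "W s \<in> borel_measurable M" using st by auto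
  have "prob {\<omega>\<in>space M. ?c \<le> \<bar>?D \<omega>\<bar>} \<le> prob {\<omega>\<in>space M. ?c ^ (2 * k) \<le> ?D \<omega> ^ (2 * k)}"
  proof (rule finite_measure_mono)
    show "{\<omega>\<in>space M. ?c \<le> \<bar>?D \<omega>\<bar>} \<subseteq> {\<omega>\<in>space M. ?c ^ (2 * k) \<le> ?D \<omega> ^ (2 * k)}"
    proof safe
      fix \<omega> assume "?c \<le> \<bar>?D \<omega>\<bar>"
      then have "?c ^ (2 * k) \<le> \<bar>?D \<omega>\<bar> ^ (2 * k)" using pos by (intro power_mono) auto
      then show "?c ^ (2 * k) \<le> ?D \<omega> ^ (2 * k)" by (simp add: power_even_abs)
    qed
  qed measurable
  also have "\<dots> \<le> expectation (\<lambda>\<omega>. ?D \<omega> ^ (2 * k)) / ?c ^ (2 * k)"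
    using pos by (intro integral_Markov_inequality_measure[OF int, of "{}"]) auto
  also have "expectation (\<lambda>\<omega>. ?D \<omega> ^ (2 * k)) = fact (2 * k) / (2 ^ k * fact k) * (t - s) ^ k"
    by (rule increment_moment(3)[OF st])
  also have "?c ^ (2 * k) = y ^ (2 * k) * (t - s) ^ k"
    using st by (simp add: power_mult_distrib power_mult)
  finally show ?thesis using st by simp
qed

lemma increment_small_ball:
  assumes st: "0 \<le> s" "s < t" and y: "0 \<le> y"
  shows "prob {\<omega>\<in>space M. \<bar>W t \<omega> - W s \<omega>\<bar> \<le> y} \<le> y / sqrt (t - s)"
proof -
  let ?D = "\<lambda>\<omega>. W t \<omega> - W s \<omega>" and ?\<sigma> = "sqrt (t - s)"
  have \<sigma>: "0 < ?\<sigma>" using st by simp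
  have nd: "normal_density 0 ?\<sigma> x \<le> 1 / (2 * ?\<sigma>)" for x
  proof -
    have "normal_density 0 ?\<sigma> x \<le> 1 / sqrt (2 * pi * ?\<sigma>\<^sup>2) * 1"
      unfolding normal_density_def by (intro mult_left_mono) auto
    also have "sqrt (2 * pi * ?\<sigma>\<^sup>2) = sqrt (2 * pi) * ?\<sigma>" using \<sigma> by (simp add: real_sqrt_mult)
    also have "1 / (sqrt (2 * pi) * ?\<sigma>) * 1 \<le> 1 / (2 * ?\<sigma>)"
    proof -
      have "sqrt 4 \<le> sqrt (2 * pi)" using pi_gt3 by (intro real_sqrt_le_mono) simp
      then have "2 \<le> sqrt (2 * pi)" by simp
      then show ?thesis using \<sigma> by (simp add: divide_left_mono mult_right_mono)
    qed
    finally show ?thesis .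
  qed
  have "{\<omega>\<in>space M. \<bar>?D \<omega>\<bar> \<le> y} = ?D -` {-y..y} \<inter> space M" by (auto simp: abs_le_iff)
  then have "emeasure M {\<omega>\<in>space M. \<bar>?D \<omega>\<bar> \<le> y} = (\<integral>\<^sup>+x. ennreal (normal_density 0 ?\<sigma> x) * indicator {-y..y} x \<partial>lborel)"
    using distributed_emeasure[OF increment_distributed[OF st], of "{-y..y}"] by simp
  also have "\<dots> \<le> (\<integral>\<^sup>+x. ennreal (1 / (2 * ?\<sigma>)) * indicator {-y..y} x \<partial>lborel)"
    using nd by (intro nn_integral_mono mult_right_mono ennreal_leI) auto
  also have "\<dots> = ennreal (1 / (2 * ?\<sigma>)) * ennreal (y - (-y))"
    using y by (simp add: nn_integral_cmult_indicator)
  also have "\<dots> = ennreal (y / ?\<sigma>)" using y \<sigma> by (simp add: ennreal_mult[symmetric])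
  finally show ?thesis using y \<sigma> by (simp add: emeasure_eq_measure)
qed

lemma increment_symmetric:
  assumes st: "0 \<le> s" "s < t"
  shows "prob {\<omega>\<in>space M. x < W t \<omega> - W s \<omega>} = prob {\<omega>\<in>space M. x < - (W t \<omega> - W s \<omega>)}"
proof -
  let ?D = "\<lambda>\<omega>. W t \<omega> - W s \<omega>"
  have \<sigma>: "0 < sqrt (t - s)" using st by simp
  note D = increment_distributed[OF st]
  have D': "distributed M lborel (\<lambda>\<omega>. - ?D \<omega>) (normal_density 0 (sqrt (t - s)))"
    using normal_density_affine[OF D \<sigma>, of "-1" 0] by simp
  have "emeasure M (?D -` {x<..} \<inter> space M) = emeasure M ((\<lambda>\<omega>. - ?D \<omega>) -` {x<..} \<inter> space M)"
    by (subst distributed_emeasure[OF D], simp, subst distributed_emeasure[OF D'], simp_all)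
  moreover have "?D -` {x<..} \<inter> space M = {\<omega>\<in>space M. x < ?D \<omega>}" "(\<lambda>\<omega>. - ?D \<omega>) -` {x<..} \<inter> space M = {\<omega>\<in>space M. x < - ?D \<omega>}"
    by auto
  ultimately show ?thesis by (simp add: measure_def)
qed

lemma increment_positive_half:
  assumes st: "0 \<le> s" "s < t" and A: "A \<in> sets (F s)" and \<sigma>: "\<sigma> = 1 \<or> \<sigma> = - 1"
  shows "prob {\<omega>\<in>A. 0 < \<sigma> * (W t \<omega> - W s \<omega>)} \<le> prob A / 2"
proof -
  let ?D = "\<lambda>\<omega>. W t \<omega> - W s \<omega>"
  have [measurable]: "W t \<in> borel_measurable M" "W s \<in> borel_measurable M" using st by auto
  have AM: "A \<subseteq> space M" using sets.sets_into_space[OF sets_F[OF st(1) A]] .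
  have "prob {\<omega>\<in>space M. 0 < ?D \<omega>} + prob {\<omega>\<in>space M. 0 < - ?D \<omega>} = prob ({\<omega>\<in>space M. 0 < ?D \<omega>} \<union> {\<omega>\<in>space M. 0 < - ?D \<omega>})"
    by (subst finite_measure_Union) auto
  also have "\<dots> \<le> 1" by simp
  finally have half: "prob {\<omega>\<in>space M. 0 < \<sigma> * ?D \<omega>} \<le> 1 / 2"
    using increment_symmetric[OF st, of 0] \<sigma> by auto
  have "{\<omega>\<in>A. 0 < \<sigma> * ?D \<omega>} = A \<inter> (?D -` {z. 0 < \<sigma> * z} \<inter> space M)" using AM by auto
  moreover have C: "{z::real. 0 < \<sigma> * z} \<in> sets borel" by measurable
  ultimately have "prob {\<omega>\<in>A. 0 < \<sigma> * ?D \<omega>} = prob A * prob (?D -` {z. 0 < \<sigma> * z} \<inter> space M)"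
    using increment_indep[OF st A C] by (simp only:)
  also have "?D -` {z. 0 < \<sigma> * z} \<inter> space M = {\<omega>\<in>space M. 0 < \<sigma> * ?D \<omega>}" by auto
  also have "prob A * prob {\<omega>\<in>space M. 0 < \<sigma> * ?D \<omega>} \<le> prob A * (1 / 2)"
    by (rule mult_left_mono[OF half]) simp
  finally show ?thesis by simp
qed

text \<open>The sign \<open>\<sigma>\<close> is 1 or -1, so that each estimate covers the walk and
  its reflection.\<close>

definition walk :: "real \<Rightarrow> real \<Rightarrow> real \<Rightarrow> nat \<Rightarrow> 'a \<Rightarrow> real" where
  "walk \<sigma> a h i \<omega> = \<sigma> * (W (a + real i * h) \<omega> - W a \<omega>)"

lemma walk_F:
  assumes "0 \<le> a" "0 \<le> h" "i \<le> j"
  shows "walk \<sigma> a h i \<in> borel_measurable (F (a + real j * h))"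
proof -
  have "real i * h \<le> real j * h" "0 \<le> real i * h" using assms by (auto intro: mult_right_mono)
  then show ?thesis
    unfolding walk_def[abs_def] using assms
    by (intro borel_measurable_times borel_measurable_diff borel_measurable_const W_F) auto
qed

lemma walk_M: "0 \<le> a \<Longrightarrow> 0 \<le> h \<Longrightarrow> walk \<sigma> a h i \<in> borel_measurable M"
  by (rule borel_F[OF _ walk_F[OF _ _ order_refl]]) auto

text \<open>Levy's inequality: at the first passage, the rest of the walk is symmetric.\<close>

lemma first_passage_half:
  assumes a: "0 \<le> a" "0 < h" and A: "A \<in> sets (F a)" and \<sigma>': "\<sigma>' = 1 \<or> \<sigma>' = - 1"
  shows "prob {\<omega>\<in>A. \<exists>i\<le>n. x < walk \<sigma> a h i \<omega> \<and> (\<forall>j<i. walk \<sigma> a h j \<omega> \<le> x) \<and> 0 < \<sigma>' * (W (a + real n * h) \<omega> - W (a + real i * h) \<omega>)}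
    \<le> prob {\<omega>\<in>A. \<exists>i\<le>n. x < walk \<sigma> a h i \<omega>} / 2"
proof -
  let ?t = "\<lambda>i. a + real i * h" and ?U = "walk \<sigma> a h"
  have t0: "0 \<le> ?t i" "a \<le> ?t i" for i using a by auto
  \<comment> \<open>The first passage above \<open>x\<close> happens at step \<open>i\<close>. These
    events are disjoint and known at time \<open>?t i\<close>, hence independent of the rest of the
    walk.\<close>
  define B where "B i = {\<omega>\<in>A. x < ?U i \<omega> \<and> (\<forall>j<i. ?U j \<omega> \<le> x)}" for i
  have AM: "A \<subseteq> space M" using sets.sets_into_space[OF sets_F[OF a(1) A]] .
  have BF: "B i \<in> sets (F (?t i))" for i
  proof -
    have A': "A \<in> sets (F (?t i))" by (rule sets_F_mono[OF a(1) t0(2) A])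
    have [measurable]: "?U j \<in> borel_measurable (F (?t i))" if "j \<le> i" for j using walk_F[of a h j i \<sigma>] a that by simp
    have "{\<omega>\<in>space (F (?t i)). x < ?U i \<omega> \<and> (\<forall>j\<in>{..<i}. ?U j \<omega> \<le> x)} \<in> sets (F (?t i))"
      by measurable
    then have "A \<inter> {\<omega>\<in>space (F (?t i)). x < ?U i \<omega> \<and> (\<forall>j\<in>{..<i}. ?U j \<omega> \<le> x)} \<in> sets (F (?t i))"
      using A' by auto
    also have "A \<inter> {\<omega>\<in>space (F (?t i)). x < ?U i \<omega> \<and> (\<forall>j\<in>{..<i}. ?U j \<omega> \<le> x)} = B i"
      using AM space_F[OF t0(1)] by (auto simp: B_def)
    finally show ?thesis .
  qed
  have BM: "B i \<in> events" for i using sets_F[OF t0(1) BF] .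
  have disj: "disjoint_family_on B {..n}"
    unfolding disjoint_family_on_def
  proof (intro ballI impI)
    fix i j :: nat assume "i \<noteq> j"
    then consider "i < j" | "j < i" by linarith
    then show "B i \<inter> B j = {}" by cases (force simp: B_def)+
  qed
  let ?C = "\<lambda>i. {\<omega>\<in>B i. 0 < \<sigma>' * (W (?t n) \<omega> - W (?t i) \<omega>)}"
  have CM: "?C i \<in> events" for i
  proof -
    have [measurable]: "W (?t n) \<in> borel_measurable M" "W (?t i) \<in> borel_measurable M" using t0 by auto
    have "{\<omega>\<in>space M. 0 < \<sigma>' * (W (?t n) \<omega> - W (?t i) \<omega>)} \<in> events" by measurable
    then have "B i \<inter> {\<omega>\<in>space M. 0 < \<sigma>' * (W (?t n) \<omega> - W (?t i) \<omega>)} \<in> events" using BM by auto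
    also have "B i \<inter> {\<omega>\<in>space M. 0 < \<sigma>' * (W (?t n) \<omega> - W (?t i) \<omega>)} = ?C i"
      using sets.sets_into_space[OF BM[of i]] by auto
    finally show ?thesis .
  qed
  have half: "prob (?C i) \<le> prob (B i) / 2" if "i \<le> n" for i
  \<comment> \<open>For \<open>i = n\<close> no walk is left: the increment is 0 and the strict
    inequality excludes it.\<close>
  proof (cases "i = n")
    case False
    then have "?t i < ?t n" using that a by simp
    then show ?thesis by (rule increment_positive_half[OF t0(1) _ BF \<sigma>'])
  qed simp
  have "{\<omega>\<in>A. \<exists>i\<le>n. x < ?U i \<omega> \<and> (\<forall>j<i. ?U j \<omega> \<le> x) \<and> 0 < \<sigma>' * (W (?t n) \<omega> - W (?t i) \<omega>)} = (\<Union>i\<in>{..n}. ?C i)"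
    by (auto simp: B_def)
  also have "prob \<dots> \<le> (\<Sum>i\<in>{..n}. prob (?C i))"
    using CM by (intro finite_measure_subadditive_finite) auto
  also have "\<dots> \<le> (\<Sum>i\<in>{..n}. prob (B i) / 2)" using half by (intro sum_mono) auto
  also have "\<dots> = prob (\<Union>i\<in>{..n}. B i) / 2"
    using BM disj by (subst finite_measure_finite_Union) (auto simp: sum_divide_distrib)
  also have "(\<Union>i\<in>{..n}. B i) = {\<omega>\<in>A. \<exists>i\<le>n. x < ?U i \<omega>}"
  proof safe
    fix \<omega> i assume "\<omega> \<in> A" "i \<le> n" "x < ?U i \<omega>"
    define k where "k = (LEAST k. x < ?U k \<omega>)"
    have "x < ?U k \<omega>" "k \<le> i" unfolding k_def using \<open>x < ?U i \<omega>\<close> by (auto intro: LeastI Least_le)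
    moreover have "?U j \<omega> \<le> x" if "j < k" for j using not_less_Least[of j] that unfolding k_def by force
    ultimately show "\<omega> \<in> (\<Union>i\<in>{..n}. B i)" using \<open>\<omega> \<in> A\<close> \<open>i \<le> n\<close> by (auto simp: B_def intro!: bexI[of _ k])
  qed (auto simp: B_def)
  finally show ?thesis by simp
qed

lemma walk_event:
  assumes "0 \<le> a" "0 \<le> h" "A \<in> events"
  shows "{\<omega>\<in>A. \<exists>i\<le>n. x < walk \<sigma> a h i \<omega>} \<in> events"
proof -
  have [measurable]: "walk \<sigma> a h i \<in> borel_measurable M" for i using walk_M assms by auto
  have "{\<omega>\<in>space M. \<exists>i\<in>{..n}. x < walk \<sigma> a h i \<omega>} \<in> events" by measurable
  then have "A \<inter> {\<omega>\<in>space M. \<exists>i\<in>{..n}. x < walk \<sigma> a h i \<omega>} \<in> events" using assms by auto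
  also have "A \<inter> {\<omega>\<in>space M. \<exists>i\<in>{..n}. x < walk \<sigma> a h i \<omega>} = {\<omega>\<in>A. \<exists>i\<le>n. x < walk \<sigma> a h i \<omega>}"
    using sets.sets_into_space[OF assms(3)] by auto
  finally show ?thesis .
qed

lemma walk_first_passage:
  assumes "i \<le> n" "x < walk \<sigma> a h i \<omega>"
  obtains k where "k \<le> n" "x < walk \<sigma> a h k \<omega>" "\<forall>j<k. walk \<sigma> a h j \<omega> \<le> x"
proof -
  define k where "k = (LEAST k. x < walk \<sigma> a h k \<omega>)"
  have k: "x < walk \<sigma> a h k \<omega>" "k \<le> i" unfolding k_def using assms by (auto intro: LeastI Least_le)
  have "walk \<sigma> a h j \<omega> \<le> x" if "j < k" for j using not_less_Least[of j] that unfolding k_def by force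
  then show thesis using that[of k] k assms(1) by simp
qed

text \<open>If the level was passed but the walk does not end above it, then the increment after the
  first passage points downwards. By symmetry this takes away at most half of the passages.\<close>

lemma walk_max_prob:
  assumes a: "0 \<le> a" "0 < h" and \<sigma>: "\<sigma> = 1 \<or> \<sigma> = - 1"
  shows "prob {\<omega>\<in>space M. \<exists>i\<le>n. x < walk \<sigma> a h i \<omega>} \<le> 2 * prob {\<omega>\<in>space M. x < walk \<sigma> a h n \<omega>}"
proof -
  let ?E = "{\<omega>\<in>space M. \<exists>i\<le>n. x < walk \<sigma> a h i \<omega>}"
  let ?H = "{\<omega>\<in>space M. \<exists>i\<le>n. x < walk \<sigma> a h i \<omega> \<and> (\<forall>j<i. walk \<sigma> a h j \<omega> \<le> x) \<and> 0 < - \<sigma> * (W (a + real n * h) \<omega> - W (a + real i * h) \<omega>)}"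
  let ?P = "{\<omega>\<in>space M. x < walk \<sigma> a h n \<omega>}"
  have sp: "space M \<in> sets (F a)" using space_F[OF a(1)] sets.top[of "F a"] by simp
  have wM [measurable]: "walk \<sigma> a h i \<in> borel_measurable M" for i using walk_M a by auto
  have [measurable]: "W (a + real i * h) \<in> borel_measurable M" for i using a by auto
  have H: "?H \<in> events"
  proof -
    have "{\<omega>\<in>space M. \<exists>i\<in>{..n}. x < walk \<sigma> a h i \<omega> \<and> (\<forall>j\<in>{..<i}. walk \<sigma> a h j \<omega> \<le> x) \<and> 0 < - \<sigma> * (W (a + real n * h) \<omega> - W (a + real i * h) \<omega>)} \<in> events"
      by measurable
    then show ?thesis by (simp add: Bex_def Ball_def)
  qed
  have P: "?P \<in> events" by measurable
  have "?E \<subseteq> ?H \<union> ?P"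
  proof
    fix \<omega> assume "\<omega> \<in> ?E"
    then obtain i where "\<omega> \<in> space M" "i \<le> n" "x < walk \<sigma> a h i \<omega>" by blast
    then obtain k where k: "k \<le> n" "x < walk \<sigma> a h k \<omega>" "\<forall>j<k. walk \<sigma> a h j \<omega> \<le> x"
      using walk_first_passage by blast
    show "\<omega> \<in> ?H \<union> ?P"
    proof (cases "x < walk \<sigma> a h n \<omega>")
      case False
      then have "0 < - \<sigma> * (W (a + real n * h) \<omega> - W (a + real k * h) \<omega>)"
        using k(2) by (simp add: walk_def algebra_simps)
      then show ?thesis using k \<open>\<omega> \<in> space M\<close> by blast
    qed (use \<open>\<omega> \<in> space M\<close> in simp)
  qed
  then have "prob ?E \<le> prob ?H + prob ?P"
    using H P by (intro order_trans[OF finite_measure_mono measure_Un_le]) auto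
  also have "prob ?H \<le> prob ?E / 2"
    using first_passage_half[OF a sp, of "- \<sigma>" n x \<sigma>] \<sigma> by auto
  finally show ?thesis by simp
qed

text \<open>Levy's inequality in the other direction; \<open>z\<close> bounds the overshoot at the first passage.\<close>

lemma walk_stays_below_prob:
  assumes a: "0 \<le> a" "0 < h" and A: "A \<in> sets (F a)" and \<sigma>: "\<sigma> = 1 \<or> \<sigma> = - 1" and n: "0 < n" and x: "0 \<le> x" and z: "0 < z"
  shows "prob {\<omega>\<in>A. \<forall>i\<le>n. walk \<sigma> a h i \<omega> \<le> x}
    \<le> prob A * ((x + z * sqrt h) / sqrt (real n * h) + 2 * real n * (fact (2 * k) / (2 ^ k * fact k) / z ^ (2 * k)))"
proof -
  let ?O = "z * sqrt h" and ?t = "\<lambda>i. a + real i * h"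
  define tail :: real where "tail = fact (2 * k) / (2 ^ k * fact k) / z ^ (2 * k)"
  have t0: "0 \<le> ?t i" for i using a by auto
  have AE: "A \<in> events" by (rule sets_F[OF a(1) A])
  have AM: "A \<subseteq> space M" using sets.sets_into_space[OF AE] .
  have wM [measurable]: "walk \<sigma> a h i \<in> borel_measurable M" for i using walk_M a by auto
  have WM [measurable]: "W (?t i) \<in> borel_measurable M" for i using a by auto
  let ?E = "{\<omega>\<in>A. \<exists>i\<le>n. x < walk \<sigma> a h i \<omega>}" and ?N = "{\<omega>\<in>A. \<forall>i\<le>n. walk \<sigma> a h i \<omega> \<le> x}"
  let ?H = "{\<omega>\<in>A. \<exists>i\<le>n. x < walk \<sigma> a h i \<omega> \<and> (\<forall>j<i. walk \<sigma> a h j \<omega> \<le> x) \<and> 0 < \<sigma> * (W (?t n) \<omega> - W (?t i) \<omega>)}"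
  let ?P = "{\<omega>\<in>A. x + ?O < walk \<sigma> a h n \<omega>}"
  let ?S = "\<lambda>i. {\<omega>\<in>A. ?O \<le> \<bar>W (?t (Suc i)) \<omega> - W (?t i) \<omega>\<bar>}"
  have restrict: "{\<omega>\<in>A. Q \<omega>} \<in> events" if "{\<omega>\<in>space M. Q \<omega>} \<in> events" for Q
  proof -
    have "{\<omega>\<in>A. Q \<omega>} = A \<inter> {\<omega>\<in>space M. Q \<omega>}" using AM by auto
    then show ?thesis using that AE by auto
  qed
  have E: "?E \<in> events" using walk_event[OF a(1) less_imp_le[OF a(2)] AE] .
  have H: "?H \<in> events"
  proof (rule restrict)
    have "{\<omega>\<in>space M. \<exists>i\<in>{..n}. x < walk \<sigma> a h i \<omega> \<and> (\<forall>j\<in>{..<i}. walk \<sigma> a h j \<omega> \<le> x) \<and> 0 < \<sigma> * (W (?t n) \<omega> - W (?t i) \<omega>)} \<in> events"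
      by measurable
    then show "{\<omega>\<in>space M. \<exists>i\<le>n. x < walk \<sigma> a h i \<omega> \<and> (\<forall>j<i. walk \<sigma> a h j \<omega> \<le> x) \<and> 0 < \<sigma> * (W (?t n) \<omega> - W (?t i) \<omega>)} \<in> events"
      by (simp add: Bex_def Ball_def)
  qed
  have P: "?P \<in> events" by (rule restrict) measurable
  have S: "?S i \<in> events" for i by (rule restrict) measurable
  have step: "prob (?S i) \<le> prob A * tail" for i
  proof -
    have lt: "?t i < ?t (Suc i)" using a by simp
    have A': "A \<in> sets (F (?t i))" using a by (intro sets_F_mono[OF a(1) _ A]) auto
    have d: "?t (Suc i) - ?t i = h" by (simp add: algebra_simps)
    have "?S i = A \<inter> ((\<lambda>\<omega>. W (?t (Suc i)) \<omega> - W (?t i) \<omega>) -` {y. ?O \<le> \<bar>y\<bar>} \<inter> space M)" using AM by auto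
    moreover have C: "{y. ?O \<le> \<bar>y\<bar>} \<in> sets borel" by measurable
    ultimately have "prob (?S i) = prob A * prob ((\<lambda>\<omega>. W (?t (Suc i)) \<omega> - W (?t i) \<omega>) -` {y. ?O \<le> \<bar>y\<bar>} \<inter> space M)"
      using increment_indep[OF t0 lt A' C] by (simp only:)
    also have "(\<lambda>\<omega>. W (?t (Suc i)) \<omega> - W (?t i) \<omega>) -` {y. ?O \<le> \<bar>y\<bar>} \<inter> space M = {\<omega>\<in>space M. ?O \<le> \<bar>W (?t (Suc i)) \<omega> - W (?t i) \<omega>\<bar>}"
      by auto
    also have "prob A * prob \<dots> \<le> prob A * tail"
      using increment_tail[OF t0 lt z, of k] unfolding d tail_def by (intro mult_left_mono) auto
    finally show ?thesis .
  qed
  \<comment> \<open>Unless some step is as large as \<open>?O\<close>, the walk is at most at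
    \<open>x + ?O\<close> at its first passage. Ending above that height, it must have a positive
    increment afterwards.\<close>
  have sub: "?P \<subseteq> ?H \<union> (\<Union>i<n. ?S i)"
  proof
    fix \<omega> assume w: "\<omega> \<in> ?P"
    then have wA: "\<omega> \<in> A" and big: "x + ?O < walk \<sigma> a h n \<omega>" by auto
    have "0 < ?O" using z a by simp
    then have "x < walk \<sigma> a h n \<omega>" using big by linarith
    then obtain j where j: "j \<le> n" "x < walk \<sigma> a h j \<omega>" "\<forall>i<j. walk \<sigma> a h i \<omega> \<le> x"
      using walk_first_passage[of n n] by blast
    show "\<omega> \<in> ?H \<union> (\<Union>i<n. ?S i)"
    proof (cases "\<exists>i<n. \<omega> \<in> ?S i")
      case False
      \<comment> \<open>The walk starts at 0, which is not above \<open>x\<close>; so the first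
        passage has a predecessor from which to measure the overshoot.\<close>
      have "j \<noteq> 0"
      proof
        assume "j = 0"
        then show False using j(2) x by (simp add: walk_def)
      qed
      then obtain i where i: "j = Suc i" using not0_implies_Suc by blast
      then have "\<bar>W (?t (Suc i)) \<omega> - W (?t i) \<omega>\<bar> < ?O" using False wA j(1) by (auto simp: not_le)
      then have "\<sigma> * (W (?t (Suc i)) \<omega> - W (?t i) \<omega>) < ?O" using \<sigma> by auto
      moreover have "walk \<sigma> a h j \<omega> = walk \<sigma> a h i \<omega> + \<sigma> * (W (?t (Suc i)) \<omega> - W (?t i) \<omega>)"
        unfolding walk_def i by (simp add: algebra_simps)
      moreover have "walk \<sigma> a h i \<omega> \<le> x" using j(3) i by simp
      ultimately have "walk \<sigma> a h j \<omega> < walk \<sigma> a h n \<omega>" using big by linarith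
      then have "0 < \<sigma> * (W (?t n) \<omega> - W (?t j) \<omega>)" by (simp add: walk_def algebra_simps)
      then show ?thesis using j wA by blast
    qed blast
  qed
  have "prob ?P \<le> prob ?H + prob (\<Union>i<n. ?S i)"
  proof -
    have U: "(\<Union>i<n. ?S i) \<in> events" using S by (intro sets.finite_UN) auto
    have "prob ?P \<le> prob (?H \<union> (\<Union>i<n. ?S i))" using sub sets.Un[OF H U] by (rule finite_measure_mono)
    also have "\<dots> \<le> prob ?H + prob (\<Union>i<n. ?S i)" by (rule measure_Un_le[OF H U])
    finally show ?thesis .
  qed
  also have "prob (\<Union>i<n. ?S i) \<le> (\<Sum>i<n. prob (?S i))"
    using S by (intro finite_measure_subadditive_finite) auto
  also have "\<dots> \<le> (\<Sum>i<n. prob A * tail)" using step by (intro sum_mono) auto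
  also have "\<dots> = prob A * (real n * tail)" by simp
  also have "prob ?H \<le> prob ?E / 2" by (rule first_passage_half[OF a A \<sigma>])
  finally have "prob ?P \<le> prob ?E / 2 + prob A * (real n * tail)" by simp
  moreover have "prob A * (2 * real n * tail) = 2 * (prob A * (real n * tail))" by simp
  ultimately have E_lower: "2 * prob ?P \<le> prob ?E + prob A * (2 * real n * tail)" by linarith
  have lt: "a < ?t n" using a n by simp
  let ?D = "\<lambda>\<omega>. W (?t n) \<omega> - W a \<omega>"
  \<comment> \<open>Symmetry: twice the probability of exceeding the height on one side is the
    probability of leaving the symmetric interval. What remains is a small-ball probability.\<close>
  have P_eq: "2 * prob ?P = prob A * (1 - prob {\<omega>\<in>space M. \<bar>?D \<omega>\<bar> \<le> x + ?O})"
  proof -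
    have [measurable]: "W a \<in> borel_measurable M" using a by auto
    let ?y = "x + ?O"
    have y0: "0 \<le> ?y" using x z a by simp
    have "?P = A \<inter> (?D -` {v. ?y < \<sigma> * v} \<inter> space M)" using AM by (auto simp: walk_def)
    moreover have C: "{v. ?y < \<sigma> * v} \<in> sets borel" by measurable
    ultimately have "prob ?P = prob A * prob (?D -` {v. ?y < \<sigma> * v} \<inter> space M)"
      using increment_indep[OF a(1) lt A C] by (simp only:)
    also have "?D -` {v. ?y < \<sigma> * v} \<inter> space M = {\<omega>\<in>space M. ?y < \<sigma> * ?D \<omega>}" by auto
    also have "prob {\<omega>\<in>space M. ?y < \<sigma> * ?D \<omega>} = prob {\<omega>\<in>space M. ?y < ?D \<omega>}"
      using increment_symmetric[OF a(1) lt, of ?y] \<sigma> by auto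
    finally have *: "prob ?P = prob A * prob {\<omega>\<in>space M. ?y < ?D \<omega>}" .
    have "1 = prob (space M)" by (simp add: prob_space)
    also have "space M = ({\<omega>\<in>space M. ?y < ?D \<omega>} \<union> {\<omega>\<in>space M. ?y < - ?D \<omega>}) \<union> {\<omega>\<in>space M. \<bar>?D \<omega>\<bar> \<le> ?y}"
      by auto
    also have "prob \<dots> = prob ({\<omega>\<in>space M. ?y < ?D \<omega>} \<union> {\<omega>\<in>space M. ?y < - ?D \<omega>}) + prob {\<omega>\<in>space M. \<bar>?D \<omega>\<bar> \<le> ?y}"
      by (intro finite_measure_Union) auto
    also have "prob ({\<omega>\<in>space M. ?y < ?D \<omega>} \<union> {\<omega>\<in>space M. ?y < - ?D \<omega>}) = prob {\<omega>\<in>space M. ?y < ?D \<omega>} + prob {\<omega>\<in>space M. ?y < - ?D \<omega>}"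
      using y0 by (intro finite_measure_Union) auto
    also have "prob {\<omega>\<in>space M. ?y < - ?D \<omega>} = prob {\<omega>\<in>space M. ?y < ?D \<omega>}"
      using increment_symmetric[OF a(1) lt, of ?y] by simp
    finally have "2 * prob {\<omega>\<in>space M. ?y < ?D \<omega>} = 1 - prob {\<omega>\<in>space M. \<bar>?D \<omega>\<bar> \<le> ?y}" by simp
    then show ?thesis unfolding * by (simp add: mult.left_commute)
  qed
  have "?N = A - ?E" by (auto simp: not_less)
  then have "prob ?N = prob A - prob ?E" using E AE by (simp add: finite_measure_Diff)
  also have "\<dots> \<le> prob A - (prob A * (1 - prob {\<omega>\<in>space M. \<bar>?D \<omega>\<bar> \<le> x + ?O}) - prob A * (2 * real n * tail))"
    using E_lower P_eq by linarith
  also have "\<dots> = prob A * (prob {\<omega>\<in>space M. \<bar>?D \<omega>\<bar> \<le> x + ?O} + 2 * real n * tail)"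
    by (simp add: algebra_simps)
  also have "\<dots> \<le> prob A * ((x + ?O) / sqrt (real n * h) + 2 * real n * tail)"
    using increment_small_ball[OF a(1) lt, of "x + ?O"] x z a by (intro mult_left_mono add_right_mono) auto
  finally show ?thesis unfolding tail_def .
qed

end

lemma card_event:
  assumes I: "finite I" "\<And>i. i \<in> I \<Longrightarrow> {\<omega>\<in>space M. P i \<omega>} \<in> sets M"
  shows "{\<omega>\<in>space M. c < card {i\<in>I. P i \<omega>}} \<in> sets M"
proof -
  have "(\<lambda>\<omega>. \<Sum>i\<in>I. if P i \<omega> then 1 else 0 :: real) \<in> borel_measurable M"
    using I(2) by (intro borel_measurable_sum measurable_If) auto
  then have "{\<omega>\<in>space M. real c < (\<Sum>i\<in>I. if P i \<omega> then 1 else 0)} \<in> sets M" by measurable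
  moreover have "(\<Sum>i\<in>I. if P i \<omega> then 1 else 0) = real (card {i\<in>I. P i \<omega>})" for \<omega>
    using sum.inter_filter[OF I(1), of "\<lambda>_. 1 :: real" "\<lambda>i. P i \<omega>"] by simp
  ultimately show ?thesis by (simp only: of_nat_less_iff)
qed

context brownian
begin

text \<open>Levy's inequality on dyadic grids holds with a bound that does not depend on the grid.
  The events increase with refinement, so the bound passes to their union, and continuity extends
  the conclusion from dyadic points to all times. The factor 4 is 2 from Levy's inequality times the
  two signs.\<close>

lemma oscillation_prob:
  assumes a: "0 \<le> a" "0 < l" and y: "0 < y"
  obtains B where "B \<in> events" "prob B \<le> 4 * (fact (2 * k) / (2 ^ k * fact k) / y ^ (2 * k))"
    "\<And>\<omega>. \<omega> \<in> space M \<Longrightarrow> \<omega> \<notin> B \<Longrightarrow> continuous_on {0..} (\<lambda>t. W t \<omega>) \<Longrightarrow> \<forall>u\<in>{a..a + l}. \<bar>W u \<omega> - W a \<omega>\<bar> \<le> y * sqrt l"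
proof -
  let ?x = "y * sqrt l" and ?h = "\<lambda>j. l / 2 ^ j"
  define tail :: real where "tail = fact (2 * k) / (2 ^ k * fact k) / y ^ (2 * k)"
  have h: "0 < ?h j" for j using a by simp
  define E where "E \<sigma> j = {\<omega>\<in>space M. \<exists>i\<le>2 ^ j. ?x < walk \<sigma> a (?h j) i \<omega>}" for \<sigma> j
  have EM: "E \<sigma> j \<in> events" for \<sigma> j
    unfolding E_def using h[of j] by (intro walk_event a sets.top) (auto simp: less_imp_le)
  have lt: "a < a + l" using a by simp
  have E_prob: "prob (E \<sigma> j) \<le> 2 * tail" if \<sigma>: "\<sigma> = 1 \<or> \<sigma> = - 1" for \<sigma> j
  proof -
    have "prob (E \<sigma> j) \<le> 2 * prob {\<omega>\<in>space M. ?x < walk \<sigma> a (?h j) (2 ^ j) \<omega>}"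
      unfolding E_def by (rule walk_max_prob[OF a(1) h \<sigma>])
    also have "prob {\<omega>\<in>space M. ?x < walk \<sigma> a (?h j) (2 ^ j) \<omega>} \<le> prob {\<omega>\<in>space M. y * sqrt (a + l - a) \<le> \<bar>W (a + l) \<omega> - W a \<omega>\<bar>}"
    proof (rule finite_measure_mono)
      show "{\<omega>\<in>space M. ?x < walk \<sigma> a (?h j) (2 ^ j) \<omega>} \<subseteq> {\<omega>\<in>space M. y * sqrt (a + l - a) \<le> \<bar>W (a + l) \<omega> - W a \<omega>\<bar>}"
        using \<sigma> by (auto simp: walk_def)
      have [measurable]: "W (a + l) \<in> borel_measurable M" "W a \<in> borel_measurable M" using a by auto
      show "{\<omega>\<in>space M. y * sqrt (a + l - a) \<le> \<bar>W (a + l) \<omega> - W a \<omega>\<bar>} \<in> events" by measurable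
    qed
    also have "\<dots> \<le> tail" unfolding tail_def by (rule increment_tail[OF a(1) lt y])
    finally show ?thesis by simp
  qed
  have E_mono: "E \<sigma> j \<subseteq> E \<sigma> (Suc j)" for \<sigma> j
  proof
    fix \<omega> assume "\<omega> \<in> E \<sigma> j"
    then obtain i where i: "\<omega> \<in> space M" "i \<le> 2 ^ j" "?x < walk \<sigma> a (?h j) i \<omega>" by (auto simp: E_def)
    have "walk \<sigma> a (?h (Suc j)) (2 * i) \<omega> = walk \<sigma> a (?h j) i \<omega>" by (simp add: walk_def)
    then show "\<omega> \<in> E \<sigma> (Suc j)" using i by (auto simp: E_def intro!: exI[of _ "2 * i"])
  qed
  have U: "prob (\<Union>j. E \<sigma> j) \<le> 2 * tail" if \<sigma>: "\<sigma> = 1 \<or> \<sigma> = - 1" for \<sigma>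
  proof (rule LIMSEQ_le_const2)
    show "(\<lambda>j. prob (E \<sigma> j)) \<longlonglongrightarrow> prob (\<Union>j. E \<sigma> j)"
      using EM E_mono by (intro finite_Lim_measure_incseq) (auto simp: incseq_Suc_iff)
  qed (use E_prob[OF \<sigma>] in auto)
  let ?B = "(\<Union>j. E 1 j) \<union> (\<Union>j. E (- 1) j)"
  have "prob ?B \<le> prob (\<Union>j. E 1 j) + prob (\<Union>j. E (- 1) j)"
    using EM by (intro measure_Un_le) auto
  also have "\<dots> \<le> 4 * tail" using U[of 1] U[of "- 1"] by simp
  finally have B_prob: "prob ?B \<le> 4 * tail" .
  have "\<forall>u\<in>{a..a + l}. \<bar>W u \<omega> - W a \<omega>\<bar> \<le> ?x"
    if \<omega>: "\<omega> \<in> space M" "\<omega> \<notin> ?B" and c: "continuous_on {0..} (\<lambda>t. W t \<omega>)" for \<omega>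
  proof
    fix u assume u: "u \<in> {a..a + l}"
    have dy: "\<bar>W (a + real i * ?h j) \<omega> - W a \<omega>\<bar> \<le> ?x" if "i \<le> 2 ^ j" for i j
    proof -
      have "\<omega> \<notin> E 1 j" "\<omega> \<notin> E (- 1) j" using \<omega>(2) by auto
      then have "walk 1 a (?h j) i \<omega> \<le> ?x" "walk (- 1) a (?h j) i \<omega> \<le> ?x" using \<omega>(1) that unfolding E_def by (auto simp: not_less)
      then show ?thesis by (simp add: walk_def abs_le_iff)
    qed
    \<comment> \<open>The last point of the grid of level \<open>j\<close> that is not later than
      \<open>u\<close>.\<close>
    define q where "q j = a + real (nat \<lfloor>(u - a) / ?h j\<rfloor>) * ?h j" for j
    have fl: "real (nat \<lfloor>(u - a) / ?h j\<rfloor>) \<le> (u - a) / ?h j" "(u - a) / ?h j < real (nat \<lfloor>(u - a) / ?h j\<rfloor>) + 1" for j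
    proof -
      have "0 \<le> (u - a) / ?h j" using u h[of j] by simp
      then show "real (nat \<lfloor>(u - a) / ?h j\<rfloor>) \<le> (u - a) / ?h j" "(u - a) / ?h j < real (nat \<lfloor>(u - a) / ?h j\<rfloor>) + 1"
        by linarith+
    qed
    have le: "real (nat \<lfloor>(u - a) / ?h j\<rfloor>) * ?h j \<le> u - a" "u - a < (real (nat \<lfloor>(u - a) / ?h j\<rfloor>) + 1) * ?h j" for j
      using fl[of j] h[of j] by (simp_all only: pos_le_divide_eq pos_divide_less_eq)
    have i_le: "nat \<lfloor>(u - a) / ?h j\<rfloor> \<le> 2 ^ j" for j
    proof -
      have "(u - a) / ?h j \<le> l / ?h j" using u h[of j] by (intro divide_right_mono) auto
      also have "\<dots> = 2 ^ j" using a by simp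
      finally have "real (nat \<lfloor>(u - a) / ?h j\<rfloor>) \<le> 2 ^ j" using fl(1)[of j] by linarith
      then have "real (nat \<lfloor>(u - a) / ?h j\<rfloor>) \<le> real (2 ^ j)" by (simp only: of_nat_power of_nat_numeral)
      then show ?thesis by (simp only: of_nat_le_iff)
    qed
    have hl: "?h \<longlonglongrightarrow> 0"
      using LIMSEQ_divide_realpow_zero[of 2 l] by simp
    have qu: "q \<longlonglongrightarrow> u"
    proof (rule LIM_zero_cancel, rule Lim_null_comparison[OF always_eventually hl], rule allI)
      show "norm (q j - u) \<le> ?h j" for j using le[of j] h[of j] unfolding q_def distrib_right mult_1 real_norm_def by linarith
    qed
    have qa: "q j \<in> {a..a + l}" for j
    proof -
      have "0 \<le> real (nat \<lfloor>(u - a) / ?h j\<rfloor>) * ?h j"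
        using h[of j] by (intro mult_nonneg_nonneg of_nat_0_le_iff less_imp_le)
      then show ?thesis using le(1)[of j] u unfolding q_def atLeastAtMost_iff by linarith
    qed
    have "continuous_on {a..a + l} (\<lambda>t. W t \<omega>)" using a by (intro continuous_on_subset[OF c]) auto
    then have "(\<lambda>j. W (q j) \<omega>) \<longlonglongrightarrow> W u \<omega>"
      by (rule continuous_on_tendsto_compose[OF _ qu u always_eventually]) (use qa in blast)
    then have "(\<lambda>j. \<bar>W (q j) \<omega> - W a \<omega>\<bar>) \<longlonglongrightarrow> \<bar>W u \<omega> - W a \<omega>\<bar>" by (intro tendsto_intros)
    then show "\<bar>W u \<omega> - W a \<omega>\<bar> \<le> ?x"
      by (rule LIMSEQ_le_const2) (use dy[OF i_le] in \<open>auto simp: q_def\<close>)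
  qed
  with EM B_prob show thesis by (intro that[of ?B]) (auto simp: tail_def)
qed

text \<open>Each visit below the level \<open>y\<close> is followed, within \<open>R\<close> steps, by a drop below \<open>y - 2 * \<epsilon>\<close> except with
  probability \<open>\<rho>\<close>, and visits more than \<open>R\<close> steps apart give independent chances.\<close>

lemma visits_prob:
  assumes h: "0 < h" and \<rho>: "0 \<le> \<rho>"
    and stay: "\<And>i A. A \<in> sets (F (real i * h)) \<Longrightarrow>
      prob {\<omega>\<in>A. \<forall>k\<le>R. - 2 * \<epsilon> \<le> W (real (i + k) * h) \<omega> - W (real i * h) \<omega>} \<le> \<rho> * prob A"
    and A: "A \<in> sets (F (real k * h))" and y: "y \<in> borel_measurable (F (real k * h))"
  shows "prob {\<omega>\<in>A. (\<forall>i\<in>{k..n}. y \<omega> - 2 * \<epsilon> \<le> W (real i * h) \<omega>) \<and>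
      m * R < card {i. k \<le> i \<and> i + R \<le> n \<and> W (real i * h) \<omega> \<le> y \<omega>}} \<le> \<rho> ^ m * prob A"
  using A y
proof (induction m arbitrary: k A y)
  case 0
  have "{\<omega>\<in>A. (\<forall>i\<in>{k..n}. y \<omega> - 2 * \<epsilon> \<le> W (real i * h) \<omega>) \<and>
      0 * R < card {i. k \<le> i \<and> i + R \<le> n \<and> W (real i * h) \<omega> \<le> y \<omega>}} \<subseteq> A" by auto
  then show ?case using 0(1) sets_F[of "real k * h" A] h by (simp add: finite_measure_mono)
next
  case (Suc m)
  have t0: "0 \<le> real i * h" for i using h by simp
  have tm: "real i * h \<le> real j * h" if "i \<le> j" for i j using h that by simp
  let ?S = "\<lambda>i \<omega>. W (real i * h) \<omega>"
  have AM: "A \<subseteq> space M" using sets.sets_into_space[OF sets_F[OF t0 Suc.prems(1)]] .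
  have SF: "?S i \<in> borel_measurable (F (real j * h))" if "i \<le> j" for i j
    using W_F[OF t0 tm[OF that]] .
  have yF: "y \<in> borel_measurable (F (real j * h))" if "k \<le> j" for j
    using borel_F_mono[OF t0 tm[OF that] Suc.prems(2)] .
  have restrict: "{\<omega>\<in>C. Q \<omega>} \<in> sets (F (real j * h))"
    if "C \<in> sets (F (real j * h))" "{\<omega>\<in>space (F (real j * h)). Q \<omega>} \<in> sets (F (real j * h))" for C Q j
  proof -
    have "{\<omega>\<in>C. Q \<omega>} = C \<inter> {\<omega>\<in>space (F (real j * h)). Q \<omega>}"
      using sets.sets_into_space[OF that(1)] by auto
    then show ?thesis using that by auto
  qed
  \<comment> \<open>The first visit below \<open>y\<close> from index \<open>k\<close> on takes
    place at \<open>j\<close>. These events are disjoint, so their probabilities add up to at most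
    that of \<open>A\<close>.\<close>
  define D where "D j = {\<omega>\<in>A. ?S j \<omega> \<le> y \<omega> \<and> (\<forall>i\<in>{k..<j}. y \<omega> < ?S i \<omega>)}" for j
  have DF: "D j \<in> sets (F (real j * h))" if kj: "k \<le> j" for j
    unfolding D_def
  proof (rule restrict)
    show "A \<in> sets (F (real j * h))" by (rule sets_F_mono[OF t0 tm[OF kj] Suc.prems(1)])
    have [measurable]: "?S i \<in> borel_measurable (F (real j * h))" if "i \<le> j" for i using SF that .
    have [measurable]: "y \<in> borel_measurable (F (real j * h))" using yF kj .
    show "{\<omega>\<in>space (F (real j * h)). ?S j \<omega> \<le> y \<omega> \<and> (\<forall>i\<in>{k..<j}. y \<omega> < ?S i \<omega>)} \<in> sets (F (real j * h))"
      by measurable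
  qed
  \<comment> \<open>After that visit the path does not drop by more than
    \<open>2 * \<epsilon>\<close> within \<open>R\<close> steps. This is known at time
    \<open>j + R\<close>, where the induction hypothesis starts afresh with \<open>G j\<close> in
    the place of \<open>A\<close>.\<close>
  define G where "G j = {\<omega>\<in>D j. \<forall>l\<le>R. - 2 * \<epsilon> \<le> ?S (j + l) \<omega> - ?S j \<omega>}" for j
  have GF: "G j \<in> sets (F (real (j + R) * h))" if kj: "k \<le> j" for j
    unfolding G_def
  proof (rule restrict)
    show "D j \<in> sets (F (real (j + R) * h))" by (rule sets_F_mono[OF t0 tm DF[OF kj]]) simp
    have [measurable]: "?S i \<in> borel_measurable (F (real (j + R) * h))" if "i \<le> j + R" for i using SF that .
    have "{\<omega>\<in>space (F (real (j + R) * h)). \<forall>l\<in>{..R}. - 2 * \<epsilon> \<le> ?S (j + l) \<omega> - ?S j \<omega>} \<in> sets (F (real (j + R) * h))"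
      by measurable
    then show "{\<omega>\<in>space (F (real (j + R) * h)). \<forall>l\<le>R. - 2 * \<epsilon> \<le> ?S (j + l) \<omega> - ?S j \<omega>} \<in> sets (F (real (j + R) * h))"
      by (simp only: Ball_def atMost_iff)
  qed
  let ?T = "\<lambda>m k A. {\<omega>\<in>A. (\<forall>i\<in>{k..n}. y \<omega> - 2 * \<epsilon> \<le> ?S i \<omega>) \<and> m * R < card {i. k \<le> i \<and> i + R \<le> n \<and> ?S i \<omega> \<le> y \<omega>}}"
  have TM: "?T m j C \<in> events" if "C \<in> events" for m j C
  proof -
    have SM: "?S i \<in> borel_measurable M" for i using W_M[OF t0] .
    have yM: "y \<in> borel_measurable M" using borel_F[OF t0 Suc.prems(2)] .
    have 1: "{\<omega>\<in>space M. \<forall>i\<in>{j..n}. y \<omega> - 2 * \<epsilon> \<le> ?S i \<omega>} \<in> events" using SM yM by measurable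
    have "{i. j \<le> i \<and> i + R \<le> n \<and> ?S i \<omega> \<le> y \<omega>} = {i\<in>{i\<in>{..n}. j \<le> i \<and> i + R \<le> n}. ?S i \<omega> \<le> y \<omega>}" for \<omega> by auto
    moreover have "{\<omega>\<in>space M. ?S i \<omega> \<le> y \<omega>} \<in> events" for i using SM[of i] yM by measurable
    then have "{\<omega>\<in>space M. m * R < card {i\<in>{i\<in>{..n}. j \<le> i \<and> i + R \<le> n}. ?S i \<omega> \<le> y \<omega>}} \<in> events"
      by (intro card_event) auto
    ultimately have 2: "{\<omega>\<in>space M. m * R < card {i. j \<le> i \<and> i + R \<le> n \<and> ?S i \<omega> \<le> y \<omega>}} \<in> events" by (simp only:)
    have "?T m j C = C \<inter> {\<omega>\<in>space M. \<forall>i\<in>{j..n}. y \<omega> - 2 * \<epsilon> \<le> ?S i \<omega>} \<inter> {\<omega>\<in>space M. m * R < card {i. j \<le> i \<and> i + R \<le> n \<and> ?S i \<omega> \<le> y \<omega>}}"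
      using sets.sets_into_space[OF that] by auto
    then show ?thesis using sets.Int[OF sets.Int[OF that 1] 2] by (simp only:)
  qed
  have sub: "?T (Suc m) k A \<subseteq> (\<Union>j\<in>{k..n}. ?T m (j + R) (G j))"
  proof
    fix \<omega> assume "\<omega> \<in> ?T (Suc m) k A"
    then have \<omega>: "\<omega> \<in> A" "\<forall>i\<in>{k..n}. y \<omega> - 2 * \<epsilon> \<le> ?S i \<omega>" and c: "Suc m * R < card {i. k \<le> i \<and> i + R \<le> n \<and> ?S i \<omega> \<le> y \<omega>}"
      unfolding mem_Collect_eq by blast+
    let ?Z = "{i. k \<le> i \<and> i + R \<le> n \<and> ?S i \<omega> \<le> y \<omega>}"
    have fin: "finite ?Z" by (rule finite_subset[of _ "{..n}"]) auto
    have "?Z \<noteq> {}" using c by (metis card.empty not_less_zero)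
    define j where "j = Min ?Z"
    have j: "j \<in> ?Z" unfolding j_def by (rule Min_in[OF fin \<open>?Z \<noteq> {}\<close>])
    have j_min: "j \<le> i" if "i \<in> ?Z" for i unfolding j_def by (rule Min_le[OF fin that])
    let ?Z' = "{i. j + R \<le> i \<and> i + R \<le> n \<and> ?S i \<omega> \<le> y \<omega>}"
    \<comment> \<open>Restarting at \<open>j + R\<close> loses at most \<open>R\<close> visits,
      which lowers \<open>Suc m * R\<close> to \<open>m * R\<close>.\<close>
    have "?Z \<subseteq> {j..<j + R} \<union> ?Z'"
    proof
      fix i assume i: "i \<in> ?Z"
      from j_min[OF this] show "i \<in> {j..<j + R} \<union> ?Z'" using i by (cases "j + R \<le> i") auto
    qed
    then have "card ?Z \<le> card ({j..<j + R} \<union> ?Z')" by (intro card_mono finite_UnI finite_subset[of ?Z' "{..n}"]) auto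
    also have "\<dots> \<le> R + card ?Z'" using card_Un_le[of "{j..<j + R}" ?Z'] by simp
    finally have c': "m * R < card ?Z'" using c by simp
    have "\<omega> \<in> D j" unfolding D_def
    proof (intro CollectI conjI ballI \<omega>(1))
      show "?S j \<omega> \<le> y \<omega>" using j by simp
      fix i assume i: "i \<in> {k..<j}"
      show "y \<omega> < ?S i \<omega>"
      proof (rule ccontr)
        assume "\<not> y \<omega> < ?S i \<omega>"
        then have "i \<in> ?Z" using i j by auto
        from j_min[OF this] show False using i by auto
      qed
    qed
    then have "\<omega> \<in> G j" unfolding G_def
    proof (intro CollectI conjI allI impI)
      fix l assume "l \<le> R"
      then have "y \<omega> - 2 * \<epsilon> \<le> ?S (j + l) \<omega>" using j by (intro bspec[OF \<omega>(2)]) auto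
      moreover have "?S j \<omega> \<le> y \<omega>" using j by simp
      ultimately show "- 2 * \<epsilon> \<le> ?S (j + l) \<omega> - ?S j \<omega>" by linarith
    qed
    moreover have "\<forall>i\<in>{j + R..n}. y \<omega> - 2 * \<epsilon> \<le> ?S i \<omega>" using \<omega>(2) j by auto
    ultimately have "\<omega> \<in> ?T m (j + R) (G j)" using c' by blast
    moreover have "j \<in> {k..n}" using j by auto
    ultimately show "\<omega> \<in> (\<Union>j\<in>{k..n}. ?T m (j + R) (G j))" by blast
  qed
  have DM: "D j \<in> events" if "k \<le> j" for j using sets_F[OF t0 DF[OF that]] .
  have GM: "G j \<in> events" if "k \<le> j" for j using sets_F[OF t0 GF[OF that]] .
  have each: "prob (?T m (j + R) (G j)) \<le> \<rho> ^ Suc m * prob (D j)" if "j \<in> {k..n}" for j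
  proof -
    have kj: "k \<le> j" using that by simp
    have "prob (?T m (j + R) (G j)) \<le> \<rho> ^ m * prob (G j)"
      using kj by (intro Suc.IH GF yF) auto
    also have "prob (G j) \<le> \<rho> * prob (D j)" unfolding G_def by (rule stay[OF DF[OF kj]])
    finally show ?thesis using \<rho> by (simp add: mult_left_mono mult.assoc mult.left_commute)
  qed
  have disj: "disjoint_family_on D {k..n}"
    unfolding disjoint_family_on_def
  proof (intro ballI impI)
    fix i j assume ij: "i \<in> {k..n}" "j \<in> {k..n}" "i \<noteq> j"
    then consider "i < j" | "j < i" by linarith
    then show "D i \<inter> D j = {}" by cases (use ij in \<open>force simp: D_def\<close>)+
  qed
  have "prob (?T (Suc m) k A) \<le> prob (\<Union>j\<in>{k..n}. ?T m (j + R) (G j))"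
    using TM GM by (intro finite_measure_mono[OF sub] sets.finite_UN) auto
  also have "\<dots> \<le> (\<Sum>j\<in>{k..n}. prob (?T m (j + R) (G j)))"
    using TM GM by (intro finite_measure_subadditive_finite) auto
  also have "\<dots> \<le> (\<Sum>j\<in>{k..n}. \<rho> ^ Suc m * prob (D j))" using each by (rule sum_mono)
  also have "\<dots> = \<rho> ^ Suc m * prob (\<Union>j\<in>{k..n}. D j)"
    using DM disj by (subst finite_measure_finite_Union) (auto simp: sum_distrib_left)
  also have "\<dots> \<le> \<rho> ^ Suc m * prob A"
  proof (rule mult_left_mono)
    show "prob (\<Union>j\<in>{k..n}. D j) \<le> prob A"
      using sets_F[OF t0 Suc.prems(1)] by (intro finite_measure_mono) (auto simp: D_def)
  qed (use \<rho> in simp)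
  finally show ?case .
qed

text \<open>Let \<open>k\<close> be the first nearly minimal index. Then every nearly minimal value
  is at most \<open>?S k \<omega> + \<epsilon>\<close>, and no value is below
  \<open>?S k \<omega> - \<epsilon>\<close>. So \<open>visits_prob\<close> applies from
  \<open>k\<close> on with the level \<open>?S k \<omega> + \<epsilon>\<close>, which is known at
  time \<open>k\<close>. The index itself is random, and the union over its possible values costs
  the factor \<open>Suc n\<close>.\<close>

lemma near_minimum_count_prob:
  assumes h: "0 < h" and \<rho>: "0 \<le> \<rho>" and \<epsilon>: "0 \<le> \<epsilon>"
    and stay: "\<And>i A. A \<in> sets (F (real i * h)) \<Longrightarrow>
      prob {\<omega>\<in>A. \<forall>k\<le>R. - 2 * \<epsilon> \<le> W (real (i + k) * h) \<omega> - W (real i * h) \<omega>} \<le> \<rho> * prob A"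
  obtains B where "B \<in> events" "prob B \<le> real (Suc n) * \<rho> ^ m"
    "\<And>\<omega>. \<omega> \<in> space M \<Longrightarrow> \<omega> \<notin> B \<Longrightarrow> card {i\<in>{..n}. \<forall>j\<in>{..n}. W (real i * h) \<omega> \<le> W (real j * h) \<omega> + \<epsilon>} \<le> Suc m * R"
proof -
  let ?S = "\<lambda>i \<omega>. W (real i * h) \<omega>"
  have t0: "0 \<le> real i * h" for i using h by simp
  let ?Z = "\<lambda>\<omega>. {i\<in>{..n}. \<forall>j\<in>{..n}. ?S i \<omega> \<le> ?S j \<omega> + \<epsilon>}"
  let ?T = "\<lambda>k. {\<omega>\<in>space M. (\<forall>i\<in>{k..n}. (?S k \<omega> + \<epsilon>) - 2 * \<epsilon> \<le> ?S i \<omega>) \<and>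
      m * R < card {i. k \<le> i \<and> i + R \<le> n \<and> ?S i \<omega> \<le> ?S k \<omega> + \<epsilon>}}"
  have T_prob: "prob (?T k) \<le> \<rho> ^ m" for k
  proof -
    have "prob (?T k) \<le> \<rho> ^ m * prob (space M)"
    proof (rule visits_prob[OF h \<rho> stay])
      show "space M \<in> sets (F (real k * h))" using space_F[OF t0] sets.top[of "F (real k * h)"] by metis
      show "(\<lambda>\<omega>. ?S k \<omega> + \<epsilon>) \<in> borel_measurable (F (real k * h))"
        using W_F[OF t0 order_refl] by (intro borel_measurable_add borel_measurable_const)
    qed
    then show ?thesis by (simp add: prob_space)
  qed
  have SM: "?S i \<in> borel_measurable M" for i using W_M[OF t0] .
  have TM: "?T k \<in> events" for k
  proof -
    have 1: "{\<omega>\<in>space M. \<forall>i\<in>{k..n}. (?S k \<omega> + \<epsilon>) - 2 * \<epsilon> \<le> ?S i \<omega>} \<in> events" using SM by measurable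
    have "{i. k \<le> i \<and> i + R \<le> n \<and> ?S i \<omega> \<le> ?S k \<omega> + \<epsilon>} = {i\<in>{i\<in>{..n}. k \<le> i \<and> i + R \<le> n}. ?S i \<omega> \<le> ?S k \<omega> + \<epsilon>}" for \<omega> by auto
    moreover have "{\<omega>\<in>space M. ?S i \<omega> \<le> ?S k \<omega> + \<epsilon>} \<in> events" for i using SM[of i] SM[of k] by measurable
    then have "{\<omega>\<in>space M. m * R < card {i\<in>{i\<in>{..n}. k \<le> i \<and> i + R \<le> n}. ?S i \<omega> \<le> ?S k \<omega> + \<epsilon>}} \<in> events"
      by (intro card_event) auto
    ultimately have 2: "{\<omega>\<in>space M. m * R < card {i. k \<le> i \<and> i + R \<le> n \<and> ?S i \<omega> \<le> ?S k \<omega> + \<epsilon>}} \<in> events" by (simp only:)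
    have "?T k = {\<omega>\<in>space M. \<forall>i\<in>{k..n}. (?S k \<omega> + \<epsilon>) - 2 * \<epsilon> \<le> ?S i \<omega>} \<inter> {\<omega>\<in>space M. m * R < card {i. k \<le> i \<and> i + R \<le> n \<and> ?S i \<omega> \<le> ?S k \<omega> + \<epsilon>}}"
      by auto
    then show ?thesis using sets.Int[OF 1 2] by (simp only:)
  qed
  let ?B = "\<Union>k\<in>{..n}. ?T k"
  have "prob ?B \<le> (\<Sum>k\<in>{..n}. prob (?T k))" using TM by (intro finite_measure_subadditive_finite) auto
  also have "\<dots> \<le> (\<Sum>k\<in>{..n}. \<rho> ^ m)" using T_prob by (rule sum_mono)
  also have "\<dots> = real (Suc n) * \<rho> ^ m" by simp
  finally have B_prob: "prob ?B \<le> real (Suc n) * \<rho> ^ m" .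
  have "card (?Z \<omega>) \<le> Suc m * R" if \<omega>: "\<omega> \<in> space M" "\<omega> \<notin> ?B" for \<omega>
  proof (rule ccontr)
    assume "\<not> card (?Z \<omega>) \<le> Suc m * R"
    then have c: "Suc m * R < card (?Z \<omega>)" by simp
    have fin: "finite (?Z \<omega>)" by simp
    have "?Z \<omega> \<noteq> {}" using c by (metis card.empty not_less_zero)
    define k where "k = Min (?Z \<omega>)"
    have kZ: "k \<in> ?Z \<omega>" unfolding k_def by (rule Min_in[OF fin \<open>?Z \<omega> \<noteq> {}\<close>])
    have k_min: "k \<le> i" if "i \<in> ?Z \<omega>" for i unfolding k_def by (rule Min_le[OF fin that])
    let ?Y = "{i. k \<le> i \<and> i + R \<le> n \<and> ?S i \<omega> \<le> ?S k \<omega> + \<epsilon>}"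
    \<comment> \<open>Near the end fewer than \<open>R\<close> steps remain and nothing can be said;
      these at most \<open>R\<close> indices turn \<open>m\<close> into
      \<open>Suc m\<close>.\<close>
    have "?Z \<omega> \<subseteq> ?Y \<union> {n + 1 - R..n}"
    proof
      fix i assume i: "i \<in> ?Z \<omega>"
      then have "?S i \<omega> \<le> ?S k \<omega> + \<epsilon>" "k \<le> i" "i \<le> n" using kZ k_min by auto
      then show "i \<in> ?Y \<union> {n + 1 - R..n}" by (cases "i + R \<le> n") auto
    qed
    then have "card (?Z \<omega>) \<le> card (?Y \<union> {n + 1 - R..n})" by (intro card_mono finite_UnI finite_subset[of ?Y "{..n}"]) auto
    also have "\<dots> \<le> card ?Y + card {n + 1 - R..n}" by (rule card_Un_le)
    also have "card {n + 1 - R..n} \<le> R" by simp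
    finally have "m * R < card ?Y" using c by simp
    moreover have "\<forall>i\<in>{k..n}. (?S k \<omega> + \<epsilon>) - 2 * \<epsilon> \<le> ?S i \<omega>"
    proof
      fix i assume "i \<in> {k..n}"
      then have "?S k \<omega> \<le> ?S i \<omega> + \<epsilon>" using kZ by auto
      then show "(?S k \<omega> + \<epsilon>) - 2 * \<epsilon> \<le> ?S i \<omega>" by linarith
    qed
    ultimately have "\<omega> \<in> ?T k" using \<omega>(1) by auto
    moreover have "k \<in> {..n}" using kZ by simp
    ultimately show False using \<omega>(2) by blast
  qed
  with TM B_prob show thesis by (intro that[of ?B] sets.finite_UN) auto
qed

end

subsection \<open>The refinement search\<close>

text \<open>\<open>B\<close> is the number of parts of each interval, \<open>L\<close> the deepest
  level, and \<open>c l\<close> the tolerance within which a left end of level \<open>l\<close>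
  counts as nearly minimal.\<close>

locale refinement_search =
  fixes B L :: nat and c :: "nat \<Rightarrow> real"
  assumes B: "0 < B"
begin

text \<open>Grid point \<open>j\<close> stands for the time \<open>j / B ^ L\<close>; the points of level \<open>l\<close> are the multiples of \<open>B ^ (L - l)\<close>.\<close>

definition mesh :: "nat \<Rightarrow> nat" where "mesh l = B ^ (L - l)"

text \<open>The left end of the interval of level \<open>l\<close> that contains
  \<open>j\<close>.\<close>

definition parent :: "nat \<Rightarrow> nat \<Rightarrow> nat" where "parent l j = mesh l * (j div mesh l)"

text \<open>A point is worth an evaluation if the interval of the previous level containing it has a
  visited, nearly minimal left end. The comparison is with the visited values only, since the true
  minimum is unknown to the method. Level 0 consists of the point 0.\<close>

fun candidate :: "nat set \<Rightarrow> (nat \<Rightarrow> real) \<Rightarrow> nat \<Rightarrow> nat \<Rightarrow> bool" where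
  "candidate S v 0 j \<longleftrightarrow> j \<notin> S \<and> j = 0"
| "candidate S v (Suc l) j \<longleftrightarrow> j \<notin> S \<and> l < L \<and> j < B ^ L \<and> mesh (Suc l) dvd j \<and> parent l j \<in> S \<and>
     (\<forall>s\<in>S. v (parent l j) \<le> v s + c l)"

text \<open>The pair (level, point) is encoded as \<open>level * (B ^ L + 1) + point\<close>, so that the least code of a candidate
  has the lowest level; the code \<open>(L + 1) * (B ^ L + 1)\<close>, with point \<open>0\<close>, means that there is no candidate.\<close>

definition code_ok :: "nat set \<Rightarrow> (nat \<Rightarrow> real) \<Rightarrow> nat \<Rightarrow> bool" where
  "code_ok S v k \<longleftrightarrow> candidate S v (k div Suc (B ^ L)) (k mod Suc (B ^ L)) \<or> k = Suc L * Suc (B ^ L)"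

definition pick :: "nat set \<Rightarrow> (nat \<Rightarrow> real) \<Rightarrow> nat" where
  "pick S v = (LEAST k. code_ok S v k) mod Suc (B ^ L)"

text \<open>The search starts at the point \<open>B ^ L\<close>, that is, at time 1, because
  \<open>W 1\<close> enters the approximation and has to be observed anyway. After \<open>k\<close>
  picks there have been \<open>k + 1\<close> observations.\<close>

fun visited :: "(nat \<Rightarrow> real) \<Rightarrow> nat \<Rightarrow> nat set" where
  "visited v 0 = {B ^ L}"
| "visited v (Suc k) = insert (pick (visited v k) v) (visited v k)"

definition index :: "(nat \<Rightarrow> real) \<Rightarrow> nat \<Rightarrow> nat" where
  "index v k = (case k of 0 \<Rightarrow> B ^ L | Suc i \<Rightarrow> pick (visited v i) v)"

text \<open>An adaptive method sees only the vector of its observations. This reconstructs the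
  visited points and their values from it; \<open>y 1\<close> is the observation at time 1. The
  default value 0 at the other points is never consulted.\<close>

fun replay :: "(nat \<Rightarrow> real) \<Rightarrow> nat \<Rightarrow> nat set \<times> (nat \<Rightarrow> real)" where
  "replay y 0 = ({B ^ L}, (\<lambda>_. 0)(B ^ L := y 1))"
| "replay y (Suc k) = (insert (pick (fst (replay y k)) (snd (replay y k))) (fst (replay y k)),
     (snd (replay y k))(pick (fst (replay y k)) (snd (replay y k)) := y (Suc (Suc k))))"

lemma candidate_cong: "(\<And>s. s \<in> S \<Longrightarrow> v s = w s) \<Longrightarrow> candidate S v l j = candidate S w l j"
  by (cases l) auto

lemma pick_cong: "(\<And>s. s \<in> S \<Longrightarrow> v s = w s) \<Longrightarrow> pick S v = pick S w"
proof -
  assume "\<And>s. s \<in> S \<Longrightarrow> v s = w s"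
  then have "candidate S v = candidate S w" by (intro ext candidate_cong)
  then show ?thesis unfolding pick_def code_ok_def by (simp only:)
qed

lemma pick_le: "pick S v \<le> B ^ L"
proof -
  have "pick S v < Suc (B ^ L)" unfolding pick_def by (rule mod_less_divisor) simp
  then show ?thesis by (simp only: less_Suc_eq_le)
qed

lemma visited_subset: "visited v k \<subseteq> {..B ^ L}"
  by (induction k) (auto simp: pick_le)

lemma finite_visited: "finite (visited v k)"
  by (induction k) auto

lemma visited_nonempty: "visited v k \<noteq> {}"
  by (induction k) auto

lemma end_visited: "B ^ L \<in> visited v k"
  by (induction k) auto

lemma replay:
  assumes "\<And>i. i \<le> k \<Longrightarrow> y (Suc i) = w (index w i)"
  shows "fst (replay y k) = visited w k \<and> (\<forall>j\<in>visited w k. snd (replay y k) j = w j)"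
  using assms
proof (induction k)
  case 0
  then show ?case by (simp add: index_def)
next
  case (Suc k)
  then have IH: "fst (replay y k) = visited w k" "\<And>j. j \<in> visited w k \<Longrightarrow> snd (replay y k) j = w j" by auto
  have p: "pick (visited w k) (snd (replay y k)) = pick (visited w k) w" using IH(2) by (rule pick_cong)
  have "y (Suc (Suc k)) = w (pick (visited w k) w)" using Suc.prems[of "Suc k"] by (simp add: index_def)
  then show ?case using IH p by auto
qed

section \<open>Measurability of the search and its form as an adaptive method\<close>

lemma pick_measurable:
  assumes S: "finite S" and v: "\<And>j. (\<lambda>x. v x j) \<in> borel_measurable P"
  shows "(\<lambda>x. pick S (v x)) \<in> measurable P (count_space UNIV)"
proof -
  note [measurable] = v
  have c: "Measurable.pred P (\<lambda>x. candidate S (v x) l j)" for l j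
  proof (cases l)
    case (Suc l')
    have "Measurable.pred P (\<lambda>x. \<forall>s\<in>S. v x (parent l' j) \<le> v x s + c l')"
      using S by (intro pred_intros_finite) measurable
    then show ?thesis unfolding Suc by simp
  qed simp
  have "Measurable.pred P (\<lambda>x. code_ok S (v x) k)" for k
    unfolding code_ok_def using c by measurable
  then have "(\<lambda>x. LEAST k. code_ok S (v x) k) \<in> measurable P (count_space UNIV)" by (rule measurable_Least)
  then show ?thesis unfolding pick_def by measurable
qed

text \<open>The visited set has only finitely many possible values, so it may be held fixed.\<close>

lemma pick_measurable':
  assumes S: "S \<in> measurable P (count_space (Pow {..B ^ L}))" and v: "\<And>j. (\<lambda>x. v x j) \<in> borel_measurable P"
  shows "(\<lambda>x. pick (S x) (v x)) \<in> measurable P (count_space UNIV)"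
  by (rule measurable_compose_countable'[OF _ S]) (auto intro!: pick_measurable v countable_finite finite_subset[of _ "{..B ^ L}"])

lemma insert_measurable:
  assumes S: "S \<in> measurable P (count_space (Pow {..B ^ L}))" and p: "p \<in> measurable P (count_space UNIV)" "\<And>x. p x \<le> B ^ L"
  shows "(\<lambda>x. insert (p x) (S x)) \<in> measurable P (count_space (Pow {..B ^ L}))"
proof -
  have p': "p \<in> measurable P (count_space {..B ^ L})"
    using p by (intro measurable_count_space_extend[OF _ _ p(1)]) (auto simp: measurable_def)
  show ?thesis
  proof (rule measurable_compose_countable'[OF _ S])
    fix T assume T: "T \<in> Pow {..B ^ L}"
    show "(\<lambda>x. insert (p x) T) \<in> measurable P (count_space (Pow {..B ^ L}))"
      by (rule measurable_compose_countable'[OF _ p']) (use T in auto)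
  qed (auto intro: countable_finite)
qed

lemma visited_measurable:
  assumes v: "\<And>j. (\<lambda>x. v x j) \<in> borel_measurable P"
  shows "(\<lambda>x. visited (v x) k) \<in> measurable P (count_space (Pow {..B ^ L}))"
proof (induction k)
  case (Suc k)
  then show ?case using pick_measurable'[OF Suc v] by (simp add: insert_measurable pick_le)
qed simp

lemma replay_measurable:
  assumes "k < n"
  shows "(\<lambda>y. fst (replay y k)) \<in> measurable (Pi\<^sub>M {1..n} (\<lambda>_. borel)) (count_space (Pow {..B ^ L}))"
    and "\<And>j. (\<lambda>y. snd (replay y k) j) \<in> borel_measurable (Pi\<^sub>M {1..n} (\<lambda>_. borel))"
  using assms
proof (induction k)
  case 0
  {
    case 1
    then show ?case by simp
  next
    case (2 j)
    then have "(\<lambda>y. y 1 :: real) \<in> borel_measurable (Pi\<^sub>M {1..n} (\<lambda>_. borel))"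
      by (intro measurable_component_singleton) auto
    then show ?case by simp
  }
next
  case (Suc k)
  {
    case 1
    then have p: "(\<lambda>y. pick (fst (replay y k)) (snd (replay y k))) \<in> measurable (Pi\<^sub>M {1..n} (\<lambda>_. borel)) (count_space UNIV)"
      using Suc.IH by (intro pick_measurable') auto
    then show ?case using Suc.IH(1) 1 by (simp add: insert_measurable pick_le)
  next
    case (2 j)
    then have p [measurable]: "(\<lambda>y. pick (fst (replay y k)) (snd (replay y k))) \<in> measurable (Pi\<^sub>M {1..n} (\<lambda>_. borel)) (count_space UNIV)"
      using Suc.IH by (intro pick_measurable') auto
    have [measurable]: "(\<lambda>y. snd (replay y k) j) \<in> borel_measurable (Pi\<^sub>M {1..n} (\<lambda>_. borel))"
      using Suc.IH(2) 2 by simp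
    have [measurable]: "(\<lambda>y. y (Suc (Suc k)) :: real) \<in> borel_measurable (Pi\<^sub>M {1..n} (\<lambda>_. borel))"
      using 2 by (intro measurable_component_singleton) auto
    have "(\<lambda>y. if pick (fst (replay y k)) (snd (replay y k)) = j then y (Suc (Suc k)) else snd (replay y k) j)
        \<in> borel_measurable (Pi\<^sub>M {1..n} (\<lambda>_. borel))"
      by measurable
    also have "(\<lambda>y. if pick (fst (replay y k)) (snd (replay y k)) = j then y (Suc (Suc k)) else snd (replay y k) j)
        = (\<lambda>y. snd (replay y (Suc k)) j)"
      by (auto simp: fun_eq_iff)
    finally show ?case .
  }
qed

lemma Min_measurable:
  assumes S: "S \<in> measurable P (count_space (Pow {..B ^ L} - {{}}))" and v: "\<And>j. (\<lambda>x. v x j :: real) \<in> borel_measurable P"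
  shows "(\<lambda>x. Min (v x ` S x)) \<in> borel_measurable P"
proof (rule measurable_compose_countable'[OF _ S])
  fix T assume "T \<in> Pow {..B ^ L} - {{}}"
  then show "(\<lambda>x. Min (v x ` T)) \<in> borel_measurable P"
    using v by (intro borel_measurable_Min) (auto intro: finite_subset[of _ "{..B ^ L}"])
qed (auto intro: countable_finite)

lemma nonempty_measurable:
  assumes S: "S \<in> measurable P (count_space (Pow {..B ^ L}))" and ne: "\<And>x. S x \<noteq> {}"
  shows "S \<in> measurable P (count_space (Pow {..B ^ L} - {{}}))"
  by (rule measurable_count_space_extend[OF _ _ S]) (use ne measurable_space[OF S] in auto)

lemma replay_nonempty: "fst (replay y k) \<noteq> {}"
  by (cases k) auto

lemma adaptive_method:
  assumes W: "\<And>t. 0 \<le> t \<Longrightarrow> W t \<in> borel_measurable M" and n: "0 < n"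
  shows "(\<lambda>\<omega>. (W 1 \<omega> + max r (- Min ((\<lambda>j. W (real j / B ^ L) \<omega>) ` visited (\<lambda>j. W (real j / B ^ L) \<omega>) (n - 1))))\<^sup>2)
    \<in> adaptive_methods M W n"
proof -
  define w where "w \<omega> j = W (real j / B ^ L) \<omega>" for \<omega> j
  have wM: "(\<lambda>\<omega>. w \<omega> j) \<in> borel_measurable M" for j unfolding w_def by (intro W) auto
  define Y where "Y \<omega> = (W 1 \<omega> + max r (- Min (w \<omega> ` visited (w \<omega>) (n - 1))))\<^sup>2" for \<omega>
  define \<tau> where "\<tau> k \<omega> = real (index (w \<omega>) (k - 1)) / B ^ L" for k :: nat and \<omega>
  \<comment> \<open>The observation with number \<open>k\<close> is placed with the knowledge of
    \<open>k - 1\<close> observations. One of them is the starting point, so \<open>k - 2\<close>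
    picks are replayed.\<close>
  define \<phi> where "\<phi> k y = real (pick (fst (replay y (k - 2))) (snd (replay y (k - 2)))) / B ^ L" for k :: nat and y
  define \<Phi> where "\<Phi> y = (y 1 + max r (- Min (snd (replay y (n - 1)) ` fst (replay y (n - 1)))))\<^sup>2" for y :: "nat \<Rightarrow> real"
  have N: "0 < real B ^ L" using B by simp
  have [measurable]: "W 1 \<in> borel_measurable M" by (rule W) simp
  have "(\<lambda>\<omega>. Min (w \<omega> ` visited (w \<omega>) (n - 1))) \<in> borel_measurable M"
    by (intro Min_measurable nonempty_measurable visited_measurable wM) (rule visited_nonempty)
  then have YM: "Y \<in> borel_measurable M" unfolding Y_def[abs_def] by measurable
  have \<phi>M: "\<phi> k \<in> measurable (Pi\<^sub>M {1..k - 1} (\<lambda>_. borel)) (restrict_space borel {0..1})" if "k \<in> {2..n}" for k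
  proof (rule measurable_restrict_space2)
    have "(\<lambda>y. pick (fst (replay y (k - 2))) (snd (replay y (k - 2)))) \<in> measurable (Pi\<^sub>M {1..k - 1} (\<lambda>_. borel)) (count_space UNIV)"
      using that by (intro pick_measurable' replay_measurable) auto
    then show "\<phi> k \<in> borel_measurable (Pi\<^sub>M {1..k - 1} (\<lambda>_. borel))" unfolding \<phi>_def by measurable
    show "\<phi> k \<in> space (Pi\<^sub>M {1..k - 1} (\<lambda>_. borel)) \<rightarrow> {0..1}"
    proof
      fix y
      have "real (pick (fst (replay y (k - 2))) (snd (replay y (k - 2)))) \<le> real (B ^ L)" using pick_le by (simp only: of_nat_le_iff)
      then show "\<phi> k y \<in> {0..1}" using N by (simp add: \<phi>_def)
    qed
  qed
  have \<Phi>M: "\<Phi> \<in> borel_measurable (Pi\<^sub>M {1..n} (\<lambda>_. borel))"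
  proof -
    have [measurable]: "(\<lambda>y. y 1 :: real) \<in> borel_measurable (Pi\<^sub>M {1..n} (\<lambda>_. borel))"
      using n by (intro measurable_component_singleton) auto
    have "(\<lambda>y. Min (snd (replay y (n - 1)) ` fst (replay y (n - 1)))) \<in> borel_measurable (Pi\<^sub>M {1..n} (\<lambda>_. borel))"
      using n by (intro Min_measurable nonempty_measurable replay_measurable replay_nonempty) auto
    then show ?thesis unfolding \<Phi>_def[abs_def] by measurable
  qed
  have obs: "W (\<tau> (Suc i) \<omega>) \<omega> = w \<omega> (index (w \<omega>) i)" for i \<omega> by (simp add: \<tau>_def w_def)
  have rep: "fst (replay (\<lambda>i\<in>{1..k}. W (\<tau> i \<omega>) \<omega>) (k - 1)) = visited (w \<omega>) (k - 1) \<and>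
      (\<forall>j\<in>visited (w \<omega>) (k - 1). snd (replay (\<lambda>i\<in>{1..k}. W (\<tau> i \<omega>) \<omega>) (k - 1)) j = w \<omega> j)" if "0 < k" for k \<omega>
    using that by (intro replay) (auto simp: obs)
  have \<tau>_eq: "\<tau> k \<omega> = \<phi> k (\<lambda>i\<in>{1..k - 1}. W (\<tau> i \<omega>) \<omega>)" if k: "k \<in> {2..n}" for k \<omega>
  proof -
    obtain i where i: "k = Suc (Suc i)" using k by (metis atLeastAtMost_iff add_2_eq_Suc le_Suc_ex)
    have f: "fst (replay (\<lambda>i\<in>{1..Suc i}. W (\<tau> i \<omega>) \<omega>) i) = visited (w \<omega>) i"
      and s: "\<forall>j\<in>visited (w \<omega>) i. snd (replay (\<lambda>i\<in>{1..Suc i}. W (\<tau> i \<omega>) \<omega>) i) j = w \<omega> j"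
      using rep[of "Suc i" \<omega>] by auto
    have "pick (fst (replay (\<lambda>i\<in>{1..Suc i}. W (\<tau> i \<omega>) \<omega>) i)) (snd (replay (\<lambda>i\<in>{1..Suc i}. W (\<tau> i \<omega>) \<omega>) i)) = pick (visited (w \<omega>) i) (w \<omega>)"
      unfolding f by (rule pick_cong) (rule bspec[OF s])
    then show ?thesis unfolding i \<tau>_def \<phi>_def by (simp add: index_def)
  qed
  have Y_eq: "Y \<omega> = \<Phi> (\<lambda>i\<in>{1..n}. W (\<tau> i \<omega>) \<omega>)" for \<omega>
  proof -
    have "snd (replay (\<lambda>i\<in>{1..n}. W (\<tau> i \<omega>) \<omega>) (n - 1)) ` visited (w \<omega>) (n - 1) = w \<omega> ` visited (w \<omega>) (n - 1)"
      using rep[OF n, of \<omega>] by (intro image_cong) auto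
    moreover have "\<tau> 1 \<omega> = 1" using N by (simp add: \<tau>_def index_def)
    ultimately show ?thesis using rep[OF n, of \<omega>] n unfolding Y_def \<Phi>_def by simp
  qed
  have \<tau>1: "\<tau> 1 \<omega> = 1" for \<omega> using N by (simp add: \<tau>_def index_def)
  have "\<forall>\<omega>\<in>space M. \<tau> 1 \<omega> = 1 \<and> (\<forall>k\<in>{2..n}. \<tau> k \<omega> = \<phi> k (\<lambda>i\<in>{1..k - 1}. W (\<tau> i \<omega>) \<omega>)) \<and>
      Y \<omega> = \<Phi> (\<lambda>i\<in>{1..n}. W (\<tau> i \<omega>) \<omega>)"
    by (intro ballI conjI \<tau>1 \<tau>_eq Y_eq)
  moreover have "(1::real) \<in> {0..1}" by simp
  ultimately have "Y \<in> adaptive_methods M W n"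
    unfolding adaptive_methods_def using YM \<phi>M \<Phi>M by blast
  then show ?thesis unfolding Y_def[abs_def] w_def[abs_def] .
qed

section \<open>Correctness and cost of the search\<close>

lemma pick_candidate:
  assumes "candidate S v l j" "l \<le> L"
  obtains l' where "l' \<le> l" "candidate S v l' (pick S v)" "\<And>i k. i < l' \<Longrightarrow> \<not> candidate S v i k"
proof -
  let ?N = "Suc (B ^ L)"
  have bound: "k < ?N" if "candidate S v i k" for i k using that by (cases i) (auto simp: less_Suc_eq)
  define K where "K = (LEAST k. code_ok S v k)"
  have ok: "code_ok S v (l * ?N + j)" if "candidate S v l j" for l j
    using bound[OF that] that by (simp add: code_ok_def del: mult_Suc_right)
  have K: "code_ok S v K" unfolding K_def using ok[OF assms(1)] by (rule LeastI)
  have K_le: "K \<le> i * ?N + k" if "candidate S v i k" for i k unfolding K_def by (rule Least_le[of "code_ok S v", OF ok[OF that]])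
  have "K \<le> l * ?N + j" using K_le assms(1) .
  also have "\<dots> < Suc l * ?N" using bound[OF assms(1)] by simp
  finally have K_lt: "K < Suc l * ?N" .
  also have "Suc l * ?N \<le> Suc L * ?N" using assms(2) by (intro mult_right_mono) auto
  finally have "K \<noteq> Suc L * ?N" by simp
  then have c: "candidate S v (K div ?N) (pick S v)" using K by (simp add: code_ok_def pick_def K_def)
  have "K div ?N < Suc l" using K_lt by (rule less_mult_imp_div_less)
  moreover have "\<not> candidate S v i k" if "i < K div ?N" for i k
  proof
    assume ck: "candidate S v i k"
    have "K < Suc i * ?N" using K_le[OF ck] bound[OF ck] by simp
    then have "K div ?N < Suc i" by (rule less_mult_imp_div_less)
    with that show False by simp
  qed
  ultimately show thesis using c that[of "K div ?N"] by auto
qed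

lemma candidate_notin: "candidate S v l j \<Longrightarrow> j \<notin> S"
  by (cases l) auto

lemma candidate_level: "candidate S v l j \<Longrightarrow> l \<le> L"
  by (cases l) auto

lemma pick_none:
  assumes "\<And>l j. \<not> candidate S v l j"
  shows "pick S v = 0"
proof -
  have "(LEAST k. code_ok S v k) = Suc L * Suc (B ^ L)"
    using assms by (intro Least_equality) (auto simp: code_ok_def)
  then show ?thesis by (simp only: pick_def mod_mult_self2_is_0)
qed

text \<open>One tolerance is allowed by the candidate test, the other by the fact that the best
  visited left end of level \<open>l\<close> may itself lie \<open>c l\<close> above the minimum
  \<open>m\<close>.\<close>

definition near :: "(nat \<Rightarrow> real) \<Rightarrow> real \<Rightarrow> nat \<Rightarrow> nat set" where
  "near v m l = {i. i < B ^ l \<and> v (i * mesh l) \<le> m + 2 * c l}"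

lemma finite_near: "finite (near v m l)"
  by (rule finite_subset[of _ "{..<B ^ l}"]) (auto simp: near_def)

text \<open>The points \<open>a l\<close> are the left ends of the intervals that contain the
  minimiser. Each of them passes the test, so an unvisited one is a candidate once its predecessor
  has been visited. While candidates remain, every pick is a new point of the finite set
  \<open>T\<close>; as \<open>T\<close> has fewer than \<open>n\<close> points, no candidate is left
  at the end, and \<open>a L\<close> has been visited.\<close>

lemma search_correct:
  assumes m: "\<And>j. j \<le> B ^ L \<Longrightarrow> m \<le> v j"
    and a: "a 0 = 0" "\<And>l. l \<le> L \<Longrightarrow> a l < B ^ L" "\<And>l. l \<le> L \<Longrightarrow> mesh l dvd a l" "\<And>l. l < L \<Longrightarrow> parent l (a (Suc l)) = a l"
    and va: "\<And>l. l \<le> L \<Longrightarrow> v (a l) \<le> m + c l"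
    and n: "2 + (\<Sum>l<L. B * card (near v m l)) < n"
  shows "Min (v ` visited v (n - 1)) \<le> m + c L"
proof -
  have chain: "a l \<in> S" if S: "S \<subseteq> {..B ^ L}" and l: "l \<le> L" and none: "\<And>i k. i \<le> l \<Longrightarrow> \<not> candidate S v i k" for S l
    using l none
  proof (induction l)
    case 0
    then show ?case using a(1) 0(2)[of 0 0] by simp
  next
    case (Suc l)
    then have "a l \<in> S" by simp
    moreover have "v (a l) \<le> v s + c l" if "s \<in> S" for s
      using va[of l] m[of s] Suc.prems(1) S that by fastforce
    ultimately have "candidate S v (Suc l) (a (Suc l))" if "a (Suc l) \<notin> S"
      using that a Suc.prems(1) by simp
    then show ?case using Suc.prems(2)[of "Suc l" "a (Suc l)"] by blast
  qed
  \<comment> \<open>The starting point, the point 0, and the \<open>B\<close> children of each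
    nearly minimal interval.\<close>
  define T where "T = insert (B ^ L) (insert 0 (\<Union>l<L. (\<lambda>(i, r). mesh (Suc l) * (B * i + r)) ` (near v m l \<times> {..<B})))"
  have mesh: "mesh l = B * mesh (Suc l)" if "l < L" for l
  proof -
    have "L - l = Suc (L - Suc l)" using that by simp
    then show ?thesis by (simp add: mesh_def)
  qed
  have mesh_pos: "0 < mesh l" for l using B by (simp add: mesh_def)
  have mesh_N: "B ^ l * mesh l = B ^ L" if "l \<le> L" for l using that by (simp add: mesh_def flip: power_add)
  have pick_T: "pick S v \<in> T" if S: "S \<subseteq> {..B ^ L}" and ex: "candidate S v l j" for S l j
  proof -
    obtain l' where l': "l' \<le> l" "candidate S v l' (pick S v)" "\<And>i k. i < l' \<Longrightarrow> \<not> candidate S v i k"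
      using pick_candidate[OF ex candidate_level[OF ex]] by blast
    show ?thesis
    proof (cases l')
      case 0
      then show ?thesis using l'(2) by (simp add: T_def)
    next
      case (Suc k)
      let ?j = "pick S v"
      have j: "k < L" "?j < B ^ L" "mesh (Suc k) dvd ?j" "\<forall>s\<in>S. v (parent k ?j) \<le> v s + c k"
        using l'(2) unfolding Suc by auto
      \<comment> \<open>Lowest levels come first: a pick of level \<open>Suc k\<close> means that no
        candidate of level at most \<open>k\<close> exists, so \<open>a k\<close> has been visited.
        The test against \<open>a k\<close> then bounds the value at the parent.\<close>
      have "a k \<in> S" using j(1) l'(3) unfolding Suc by (intro chain[OF S]) auto
      then have low: "v (parent k ?j) \<le> m + 2 * c k" using j(1,4) va[of k] by fastforce
      obtain q where q: "?j = mesh (Suc k) * q" using j(3) by blast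
      have div: "?j div mesh k = q div B"
        unfolding q mesh[OF j(1)] using mesh_pos by (metis div_mult2_eq mult.commute nonzero_mult_div_cancel_left not_gr_zero)
      have "?j div mesh k < B ^ k"
        using j(2) mesh_N[of k] j(1) by (intro less_mult_imp_div_less) simp
      then have "q div B \<in> near v m k"
        using low unfolding near_def parent_def div by (simp add: mult.commute)
      moreover have "q mod B < B" using B by simp
      moreover have "?j = mesh (Suc k) * (B * (q div B) + q mod B)" unfolding q by simp
      ultimately have "?j \<in> (\<lambda>(i, r). mesh (Suc k) * (B * i + r)) ` (near v m k \<times> {..<B})"
        by (intro image_eqI[of _ _ "(q div B, q mod B)"]) auto
      then show ?thesis using j(1) unfolding T_def by blast
    qed
  qed
  have card_T: "finite T" "card T \<le> 2 + (\<Sum>l<L. B * card (near v m l))"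
  proof -
    let ?I = "\<lambda>l. (\<lambda>(i, r). mesh (Suc l) * (B * i + r)) ` (near v m l \<times> {..<B})"
    have fin: "finite (?I l)" for l using finite_near by (intro finite_imageI finite_cartesian_product) auto
    then show "finite T" by (auto simp: T_def)
    have "card (?I l) \<le> B * card (near v m l)" for l
      using card_image_le[of "near v m l \<times> {..<B}"] finite_near by (simp add: card_cartesian_product mult.commute)
    then have "card (\<Union>l<L. ?I l) \<le> (\<Sum>l<L. B * card (near v m l))"
      by (intro order_trans[OF card_UN_le] sum_mono) auto
    moreover have "card T \<le> Suc (Suc (card (\<Union>l<L. ?I l)))"
      unfolding T_def using fin by (intro order_trans[OF card_insert_le_m1] ) (auto simp: card_insert_if)
    ultimately show "card T \<le> 2 + (\<Sum>l<L. B * card (near v m l))" by simp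
  qed
  have none: "\<not> candidate (visited v (n - 1)) v l j" for l j
  proof
    assume ex: "candidate (visited v (n - 1)) v l j"
    \<comment> \<open>Without candidates the default pick is the point 0. It has already been
      visited, being a candidate otherwise, so nothing changes any more.\<close>
    have stuck: "visited v i = visited v k" if "\<And>l j. \<not> candidate (visited v k) v l j" "k \<le> i" for i k
      using that(2)
    proof (induction i)
      case (Suc i)
      show ?case
      proof (cases "k = Suc i")
        case False
        then have eq: "visited v i = visited v k" using Suc by simp
        moreover have "0 \<in> visited v k" using that(1)[of 0 0] by auto
        moreover have "pick (visited v k) v = 0" using that(1) by (rule pick_none)
        ultimately show ?thesis by (simp add: insert_absorb)
      qed simp
    qed simp
    have "card (visited v k) = Suc k \<and> visited v k \<subseteq> T" if "k \<le> n - 1" for k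
      using that
    proof (induction k)
      case 0
      then show ?case by (simp add: T_def)
    next
      case (Suc k)
      have "\<exists>l j. candidate (visited v k) v l j"
      proof (rule ccontr)
        assume "\<not> ?thesis"
        then have "visited v (n - 1) = visited v k" using stuck[of k "n - 1"] Suc.prems by auto
        with ex \<open>\<not> ?thesis\<close> show False by auto
      qed
      then obtain l' j' where c: "candidate (visited v k) v l' j'" by blast
      have "pick (visited v k) v \<notin> visited v k"
        by (rule pick_candidate[OF c candidate_level[OF c]]) (rule candidate_notin)
      moreover have "pick (visited v k) v \<in> T" using pick_T[OF visited_subset c] .
      ultimately show ?case using Suc finite_visited by (simp add: card_insert_if)
    qed
    then have "card (visited v (n - 1)) = Suc (n - 1)" "visited v (n - 1) \<subseteq> T" by auto
    then have "Suc (n - 1) \<le> card T" using card_mono[OF card_T(1)] by metis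
    then show False using card_T(2) n by linarith
  qed
  have "a L \<in> visited v (n - 1)" by (rule chain[OF visited_subset order_refl none])
  then have "Min (v ` visited v (n - 1)) \<le> v (a L)" using finite_visited by (intro Min_le) auto
  also have "\<dots> \<le> m + c L" using va by simp
  finally show ?thesis .
qed

end

subsection \<open>Paths with few near-minimal points\<close>

text \<open>The moment of order \<open>2 * k\<close> of the standard normal distribution.\<close>

definition gauss_moment :: "nat \<Rightarrow> real" where
  "gauss_moment k = fact (2 * k) / (2 ^ k * fact k)"

lemma gauss_moment_pos: "0 < gauss_moment k"
  by (simp add: gauss_moment_def)

context brownian
begin

text \<open>An integrable bound for powers of the maximum of \<open>\<bar>W u \<omega>\<bar>\<close>
  that avoids the measurability of the maximum. Apart from its constant first term, \<open>T\<close>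
  is a weighted sum of indicators of the events \<open>A j\<close>, outside which the continuous
  path started at 0 stays within \<open>Suc j\<close>.\<close>

lemma moment_majorant:
  assumes s: "0 \<le> s"
  obtains T where "T \<in> borel_measurable M" "(\<integral>\<^sup>+\<omega>. T \<omega> \<partial>M) < \<infinity>"
    "AE \<omega> in M. \<exists>V\<ge>1. (\<forall>u\<in>{0..1}. \<bar>W u \<omega>\<bar> \<le> V) \<and> ennreal ((2 * V + s) ^ P) \<le> T \<omega>"
proof -
  \<comment> \<open>The tail of order \<open>2 * P + 2\<close> outweighs the power \<open>P\<close>
    and leaves a summable inverse square.\<close>
  define k where "k = Suc P"
  have "\<exists>A. A \<in> events \<and> prob A \<le> 4 * (gauss_moment k / real (Suc j) ^ (2 * k)) \<and>
      (\<forall>\<omega>\<in>space M. \<omega> \<notin> A \<longrightarrow> continuous_on {0..} (\<lambda>t. W t \<omega>) \<longrightarrow> (\<forall>u\<in>{0..0 + 1}. \<bar>W u \<omega> - W 0 \<omega>\<bar> \<le> real (Suc j) * sqrt 1))" for j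
    by (rule oscillation_prob[of 0 1 "real (Suc j)" k]) (auto simp: gauss_moment_def)
  then obtain A where A: "\<And>j. A j \<in> events" "\<And>j. prob (A j) \<le> 4 * (gauss_moment k / real (Suc j) ^ (2 * k))"
    "\<And>j \<omega>. \<omega> \<in> space M \<Longrightarrow> \<omega> \<notin> A j \<Longrightarrow> continuous_on {0..} (\<lambda>t. W t \<omega>) \<Longrightarrow> \<forall>u\<in>{0..1}. \<bar>W u \<omega> - W 0 \<omega>\<bar> \<le> real (Suc j)"
    by (metis add_0 mult.right_neutral real_sqrt_one)
  \<comment> \<open>If \<open>j\<close> is the first index with
    \<open>\<omega> \<notin> A j\<close>, then \<open>V = Suc j\<close> works. For
    \<open>j = 0\<close> the constant term covers it; otherwise the path lies in the event with
    index \<open>j - 1\<close>, whose weight is that of \<open>V\<close>.\<close>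
  define T where "T \<omega> = ennreal ((2 + s) ^ P) + (\<Sum>j. ennreal ((2 * real (j + 2) + s) ^ P) * indicator (A j) \<omega>)" for \<omega>
  have TM: "T \<in> borel_measurable M" unfolding T_def[abs_def] using A(1) by measurable
  define C where "C = (4 + s) ^ P * 4 * gauss_moment k"
  have C: "0 \<le> C" using s gauss_moment_pos[of k] by (simp add: C_def)
  have term_le: "(2 * real (j + 2) + s) ^ P * prob (A j) \<le> C * (1 / real (Suc j) ^ 2)" for j
  proof -
    let ?x = "real (Suc j)"
    have x: "1 \<le> ?x" by simp
    have "2 * real (j + 2) + s \<le> (4 + s) * ?x"
      using s by (simp add: algebra_simps)
    then have "(2 * real (j + 2) + s) ^ P \<le> ((4 + s) * ?x) ^ P" using s by (intro power_mono) auto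
    then have "(2 * real (j + 2) + s) ^ P * prob (A j) \<le> ((4 + s) * ?x) ^ P * (4 * (gauss_moment k / ?x ^ (2 * k)))"
      using A(2)[of j] s by (intro mult_mono) auto
    also have "\<dots> = C * (?x ^ P / ?x ^ (2 * k))" by (simp add: C_def power_mult_distrib del: of_nat_Suc)
    also have "\<dots> \<le> C * (1 / ?x ^ 2)"
    proof (rule mult_left_mono[OF _ C])
      have "?x ^ P * ?x ^ 2 \<le> ?x ^ (2 * k)" unfolding power_add[symmetric] k_def using x by (intro power_increasing) auto
      then show "?x ^ P / ?x ^ (2 * k) \<le> 1 / ?x ^ 2" using x by (simp add: divide_simps del: of_nat_Suc)
    qed
    finally show ?thesis .
  qed
  have summ: "summable (\<lambda>j. C * (1 / real (Suc j) ^ 2))"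
    using inverse_squares_sums by (intro summable_mult) (auto simp: sums_iff add.commute)
  have "(\<integral>\<^sup>+\<omega>. T \<omega> \<partial>M) = ennreal ((2 + s) ^ P) + (\<Sum>j. ennreal ((2 * real (j + 2) + s) ^ P) * emeasure M (A j))"
    unfolding T_def using A(1) by (subst nn_integral_add) (auto simp: nn_integral_suminf nn_integral_cmult_indicator emeasure_space_1)
  also have "(\<Sum>j. ennreal ((2 * real (j + 2) + s) ^ P) * emeasure M (A j)) \<le> (\<Sum>j. ennreal (C * (1 / real (Suc j) ^ 2)))"
  proof (intro suminf_le summableI)
    fix j
    have "ennreal ((2 * real (j + 2) + s) ^ P) * emeasure M (A j) = ennreal ((2 * real (j + 2) + s) ^ P * prob (A j))"
      using s by (simp add: emeasure_eq_measure ennreal_mult)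
    also have "\<dots> \<le> ennreal (C * (1 / real (Suc j) ^ 2))" by (rule ennreal_leI[OF term_le])
    finally show "ennreal ((2 * real (j + 2) + s) ^ P) * emeasure M (A j) \<le> ennreal (C * (1 / real (Suc j) ^ 2))" .
  qed
  also have "\<dots> = ennreal (\<Sum>j. C * (1 / real (Suc j) ^ 2))"
    using C by (intro suminf_ennreal2 summ) auto
  finally have "(\<integral>\<^sup>+\<omega>. T \<omega> \<partial>M) \<le> ennreal ((2 + s) ^ P) + ennreal (\<Sum>j. C * (1 / real (Suc j) ^ 2))"
    by (simp add: add_left_mono)
  also have "\<dots> < \<infinity>" by simp
  finally have T_fin: "(\<integral>\<^sup>+\<omega>. T \<omega> \<partial>M) < \<infinity>" .
  have null: "prob (\<Inter>j. A j) = 0"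
  proof -
    have "prob (\<Inter>j. A j) \<le> C * (1 / real (Suc j))" for j
    proof -
      have "prob (\<Inter>j. A j) \<le> prob (A j)" using A(1) by (intro finite_measure_mono) auto
      also have "\<dots> \<le> (2 * real (j + 2) + s) ^ P * prob (A j)"
        using s by (intro mult_le_cancel_right1[THEN iffD2]) (auto intro!: one_le_power)
      also have "\<dots> \<le> C * (1 / real (Suc j) ^ 2)" by (rule term_le)
      also have "\<dots> \<le> C * (1 / real (Suc j))"
        using C by (intro mult_left_mono divide_left_mono self_le_power) auto
      finally show ?thesis .
    qed
    moreover have "(\<lambda>j. C * (1 / real (Suc j))) \<longlonglongrightarrow> 0"
      using tendsto_mult_right_zero[OF mesh_tendsto_0[of 1]] by simp
    ultimately have "prob (\<Inter>j. A j) \<le> 0" by (intro LIMSEQ_le_const[of _ 0]) auto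
    then show ?thesis using measure_nonneg[of M "\<Inter>j. A j"] by linarith
  qed
  have "(\<Inter>j. A j) \<in> null_sets M"
    using null A(1) by (auto simp: null_sets_def emeasure_eq_measure)
  then have "AE \<omega> in M. \<omega> \<notin> (\<Inter>j. A j)" by (rule AE_not_in)
  then have "AE \<omega> in M. \<exists>V\<ge>1. (\<forall>u\<in>{0..1}. \<bar>W u \<omega>\<bar> \<le> V) \<and> ennreal ((2 * V + s) ^ P) \<le> T \<omega>"
    using AE_W_0 AE_W_continuous AE_space
  proof eventually_elim
    case (elim \<omega>)
    define j where "j = (LEAST j. \<omega> \<notin> A j)"
    obtain i where "\<omega> \<notin> A i" using elim(1) by blast
    then have j: "\<omega> \<notin> A j" unfolding j_def by (rule LeastI)
    have V: "\<forall>u\<in>{0..1}. \<bar>W u \<omega>\<bar> \<le> real (Suc j)" using A(3)[OF elim(4) j elim(3)] elim(2) by simp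
    have "ennreal ((2 * real (Suc j) + s) ^ P) \<le> T \<omega>"
    proof (cases j)
      case 0
      then show ?thesis by (simp add: T_def)
    next
      case (Suc i)
      then have "\<omega> \<in> A i" using not_less_Least[of i "\<lambda>j. \<omega> \<notin> A j"] unfolding j_def by auto
      define f where "f j = ennreal ((2 * real (j + 2) + s) ^ P) * indicator (A j) \<omega>" for j
      have "ennreal ((2 * real (i + 2) + s) ^ P) = f i" using \<open>\<omega> \<in> A i\<close> by (simp add: f_def)
      also have "\<dots> \<le> (\<Sum>j. f j)" using sum_le_suminf[of f "{i}"] by simp
      also have "\<dots> \<le> T \<omega>" unfolding T_def f_def by simp
      finally show ?thesis using Suc by (simp add: algebra_simps)
    qed
    then show ?case using V by (intro exI[of _ "real (Suc j)"]) auto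
  qed
  with TM T_fin show thesis by (rule that)
qed

text \<open>Every interval is divided into \<open>z\<^sup>2\<close> parts, so level \<open>l\<close> has mesh \<open>z powr (- 2 * l)\<close>, and the tolerance
  \<open>z / z ^ l\<close> is \<open>z\<close> times the standard deviation of an increment.\<close>

definition good_path :: "nat \<Rightarrow> nat \<Rightarrow> nat \<Rightarrow> 'a \<Rightarrow> bool" where
  "good_path z L m \<omega> \<longleftrightarrow>
     (\<forall>l\<le>L. \<forall>i<(z\<^sup>2) ^ l. \<forall>u\<in>{real i / real ((z\<^sup>2) ^ l)..real (Suc i) / real ((z\<^sup>2) ^ l)}.
        \<bar>W u \<omega> - W (real i / real ((z\<^sup>2) ^ l)) \<omega>\<bar> \<le> real z / real z ^ l) \<and>
     (\<forall>l<L. card {i\<in>{..(z\<^sup>2) ^ l}. \<forall>j\<in>{..(z\<^sup>2) ^ l}.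
        W (real i / real ((z\<^sup>2) ^ l)) \<omega> \<le> W (real j / real ((z\<^sup>2) ^ l)) \<omega> + 2 * (real z / real z ^ l)} \<le> Suc m * z ^ 4)"

text \<open>For fixed depth \<open>L\<close> and order \<open>Q\<close>, the constants
  \<open>C\<close> and \<open>m\<close> do not depend on \<open>z\<close>. Oscillations are excluded
  for each cell of each level, and large counts of nearly minimal points for each level below
  \<open>L\<close>.\<close>

lemma good_path_prob:
  obtains C m where "0 \<le> C" "\<And>z. 1 \<le> z \<Longrightarrow> \<exists>A\<in>events. prob A \<le> C / real z ^ (2 * Q) \<and>
    (\<forall>\<omega>\<in>space M. \<omega> \<notin> A \<longrightarrow> continuous_on {0..} (\<lambda>t. W t \<omega>) \<longrightarrow> good_path z L m \<omega>)"
proof -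
  \<comment> \<open>There are at most \<open>z ^ (2 * L)\<close> cells per level, and the tail of
    order \<open>2 * k\<close> has to reduce this number to \<open>z\<close> to the power
    \<open>- 2 * Q\<close>. The summand 3 ensures that it also outweighs
    \<open>z ^ 5\<close>.\<close>
  define k where "k = L + Q + 3"
  \<comment> \<open>A power \<open>m\<close> of \<open>\<rho>\<close>, which is of order
    \<open>1 / z\<close>, compensates for the choice of the starting index among the grid points and
    leaves the order \<open>2 * Q\<close>.\<close>
  define m where "m = 2 * L + 2 * Q"
  define K where "K = gauss_moment k"
  have K: "0 < K" unfolding K_def by (rule gauss_moment_pos)
  define C where "C = real (Suc L) * (4 * K) + real L * (2 * (5 + 2 * K) ^ m)"
  have C: "0 \<le> C" using K by (simp add: C_def)
  have "\<exists>A\<in>events. prob A \<le> C / real z ^ (2 * Q) \<and>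
    (\<forall>\<omega>\<in>space M. \<omega> \<notin> A \<longrightarrow> continuous_on {0..} (\<lambda>t. W t \<omega>) \<longrightarrow> good_path z L m \<omega>)" if z: "1 \<le> z" for z
  proof -
    let ?N = "\<lambda>l. (z\<^sup>2) ^ l" and ?z = "real z"
    have z1: "1 \<le> ?z" using z by simp
    define h where "h l = 1 / real (?N l)" for l
    have h: "0 < h l" for l using z by (simp add: h_def)
    have sqrt_h: "sqrt (h l) = 1 / ?z ^ l" for l
    proof -
      have "h l = (1 / ?z ^ l)\<^sup>2" by (simp add: h_def power_divide power_mult[symmetric] mult.commute)
      then show ?thesis using z1 by simp
    qed
    have ih: "real i / real (?N l) = real i * h l" for i l by (simp add: h_def)
    have N_le: "real (?N l) \<le> ?z ^ (2 * L)" if "l \<le> L" for l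
      using that z1 by (simp add: power_mult[symmetric] power_increasing)
    have osc: "\<exists>A. A \<in> events \<and> prob A \<le> 4 * (K / ?z ^ (2 * k)) \<and> (\<forall>\<omega>\<in>space M. \<omega> \<notin> A \<longrightarrow> continuous_on {0..} (\<lambda>t. W t \<omega>) \<longrightarrow>
        (\<forall>u\<in>{real i * h l..real i * h l + h l}. \<bar>W u \<omega> - W (real i * h l) \<omega>\<bar> \<le> ?z * sqrt (h l)))" for l i
      by (rule oscillation_prob[of "real i * h l" "h l" ?z k]) (use h[of l] z1 in \<open>auto simp: K_def gauss_moment_def\<close>)
    have "\<forall>l i. \<exists>A. A \<in> events \<and> prob A \<le> 4 * (K / ?z ^ (2 * k)) \<and> (\<forall>\<omega>\<in>space M. \<omega> \<notin> A \<longrightarrow> continuous_on {0..} (\<lambda>t. W t \<omega>) \<longrightarrow>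
        (\<forall>u\<in>{real i * h l..real i * h l + h l}. \<bar>W u \<omega> - W (real i * h l) \<omega>\<bar> \<le> ?z * sqrt (h l)))"
      using osc by blast
    then obtain A where A: "\<And>l i. A l i \<in> events" "\<And>l i. prob (A l i) \<le> 4 * (K / ?z ^ (2 * k))"
      "\<And>l i \<omega>. \<omega> \<in> space M \<Longrightarrow> \<omega> \<notin> A l i \<Longrightarrow> continuous_on {0..} (\<lambda>t. W t \<omega>) \<Longrightarrow>
        \<forall>u\<in>{real i * h l..real i * h l + h l}. \<bar>W u \<omega> - W (real i * h l) \<omega>\<bar> \<le> ?z * sqrt (h l)"
      by (subst (asm) choice_iff, subst (asm) choice_iff) blast
    \<comment> \<open>The walk has to stay above \<open>-4 * z\<close> standard deviations of a step
      during \<open>z ^ 4\<close> steps. Adding \<open>z\<close> for the overshoot and dividing by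
      \<open>z\<^sup>2\<close> gives \<open>5 / z\<close>; the summand \<open>2 * K / z\<close>
      bounds the chance of a large step.\<close>
    define \<rho> where "\<rho> = (5 + 2 * K) / ?z"
    have \<rho>: "0 \<le> \<rho>" using K by (simp add: \<rho>_def)
    let ?\<epsilon> = "\<lambda>l. 2 * (?z / ?z ^ l)"
    have stay: "prob {\<omega>\<in>D. \<forall>j\<le>z ^ 4. - 2 * ?\<epsilon> l \<le> W (real (i + j) * h l) \<omega> - W (real i * h l) \<omega>} \<le> \<rho> * prob D"
      if D: "D \<in> sets (F (real i * h l))" for l i D
    proof -
      let ?x = "4 * ?z * sqrt (h l)"
      have t0: "0 \<le> real i * h l" using h[of l] by simp
      have "prob {\<omega>\<in>D. \<forall>j\<le>z ^ 4. walk (- 1) (real i * h l) (h l) j \<omega> \<le> ?x}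
          \<le> prob D * ((?x + ?z * sqrt (h l)) / sqrt (real (z ^ 4) * h l) + 2 * real (z ^ 4) * (fact (2 * k) / (2 ^ k * fact k) / ?z ^ (2 * k)))"
        using h[of l] z1 by (intro walk_stays_below_prob[OF t0 h D]) auto
      also have "(?x + ?z * sqrt (h l)) / sqrt (real (z ^ 4) * h l) = 5 / ?z"
      proof -
        have "sqrt (real (z ^ 4) * h l) = ?z\<^sup>2 * sqrt (h l)"
          using real_sqrt_abs[of "?z\<^sup>2"] by (simp add: real_sqrt_mult power_mult[symmetric] flip: power_mult)
        then show ?thesis using h[of l] z1 by (simp add: field_simps power2_eq_square)
      qed
      also have "2 * real (z ^ 4) * (fact (2 * k) / (2 ^ k * fact k) / ?z ^ (2 * k)) \<le> 2 * K / ?z"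
      proof -
        have "?z ^ 4 * ?z \<le> ?z ^ (2 * k)" unfolding power_Suc2[symmetric] k_def using z1 by (intro power_increasing) auto
        then have "?z ^ 4 / ?z ^ (2 * k) \<le> 1 / ?z" using z1 by (simp add: divide_simps)
        then have "2 * K * (?z ^ 4 / ?z ^ (2 * k)) \<le> 2 * K * (1 / ?z)" using K by (intro mult_left_mono) auto
        then show ?thesis by (simp add: K_def gauss_moment_def mult_ac)
      qed
      finally have "prob {\<omega>\<in>D. \<forall>j\<le>z ^ 4. walk (- 1) (real i * h l) (h l) j \<omega> \<le> ?x} \<le> prob D * (5 / ?z + 2 * K / ?z)"
        by (simp add: mult_left_mono add_left_mono)
      also have "\<dots> = \<rho> * prob D" by (simp add: \<rho>_def add_divide_distrib mult.commute)
      also have "{\<omega>\<in>D. \<forall>j\<le>z ^ 4. walk (- 1) (real i * h l) (h l) j \<omega> \<le> ?x}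
          = {\<omega>\<in>D. \<forall>j\<le>z ^ 4. - 2 * ?\<epsilon> l \<le> W (real (i + j) * h l) \<omega> - W (real i * h l) \<omega>}"
      proof -
        have "walk (- 1) (real i * h l) (h l) j \<omega> \<le> ?x \<longleftrightarrow> - 2 * ?\<epsilon> l \<le> W (real (i + j) * h l) \<omega> - W (real i * h l) \<omega>" for j \<omega>
        proof -
          have "real i * h l + real j * h l = real (i + j) * h l" by (simp add: distrib_right)
          moreover have "?x = 2 * ?\<epsilon> l" by (simp add: sqrt_h)
          ultimately show ?thesis unfolding walk_def by auto
        qed
        then show ?thesis by simp
      qed
      finally show ?thesis .
    qed
    have cnt: "\<exists>A. A \<in> events \<and> prob A \<le> real (Suc (?N l)) * \<rho> ^ m \<and> (\<forall>\<omega>\<in>space M. \<omega> \<notin> A \<longrightarrow>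
        card {i\<in>{..?N l}. \<forall>j\<in>{..?N l}. W (real i * h l) \<omega> \<le> W (real j * h l) \<omega> + ?\<epsilon> l} \<le> Suc m * z ^ 4)" for l
      by (rule near_minimum_count_prob[OF h \<rho> _ stay, of l "?N l" m]) auto
    define A' where "A' l = (SOME A. A \<in> events \<and> prob A \<le> real (Suc (?N l)) * \<rho> ^ m \<and> (\<forall>\<omega>\<in>space M. \<omega> \<notin> A \<longrightarrow>
        card {i\<in>{..?N l}. \<forall>j\<in>{..?N l}. W (real i * h l) \<omega> \<le> W (real j * h l) \<omega> + ?\<epsilon> l} \<le> Suc m * z ^ 4))" for l
    have "A' l \<in> events \<and> prob (A' l) \<le> real (Suc (?N l)) * \<rho> ^ m \<and> (\<forall>\<omega>\<in>space M. \<omega> \<notin> A' l \<longrightarrow>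
        card {i\<in>{..?N l}. \<forall>j\<in>{..?N l}. W (real i * h l) \<omega> \<le> W (real j * h l) \<omega> + ?\<epsilon> l} \<le> Suc m * z ^ 4)" for l
      unfolding A'_def by (rule someI_ex[OF cnt])
    note A'_all = this
    have A': "A' l \<in> events" "prob (A' l) \<le> real (Suc (?N l)) * \<rho> ^ m"
      "\<omega> \<in> space M \<Longrightarrow> \<omega> \<notin> A' l \<Longrightarrow>
        card {i\<in>{..?N l}. \<forall>j\<in>{..?N l}. W (real i * h l) \<omega> \<le> W (real j * h l) \<omega> + ?\<epsilon> l} \<le> Suc m * z ^ 4" for l \<omega>
      by (rule conjunct1[OF A'_all], rule conjunct1[OF conjunct2[OF A'_all]],
          rule conjunct2[OF conjunct2[OF A'_all], rule_format])
    let ?B1 = "\<Union>l\<in>{..L}. \<Union>i\<in>{..<?N l}. A l i" and ?B2 = "\<Union>l\<in>{..<L}. A' l"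
    have B1: "?B1 \<in> events" using A(1) by (intro sets.finite_UN) auto
    have B2: "?B2 \<in> events" using A'(1) by (intro sets.finite_UN) auto
    have zk: "?z ^ (2 * L) / ?z ^ (2 * k) \<le> 1 / ?z ^ (2 * Q)"
    proof -
      have "?z ^ (2 * L) * ?z ^ (2 * Q) \<le> ?z ^ (2 * k)" unfolding power_add[symmetric] k_def using z1 by (intro power_increasing) auto
      then show ?thesis using z1 by (simp add: divide_simps)
    qed
    have P1: "prob ?B1 \<le> real (Suc L) * (4 * K) / ?z ^ (2 * Q)"
    proof -
      have "prob ?B1 \<le> (\<Sum>l\<in>{..L}. prob (\<Union>i\<in>{..<?N l}. A l i))"
        using A(1) by (intro finite_measure_subadditive_finite) auto
      also have "\<dots> \<le> (\<Sum>l\<in>{..L}. 4 * K * (1 / ?z ^ (2 * Q)))"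
      proof (rule sum_mono)
        fix l assume "l \<in> {..L}"
        then have l: "l \<le> L" by simp
        have "prob (\<Union>i\<in>{..<?N l}. A l i) \<le> (\<Sum>i\<in>{..<?N l}. prob (A l i))"
          using A(1) by (intro finite_measure_subadditive_finite) auto
        also have "\<dots> \<le> (\<Sum>i\<in>{..<?N l}. 4 * (K / ?z ^ (2 * k)))" using A(2) by (intro sum_mono) auto
        also have "\<dots> = real (?N l) * (4 * (K / ?z ^ (2 * k)))" by simp
        also have "\<dots> \<le> ?z ^ (2 * L) * (4 * (K / ?z ^ (2 * k)))"
          using N_le[OF l] K z1 by (intro mult_right_mono) auto
        also have "\<dots> = 4 * K * (?z ^ (2 * L) / ?z ^ (2 * k))" by simp
        also have "\<dots> \<le> 4 * K * (1 / ?z ^ (2 * Q))" using zk K by (intro mult_left_mono) auto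
        finally show "prob (\<Union>i\<in>{..<?N l}. A l i) \<le> 4 * K * (1 / ?z ^ (2 * Q))" .
      qed
      also have "\<dots> = real (Suc L) * (4 * K) / ?z ^ (2 * Q)" by simp
      finally show ?thesis .
    qed
    have P2: "prob ?B2 \<le> real L * (2 * (5 + 2 * K) ^ m) / ?z ^ (2 * Q)"
    proof -
      have "prob ?B2 \<le> (\<Sum>l\<in>{..<L}. prob (A' l))"
        using A'(1) by (intro finite_measure_subadditive_finite) auto
      also have "\<dots> \<le> (\<Sum>l\<in>{..<L}. 2 * (5 + 2 * K) ^ m / ?z ^ (2 * Q))"
      proof (rule sum_mono)
        fix l assume "l \<in> {..<L}"
        then have l: "l \<le> L" by simp
        have "1 \<le> ?z ^ (2 * L)" using z1 by (simp add: one_le_power)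
        then have "real (Suc (?N l)) \<le> 2 * ?z ^ (2 * L)" using N_le[OF l] by simp
        then have "real (Suc (?N l)) * \<rho> ^ m \<le> (2 * ?z ^ (2 * L)) * \<rho> ^ m" using \<rho> by (intro mult_right_mono) auto
        also have "\<dots> = 2 * (5 + 2 * K) ^ m * (?z ^ (2 * L) / ?z ^ m)" by (simp add: \<rho>_def power_divide)
        also have "?z ^ (2 * L) / ?z ^ m = 1 / ?z ^ (2 * Q)" using z1 by (simp add: m_def power_add)
        finally show "prob (A' l) \<le> 2 * (5 + 2 * K) ^ m / ?z ^ (2 * Q)" using A'(2)[of l] by simp
      qed
      also have "\<dots> = real L * (2 * (5 + 2 * K) ^ m) / ?z ^ (2 * Q)" by simp
      finally show ?thesis .
    qed
    have "prob (?B1 \<union> ?B2) \<le> prob ?B1 + prob ?B2" by (rule measure_Un_le[OF B1 B2])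
    also have "\<dots> \<le> C / ?z ^ (2 * Q)" using P1 P2 by (simp add: C_def add_divide_distrib)
    finally have P: "prob (?B1 \<union> ?B2) \<le> C / ?z ^ (2 * Q)" .
    have "good_path z L m \<omega>" if \<omega>: "\<omega> \<in> space M" "\<omega> \<notin> ?B1 \<union> ?B2" "continuous_on {0..} (\<lambda>t. W t \<omega>)" for \<omega>
      unfolding good_path_def
    proof (intro conjI allI impI)
      fix l i assume "l \<le> L" "i < ?N l"
      then have "\<omega> \<notin> A l i" using \<omega>(2) by blast
      from A(3)[OF \<omega>(1) this \<omega>(3)]
      have "\<forall>u\<in>{real i * h l..real i * h l + h l}. \<bar>W u \<omega> - W (real i * h l) \<omega>\<bar> \<le> ?z / ?z ^ l"
        by (simp add: sqrt_h)
      moreover have "real (Suc i) * h l = real i * h l + h l" by (simp add: distrib_right)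
      ultimately show "\<forall>u\<in>{real i / real (?N l)..real (Suc i) / real (?N l)}. \<bar>W u \<omega> - W (real i / real (?N l)) \<omega>\<bar> \<le> ?z / ?z ^ l"
        unfolding ih by (simp only:)
    next
      fix l assume "l < L"
      then have "\<omega> \<notin> A' l" using \<omega>(2) by blast
      from A'(3)[OF \<omega>(1) this]
      show "card {i\<in>{..?N l}. \<forall>j\<in>{..?N l}. W (real i / real (?N l)) \<omega> \<le> W (real j / real (?N l)) \<omega> + ?\<epsilon> l} \<le> Suc m * z ^ 4"
        unfolding ih .
    qed
    then show ?thesis using B1 B2 P by (intro bexI[of _ "?B1 \<union> ?B2"]) auto
  qed
  with C show thesis by (rule that)
qed

definition search_min :: "nat \<Rightarrow> nat \<Rightarrow> nat \<Rightarrow> 'a \<Rightarrow> real" where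
  "search_min z L n \<omega> = Min ((\<lambda>j. W (real j / (z\<^sup>2) ^ L) \<omega>) `
     refinement_search.visited (z\<^sup>2) L (\<lambda>l. real z / real z ^ l) (\<lambda>j. W (real j / (z\<^sup>2) ^ L) \<omega>) (n - 1))"

end

subsection \<open>The error of the search\<close>

lemma reflected_square_bound:
  fixes w a b s V :: real
  assumes "0 \<le> s" "\<bar>w\<bar> \<le> V" "\<bar>a\<bar> \<le> V" "\<bar>b\<bar> \<le> V"
  shows "\<bar>(w + max s (- a))\<^sup>2 - (w + max s (- b))\<^sup>2\<bar> \<le> (2 * V + s)\<^sup>2"
proof -
  have "(w + max s (- a))\<^sup>2 \<le> (2 * V + s)\<^sup>2" "(w + max s (- b))\<^sup>2 \<le> (2 * V + s)\<^sup>2"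
    using assms by (auto simp: abs_le_square_iff[symmetric])
  then show ?thesis using zero_le_power2[of "w + max s (- a)"] zero_le_power2[of "w + max s (- b)"] by linarith
qed

lemma reflected_square_diff:
  fixes w a b s V :: real
  assumes "0 \<le> s" "\<bar>w\<bar> \<le> V" "\<bar>a\<bar> \<le> V" "\<bar>b\<bar> \<le> V"
  shows "\<bar>(w + max s (- a))\<^sup>2 - (w + max s (- b))\<^sup>2\<bar> \<le> \<bar>a - b\<bar> * (4 * V + 2 * s)"
proof -
  have "(w + max s (- a))\<^sup>2 - (w + max s (- b))\<^sup>2 = (max s (- a) - max s (- b)) * (2 * w + max s (- a) + max s (- b))"
    by (simp add: power2_eq_square algebra_simps)
  moreover have "\<bar>max s (- a) - max s (- b)\<bar> \<le> \<bar>a - b\<bar>" by linarith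
  moreover have "\<bar>2 * w + max s (- a) + max s (- b)\<bar> \<le> 4 * V + 2 * s" using assms by linarith
  ultimately show ?thesis by (simp add: abs_mult mult_mono)
qed

text \<open>The output is a value of the path at a time in \<open>{0..1}\<close>, on bad paths as
  well; the maximum of \<open>\<bar>W u \<omega>\<bar>\<close> therefore always bounds it.\<close>

lemma (in brownian) search_min_attained:
  assumes "1 \<le> z"
  shows "\<exists>u\<in>{0..1}. search_min z L n \<omega> = W u \<omega>"
proof -
  interpret refinement_search "z\<^sup>2" L "\<lambda>l. real z / real z ^ l" by unfold_locales (use assms in simp)
  define g where "g j = W (real j / (z\<^sup>2) ^ L) \<omega>" for j
  have "Min (g ` visited g (n - 1)) \<in> g ` visited g (n - 1)"
    using finite_visited visited_nonempty by (intro Min_in) auto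
  then obtain j where j: "j \<in> visited g (n - 1)" "Min (g ` visited g (n - 1)) = g j" by blast
  have "j \<le> (z\<^sup>2) ^ L" using j(1) visited_subset by blast
  then have "real j \<le> real ((z\<^sup>2) ^ L)" by (simp only: of_nat_le_iff)
  then have "real j / (z\<^sup>2) ^ L \<in> {0..1}" using assms by simp
  moreover have "search_min z L n \<omega> = W (real j / (z\<^sup>2) ^ L) \<omega>"
    using j(2) unfolding search_min_def g_def .
  ultimately show ?thesis by blast
qed

text \<open>On a good path, the left end of the interval around the minimiser \<open>v\<close> is
  within the tolerance at each level. The bound on the number of evaluations is
  \<open>2 + L * Suc m * z ^ 6\<close>; the condition on \<open>z\<^sup>2\<close> puts it below
  \<open>z ^ 8\<close>.\<close>

lemma (in brownian) search_min_le:
  assumes z: "1 \<le> z" "L * Suc m + 3 \<le> z\<^sup>2" and n: "z ^ 8 \<le> n"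
    and good: "good_path z L m \<omega>"
    and v: "v \<in> {0..1}" "\<forall>u\<in>{0..1}. W v \<omega> \<le> W u \<omega>"
  shows "search_min z L n \<omega> \<le> W v \<omega> + real z / real z ^ L"
proof -
  interpret refinement_search "z\<^sup>2" L "\<lambda>l. real z / real z ^ l" by unfold_locales (use z in simp)
  define g where "g j = W (real j / real ((z\<^sup>2) ^ L)) \<omega>" for j
  have sm: "search_min z L n \<omega> = Min (g ` visited g (n - 1))" unfolding search_min_def g_def by simp
  have N: "0 < real ((z\<^sup>2) ^ l)" for l using z by simp
  have mesh_N: "(z\<^sup>2) ^ l * mesh l = (z\<^sup>2) ^ L" if "l \<le> L" for l using that by (simp add: mesh_def flip: power_add)
  have mesh_pos: "0 < mesh l" for l using z by (simp add: mesh_def)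
  have mesh_Suc: "mesh l = z\<^sup>2 * mesh (Suc l)" if "l < L" for l
  proof -
    have "L - l = Suc (L - Suc l)" using that by simp
    then show ?thesis by (simp add: mesh_def)
  qed
  have g_mesh: "g (i * mesh l) = W (real i / real ((z\<^sup>2) ^ l)) \<omega>" if "l \<le> L" for i l
    unfolding g_def mesh_N[OF that, symmetric] of_nat_mult using mesh_pos[of l] by simp
  show ?thesis
  \<comment> \<open>Time 1 is the left end of no interval, but it is visited from the start.\<close>
  proof (cases "v = 1")
    case True
    have "Min (g ` visited g (n - 1)) \<le> g ((z\<^sup>2) ^ L)"
      using finite_visited end_visited by (intro Min_le) auto
    also have "g ((z\<^sup>2) ^ L) = W v \<omega>" using z by (simp add: g_def True)
    finally show ?thesis unfolding sm by (simp add: add_increasing2)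
  next
    case False
    then have v1: "0 \<le> v" "v < 1" using v(1) by auto
    \<comment> \<open>The number of the interval of level \<open>l\<close> that contains
      \<open>v\<close>. Iterated floors are consistent, so these intervals are nested.\<close>
    define i where "i l = nat \<lfloor>v * real ((z\<^sup>2) ^ l)\<rfloor>" for l
    have i_le: "real (i l) \<le> v * real ((z\<^sup>2) ^ l)" and i_gt: "v * real ((z\<^sup>2) ^ l) < real (Suc (i l))" for l
    proof -
      have "0 \<le> v * real ((z\<^sup>2) ^ l)" using v1 by simp
      then show "real (i l) \<le> v * real ((z\<^sup>2) ^ l)" "v * real ((z\<^sup>2) ^ l) < real (Suc (i l))"
        unfolding i_def by linarith+
    qed
    have i_less: "i l < (z\<^sup>2) ^ l" for l
    proof -
      have "v * real ((z\<^sup>2) ^ l) < 1 * real ((z\<^sup>2) ^ l)" using v1(2) N[of l] by (rule mult_strict_right_mono)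
      then have "real (i l) < real ((z\<^sup>2) ^ l)" using i_le[of l] by linarith
      then show ?thesis by (simp only: of_nat_less_iff)
    qed
    have i_div: "i (Suc l) div z\<^sup>2 = i l" for l
    proof -
      have "v * real ((z\<^sup>2) ^ l) = v * real ((z\<^sup>2) ^ Suc l) / real_of_int (int (z\<^sup>2))" using z by simp
      then have "\<lfloor>v * real ((z\<^sup>2) ^ l)\<rfloor> = \<lfloor>v * real ((z\<^sup>2) ^ Suc l)\<rfloor> div int (z\<^sup>2)"
        using floor_divide_real_eq_div[of "int (z\<^sup>2)" "v * real ((z\<^sup>2) ^ Suc l)"] by (simp only: of_nat_0_le_iff simp_thms)
      then show ?thesis unfolding i_def by (simp only: nat_div_distrib' of_nat_0_le_iff nat_int)
    qed
    have "Min (g ` visited g (n - 1)) \<le> W v \<omega> + real z / real z ^ L"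
    proof (rule search_correct[where a = "\<lambda>l. i l * mesh l"])
      fix j assume "j \<le> (z\<^sup>2) ^ L"
      then have "real j \<le> real ((z\<^sup>2) ^ L)" by (simp only: of_nat_le_iff)
      then have "real j / real ((z\<^sup>2) ^ L) \<in> {0..1}" using N[of L] by simp
      then show "W v \<omega> \<le> g j" unfolding g_def by (rule bspec[OF v(2)])
    next
      show "i 0 * mesh 0 = 0" using i_less[of 0] by simp
    next
      fix l assume l: "l \<le> L"
      show "i l * mesh l < (z\<^sup>2) ^ L"
        unfolding mesh_N[OF l, symmetric] using i_less[of l] mesh_pos[of l] by (rule mult_strict_right_mono)
      show "mesh l dvd i l * mesh l" by simp
      have "v \<in> {real (i l) / real ((z\<^sup>2) ^ l)..real (Suc (i l)) / real ((z\<^sup>2) ^ l)}"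
        using i_le[of l] i_gt[of l] N[of l] by (simp add: pos_divide_le_eq pos_le_divide_eq)
      then have "\<bar>W v \<omega> - W (real (i l) / real ((z\<^sup>2) ^ l)) \<omega>\<bar> \<le> real z / real z ^ l"
        using good l i_less[of l] unfolding good_path_def by blast
      then show "g (i l * mesh l) \<le> W v \<omega> + real z / real z ^ l" unfolding g_mesh[OF l] by linarith
    next
      fix l assume l: "l < L"
      have "i (Suc l) * mesh (Suc l) div mesh l = i (Suc l) div z\<^sup>2"
        unfolding mesh_Suc[OF l] using mesh_pos[of "Suc l"] by simp
      then show "parent l (i (Suc l) * mesh (Suc l)) = i l * mesh l" by (simp add: parent_def i_div mult.commute)
    next
      have "card (near g (W v \<omega>) l) \<le> Suc m * z ^ 4" if l: "l < L" for l
      proof -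
        have "card (near g (W v \<omega>) l) \<le> card {i\<in>{..(z\<^sup>2) ^ l}. \<forall>j\<in>{..(z\<^sup>2) ^ l}.
          W (real i / real ((z\<^sup>2) ^ l)) \<omega> \<le> W (real j / real ((z\<^sup>2) ^ l)) \<omega> + 2 * (real z / real z ^ l)}"
        proof (rule card_mono)
          show "near g (W v \<omega>) l \<subseteq> {i\<in>{..(z\<^sup>2) ^ l}. \<forall>j\<in>{..(z\<^sup>2) ^ l}.
            W (real i / real ((z\<^sup>2) ^ l)) \<omega> \<le> W (real j / real ((z\<^sup>2) ^ l)) \<omega> + 2 * (real z / real z ^ l)}"
          proof
            fix k assume k: "k \<in> near g (W v \<omega>) l"
            have "W (real k / real ((z\<^sup>2) ^ l)) \<omega> \<le> W (real j / real ((z\<^sup>2) ^ l)) \<omega> + 2 * (real z / real z ^ l)"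
              if "j \<le> (z\<^sup>2) ^ l" for j
            proof -
              have "real j \<le> real ((z\<^sup>2) ^ l)" using that by (simp only: of_nat_le_iff)
              then have "real j / real ((z\<^sup>2) ^ l) \<in> {0..1}" using N[of l] by simp
              then have "W v \<omega> \<le> W (real j / real ((z\<^sup>2) ^ l)) \<omega>" by (rule bspec[OF v(2)])
              moreover have "g (k * mesh l) \<le> W v \<omega> + 2 * (real z / real z ^ l)" using k by (simp add: near_def)
              ultimately show ?thesis using g_mesh[of l k] l by linarith
            qed
            moreover have "k < (z\<^sup>2) ^ l" using k by (simp add: near_def)
            ultimately show "k \<in> {i\<in>{..(z\<^sup>2) ^ l}. \<forall>j\<in>{..(z\<^sup>2) ^ l}.
              W (real i / real ((z\<^sup>2) ^ l)) \<omega> \<le> W (real j / real ((z\<^sup>2) ^ l)) \<omega> + 2 * (real z / real z ^ l)}"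
              by (intro CollectI conjI ballI) auto
          qed
        qed simp
        also have "\<dots> \<le> Suc m * z ^ 4" using good l unfolding good_path_def by blast
        finally show ?thesis .
      qed
      then have "(\<Sum>l<L. z\<^sup>2 * card (near g (W v \<omega>) l)) \<le> (\<Sum>l<L. z\<^sup>2 * (Suc m * z ^ 4))"
        by (intro sum_mono mult_left_mono) auto
      also have "\<dots> = L * Suc m * z ^ 6" by (simp add: eval_nat_numeral algebra_simps)
      finally have "2 + (\<Sum>l<L. z\<^sup>2 * card (near g (W v \<omega>) l)) \<le> 2 + L * Suc m * z ^ 6" by (rule add_left_mono)
      also have "\<dots> < n"
      proof -
        have "1 \<le> z ^ 6" using z by simp
        then have "2 + L * Suc m * z ^ 6 < (L * Suc m + 3) * z ^ 6" by (simp only: distrib_right)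
        also have "\<dots> \<le> z\<^sup>2 * z ^ 6" using z(2) by (rule mult_right_mono) simp
        also have "\<dots> = z ^ 8" by (simp flip: power_add)
        finally show ?thesis using n by simp
      qed
      finally show "2 + (\<Sum>l<L. z\<^sup>2 * card (near g (W v \<omega>) l)) < n" .
    qed
    then show ?thesis unfolding sm .
  qed
qed

lemma sqrt_bound_ennreal:
  fixes a :: ennreal
  assumes "a\<^sup>2 \<le> ennreal (b\<^sup>2)" "0 \<le> b"
  shows "a \<le> ennreal b"
proof (cases a)
  case (real r)
  then have "r\<^sup>2 \<le> b\<^sup>2" using assms by (simp add: ennreal_power ennreal_le_iff)
  then show ?thesis using real assms(2) by (auto intro: ennreal_leI power2_le_imp_le)
next
  case top
  then show ?thesis using assms(1) by (simp add: power2_eq_square ennreal_top_mult top_unique)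
qed

text \<open>The scale is the integer part of the eighth root of \<open>n\<close>. As that root is at
  least 1, rounding down loses at most a factor 2.\<close>

lemma eighth_root_scale:
  assumes "1 \<le> n"
  obtains z :: nat where "1 \<le> z" "z ^ 8 \<le> n" "real n \<le> (2 * real z) ^ 8"
proof -
  define r where "r = root 8 (real n)"
  have r: "r ^ 8 = real n" "1 \<le> r" using assms by (auto simp: r_def)
  define z where "z = nat \<lfloor>r\<rfloor>"
  have z: "1 \<le> z" "real z \<le> r" "r < real z + 1" using r(2) unfolding z_def by linarith+
  have "real z ^ 8 \<le> r ^ 8" using z(2) by (intro power_mono) auto
  then have "z ^ 8 \<le> n" unfolding r(1) by (metis of_nat_le_iff of_nat_power)
  moreover have "r ^ 8 \<le> (2 * real z) ^ 8" using z r(2) by (intro power_mono) linarith+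
  ultimately show thesis using z(1) that r(1) by simp
qed

context sq_bessel
begin

definition approx :: "nat \<Rightarrow> nat \<Rightarrow> nat \<Rightarrow> 'a \<Rightarrow> real" where
  "approx z L n \<omega> = (W 1 \<omega> + max (sqrt x0) (- search_min z L n \<omega>))\<^sup>2"

lemma approx_adaptive:
  assumes "1 \<le> z" "1 \<le> n"
  shows "approx z L n \<in> adaptive_methods M W n"
proof -
  interpret refinement_search "z\<^sup>2" L "\<lambda>l. real z / real z ^ l" by unfold_locales (use assms in simp)
  show ?thesis
    using adaptive_method[of W M n "sqrt x0"] W_M assms(2) unfolding approx_def[abs_def] search_min_def by simp
qed

lemma approx_M: "1 \<le> z \<Longrightarrow> 1 \<le> n \<Longrightarrow> approx z L n \<in> borel_measurable M"
  using approx_adaptive unfolding adaptive_methods_def by blast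

lemma approx_error_bound:
  assumes "1 \<le> z" "\<forall>u\<in>{0..1}. \<bar>W u \<omega>\<bar> \<le> V" "v \<in> {0..1}"
  shows "\<bar>(W 1 \<omega> + max (sqrt x0) (- W v \<omega>))\<^sup>2 - approx z L n \<omega>\<bar> \<le> (2 * V + sqrt x0)\<^sup>2"
proof -
  obtain u where "u \<in> {0..1}" "search_min z L n \<omega> = W u \<omega>" using search_min_attained[OF assms(1)] by blast
  then show ?thesis unfolding approx_def using assms x0 by (intro reflected_square_bound) auto
qed

text \<open>Of the two extra levels, one pays for the factor \<open>z\<close> in the tolerance, the
  other for the bound \<open>z\<close> on the path, which is the oscillation bound at level
  0.\<close>

lemma approx_error_good:
  assumes z: "1 \<le> z" "Suc (Suc K) * Suc m + 3 \<le> z\<^sup>2" and n: "z ^ 8 \<le> n"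
    and good: "good_path z (Suc (Suc K)) m \<omega>" and W0: "W 0 \<omega> = 0"
    and v: "v \<in> {0..1}" "\<forall>u\<in>{0..1}. W v \<omega> \<le> W u \<omega>"
  shows "\<bar>(W 1 \<omega> + max (sqrt x0) (- W v \<omega>))\<^sup>2 - approx z (Suc (Suc K)) n \<omega>\<bar> \<le> (4 + 2 * sqrt x0) / real z ^ K"
proof -
  have z1: "1 \<le> real z" using z(1) by simp
  obtain u where u: "u \<in> {0..1}" "search_min z (Suc (Suc K)) n \<omega> = W u \<omega>" using search_min_attained[OF z(1)] by blast
  have bound: "\<bar>W u \<omega>\<bar> \<le> real z" if "u \<in> {0..1}" for u
  proof -
    have "\<forall>i<(z\<^sup>2) ^ 0. \<forall>u\<in>{real i / real ((z\<^sup>2) ^ 0)..real (Suc i) / real ((z\<^sup>2) ^ 0)}.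
        \<bar>W u \<omega> - W (real i / real ((z\<^sup>2) ^ 0)) \<omega>\<bar> \<le> real z / real z ^ 0"
      using good unfolding good_path_def by blast
    then show ?thesis using that W0 by simp
  qed
  have "W v \<omega> \<le> W u \<omega>" using v(2) u(1) by blast
  moreover have "W u \<omega> \<le> W v \<omega> + real z / real z ^ Suc (Suc K)"
    using search_min_le[OF z n good v] unfolding u(2) .
  ultimately have d: "\<bar>W v \<omega> - W u \<omega>\<bar> \<le> real z / real z ^ Suc (Suc K)" by linarith
  have "\<bar>(W 1 \<omega> + max (sqrt x0) (- W v \<omega>))\<^sup>2 - approx z (Suc (Suc K)) n \<omega>\<bar> \<le> \<bar>W v \<omega> - W u \<omega>\<bar> * (4 * real z + 2 * sqrt x0)"
    unfolding approx_def u(2) using bound v(1) u(1) x0 by (intro reflected_square_diff) auto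
  also have "\<dots> \<le> (real z / real z ^ Suc (Suc K)) * (real z * (4 + 2 * sqrt x0))"
  proof (rule mult_mono[OF d])
    have "1 * (2 * sqrt x0) \<le> real z * (2 * sqrt x0)" using z1 x0 by (intro mult_right_mono) auto
    then show "4 * real z + 2 * sqrt x0 \<le> real z * (4 + 2 * sqrt x0)" by (simp add: algebra_simps)
  qed (use z1 x0 in auto)
  also have "\<dots> = (4 + 2 * sqrt x0) / real z ^ K" using z1 by simp
  finally show ?thesis .
qed

text \<open>Good paths contribute the pointwise error. On the exceptional event the Cauchy-Schwarz
  inequality is used, with the root of its probability and a second moment of the error power that
  is finite uniformly in \<open>z\<close>.\<close>

lemma moment_bound:
  assumes p: "1 \<le> p"
  obtains C where "0 \<le> C" "\<And>n. 1 \<le> n \<Longrightarrow> \<exists>Y\<in>adaptive_methods M W n.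
    (\<integral>\<^sup>+\<omega>. ennreal (\<bar>X 1 \<omega> - Y \<omega>\<bar> powr p) \<partial>M) \<le> ennreal (C * real n powr (- (q * p)))"
proof -
  let ?s = "sqrt x0"
  have s: "0 \<le> ?s" using x0 by simp
  \<comment> \<open>As \<open>z ^ 8\<close> is comparable to \<open>n\<close>, the target is
    \<open>z powr (- r)\<close>. \<open>K\<close> yields it on good paths and \<open>Q\<close>
    through the root of the exceptional probability. The squared error power is at most
    \<open>2 * V + ?s\<close> to the power \<open>4 * p\<close>, whence \<open>P\<close>.\<close>
  define r where "r = 8 * \<bar>q\<bar> * p"
  have r: "0 \<le> r" using p by (simp add: r_def)
  define K where "K = nat \<lceil>8 * \<bar>q\<bar>\<rceil>"
  define Q where "Q = nat \<lceil>r\<rceil>"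
  define P where "P = nat \<lceil>4 * p\<rceil>"
  have KQP: "8 * \<bar>q\<bar> \<le> real K" "r \<le> real Q" "4 * p \<le> real P" unfolding K_def Q_def P_def by linarith+
  obtain T where T: "T \<in> borel_measurable M" "(\<integral>\<^sup>+\<omega>. T \<omega> \<partial>M) < \<infinity>"
    "AE \<omega> in M. \<exists>V\<ge>1. (\<forall>u\<in>{0..1}. \<bar>W u \<omega>\<bar> \<le> V) \<and> ennreal ((2 * V + ?s) ^ P) \<le> T \<omega>"
    by (rule moment_majorant[OF s, of P])
  define t where "t = enn2real (\<integral>\<^sup>+\<omega>. T \<omega> \<partial>M)"
  have t: "0 \<le> t" "(\<integral>\<^sup>+\<omega>. T \<omega> \<partial>M) = ennreal t" using T(2) by (auto simp: t_def)
  obtain C0 m where C0: "0 \<le> C0" "\<And>z. 1 \<le> z \<Longrightarrow> \<exists>A\<in>events. prob A \<le> C0 / real z ^ (2 * Q) \<and>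
    (\<forall>\<omega>\<in>space M. \<omega> \<notin> A \<longrightarrow> continuous_on {0..} (\<lambda>t. W t \<omega>) \<longrightarrow> good_path z (Suc (Suc K)) m \<omega>)"
    using good_path_prob[where Q = Q and L = "Suc (Suc K)"] by metis
  define Z where "Z = Suc (Suc K) * Suc m + 3"
  define C1 where "C1 = (4 + 2 * ?s) powr p + sqrt (t * C0)"
  \<comment> \<open>The second summand covers the scales with \<open>z\<^sup>2 < Z\<close>, too
    small for the evaluation count; there \<open>z \<le> Z\<close>, and the bound
    \<open>1 + t\<close> suffices.\<close>
  define C2 where "C2 = C1 + (1 + t) * real Z powr r"
  have C: "0 \<le> C1" "0 \<le> C2" using t(1) C0(1) by (auto simp: C1_def C2_def)
  define D where "D z n \<omega> = ennreal (\<bar>X 1 \<omega> - approx z (Suc (Suc K)) n \<omega>\<bar> powr p)" for z n \<omega>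
  have DM: "D z n \<in> borel_measurable M" if "1 \<le> z" "1 \<le> n" for z n
  proof -
    have [measurable]: "approx z (Suc (Suc K)) n \<in> borel_measurable M" "X 1 \<in> borel_measurable M"
      using approx_M[OF that] X_M by auto
    show ?thesis unfolding D_def[abs_def] by measurable
  qed
  have D2: "AE \<omega> in M. D z n \<omega> ^ 2 \<le> T \<omega>" if z: "1 \<le> z" for z n
    using T(3) terminal_value
  proof eventually_elim
    case (elim \<omega>)
    obtain V where V: "1 \<le> V" "\<forall>u\<in>{0..1}. \<bar>W u \<omega>\<bar> \<le> V" "ennreal ((2 * V + ?s) ^ P) \<le> T \<omega>" using elim(1) by blast
    obtain v where v: "v \<in> {0..1}" "X 1 \<omega> = (W 1 \<omega> + max ?s (- W v \<omega>))\<^sup>2" using elim(2) by blast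
    have V': "1 \<le> 2 * V + ?s" using V(1) s by linarith
    have "\<bar>X 1 \<omega> - approx z (Suc (Suc K)) n \<omega>\<bar> powr p \<le> ((2 * V + ?s)\<^sup>2) powr p"
      unfolding v(2) using p by (intro powr_mono2 approx_error_bound[OF z V(2) v(1)]) auto
    also have "\<dots> = (2 * V + ?s) powr (2 * p)" using V' by (simp add: powr_powr flip: powr_numeral)
    finally have "(\<bar>X 1 \<omega> - approx z (Suc (Suc K)) n \<omega>\<bar> powr p)\<^sup>2 \<le> ((2 * V + ?s) powr (2 * p))\<^sup>2"
      by (intro power_mono) auto
    also have "\<dots> = (2 * V + ?s) powr (4 * p)" by (simp add: power2_eq_square flip: powr_add)
    also have "\<dots> \<le> (2 * V + ?s) powr real P" using V' KQP(3) by (intro powr_mono) auto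
    also have "\<dots> = (2 * V + ?s) ^ P" using V' by (simp add: powr_realpow)
    finally have "ennreal ((\<bar>X 1 \<omega> - approx z (Suc (Suc K)) n \<omega>\<bar> powr p)\<^sup>2) \<le> ennreal ((2 * V + ?s) ^ P)" by (rule ennreal_leI)
    also note V(3)
    finally show ?case unfolding D_def by (simp add: ennreal_power)
  qed
  have coarse: "(\<integral>\<^sup>+\<omega>. D z n \<omega> \<partial>M) \<le> ennreal (1 + t)" if z: "1 \<le> z" for z n
  proof -
    have "AE \<omega> in M. D z n \<omega> \<le> 1 + T \<omega>" using D2[OF z, of n]
    proof eventually_elim
      case (elim \<omega>)
      have "x \<le> 1 + x\<^sup>2" if "0 \<le> x" for x :: real
        using zero_le_power2[of "x - 1"] that by (simp add: power2_eq_square algebra_simps)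
      then have "D z n \<omega> \<le> 1 + D z n \<omega> ^ 2"
        unfolding D_def by (simp add: ennreal_power flip: ennreal_1 ennreal_plus)
      also have "\<dots> \<le> 1 + T \<omega>" using elim by (rule add_left_mono)
      finally show ?case .
    qed
    then have "(\<integral>\<^sup>+\<omega>. D z n \<omega> \<partial>M) \<le> (\<integral>\<^sup>+\<omega>. 1 + T \<omega> \<partial>M)" by (rule nn_integral_mono_AE)
    also have "\<dots> = 1 + ennreal t" using T(1) by (subst nn_integral_add) (auto simp: emeasure_space_1 t(2))
    finally show ?thesis using t(1) by (simp add: ennreal_plus)
  qed
  have fine: "(\<integral>\<^sup>+\<omega>. D z n \<omega> \<partial>M) \<le> ennreal (C1 * real z powr (- r))" if z: "1 \<le> z" "Z \<le> z\<^sup>2" "z ^ 8 \<le> n" for z n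
  proof -
    have z1: "1 \<le> real z" using z(1) by simp
    have "1 \<le> z ^ 8" using z(1) by simp
    then have n: "1 \<le> n" using z(3) by linarith
    note [measurable] = DM[OF z(1) n]
    obtain A where A: "A \<in> events" "prob A \<le> C0 / real z ^ (2 * Q)"
      "\<forall>\<omega>\<in>space M. \<omega> \<notin> A \<longrightarrow> continuous_on {0..} (\<lambda>t. W t \<omega>) \<longrightarrow> good_path z (Suc (Suc K)) m \<omega>"
      using C0(2)[OF z(1)] by blast
    define e where "e = (4 + 2 * ?s) powr p * real z powr (- r)"
    have e: "0 \<le> e" by (simp add: e_def)
    have "AE \<omega> in M. D z n \<omega> \<le> ennreal e + D z n \<omega> * indicator A \<omega>"
      using terminal_value AE_W_0 AE_W_continuous AE_space
    proof eventually_elim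
      case (elim \<omega>)
      show ?case
      proof (cases "\<omega> \<in> A")
        case False
        obtain v where v: "v \<in> {0..1}" "\<forall>u\<in>{0..1}. W v \<omega> \<le> W u \<omega>" "X 1 \<omega> = (W 1 \<omega> + max ?s (- W v \<omega>))\<^sup>2" using elim(1) by blast
        have good: "good_path z (Suc (Suc K)) m \<omega>" using A(3) elim(3,4) False by blast
        have "\<bar>X 1 \<omega> - approx z (Suc (Suc K)) n \<omega>\<bar> \<le> (4 + 2 * ?s) / real z ^ K"
          unfolding v(3) by (rule approx_error_good[OF z(1) z(2)[unfolded Z_def] z(3) good elim(2) v(1,2)])
        then have "\<bar>X 1 \<omega> - approx z (Suc (Suc K)) n \<omega>\<bar> powr p \<le> ((4 + 2 * ?s) / real z ^ K) powr p"
          using p by (intro powr_mono2) auto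
        also have "\<dots> = (4 + 2 * ?s) powr p * real z powr (- (real K * p))"
        proof -
          have "(4 + 2 * ?s) / real z ^ K = (4 + 2 * ?s) * real z powr (- real K)"
            using z1 by (simp add: powr_minus powr_realpow divide_inverse)
          then show ?thesis using s by (simp add: powr_mult powr_powr)
        qed
        also have "\<dots> \<le> e" unfolding e_def
        proof (intro mult_left_mono powr_mono)
          have "8 * \<bar>q\<bar> * p \<le> real K * p" using KQP(1) p by (intro mult_right_mono) auto
          then show "- (real K * p) \<le> - r" by (simp add: r_def)
        qed (use z1 in auto)
        finally show ?thesis using False unfolding D_def by (simp add: ennreal_leI)
      qed simp
    qed
    then have "(\<integral>\<^sup>+\<omega>. D z n \<omega> \<partial>M) \<le> (\<integral>\<^sup>+\<omega>. ennreal e + D z n \<omega> * indicator A \<omega> \<partial>M)" by (rule nn_integral_mono_AE)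
    also have "\<dots> = ennreal e + (\<integral>\<^sup>+\<omega>. D z n \<omega> * indicator A \<omega> \<partial>M)"
      using A(1) by (subst nn_integral_add) (auto simp: emeasure_space_1)
    \<comment> \<open>Cauchy-Schwarz for the error power and the indicator of \<open>A\<close>; the
      exponent \<open>2 * Q\<close> of the probability becomes \<open>Q\<close>, which is at least
      \<open>r\<close>.\<close>
    also have "(\<integral>\<^sup>+\<omega>. D z n \<omega> * indicator A \<omega> \<partial>M) \<le> ennreal (sqrt (t * C0) * real z powr (- r))"
    proof (rule sqrt_bound_ennreal)
      have "(\<integral>\<^sup>+\<omega>. D z n \<omega> * indicator A \<omega> \<partial>M)\<^sup>2 \<le> (\<integral>\<^sup>+\<omega>. D z n \<omega> ^ 2 \<partial>M) * (\<integral>\<^sup>+\<omega>. indicator A \<omega> ^ 2 \<partial>M)"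
        using A(1) by (intro Cauchy_Schwarz_nn_integral) auto
      also have "(\<integral>\<^sup>+\<omega>. indicator A \<omega> ^ 2 \<partial>M) = (\<integral>\<^sup>+\<omega>. indicator A \<omega> \<partial>M)"
        by (intro nn_integral_cong) (auto simp: indicator_def)
      also have "\<dots> = ennreal (prob A)" using A(1) by (simp add: emeasure_eq_measure)
      also have "(\<integral>\<^sup>+\<omega>. D z n \<omega> ^ 2 \<partial>M) * ennreal (prob A) \<le> ennreal t * ennreal (C0 / real z ^ (2 * Q))"
        unfolding t(2)[symmetric] using A(2) by (intro mult_mono nn_integral_mono_AE[OF D2[OF z(1)]] ennreal_leI) auto
      also have "\<dots> = ennreal (t * C0 * (1 / real z ^ (2 * Q)))" using t(1) C0(1) by (simp flip: ennreal_mult)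
      also have "\<dots> \<le> ennreal ((sqrt (t * C0) * real z powr (- r))\<^sup>2)"
      proof (rule ennreal_leI)
        have "1 / real z ^ (2 * Q) = real z powr (- (2 * real Q))"
          using z1 by (simp add: powr_minus divide_inverse flip: powr_realpow)
        also have "\<dots> \<le> real z powr (- (2 * r))" using KQP(2) z1 by (intro powr_mono) auto
        also have "\<dots> = (real z powr (- r))\<^sup>2" by (simp add: power2_eq_square flip: powr_add)
        finally have "t * C0 * (1 / real z ^ (2 * Q)) \<le> t * C0 * (real z powr (- r))\<^sup>2"
          using t(1) C0(1) by (intro mult_left_mono) auto
        then show "t * C0 * (1 / real z ^ (2 * Q)) \<le> (sqrt (t * C0) * real z powr (- r))\<^sup>2"
          using t(1) C0(1) by (simp add: power_mult_distrib)
      qed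
      finally show "(\<integral>\<^sup>+\<omega>. D z n \<omega> * indicator A \<omega> \<partial>M)\<^sup>2 \<le> ennreal ((sqrt (t * C0) * real z powr (- r))\<^sup>2)" .
    qed (use t(1) C0(1) in auto)
    finally show ?thesis using e t(1) C0(1) by (simp add: C1_def e_def distrib_right ennreal_plus add_left_mono)
  qed
  have both: "(\<integral>\<^sup>+\<omega>. D z n \<omega> \<partial>M) \<le> ennreal (C2 * real z powr (- r))" if z: "1 \<le> z" "z ^ 8 \<le> n" for z n
  proof (cases "Z \<le> z\<^sup>2")
    case True
    have "C1 * real z powr (- r) \<le> C2 * real z powr (- r)" using t(1) by (intro mult_right_mono) (auto simp: C2_def)
    then show ?thesis using fine[OF z(1) True z(2)] ennreal_leI order_trans by blast
  next
    case False
    have "z \<le> z\<^sup>2" using z(1) by (simp add: power2_eq_square)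
    then have "real z \<le> real Z" using False by simp
    then have "real z powr r \<le> real Z powr r" using r by (intro powr_mono2) auto
    then have "1 \<le> real Z powr r * real z powr (- r)" using z(1) by (simp add: powr_minus divide_simps)
    then have "(1 + t) * 1 \<le> (1 + t) * (real Z powr r * real z powr (- r))" using t(1) by (intro mult_left_mono) auto
    also have "\<dots> \<le> C2 * real z powr (- r)" using C(1) by (simp add: C2_def distrib_right)
    finally show ?thesis using coarse[OF z(1), of n] ennreal_leI order_trans by (metis mult.right_neutral)
  qed
  show thesis
  proof (rule that[of "C2 * 2 powr r"])
    show "0 \<le> C2 * 2 powr r" using C(2) by simp
    fix n :: nat assume n: "1 \<le> n"
    obtain z :: nat where z: "1 \<le> z" "z ^ 8 \<le> n" "real n \<le> (2 * real z) ^ 8" by (rule eighth_root_scale[OF n])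
    have "real n powr (q * p) \<le> real n powr (\<bar>q\<bar> * p)" using n p by (intro powr_mono mult_right_mono) auto
    also have "\<dots> \<le> ((2 * real z) ^ 8) powr (\<bar>q\<bar> * p)" using z(3) p by (intro powr_mono2) auto
    also have "\<dots> = 2 powr r * real z powr r"
    proof -
      have "(2 * real z) ^ 8 = (2 * real z) powr 8" using z(1) by (simp only: powr_numeral)
      then have "((2 * real z) ^ 8) powr (\<bar>q\<bar> * p) = (2 * real z) powr r" by (simp only: powr_powr r_def mult.assoc)
      then show ?thesis by (simp only: powr_mult)
    qed
    finally have "real z powr (- r) \<le> 2 powr r * real n powr (- (q * p))"
      using z(1) n by (simp add: powr_minus divide_simps mult.commute)
    then have "C2 * real z powr (- r) \<le> C2 * 2 powr r * real n powr (- (q * p))"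
      using C(2) by (simp add: mult.assoc mult_left_mono)
    then have "(\<integral>\<^sup>+\<omega>. D z n \<omega> \<partial>M) \<le> ennreal (C2 * 2 powr r * real n powr (- (q * p)))"
      using both[OF z(1,2)] ennreal_leI order_trans by blast
    then show "\<exists>Y\<in>adaptive_methods M W n.
        (\<integral>\<^sup>+\<omega>. ennreal (\<bar>X 1 \<omega> - Y \<omega>\<bar> powr p) \<partial>M) \<le> ennreal (C2 * 2 powr r * real n powr (- (q * p)))"
      using approx_adaptive[OF z(1) n] unfolding D_def by blast
  qed
qed

lemma min_error_bound:
  assumes p: "1 \<le> p"
  shows "asymp_le (min_error_ad M W (X 1) p) (\<lambda>n. real n powr (- q))"
proof -
  obtain C where C: "0 \<le> C" "\<And>n. 1 \<le> n \<Longrightarrow> \<exists>Y\<in>adaptive_methods M W n.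
    (\<integral>\<^sup>+\<omega>. ennreal (\<bar>X 1 \<omega> - Y \<omega>\<bar> powr p) \<partial>M) \<le> ennreal (C * real n powr (- (q * p)))"
    using moment_bound[OF p] by metis
  \<comment> \<open>The summand 1 makes the constant positive even if \<open>C\<close> is 0.\<close>
  have "min_error_ad M W (X 1) p n \<le> ennreal ((C powr (1 / p) + 1) * real n powr (- q))" if n: "1 \<le> n" for n
  proof -
    obtain Y where Y: "Y \<in> adaptive_methods M W n"
      "(\<integral>\<^sup>+\<omega>. ennreal (\<bar>X 1 \<omega> - Y \<omega>\<bar> powr p) \<partial>M) \<le> ennreal (C * real n powr (- (q * p)))"
      using C(2)[OF n] by blast
    let ?E = "\<integral>\<^sup>+\<omega>. ennreal (\<bar>X 1 \<omega> - Y \<omega>\<bar> powr p) \<partial>M"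
    have fin: "?E \<noteq> \<infinity>" using Y(2) by (auto simp: top_unique)
    have "enn2real ?E \<le> C * real n powr (- (q * p))"
      using Y(2) C(1) by (intro enn2real_leI) auto
    then have "enn2real ?E powr (1 / p) \<le> (C * real n powr (- (q * p))) powr (1 / p)"
      using p by (intro powr_mono2) auto
    also have "\<dots> = C powr (1 / p) * real n powr (- q)"
      using p C(1) by (simp add: powr_mult powr_powr)
    also have "\<dots> \<le> (C powr (1 / p) + 1) * real n powr (- q)" by (simp add: distrib_right)
    finally have "Lp_error M p (X 1) Y \<le> ennreal ((C powr (1 / p) + 1) * real n powr (- q))"
      using fin by (simp add: Lp_error_def ennreal_leI)
    then show ?thesis unfolding min_error_ad_def by (rule INF_lower2[OF Y(1)])
  qed
  moreover have "0 < C powr (1 / p) + 1" by (simp add: add_nonneg_pos)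
  ultimately show ?thesis unfolding asymp_le_def by blast
qed

end

theorem corollary2:
  fixes M :: "'a measure" and F :: "real \<Rightarrow> 'a measure"
    and W X :: "real \<Rightarrow> 'a \<Rightarrow> real" and x0 :: real
  assumes "prob_space M" and "complete_measure M" and "usual_filtration M F"
    and "brownian_motion M F W"
    and "x0 \<ge> 0"
    and "strong_solution M F W (\<lambda>x. 1) (\<lambda>x. 2 * sqrt x) x0 X"
    and "AE \<omega> in M. \<forall>t\<ge>0. X t \<omega> \<ge> 0"
  shows "\<forall>p::real. p \<ge> 1 \<longrightarrow> (\<forall>q::real. q \<ge> 1 \<longrightarrow>
           asymp_le (min_error_ad M W (X 1) p) (\<lambda>n. real n powr (- q)))"
proof -
  interpret sq_bessel M F W X x0
    using assms by (simp add: sq_bessel_def brownian_def sq_bessel_axioms_def brownian_axioms_def)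
  show ?thesis using min_error_bound by blast
qed

end
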